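(* Let $k$ be a field of characteristic zero and let $E\in\mathrm{GL}_n(k)$ be such that there exists $q\in k^*$ with $\mathrm{tr}(E^{-1}E^t)=-q-q^{-1}$ and $q$ is not a root of unity of order $\ge3$. Then for $t\in\{0,1\}$, $\mathcal A_{E^{-1},t}$ is a model $\mathcal B(E)$-comodule algebra.
   Context: For $E\in\mathrm{GL}_n(k)$, $\mathcal B(E)$ is the $k$-algebra presented by generators $a_{ij}$, $1\le i,j\le n$, with relations $E^{-1}a^tEa=I_n=aE^{-1}a^tE$, where $a=(a_{ij})$ and the superscript $t$ on a matrix denotes transpose; it is a Hopf algebra with $\Delta(a_{ij})=\sum_k a_{ik}\otimes a_{kj}$, $\varepsilon(a_{ij})=\delta_{ij}$, $S(a)=E^{-1}a^tE$. For $M=(\alpha_{ij})\in M_n(k)$ and $t\in k$, $\mathcal A_{M,t}$ is the $k$-algebra presented by generators $x_1,\ldots,x_n$ and the single relation $\sum_{i,j}\alpha_{ij}x_ix_j=t$. $\mathcal A_{E^{-1},t}$ is a right $\mathcal B(E)$-comodule algebra with coaction $\alpha(x_i)=\sum_k x_k\otimes a_{ki}$. For a cosemisimple Hopf algebra $H$, a model $H$-comodule algebra is a right $H$-comodule algebra in which every simple $H$-comodule appears with multiplicity one. Under the hypotheses of the statement, $\mathcal B(E)$ is cosemisimple. *)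

theory Defs
  imports
    "HOL-Analysis.Determinants"
    "HOL-Algebra.QuotRing"
    "HOL-Algebra.Module"
    "HOL-Library.Poly_Mapping"
begin

section \<open>Vector spaces and algebras over a type-class field\<close>

text \<open>
  The record \<^type>\<open>module\<close> of HOL-Algebra carries both a multiplication and a scalar
  multiplication. It is used here for algebras as well as for bare vector spaces; in the latter
  case the fields \<open>mult\<close> and \<open>one\<close> are ignored, as in the locale \<open>Module.module\<close>.
\<close>

definition base :: "('k::field, 'k) module" where
  "base = \<lparr>carrier = UNIV, mult = (*), one = 1, zero = 0, add = (+), smult = (*)\<rparr>"

definition vect :: "('k::field, 'v, 'm) module_scheme \<Rightarrow> bool" where
  "vect V \<longleftrightarrow> Module.module base V"

definition lin_hom ::
  "('k::field, 'v, 'm) module_scheme \<Rightarrow> ('k, 'w, 'n) module_scheme \<Rightarrow> ('v \<Rightarrow> 'w) set" where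
  "lin_hom V W = {f \<in> carrier V \<rightarrow> carrier W.
     (\<forall>x\<in>carrier V. \<forall>y\<in>carrier V. f (x \<oplus>\<^bsub>V\<^esub> y) = f x \<oplus>\<^bsub>W\<^esub> f y) \<and>
     (\<forall>c. \<forall>x\<in>carrier V. f (c \<odot>\<^bsub>V\<^esub> x) = c \<odot>\<^bsub>W\<^esub> f x)}"

definition k_algebra :: "('k::field, 'a, 'm) module_scheme \<Rightarrow> bool" where
  "k_algebra A \<longleftrightarrow> vect A \<and> ring A \<and>
     (\<forall>c. \<forall>x\<in>carrier A. \<forall>y\<in>carrier A.
        (c \<odot>\<^bsub>A\<^esub> x) \<otimes>\<^bsub>A\<^esub> y = c \<odot>\<^bsub>A\<^esub> (x \<otimes>\<^bsub>A\<^esub> y) \<and>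
        x \<otimes>\<^bsub>A\<^esub> (c \<odot>\<^bsub>A\<^esub> y) = c \<odot>\<^bsub>A\<^esub> (x \<otimes>\<^bsub>A\<^esub> y))"

definition alg_hom ::
  "('k::field, 'a, 'm) module_scheme \<Rightarrow> ('k, 'b, 'n) module_scheme \<Rightarrow> ('a \<Rightarrow> 'b) set" where
  "alg_hom A B = lin_hom A B \<inter> ring_hom A B"

text \<open>
  The quotient by a subspace. If the argument is an algebra and the subspace is a two-sided ideal,
  this is the quotient algebra.
\<close>

definition quot :: "('k::field, 'v, 'm) module_scheme \<Rightarrow> 'v set \<Rightarrow> ('k, 'v set) module" where
  "quot V N = ring.extend (V Quot N)
     (module.fields (\<lambda>c X. \<Union>x\<in>X. N +>\<^bsub>V\<^esub> (c \<odot>\<^bsub>V\<^esub> x)))"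

definition lin_span :: "('k::field, 'v, 'm) module_scheme \<Rightarrow> 'v set \<Rightarrow> 'v set" where
  "lin_span V S = \<Inter>{N. submodule N base V \<and> S \<subseteq> N}"

text \<open>
  \<open>lin_ext U \<beta>\<close> extends a map \<open>\<beta>\<close> on a basis linearly to finitely supported functions, and
  \<open>coset_ext U \<beta>\<close> is the map it induces on a quotient. The latter is meaningful whenever
  \<open>lin_ext U \<beta>\<close> is constant on cosets.
\<close>

definition lin_ext ::
  "('k::field, 'u, 'm) module_scheme \<Rightarrow> ('x \<Rightarrow> 'u) \<Rightarrow> ('x \<Rightarrow>\<^sub>0 'k) \<Rightarrow> 'u" where
  "lin_ext U \<beta> p = (\<Oplus>\<^bsub>U\<^esub> x \<in> Poly_Mapping.keys p. Poly_Mapping.lookup p x \<odot>\<^bsub>U\<^esub> \<beta> x)"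

definition coset_ext ::
  "('k::field, 'u, 'm) module_scheme \<Rightarrow> ('x \<Rightarrow> 'u) \<Rightarrow> ('x \<Rightarrow>\<^sub>0 'k) set \<Rightarrow> 'u" where
  "coset_ext U \<beta> X = (THE u. \<forall>p\<in>X. u = lin_ext U \<beta> p)"


section \<open>Tensor products\<close>

text \<open>
  The free vector space on \<open>carrier V \<times> carrier W\<close>. Its multiplication is the bilinear extension
  of the componentwise one, so that for algebras \<open>V\<close> and \<open>W\<close> the record \<open>tensor V W\<close> below is the
  tensor product algebra.
\<close>

definition free_pairs ::
  "('k::field, 'v, 'm) module_scheme \<Rightarrow> ('k, 'w, 'n) module_scheme
    \<Rightarrow> ('k, 'v \<times> 'w \<Rightarrow>\<^sub>0 'k) module" where
  "free_pairs V W =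
     \<lparr>carrier = {p. Poly_Mapping.keys p \<subseteq> carrier V \<times> carrier W},
      mult = (\<lambda>p q. \<Sum>(v, w)\<in>Poly_Mapping.keys p. \<Sum>(v', w')\<in>Poly_Mapping.keys q.
                Poly_Mapping.single (v \<otimes>\<^bsub>V\<^esub> v', w \<otimes>\<^bsub>W\<^esub> w')
                  (Poly_Mapping.lookup p (v, w) * Poly_Mapping.lookup q (v', w'))),
      one = Poly_Mapping.single (\<one>\<^bsub>V\<^esub>, \<one>\<^bsub>W\<^esub>) 1,
      zero = 0,
      add = (+),
      smult = (\<lambda>c. Poly_Mapping.map ((*) c))\<rparr>"

definition tensor_rels ::
  "('k::field, 'v, 'm) module_scheme \<Rightarrow> ('k, 'w, 'n) module_scheme \<Rightarrow> ('v \<times> 'w \<Rightarrow>\<^sub>0 'k) set" where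
  "tensor_rels V W = (let \<delta> = (\<lambda>v w. Poly_Mapping.single (v, w) (1::'k)) in
     lin_span (free_pairs V W)
      ({\<delta> (v \<oplus>\<^bsub>V\<^esub> v') w - \<delta> v w - \<delta> v' w | v v' w.
          v \<in> carrier V \<and> v' \<in> carrier V \<and> w \<in> carrier W} \<union>
       {\<delta> v (w \<oplus>\<^bsub>W\<^esub> w') - \<delta> v w - \<delta> v w' | v w w'.
          v \<in> carrier V \<and> w \<in> carrier W \<and> w' \<in> carrier W} \<union>
       {\<delta> (c \<odot>\<^bsub>V\<^esub> v) w - Poly_Mapping.single (v, w) c | c v w.
          v \<in> carrier V \<and> w \<in> carrier W} \<union>
       {\<delta> v (c \<odot>\<^bsub>W\<^esub> w) - Poly_Mapping.single (v, w) c | c v w.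
          v \<in> carrier V \<and> w \<in> carrier W}))"

definition tensor ::
  "('k::field, 'v, 'm) module_scheme \<Rightarrow> ('k, 'w, 'n) module_scheme
    \<Rightarrow> ('k, ('v \<times> 'w \<Rightarrow>\<^sub>0 'k) set) module" where
  "tensor V W = quot (free_pairs V W) (tensor_rels V W)"

definition pure_tensor ::
  "('k::field, 'v, 'm) module_scheme \<Rightarrow> ('k, 'w, 'n) module_scheme
    \<Rightarrow> 'v \<Rightarrow> 'w \<Rightarrow> ('v \<times> 'w \<Rightarrow>\<^sub>0 'k) set" where
  "pure_tensor V W v w = tensor_rels V W +>\<^bsub>free_pairs V W\<^esub> Poly_Mapping.single (v, w) 1"

text \<open>The linear map \<open>V \<otimes> W \<rightarrow> U\<close> given by a bilinear map \<open>V \<times> W \<rightarrow> U\<close>.\<close>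

definition tensor_lift ::
  "('k::field, 'u, 'm) module_scheme \<Rightarrow> ('v \<Rightarrow> 'w \<Rightarrow> 'u) \<Rightarrow> ('v \<times> 'w \<Rightarrow>\<^sub>0 'k) set \<Rightarrow> 'u" where
  "tensor_lift U \<beta> = coset_ext U (\<lambda>(v, w). \<beta> v w)"

text \<open>The map \<open>f \<otimes> g\<close> into \<open>V \<otimes> W\<close>.\<close>

definition tensor_map ::
  "('k::field, 'v, 'm) module_scheme \<Rightarrow> ('k, 'w, 'n) module_scheme
    \<Rightarrow> ('a \<Rightarrow> 'v) \<Rightarrow> ('b \<Rightarrow> 'w) \<Rightarrow> ('a \<times> 'b \<Rightarrow>\<^sub>0 'k) set \<Rightarrow> ('v \<times> 'w \<Rightarrow>\<^sub>0 'k) set" where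
  "tensor_map V W f g = tensor_lift (tensor V W) (\<lambda>a b. pure_tensor V W (f a) (g b))"

text \<open>The canonical map \<open>(U \<otimes> V) \<otimes> W \<rightarrow> U \<otimes> (V \<otimes> W)\<close>.\<close>

definition tensor_assoc ::
  "('k::field, 'u, 'l) module_scheme \<Rightarrow> ('k, 'v, 'm) module_scheme \<Rightarrow> ('k, 'w, 'n) module_scheme
    \<Rightarrow> (('u \<times> 'v \<Rightarrow>\<^sub>0 'k) set \<times> 'w \<Rightarrow>\<^sub>0 'k) set
    \<Rightarrow> ('u \<times> ('v \<times> 'w \<Rightarrow>\<^sub>0 'k) set \<Rightarrow>\<^sub>0 'k) set" where
  "tensor_assoc U V W =
     tensor_lift (tensor U (tensor V W))
       (\<lambda>x w. tensor_lift (tensor U (tensor V W))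
          (\<lambda>u v. pure_tensor U (tensor V W) u (pure_tensor V W v w)) x)"


section \<open>Hopf algebras and comodules\<close>

record (overloaded) ('k::zero, 'h) hopf = "('k, 'h) module" +
  comult :: "'h \<Rightarrow> ('h \<times> 'h \<Rightarrow>\<^sub>0 'k) set"
  counit :: "'h \<Rightarrow> 'k"
  antipode :: "'h \<Rightarrow> 'h"

record (overloaded) ('k::zero, 'h, 'v) comodule = "('k, 'v) module" +
  coaction :: "'v \<Rightarrow> ('v \<times> 'h \<Rightarrow>\<^sub>0 'k) set"

definition right_comodule :: "('k::field, 'h) hopf \<Rightarrow> ('k, 'h, 'v) comodule \<Rightarrow> bool" where
  "right_comodule H V \<longleftrightarrow> vect V \<and> coaction V \<in> lin_hom V (tensor V H) \<and>
     (\<forall>v\<in>carrier V.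
        tensor_assoc V H H (tensor_map (tensor V H) H (coaction V) (\<lambda>h. h) (coaction V v)) =
          tensor_map V (tensor H H) (\<lambda>x. x) (comult H) (coaction V v) \<and>
        tensor_lift V (\<lambda>x h. counit H h \<odot>\<^bsub>V\<^esub> x) (coaction V v) = v)"

definition regular_comodule :: "('k::field, 'h) hopf \<Rightarrow> ('k, 'h, 'h) comodule" where
  "regular_comodule H = module.extend (module.truncate H) (comodule.fields (comult H))"

text \<open>
  Coassociativity and the right counit law of \<open>H\<close> are the comodule laws of the regular comodule.
\<close>

definition hopf_algebra :: "('k::field, 'h) hopf \<Rightarrow> bool" where
  "hopf_algebra H \<longleftrightarrow> k_algebra H \<and>
     right_comodule H (regular_comodule H) \<and>
     (\<forall>h\<in>carrier H. tensor_lift H (\<lambda>x y. counit H x \<odot>\<^bsub>H\<^esub> y) (comult H h) = h) \<and>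
     comult H \<in> alg_hom H (tensor H H) \<and>
     counit H \<in> alg_hom H base \<and>
     antipode H \<in> lin_hom H H \<and>
     (\<forall>h\<in>carrier H.
        tensor_lift H (\<lambda>x y. antipode H x \<otimes>\<^bsub>H\<^esub> y) (comult H h) = counit H h \<odot>\<^bsub>H\<^esub> \<one>\<^bsub>H\<^esub> \<and>
        tensor_lift H (\<lambda>x y. x \<otimes>\<^bsub>H\<^esub> antipode H y) (comult H h) = counit H h \<odot>\<^bsub>H\<^esub> \<one>\<^bsub>H\<^esub>)"

definition comodule_hom ::
  "('k::field, 'h) hopf \<Rightarrow> ('k, 'h, 'v) comodule \<Rightarrow> ('k, 'h, 'w) comodule \<Rightarrow> ('v \<Rightarrow> 'w) set" where
  "comodule_hom H V W = {f \<in> lin_hom V W.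
     \<forall>v\<in>carrier V. coaction W (f v) = tensor_map W H f (\<lambda>h. h) (coaction V v)}"

text \<open>The coaction maps \<open>S\<close> into the image of \<open>S \<otimes> H\<close> in \<open>V \<otimes> H\<close>.\<close>

definition subcomodule ::
  "('k::field, 'h) hopf \<Rightarrow> ('k, 'h, 'v) comodule \<Rightarrow> 'v set \<Rightarrow> bool" where
  "subcomodule H V S \<longleftrightarrow> submodule S base V \<and>
     (\<forall>s\<in>S. coaction V s \<in> lin_span (tensor V H)
        {pure_tensor V H x h | x h. x \<in> S \<and> h \<in> carrier H})"

definition simple_subcomodule ::
  "('k::field, 'h) hopf \<Rightarrow> ('k, 'h, 'v) comodule \<Rightarrow> 'v set \<Rightarrow> bool" where
  "simple_subcomodule H V S \<longleftrightarrow> subcomodule H V S \<and> S \<noteq> {\<zero>\<^bsub>V\<^esub>} \<and>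
     (\<forall>T\<subseteq>S. subcomodule H V T \<longrightarrow> T = {\<zero>\<^bsub>V\<^esub>} \<or> T = S)"

definition simple_comodule :: "('k::field, 'h) hopf \<Rightarrow> ('k, 'h, 'v) comodule \<Rightarrow> bool" where
  "simple_comodule H V \<longleftrightarrow> right_comodule H V \<and> simple_subcomodule H V (carrier V)"

text \<open>
  \<open>V\<close> is the internal direct sum of the family \<open>\<S>\<close> of subspaces: every vector is a sum of
  components \<open>f S \<in> S\<close>, almost all zero, in exactly one way.
\<close>

definition direct_sum_of :: "('k::field, 'v, 'm) module_scheme \<Rightarrow> 'v set set \<Rightarrow> bool" where
  "direct_sum_of V \<S> \<longleftrightarrow> (\<forall>S\<in>\<S>. submodule S base V) \<and>
     (\<forall>v\<in>carrier V. \<exists>!f. f \<in> (\<Pi>\<^sub>E S\<in>\<S>. S) \<and> finite {S\<in>\<S>. f S \<noteq> \<zero>\<^bsub>V\<^esub>} \<and>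
        v = (\<Oplus>\<^bsub>V\<^esub> S \<in> {S\<in>\<S>. f S \<noteq> \<zero>\<^bsub>V\<^esub>}. f S))"

text \<open>
  A decomposition of \<open>V\<close> into simple subcomodules. Simple subcomodules in a direct sum are pairwise
  distinct as sets, so that a set of them loses no multiplicities.
\<close>

definition simple_decomposition ::
  "('k::field, 'h) hopf \<Rightarrow> ('k, 'h, 'v) comodule \<Rightarrow> 'v set set \<Rightarrow> bool" where
  "simple_decomposition H V \<S> \<longleftrightarrow> (\<forall>S\<in>\<S>. simple_subcomodule H V S) \<and> direct_sum_of V \<S>"

definition iso_to_subcomodule ::
  "('k::field, 'h) hopf \<Rightarrow> ('k, 'h, 'w) comodule \<Rightarrow> ('k, 'h, 'v) comodule \<Rightarrow> 'v set \<Rightarrow> bool" where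
  "iso_to_subcomodule H W V S \<longleftrightarrow> (\<exists>f\<in>comodule_hom H W V. bij_betw f (carrier W) S)"

text \<open>
  Cosemisimplicity is taken to mean that \<open>H\<close> is semisimple as a right comodule over itself, the
  formal dual of semisimplicity of a ring. Every right comodule is then semisimple, because a
  comodule \<open>V\<close> embeds via its coaction into \<open>V \<otimes> H\<close>, a direct sum of copies of \<open>H\<close>.
\<close>

definition cosemisimple :: "('k::field, 'h) hopf \<Rightarrow> bool" where
  "cosemisimple H \<longleftrightarrow> (\<exists>\<S>. simple_decomposition H (regular_comodule H) \<S>)"

definition right_comodule_algebra ::
  "('k::field, 'h) hopf \<Rightarrow> ('k, 'h, 'a) comodule \<Rightarrow> bool" where
  "right_comodule_algebra H A \<longleftrightarrow> k_algebra A \<and> right_comodule H A \<and>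
     coaction A \<in> alg_hom A (tensor A H)"

text \<open>
  HOL cannot quantify over types inside a formula, so the type \<open>'v\<close> in which the simple comodules
  live is a parameter; a statement about all simple comodules leaves it free.
\<close>

definition model_comodule_algebra ::
  "'v itself \<Rightarrow> ('k::field, 'h) hopf \<Rightarrow> ('k, 'h, 'a) comodule \<Rightarrow> bool" where
  "model_comodule_algebra _ H A \<longleftrightarrow> hopf_algebra H \<and> cosemisimple H \<and>
     right_comodule_algebra H A \<and>
     (\<exists>\<S>. simple_decomposition H A \<S> \<and>
        (\<forall>W :: ('k, 'h, 'v) comodule. simple_comodule H W \<longrightarrow>
           card {S\<in>\<S>. iso_to_subcomodule H W A S} = 1))"


section \<open>Presented algebras\<close>

text \<open>
  With concatenation as addition on words, \<open>'x list \<Rightarrow>\<^sub>0 'k\<close> with its library (convolution) product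
  is the free algebra on \<open>'x\<close>.
\<close>

instantiation list :: (type) monoid_add
begin

definition zero_list :: "'a list" where "zero_list = []"
definition plus_list :: "'a list \<Rightarrow> 'a list \<Rightarrow> 'a list" where "plus_list = (@)"

instance by standard (simp_all add: zero_list_def plus_list_def)

end

definition free_algebra :: "('k::field, 'x list \<Rightarrow>\<^sub>0 'k) module" where
  "free_algebra = \<lparr>carrier = UNIV, mult = (*), one = 1, zero = 0, add = (+),
     smult = (\<lambda>c. Poly_Mapping.map ((*) c))\<rparr>"

definition var :: "'x \<Rightarrow> 'x list \<Rightarrow>\<^sub>0 'k::field" where
  "var x = Poly_Mapping.single [x] 1"

definition const :: "'k \<Rightarrow> 'x list \<Rightarrow>\<^sub>0 'k::field" where
  "const c = Poly_Mapping.single [] c"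

definition presented_algebra ::
  "('x list \<Rightarrow>\<^sub>0 'k::field) set \<Rightarrow> ('k, ('x list \<Rightarrow>\<^sub>0 'k) set) module" where
  "presented_algebra R = quot free_algebra (genideal free_algebra R)"

definition cls :: "('x list \<Rightarrow>\<^sub>0 'k::field) set \<Rightarrow> ('x list \<Rightarrow>\<^sub>0 'k) \<Rightarrow> ('x list \<Rightarrow>\<^sub>0 'k) set" where
  "cls R p = genideal free_algebra R +>\<^bsub>free_algebra\<^esub> p"

definition word_prod :: "('a, 'm) monoid_scheme \<Rightarrow> ('x \<Rightarrow> 'a) \<Rightarrow> 'x list \<Rightarrow> 'a" where
  "word_prod A g w = foldr (\<lambda>x a. g x \<otimes>\<^bsub>A\<^esub> a) w \<one>\<^bsub>A\<^esub>"

text \<open>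
  The (anti-)homomorphism from a presented algebra to \<open>A\<close> determined by the images \<open>g\<close> of the
  generators, provided these satisfy the relations.
\<close>

definition induced_hom ::
  "('k::field, 'a, 'm) module_scheme \<Rightarrow> ('x \<Rightarrow> 'a) \<Rightarrow> ('x list \<Rightarrow>\<^sub>0 'k) set \<Rightarrow> 'a" where
  "induced_hom A g = coset_ext A (word_prod A g)"

definition induced_antihom ::
  "('k::field, 'a, 'm) module_scheme \<Rightarrow> ('x \<Rightarrow> 'a) \<Rightarrow> ('x list \<Rightarrow>\<^sub>0 'k) set \<Rightarrow> 'a" where
  "induced_antihom A g = coset_ext A (\<lambda>w. word_prod A g (rev w))"


section \<open>The Hopf algebra \<open>\<B>(E)\<close>\<close>

definition gen_matrix :: "(('n::finite \<times> 'n) list \<Rightarrow>\<^sub>0 'k::field)^'n^'n" where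
  "gen_matrix = (\<chi> i j. var (i, j))"

text \<open>\<open>E\<^sup>-\<^sup>1 a\<^sup>t E\<close> over the free algebra: both the inverse of \<open>a\<close> imposed by the relations and \<open>S(a)\<close>.\<close>

definition antipode_matrix ::
  "'k::field^'n^'n \<Rightarrow> (('n::finite \<times> 'n) list \<Rightarrow>\<^sub>0 'k)^'n^'n" where
  "antipode_matrix E =
     map_matrix const (matrix_inv E) ** transpose gen_matrix ** map_matrix const E"

definition B_rels :: "'k::field^'n^'n \<Rightarrow> (('n::finite \<times> 'n) list \<Rightarrow>\<^sub>0 'k) set" where
  "B_rels E = {(antipode_matrix E ** gen_matrix - mat 1) $ i $ j | i j. True} \<union>
     {(gen_matrix ** antipode_matrix E - mat 1) $ i $ j | i j. True}"

definition B_alg ::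
  "'k::field^'n^'n \<Rightarrow> ('k, (('n::finite \<times> 'n) list \<Rightarrow>\<^sub>0 'k) set) module" where
  "B_alg E = presented_algebra (B_rels E)"

definition B_gen :: "'k::field^'n^'n \<Rightarrow> 'n \<Rightarrow> 'n \<Rightarrow> (('n::finite \<times> 'n) list \<Rightarrow>\<^sub>0 'k) set" where
  "B_gen E i j = cls (B_rels E) (gen_matrix $ i $ j)"

definition B_hopf ::
  "'k::field^'n^'n \<Rightarrow> ('k, (('n::finite \<times> 'n) list \<Rightarrow>\<^sub>0 'k) set) hopf" where
  "B_hopf E = module.extend (B_alg E) (hopf.fields
     (induced_hom (tensor (B_alg E) (B_alg E))
        (\<lambda>(i, j). \<Oplus>\<^bsub>tensor (B_alg E) (B_alg E)\<^esub> k \<in> UNIV.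
           pure_tensor (B_alg E) (B_alg E) (B_gen E i k) (B_gen E k j)))
     (induced_hom base (\<lambda>(i, j). if i = j then 1 else 0))
     (induced_antihom (B_alg E) (\<lambda>(i, j). cls (B_rels E) (antipode_matrix E $ i $ j))))"


section \<open>The comodule algebra \<open>\<A>(M, t)\<close>\<close>

definition A_rels :: "'k::field^'n^'n \<Rightarrow> 'k \<Rightarrow> ('n::finite list \<Rightarrow>\<^sub>0 'k) set" where
  "A_rels M t = {(\<Sum>i\<in>UNIV. \<Sum>j\<in>UNIV. const (M $ i $ j) * var i * var j) - const t}"

definition A_alg :: "'k::field^'n^'n \<Rightarrow> 'k \<Rightarrow> ('k, ('n::finite list \<Rightarrow>\<^sub>0 'k) set) module" where
  "A_alg M t = presented_algebra (A_rels M t)"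

text \<open>\<open>\<A>(E\<^sup>-\<^sup>1, t)\<close> with the coaction of \<open>\<B>(E)\<close> given by \<open>x\<^sub>i \<mapsto> \<Sum>\<^sub>k x\<^sub>k \<otimes> a\<^sub>k\<^sub>i\<close>.\<close>

definition A_comodule ::
  "'k::field^'n^'n \<Rightarrow> 'k
    \<Rightarrow> ('k, (('n::finite \<times> 'n) list \<Rightarrow>\<^sub>0 'k) set, ('n list \<Rightarrow>\<^sub>0 'k) set) comodule" where
  "A_comodule E t = (let A = A_alg (matrix_inv E) t; B = B_alg E in
     module.extend A (comodule.fields
       (induced_hom (tensor A B)
          (\<lambda>i. \<Oplus>\<^bsub>tensor A B\<^esub> k \<in> UNIV.
             pure_tensor A B (cls (A_rels (matrix_inv E) t) (var k)) (B_gen E k i)))))"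


section \<open>Roots of unity\<close>

definition root_of_unity_of_order :: "nat \<Rightarrow> 'k::field \<Rightarrow> bool" where
  "root_of_unity_of_order m q \<longleftrightarrow> m > 0 \<and> q ^ m = 1 \<and> (\<forall>j. 0 < j \<and> j < m \<longrightarrow> q ^ j \<noteq> 1)"

end

theory Submission
  imports Defs
begin

text \<open>
  Write \<open>\<beta>\<close> for the bilinear form with matrix \<open>E\<close> and \<open>\<omega>\<close> for the one with matrix \<open>E\<^sup>-\<^sup>1\<close>, and call a
  tensor \<open>y\<close> of degree \<open>j\<close> (a function on words of length \<open>j\<close> in the index type) capfree if
  contracting any two neighbouring factors with \<open>\<beta>\<close> gives zero. Let \<open>K\<^sub>j\<close> be the space of capfree
  tensors of degree \<open>j\<close>; it is the image of a Jones-Wenzl projection. The quantum integers \<open>[j]\<close> with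
  \<open>[2] = q + q\<^sup>-\<^sup>1\<close> are nonzero for \<open>j > 0\<close> under the hypothesis on \<open>q\<close> (\<open>qint_nonzero\<close>), and the trace
  condition says that the full contraction of \<open>\<omega>\<close> with \<open>\<beta>\<close> is \<open>- [2]\<close>. This is what is needed for
  operators \<open>up v\<close>, raising the degree by one, that compose the creation of a factor \<open>v\<close> with the
  projection to capfree tensors; their recursive definition has the coefficients \<open>[j] / [j + 1]\<close>.
  Together with the lowering operators \<open>down v\<close> they satisfy \<open>down_up\<close> and, after contraction
  with \<open>\<omega>\<close>, the relations \<open>up_up_omega\<close>, \<open>up_down_omega\<close>, \<open>down_up_omega\<close>, \<open>down_down_omega\<close>.

  The algebra \<open>\<A>(E\<^sup>-\<^sup>1, t)\<close>: letting \<open>x\<^sub>v\<close> act on capfree tensors by \<open>up v\<close> plus a multiple of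
  \<open>down v\<close> fulfils the defining relation for every \<open>t\<close> (\<open>act_act_omega\<close>). Applying a word to the
  vacuum therefore yields well-defined coordinates, and conversely every word equals its normal form
  in the algebra (\<open>nf_pair\<close>). Hence the algebra is the direct sum of copies of the \<open>K\<^sub>j\<close>, whatever \<open>t\<close>
  is, and each copy is a subcomodule.

  The Hopf algebra \<open>\<B>(E)\<close>: in the same way the generators \<open>a\<^sub>k\<^sub>l\<close> act on tensors with a row and a
  column argument that are capfree in both, a model of the sum of the coalgebras of matrix
  coefficients of the \<open>K\<^sub>j\<close> (\<open>gen_op_omega\<close>, \<open>gen_op_beta\<close>). This yields functionals \<open>phi u' u\<close> on
  \<open>\<B>(E)\<close>. Three facts about them carry the proof. Those with \<open>u'\<close> and \<open>u\<close> of length \<open>j\<close> act on \<open>K\<^sub>j\<close> by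
  rank one operators that span all endomorphisms, and they kill the other \<open>K\<^sub>i\<close> (\<open>act_by_elt\<close>), so that
  the \<open>K\<^sub>j\<close> are simple and pairwise non-isomorphic. Up to the coproduct they transform like the matrix
  of generators (\<open>pw_coef_intertwine\<close>), so that for every vector \<open>x\<close> of a comodule \<open>W\<close> and every word
  \<open>u\<close> there is a comodule map \<open>smap u x\<close> from \<open>K\<^sub>j\<close> to \<open>W\<close>, where \<open>j\<close> is the length of \<open>u\<close>. The counit is the
  sum of all \<open>phi u u\<close> (\<open>pw_coef_trace\<close>), so that the images of these maps span \<open>W\<close>. Thus every comodule
  is a sum of simple ones, each isomorphic to some \<open>K\<^sub>j\<close>, and by Zorn's lemma it is a direct sum.
  Applied to the regular comodule this is cosemisimplicity; applied to a simple comodule it shows that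
  it occurs in the algebra, exactly once.
\<close>

section \<open>Linear algebra with carriers\<close>

lemma base_simps [simp]:
  "carrier base = UNIV" "add base = (+)" "mult base = (*)" "one base = 1" "zero base = 0"
  "smult base = (*)"
  by (simp_all add: base_def)

lemma abelian_group_base: "abelian_group (base :: ('k::field, 'k) module)"
  by (rule abelian_groupI) (auto simp: add.assoc add.commute intro: exI[of _ "- x" for x])

lemma cring_base: "cring (base :: ('k::field, 'k) module)"
proof (rule cringI)
  show "abelian_group (base :: ('k, 'k) module)" by (rule abelian_group_base)
  show "comm_monoid (base :: ('k, 'k) module)"
    by (rule comm_monoidI) (auto simp: mult.assoc mult.commute)
qed (auto simp: algebra_simps)

lemma vect_iff:
  "vect V \<longleftrightarrow> abelian_group V \<and>
    (\<forall>c. \<forall>x\<in>carrier V. c \<odot>\<^bsub>V\<^esub> x \<in> carrier V) \<and>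
    (\<forall>c d. \<forall>x\<in>carrier V. (c + d) \<odot>\<^bsub>V\<^esub> x = c \<odot>\<^bsub>V\<^esub> x \<oplus>\<^bsub>V\<^esub> d \<odot>\<^bsub>V\<^esub> x) \<and>
    (\<forall>c. \<forall>x\<in>carrier V. \<forall>y\<in>carrier V. c \<odot>\<^bsub>V\<^esub> (x \<oplus>\<^bsub>V\<^esub> y) = c \<odot>\<^bsub>V\<^esub> x \<oplus>\<^bsub>V\<^esub> c \<odot>\<^bsub>V\<^esub> y) \<and>
    (\<forall>c d. \<forall>x\<in>carrier V. (c * d) \<odot>\<^bsub>V\<^esub> x = c \<odot>\<^bsub>V\<^esub> (d \<odot>\<^bsub>V\<^esub> x)) \<and>
    (\<forall>x\<in>carrier V. 1 \<odot>\<^bsub>V\<^esub> x = x)"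
  unfolding vect_def Module.module_def module_axioms_def
  by (auto simp: cring_base)

lemma vect_abelian_group: "vect V \<Longrightarrow> abelian_group V"
  by (simp add: vect_iff)

lemma vect_abelian_monoid: "vect V \<Longrightarrow> abelian_monoid V"
  using abelian_group.axioms(1) vect_abelian_group by blast

lemma vect_smult_closed [simp, intro]: "vect V \<Longrightarrow> x \<in> carrier V \<Longrightarrow> c \<odot>\<^bsub>V\<^esub> x \<in> carrier V"
  and vect_smult_l_distr: "vect V \<Longrightarrow> x \<in> carrier V \<Longrightarrow> (c + d) \<odot>\<^bsub>V\<^esub> x = c \<odot>\<^bsub>V\<^esub> x \<oplus>\<^bsub>V\<^esub> d \<odot>\<^bsub>V\<^esub> x"
  and vect_smult_r_distr: "vect V \<Longrightarrow> x \<in> carrier V \<Longrightarrow> y \<in> carrier V \<Longrightarrow>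
      c \<odot>\<^bsub>V\<^esub> (x \<oplus>\<^bsub>V\<^esub> y) = c \<odot>\<^bsub>V\<^esub> x \<oplus>\<^bsub>V\<^esub> c \<odot>\<^bsub>V\<^esub> y"
  and vect_smult_assoc: "vect V \<Longrightarrow> x \<in> carrier V \<Longrightarrow> c \<odot>\<^bsub>V\<^esub> (d \<odot>\<^bsub>V\<^esub> x) = (c * d) \<odot>\<^bsub>V\<^esub> x"
  and vect_smult_one [simp]: "vect V \<Longrightarrow> x \<in> carrier V \<Longrightarrow> 1 \<odot>\<^bsub>V\<^esub> x = x"
  by (simp_all add: vect_iff)

lemma vect_add_closed [simp, intro]:
    "vect V \<Longrightarrow> x \<in> carrier V \<Longrightarrow> y \<in> carrier V \<Longrightarrow> x \<oplus>\<^bsub>V\<^esub> y \<in> carrier V"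
  and vect_zero_closed [simp, intro]: "vect V \<Longrightarrow> \<zero>\<^bsub>V\<^esub> \<in> carrier V"
  and vect_a_inv_closed [simp, intro]: "vect V \<Longrightarrow> x \<in> carrier V \<Longrightarrow> \<ominus>\<^bsub>V\<^esub> x \<in> carrier V"
  and vect_l_zero [simp]: "vect V \<Longrightarrow> x \<in> carrier V \<Longrightarrow> \<zero>\<^bsub>V\<^esub> \<oplus>\<^bsub>V\<^esub> x = x"
  and vect_r_zero [simp]: "vect V \<Longrightarrow> x \<in> carrier V \<Longrightarrow> x \<oplus>\<^bsub>V\<^esub> \<zero>\<^bsub>V\<^esub> = x"
  and vect_l_neg [simp]: "vect V \<Longrightarrow> x \<in> carrier V \<Longrightarrow> \<ominus>\<^bsub>V\<^esub> x \<oplus>\<^bsub>V\<^esub> x = \<zero>\<^bsub>V\<^esub>"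
  and vect_r_neg [simp]: "vect V \<Longrightarrow> x \<in> carrier V \<Longrightarrow> x \<oplus>\<^bsub>V\<^esub> \<ominus>\<^bsub>V\<^esub> x = \<zero>\<^bsub>V\<^esub>"
  and vect_a_comm: "vect V \<Longrightarrow> x \<in> carrier V \<Longrightarrow> y \<in> carrier V \<Longrightarrow> x \<oplus>\<^bsub>V\<^esub> y = y \<oplus>\<^bsub>V\<^esub> x"
  and vect_a_assoc: "vect V \<Longrightarrow> x \<in> carrier V \<Longrightarrow> y \<in> carrier V \<Longrightarrow> z \<in> carrier V \<Longrightarrow>
      x \<oplus>\<^bsub>V\<^esub> y \<oplus>\<^bsub>V\<^esub> z = x \<oplus>\<^bsub>V\<^esub> (y \<oplus>\<^bsub>V\<^esub> z)"
proof -
  assume "vect V"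
  then interpret abelian_group V by (rule vect_abelian_group)
  show "\<zero>\<^bsub>V\<^esub> \<in> carrier V" by simp
  { fix x assume "x \<in> carrier V"
    then show "\<ominus>\<^bsub>V\<^esub> x \<in> carrier V" "\<zero>\<^bsub>V\<^esub> \<oplus>\<^bsub>V\<^esub> x = x" "x \<oplus>\<^bsub>V\<^esub> \<zero>\<^bsub>V\<^esub> = x"
      "\<ominus>\<^bsub>V\<^esub> x \<oplus>\<^bsub>V\<^esub> x = \<zero>\<^bsub>V\<^esub>" "x \<oplus>\<^bsub>V\<^esub> \<ominus>\<^bsub>V\<^esub> x = \<zero>\<^bsub>V\<^esub>"
      by (simp_all add: l_neg r_neg) }
  { fix x y assume "x \<in> carrier V" "y \<in> carrier V"
    then show "x \<oplus>\<^bsub>V\<^esub> y \<in> carrier V" "x \<oplus>\<^bsub>V\<^esub> y = y \<oplus>\<^bsub>V\<^esub> x" by (simp_all add: a_comm) }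
  { fix x y z assume "x \<in> carrier V" "y \<in> carrier V" "z \<in> carrier V"
    then show "x \<oplus>\<^bsub>V\<^esub> y \<oplus>\<^bsub>V\<^esub> z = x \<oplus>\<^bsub>V\<^esub> (y \<oplus>\<^bsub>V\<^esub> z)" by (simp add: a_assoc) }
qed

lemma vect_add_cancel:
  "vect V \<Longrightarrow> x \<in> carrier V \<Longrightarrow> y \<in> carrier V \<Longrightarrow> x \<oplus>\<^bsub>V\<^esub> y = x \<longleftrightarrow> y = \<zero>\<^bsub>V\<^esub>"
  by (metis abelian_group.r_neg1 vect_abelian_group vect_l_neg vect_r_zero)

lemma vect_smult_zero_left [simp]: "vect V \<Longrightarrow> x \<in> carrier V \<Longrightarrow> 0 \<odot>\<^bsub>V\<^esub> x = \<zero>\<^bsub>V\<^esub>"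
  by (metis add_0 vect_add_cancel vect_smult_closed vect_smult_l_distr)

lemma vect_smult_zero_right [simp]: "vect V \<Longrightarrow> c \<odot>\<^bsub>V\<^esub> \<zero>\<^bsub>V\<^esub> = \<zero>\<^bsub>V\<^esub>"
  by (metis vect_add_cancel vect_l_zero vect_smult_closed vect_smult_r_distr vect_zero_closed)

lemma vect_a_inv: "vect V \<Longrightarrow> x \<in> carrier V \<Longrightarrow> \<ominus>\<^bsub>V\<^esub> x = (- 1) \<odot>\<^bsub>V\<^esub> x"
proof -
  assume V: "vect V" and x: "x \<in> carrier V"
  have "(- 1) \<odot>\<^bsub>V\<^esub> x \<oplus>\<^bsub>V\<^esub> x = (- 1 + 1) \<odot>\<^bsub>V\<^esub> x"
    using vect_smult_l_distr[OF V x, of "-1" 1] V x by simp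
  also have "\<dots> = \<zero>\<^bsub>V\<^esub>"
    unfolding add.left_inverse using V x by (rule vect_smult_zero_left)
  finally have "(- 1) \<odot>\<^bsub>V\<^esub> x \<oplus>\<^bsub>V\<^esub> x = \<zero>\<^bsub>V\<^esub>" .
  then show ?thesis
    using V x by (intro abelian_group.minus_equality[OF vect_abelian_group]) auto
qed

lemma vect_add_swap:
  assumes "vect V" "a \<in> carrier V" "b \<in> carrier V" "c \<in> carrier V" "d \<in> carrier V"
  shows "(a \<oplus>\<^bsub>V\<^esub> b) \<oplus>\<^bsub>V\<^esub> (c \<oplus>\<^bsub>V\<^esub> d) = (a \<oplus>\<^bsub>V\<^esub> c) \<oplus>\<^bsub>V\<^esub> (b \<oplus>\<^bsub>V\<^esub> d)"
proof -
  interpret abelian_monoid V using assms(1) by (rule vect_abelian_monoid)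
  show ?thesis using assms by (simp add: a_ac)
qed

lemma vect_base: "vect (base :: ('k::field, 'k) module)"
  by (simp add: vect_iff abelian_group_base algebra_simps)

text \<open>
  If scalars act linearly and 0 acts as zero, then \<open>(- 1) \<odot> x\<close> is an additive inverse of \<open>x\<close>, so
  that no inverses have to be exhibited separately.
\<close>

lemma vectI_inverse:
  assumes "\<And>x y. x \<in> carrier V \<Longrightarrow> y \<in> carrier V \<Longrightarrow> x \<oplus>\<^bsub>V\<^esub> y \<in> carrier V"
    and "\<zero>\<^bsub>V\<^esub> \<in> carrier V"
    and "\<And>x y z. x \<in> carrier V \<Longrightarrow> y \<in> carrier V \<Longrightarrow> z \<in> carrier V \<Longrightarrow>
      x \<oplus>\<^bsub>V\<^esub> y \<oplus>\<^bsub>V\<^esub> z = x \<oplus>\<^bsub>V\<^esub> (y \<oplus>\<^bsub>V\<^esub> z)"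
    and "\<And>x y. x \<in> carrier V \<Longrightarrow> y \<in> carrier V \<Longrightarrow> x \<oplus>\<^bsub>V\<^esub> y = y \<oplus>\<^bsub>V\<^esub> x"
    and "\<And>x. x \<in> carrier V \<Longrightarrow> \<zero>\<^bsub>V\<^esub> \<oplus>\<^bsub>V\<^esub> x = x"
    and "\<And>c x. x \<in> carrier V \<Longrightarrow> c \<odot>\<^bsub>V\<^esub> x \<in> carrier V"
    and "\<And>c d x. x \<in> carrier V \<Longrightarrow> (c + d) \<odot>\<^bsub>V\<^esub> x = c \<odot>\<^bsub>V\<^esub> x \<oplus>\<^bsub>V\<^esub> d \<odot>\<^bsub>V\<^esub> x"
    and "\<And>c x y. x \<in> carrier V \<Longrightarrow> y \<in> carrier V \<Longrightarrow> c \<odot>\<^bsub>V\<^esub> (x \<oplus>\<^bsub>V\<^esub> y) = c \<odot>\<^bsub>V\<^esub> x \<oplus>\<^bsub>V\<^esub> c \<odot>\<^bsub>V\<^esub> y"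
    and "\<And>c d x. x \<in> carrier V \<Longrightarrow> (c * d) \<odot>\<^bsub>V\<^esub> x = c \<odot>\<^bsub>V\<^esub> (d \<odot>\<^bsub>V\<^esub> x)"
    and "\<And>x. x \<in> carrier V \<Longrightarrow> 1 \<odot>\<^bsub>V\<^esub> x = x"
    and zero: "\<And>x. x \<in> carrier V \<Longrightarrow> 0 \<odot>\<^bsub>V\<^esub> x = \<zero>\<^bsub>V\<^esub>"
  shows "vect V"
proof -
  have ag: "abelian_group V"
  proof (rule abelian_groupI)
    fix x assume x: "x \<in> carrier V"
    have "(- 1) \<odot>\<^bsub>V\<^esub> x \<oplus>\<^bsub>V\<^esub> x = (- 1 + 1) \<odot>\<^bsub>V\<^esub> x"
      using assms(7)[OF x, of "-1" 1] assms(10)[OF x] by simp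
    then show "\<exists>y\<in>carrier V. y \<oplus>\<^bsub>V\<^esub> x = \<zero>\<^bsub>V\<^esub>"
      using zero[OF x] assms(6)[OF x] by auto
  qed (rule assms; assumption)+
  show ?thesis unfolding vect_iff
    by (intro conjI ballI allI ag) (rule assms; assumption)+
qed

lemma vect_cong:
  assumes "carrier V = carrier W" "zero V = zero W" "add V = add W" "smult V = smult W"
    and V: "vect V"
  shows "vect W"
proof (rule vectI_inverse)
  fix x y assume "x \<in> carrier W" "y \<in> carrier W"
  then show "x \<oplus>\<^bsub>W\<^esub> y = y \<oplus>\<^bsub>W\<^esub> x"
    using vect_a_comm[OF V, of x y] by (simp add: assms(1-4)[symmetric])
qed (simp_all add: assms(1-4)[symmetric] V vect_a_assoc vect_smult_l_distr vect_smult_r_distr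
       vect_smult_assoc)

lemma k_algebraD:
  assumes "k_algebra A"
  shows "vect A" "ring A"
    "x \<in> carrier A \<Longrightarrow> y \<in> carrier A \<Longrightarrow> (c \<odot>\<^bsub>A\<^esub> x) \<otimes>\<^bsub>A\<^esub> y = c \<odot>\<^bsub>A\<^esub> (x \<otimes>\<^bsub>A\<^esub> y)"
    "x \<in> carrier A \<Longrightarrow> y \<in> carrier A \<Longrightarrow> x \<otimes>\<^bsub>A\<^esub> (c \<odot>\<^bsub>A\<^esub> y) = c \<odot>\<^bsub>A\<^esub> (x \<otimes>\<^bsub>A\<^esub> y)"
  using assms by (auto simp: k_algebra_def)

lemma k_algebraI:
  assumes "vect A"
    and "\<And>x y. x \<in> carrier A \<Longrightarrow> y \<in> carrier A \<Longrightarrow> x \<otimes>\<^bsub>A\<^esub> y \<in> carrier A"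
    and "\<one>\<^bsub>A\<^esub> \<in> carrier A"
    and "\<And>x y z. x \<in> carrier A \<Longrightarrow> y \<in> carrier A \<Longrightarrow> z \<in> carrier A \<Longrightarrow>
      x \<otimes>\<^bsub>A\<^esub> y \<otimes>\<^bsub>A\<^esub> z = x \<otimes>\<^bsub>A\<^esub> (y \<otimes>\<^bsub>A\<^esub> z)"
    and "\<And>x. x \<in> carrier A \<Longrightarrow> \<one>\<^bsub>A\<^esub> \<otimes>\<^bsub>A\<^esub> x = x" "\<And>x. x \<in> carrier A \<Longrightarrow> x \<otimes>\<^bsub>A\<^esub> \<one>\<^bsub>A\<^esub> = x"
    and "\<And>x y z. x \<in> carrier A \<Longrightarrow> y \<in> carrier A \<Longrightarrow> z \<in> carrier A \<Longrightarrow>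
      (x \<oplus>\<^bsub>A\<^esub> y) \<otimes>\<^bsub>A\<^esub> z = x \<otimes>\<^bsub>A\<^esub> z \<oplus>\<^bsub>A\<^esub> y \<otimes>\<^bsub>A\<^esub> z"
    and "\<And>x y z. x \<in> carrier A \<Longrightarrow> y \<in> carrier A \<Longrightarrow> z \<in> carrier A \<Longrightarrow>
      z \<otimes>\<^bsub>A\<^esub> (x \<oplus>\<^bsub>A\<^esub> y) = z \<otimes>\<^bsub>A\<^esub> x \<oplus>\<^bsub>A\<^esub> z \<otimes>\<^bsub>A\<^esub> y"
    and "\<And>c x y. x \<in> carrier A \<Longrightarrow> y \<in> carrier A \<Longrightarrow> (c \<odot>\<^bsub>A\<^esub> x) \<otimes>\<^bsub>A\<^esub> y = c \<odot>\<^bsub>A\<^esub> (x \<otimes>\<^bsub>A\<^esub> y)"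
    and "\<And>c x y. x \<in> carrier A \<Longrightarrow> y \<in> carrier A \<Longrightarrow> x \<otimes>\<^bsub>A\<^esub> (c \<odot>\<^bsub>A\<^esub> y) = c \<odot>\<^bsub>A\<^esub> (x \<otimes>\<^bsub>A\<^esub> y)"
  shows "k_algebra A"
proof -
  have ring: "ring A"
    by (intro ringI monoidI vect_abelian_group assms(1)) (rule assms; assumption)+
  show ?thesis unfolding k_algebra_def
    by (intro conjI ballI allI assms(1) ring) (rule assms; assumption)+
qed

lemma submodule_base_iff:
  assumes "vect V"
  shows "submodule N base V \<longleftrightarrow> N \<subseteq> carrier V \<and> \<zero>\<^bsub>V\<^esub> \<in> N \<and>
    (\<forall>x\<in>N. \<forall>y\<in>N. x \<oplus>\<^bsub>V\<^esub> y \<in> N) \<and> (\<forall>c. \<forall>x\<in>N. c \<odot>\<^bsub>V\<^esub> x \<in> N)"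
proof -
  interpret M: Module.module base V using assms by (simp add: vect_def)
  show ?thesis
  proof
    assume N: "submodule N base V"
    show "N \<subseteq> carrier V \<and> \<zero>\<^bsub>V\<^esub> \<in> N \<and> (\<forall>x\<in>N. \<forall>y\<in>N. x \<oplus>\<^bsub>V\<^esub> y \<in> N) \<and> (\<forall>c. \<forall>x\<in>N. c \<odot>\<^bsub>V\<^esub> x \<in> N)"
      using M.submoduleE[OF N] subgroup.one_closed[OF submodule.axioms(1)[OF N]] by auto
  next
    assume *: "N \<subseteq> carrier V \<and> \<zero>\<^bsub>V\<^esub> \<in> N \<and>
      (\<forall>x\<in>N. \<forall>y\<in>N. x \<oplus>\<^bsub>V\<^esub> y \<in> N) \<and> (\<forall>c. \<forall>x\<in>N. c \<odot>\<^bsub>V\<^esub> x \<in> N)"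
    have "\<ominus>\<^bsub>V\<^esub> a \<in> N" if "a \<in> N" for a
      using that * vect_a_inv[OF assms, of a] by auto
    with * show "submodule N base V"
      by (intro M.submoduleI) auto
  qed
qed

lemma submoduleD:
  assumes "vect V" "submodule N base V"
  shows "N \<subseteq> carrier V" "\<zero>\<^bsub>V\<^esub> \<in> N" "x \<in> N \<Longrightarrow> y \<in> N \<Longrightarrow> x \<oplus>\<^bsub>V\<^esub> y \<in> N" "x \<in> N \<Longrightarrow> c \<odot>\<^bsub>V\<^esub> x \<in> N"
    "x \<in> N \<Longrightarrow> \<ominus>\<^bsub>V\<^esub> x \<in> N"
proof -
  show *: "N \<subseteq> carrier V" "\<zero>\<^bsub>V\<^esub> \<in> N" "x \<in> N \<Longrightarrow> y \<in> N \<Longrightarrow> x \<oplus>\<^bsub>V\<^esub> y \<in> N" "x \<in> N \<Longrightarrow> c \<odot>\<^bsub>V\<^esub> x \<in> N" for c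
    using assms by (simp_all add: submodule_base_iff)
  show "x \<in> N \<Longrightarrow> \<ominus>\<^bsub>V\<^esub> x \<in> N" using *(1) *(4)[of "-1"] assms(1) vect_a_inv[of V x] by auto
qed

lemma lin_homD:
  assumes "f \<in> lin_hom V W"
  shows "x \<in> carrier V \<Longrightarrow> f x \<in> carrier W"
    "x \<in> carrier V \<Longrightarrow> y \<in> carrier V \<Longrightarrow> f (x \<oplus>\<^bsub>V\<^esub> y) = f x \<oplus>\<^bsub>W\<^esub> f y"
    "x \<in> carrier V \<Longrightarrow> f (c \<odot>\<^bsub>V\<^esub> x) = c \<odot>\<^bsub>W\<^esub> f x"
  using assms by (auto simp: lin_hom_def)

lemma lin_homI:
  assumes "\<And>x. x \<in> carrier V \<Longrightarrow> f x \<in> carrier W"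
    "\<And>x y. x \<in> carrier V \<Longrightarrow> y \<in> carrier V \<Longrightarrow> f (x \<oplus>\<^bsub>V\<^esub> y) = f x \<oplus>\<^bsub>W\<^esub> f y"
    "\<And>c x. x \<in> carrier V \<Longrightarrow> f (c \<odot>\<^bsub>V\<^esub> x) = c \<odot>\<^bsub>W\<^esub> f x"
  shows "f \<in> lin_hom V W"
  using assms by (auto simp: lin_hom_def)

lemma lin_hom_zero: "vect V \<Longrightarrow> vect W \<Longrightarrow> f \<in> lin_hom V W \<Longrightarrow> f \<zero>\<^bsub>V\<^esub> = \<zero>\<^bsub>W\<^esub>"
  by (metis lin_homD(1) lin_homD(3) vect_smult_zero_left vect_zero_closed)

lemma lin_hom_comp:
  "f \<in> lin_hom U V \<Longrightarrow> g \<in> lin_hom V W \<Longrightarrow> (\<lambda>x. g (f x)) \<in> lin_hom U W"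
  by (auto simp: lin_hom_def Pi_def)

lemma lin_hom_id: "(\<lambda>x. x) \<in> lin_hom V V"
  by (auto simp: lin_hom_def)

lemma lin_hom_smult: "vect W \<Longrightarrow> f \<in> lin_hom V W \<Longrightarrow> (\<lambda>x. c \<odot>\<^bsub>W\<^esub> f x) \<in> lin_hom V W"
  by (rule lin_homI) (auto simp: lin_homD vect_smult_r_distr vect_smult_assoc mult.commute)

lemma lin_hom_kernel:
  assumes "vect V" "vect W" "f \<in> lin_hom V W" "submodule N base W"
  shows "submodule {x \<in> carrier V. f x \<in> N} base V"
  using assms submoduleD[OF assms(2,4)] lin_hom_zero[OF assms(1-3)]
  by (auto simp: submodule_base_iff lin_homD[OF assms(3)])

lemma equalizer_submodule:
  assumes V: "vect V" and f: "f \<in> lin_hom V U" and g: "g \<in> lin_hom V U" and U: "vect U"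
  shows "submodule {x \<in> carrier V. f x = g x} base V"
  using lin_hom_zero[OF V U f] lin_hom_zero[OF V U g] V
  by (auto simp: submodule_base_iff[OF V] lin_homD[OF f] lin_homD[OF g])

lemma image_submodule:
  assumes V: "vect V" and U: "vect U" and f: "f \<in> lin_hom V U" and S: "submodule S base V"
  shows "submodule (f ` S) base U"
proof -
  note SD = submoduleD[OF V S]
  show ?thesis unfolding submodule_base_iff[OF U]
  proof (intro conjI ballI allI subsetI)
    show "\<zero>\<^bsub>U\<^esub> \<in> f ` S" using lin_hom_zero[OF V U f] SD(2) by force
    fix x assume "x \<in> f ` S"
    then obtain x' where x: "x' \<in> S" "x = f x'" by auto
    then have xc: "x' \<in> carrier V" using SD(1) by auto
    show "x \<in> carrier U" using x xc lin_homD(1)[OF f] by auto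
    show "c \<odot>\<^bsub>U\<^esub> x \<in> f ` S" for c
      using x xc lin_homD(3)[OF f, of x' c] SD(4)[of x' c] by (metis imageI)
    fix y assume "y \<in> f ` S"
    then obtain y' where y: "y' \<in> S" "y = f y'" by auto
    then have yc: "y' \<in> carrier V" using SD(1) by auto
    show "x \<oplus>\<^bsub>U\<^esub> y \<in> f ` S"
      using x y lin_homD(2)[OF f xc yc] SD(3)[of x' y'] by force
  qed
qed

lemma submodule_zero: "vect V \<Longrightarrow> submodule {\<zero>\<^bsub>V\<^esub>} base V"
  by (auto simp: submodule_base_iff)

lemma submodule_carrier: "vect V \<Longrightarrow> submodule (carrier V) base V"
  by (auto simp: submodule_base_iff)

lemma submodule_Int:
  "vect V \<Longrightarrow> submodule M base V \<Longrightarrow> submodule N base V \<Longrightarrow> submodule (M \<inter> N) base V"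
  by (auto simp: submodule_base_iff)

lemma lin_span_submodule:
  assumes V: "vect V" and S: "S \<subseteq> carrier V"
  shows "submodule (lin_span V S) base V"
  using submodule_carrier[OF V] S
  unfolding submodule_base_iff[OF V] lin_span_def by (auto simp: submodule_base_iff[OF V])

lemma lin_span_superset: "S \<subseteq> lin_span V S"
  by (auto simp: lin_span_def)

lemma lin_span_least: "submodule N base V \<Longrightarrow> S \<subseteq> N \<Longrightarrow> lin_span V S \<subseteq> N"
  by (auto simp: lin_span_def)

lemma lin_span_image:
  assumes V: "vect V" and U: "vect U" and f: "f \<in> lin_hom V U" and P: "P \<subseteq> carrier V" and Q: "Q \<subseteq> carrier U"
    and PQ: "\<And>x. x \<in> P \<Longrightarrow> f x \<in> Q" and x: "x \<in> lin_span V P"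
  shows "f x \<in> lin_span U Q"
proof -
  have "lin_span V P \<subseteq> {x \<in> carrier V. f x \<in> lin_span U Q}"
    using P PQ lin_span_superset[of Q U]
    by (intro lin_span_least lin_hom_kernel[OF V U f lin_span_submodule[OF U Q]]) auto
  then show ?thesis using x by auto
qed

subsection \<open>Finite sums\<close>

lemma vect_finsum_closed [simp, intro]:
  assumes "vect V" "f \<in> A \<rightarrow> carrier V" shows "finsum V f A \<in> carrier V"
proof -
  interpret abelian_monoid V using assms(1) by (rule vect_abelian_monoid)
  show ?thesis using assms(2) by (rule finsum_closed)
qed

lemma finsum_in_submodule:
  assumes V: "vect V" and N: "submodule N base V" and f: "f \<in> A \<rightarrow> N"
  shows "finsum V f A \<in> N"
proof -
  interpret abelian_monoid V using V by (rule vect_abelian_monoid)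
  show ?thesis using f
  proof (induction A rule: infinite_finite_induct)
    case (insert x F)
    then have "f \<in> F \<rightarrow> carrier V" "f x \<in> carrier V" using submoduleD(1)[OF V N] by auto
    then show ?case using insert submoduleD(3)[OF V N] by (simp add: finsum_insert)
  qed (use submoduleD(2)[OF V N] in auto)
qed

lemma lin_hom_finsum:
  assumes V: "vect V" and W: "vect W" and h: "h \<in> lin_hom V W" and f: "f \<in> A \<rightarrow> carrier V"
  shows "h (finsum V f A) = finsum W (\<lambda>x. h (f x)) A"
proof -
  interpret V: abelian_monoid V using V by (rule vect_abelian_monoid)
  interpret W: abelian_monoid W using W by (rule vect_abelian_monoid)
  show ?thesis using f
  proof (induction A rule: infinite_finite_induct)
    case (insert x F)
    then have "f \<in> F \<rightarrow> carrier V" "f x \<in> carrier V" "(\<lambda>x. h (f x)) \<in> F \<rightarrow> carrier W" "h (f x) \<in> carrier W"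
      by (auto simp: Pi_def lin_homD(1)[OF h])
    then show ?case using insert by (simp add: lin_homD[OF h])
  qed (auto simp: lin_hom_zero[OF V W h])
qed

lemma lin_hom_of_finsum:
  assumes V: "vect V" and W: "vect W" and f: "\<And>i. i \<in> A \<Longrightarrow> f i \<in> lin_hom V W"
  shows "(\<lambda>x. finsum W (\<lambda>i. f i x) A) \<in> lin_hom V W"
proof -
  interpret W: abelian_monoid W using W by (rule vect_abelian_monoid)
  show ?thesis
  proof (rule lin_homI)
    fix x assume x: "x \<in> carrier V"
    then have fx: "(\<lambda>i. f i x) \<in> A \<rightarrow> carrier W" using lin_homD(1)[OF f] by auto
    then show "finsum W (\<lambda>i. f i x) A \<in> carrier W" by simp
    { fix c
      have "(\<lambda>x. c \<odot>\<^bsub>W\<^esub> x) \<in> lin_hom W W" using lin_hom_smult[OF W lin_hom_id] .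
      from lin_hom_finsum[OF W W this fx]
      show "finsum W (\<lambda>i. f i (c \<odot>\<^bsub>V\<^esub> x)) A = c \<odot>\<^bsub>W\<^esub> finsum W (\<lambda>i. f i x) A"
        using lin_homD(3)[OF f x] fx W by (auto simp: Pi_def intro!: W.finsum_cong') }
    { fix y assume y: "y \<in> carrier V"
      then have fy: "(\<lambda>i. f i y) \<in> A \<rightarrow> carrier W" using lin_homD(1)[OF f] by auto
      have "finsum W (\<lambda>i. f i (x \<oplus>\<^bsub>V\<^esub> y)) A = finsum W (\<lambda>i. f i x \<oplus>\<^bsub>W\<^esub> f i y) A"
        by (rule W.finsum_cong') (use lin_homD(2)[OF f x y] fx fy W in auto)
      then show "finsum W (\<lambda>i. f i (x \<oplus>\<^bsub>V\<^esub> y)) A = finsum W (\<lambda>i. f i x) A \<oplus>\<^bsub>W\<^esub> finsum W (\<lambda>i. f i y) A"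
        using W.finsum_addf[OF fx fy] by simp }
  qed
qed

lemma finsum_base: "finsum (base :: ('k::field, 'k) module) f A = sum f A"
proof -
  interpret abelian_monoid "base :: ('k, 'k) module" by (rule vect_abelian_monoid[OF vect_base])
  show ?thesis
    by (induction A rule: infinite_finite_induct) (auto simp: Pi_def)
qed

lemma finsum_record_cong:
  assumes "carrier V = carrier W" "zero V = zero W" "add V = add W"
  shows "finsum V f A = finsum W f A"
  using assms by (simp add: finsum_def finprod_def)

lemma vect_finsum_cong:
  assumes "vect V" "A = B" "\<And>i. i \<in> B \<Longrightarrow> f i = g i" "\<And>i. i \<in> B \<Longrightarrow> g i \<in> carrier V"
  shows "finsum V f A = finsum V g B"
proof -
  interpret abelian_monoid V using assms(1) by (rule vect_abelian_monoid)
  show ?thesis by (rule finsum_cong') (use assms in auto)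
qed

lemma vect_finsum_add:
  assumes "vect V" "\<And>i. i \<in> A \<Longrightarrow> f i \<in> carrier V" "\<And>i. i \<in> A \<Longrightarrow> g i \<in> carrier V"
  shows "(\<Oplus>\<^bsub>V\<^esub>i\<in>A. f i \<oplus>\<^bsub>V\<^esub> g i) = finsum V f A \<oplus>\<^bsub>V\<^esub> finsum V g A"
proof -
  interpret abelian_monoid V using assms(1) by (rule vect_abelian_monoid)
  show ?thesis by (rule finsum_addf) (use assms in auto)
qed

lemma smult_finsum:
  assumes V: "vect V" and f: "f \<in> A \<rightarrow> carrier V"
  shows "c \<odot>\<^bsub>V\<^esub> finsum V f A = (\<Oplus>\<^bsub>V\<^esub>i\<in>A. c \<odot>\<^bsub>V\<^esub> f i)"
  by (rule lin_hom_finsum[OF V V lin_hom_smult[OF V lin_hom_id] f])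

lemma finsum_smult_left:
  assumes V: "vect V" and x: "x \<in> carrier V"
  shows "(sum f A) \<odot>\<^bsub>V\<^esub> x = (\<Oplus>\<^bsub>V\<^esub>i\<in>A. f i \<odot>\<^bsub>V\<^esub> x)"
proof -
  have "(\<lambda>c. c \<odot>\<^bsub>V\<^esub> x) \<in> lin_hom base V"
    by (rule lin_homI) (use V x in \<open>auto simp: vect_smult_l_distr vect_smult_assoc\<close>)
  from lin_hom_finsum[OF vect_base V this, of f A] show ?thesis by (simp add: finsum_base)
qed

lemma vect_finsum_delta:
  assumes V: "vect V" and "finite A" "w \<in> A" "f \<in> A \<rightarrow> carrier V"
  shows "(\<Oplus>\<^bsub>V\<^esub>u\<in>A. (if u = w then 1 else 0) \<odot>\<^bsub>V\<^esub> f u) = f w" "(\<Oplus>\<^bsub>V\<^esub>u\<in>A. (if w = u then 1 else 0) \<odot>\<^bsub>V\<^esub> f u) = f w"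
proof -
  interpret abelian_group V using V by (rule vect_abelian_group)
  have "(\<Oplus>\<^bsub>V\<^esub>u\<in>A. (if w = u then 1 else 0) \<odot>\<^bsub>V\<^esub> f u) = (\<Oplus>\<^bsub>V\<^esub>u\<in>A. if w = u then f u else \<zero>\<^bsub>V\<^esub>)"
    by (rule finsum_cong') (use assms in \<open>auto simp: Pi_iff\<close>)
  also have "\<dots> = f w" by (rule finsum_singleton) (use assms in auto)
  finally show "(\<Oplus>\<^bsub>V\<^esub>u\<in>A. (if w = u then 1 else 0) \<odot>\<^bsub>V\<^esub> f u) = f w" .
  then show "(\<Oplus>\<^bsub>V\<^esub>u\<in>A. (if u = w then 1 else 0) \<odot>\<^bsub>V\<^esub> f u) = f w" by (simp add: eq_commute)
qed

lemma finsum_extend: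
  assumes V: "vect V" and "finite B" "A \<subseteq> B" "\<And>i. i \<in> A \<Longrightarrow> f i \<in> carrier V"
  shows "finsum V f A = finsum V (\<lambda>i. if i \<in> A then f i else \<zero>\<^bsub>V\<^esub>) B"
proof -
  interpret abelian_group V using V by (rule vect_abelian_group)
  show ?thesis
    by (rule add.finprod_mono_neutral_cong_left) (use assms in \<open>auto simp: Pi_iff\<close>)
qed

lemma finsum_swap:
  assumes V: "vect V" and fin: "finite A" and f: "\<And>x y. x \<in> A \<Longrightarrow> y \<in> B \<Longrightarrow> f x y \<in> carrier V"
  shows "(\<Oplus>\<^bsub>V\<^esub>x\<in>A. \<Oplus>\<^bsub>V\<^esub>y\<in>B. f x y) = (\<Oplus>\<^bsub>V\<^esub>y\<in>B. \<Oplus>\<^bsub>V\<^esub>x\<in>A. f x y)"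
proof -
  interpret abelian_monoid V using V by (rule vect_abelian_monoid)
  show ?thesis using fin f
  proof (induction A rule: finite_induct)
    case empty
    show ?case by (simp add: finsum_empty finsum_zero)
  next
    case (insert a A)
    have 1: "(\<lambda>x. \<Oplus>\<^bsub>V\<^esub>y\<in>B. f x y) \<in> A \<rightarrow> carrier V" "(\<Oplus>\<^bsub>V\<^esub>y\<in>B. f a y) \<in> carrier V"
      using insert.prems by (auto intro!: finsum_closed)
    have 2: "(\<lambda>y. f a y) \<in> B \<rightarrow> carrier V" "(\<lambda>y. \<Oplus>\<^bsub>V\<^esub>x\<in>A. f x y) \<in> B \<rightarrow> carrier V"
      using insert.prems by (auto intro!: finsum_closed)
    have 3: "(\<Oplus>\<^bsub>V\<^esub>x\<in>insert a A. f x y) = f a y \<oplus>\<^bsub>V\<^esub> (\<Oplus>\<^bsub>V\<^esub>x\<in>A. f x y)" if "y \<in> B" for y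
      by (rule finsum_insert) (use insert that in auto)
    have "(\<Oplus>\<^bsub>V\<^esub>x\<in>insert a A. \<Oplus>\<^bsub>V\<^esub>y\<in>B. f x y) = (\<Oplus>\<^bsub>V\<^esub>y\<in>B. f a y) \<oplus>\<^bsub>V\<^esub> (\<Oplus>\<^bsub>V\<^esub>x\<in>A. \<Oplus>\<^bsub>V\<^esub>y\<in>B. f x y)"
      by (rule finsum_insert) (use insert.hyps 1 in auto)
    also have "\<dots> = (\<Oplus>\<^bsub>V\<^esub>y\<in>B. f a y) \<oplus>\<^bsub>V\<^esub> (\<Oplus>\<^bsub>V\<^esub>y\<in>B. \<Oplus>\<^bsub>V\<^esub>x\<in>A. f x y)"
      using insert.IH insert.prems by simp
    also have "\<dots> = (\<Oplus>\<^bsub>V\<^esub>y\<in>B. f a y \<oplus>\<^bsub>V\<^esub> (\<Oplus>\<^bsub>V\<^esub>x\<in>A. f x y))"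
      using finsum_addf[OF 2] by simp
    also have "\<dots> = (\<Oplus>\<^bsub>V\<^esub>y\<in>B. \<Oplus>\<^bsub>V\<^esub>x\<in>insert a A. f x y)"
      by (rule finsum_cong') (use 2 3 in \<open>auto simp: Pi_iff\<close>)
    finally show ?case .
  qed
qed

subsection \<open>Linear extension from a basis\<close>

text \<open>
  Several records have finitely supported functions on a set as underlying vector space and differ
  in their multiplications only.
\<close>

definition free_on :: "('k::field, 'x \<Rightarrow>\<^sub>0 'k, 'm) module_scheme \<Rightarrow> 'x set \<Rightarrow> bool" where
  "free_on F D \<longleftrightarrow> carrier F = {p. Poly_Mapping.keys p \<subseteq> D} \<and> zero F = 0 \<and> add F = (+) \<and>
     smult F = (\<lambda>c. Poly_Mapping.map ((*) c))"

abbreviation scl :: "'k::field \<Rightarrow> ('x \<Rightarrow>\<^sub>0 'k) \<Rightarrow> ('x \<Rightarrow>\<^sub>0 'k)" where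
  "scl c \<equiv> Poly_Mapping.map ((*) c)"

lemma lookup_scl [simp]: "Poly_Mapping.lookup (scl c p) x = c * Poly_Mapping.lookup p x"
  by (simp add: Poly_Mapping.map.rep_eq when_def)

lemma keys_scl: "Poly_Mapping.keys (scl c p) \<subseteq> Poly_Mapping.keys p"
  by (auto simp: in_keys_iff)

lemma scl_id [simp]: "Poly_Mapping.map (\<lambda>a. a) p = (p :: 'x \<Rightarrow>\<^sub>0 'k::field)"
  by (simp add: poly_mapping_eq_iff fun_eq_iff Poly_Mapping.map.rep_eq when_def)

lemma scl_null [simp]: "Poly_Mapping.map (\<lambda>a. 0) p = (0 :: 'x \<Rightarrow>\<^sub>0 'k::field)"
  by (simp add: poly_mapping_eq_iff fun_eq_iff Poly_Mapping.map.rep_eq when_def)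

lemma single_sum: "Poly_Mapping.single x (sum g I) = (\<Sum>i\<in>I. Poly_Mapping.single x (g i))"
  by (induction I rule: infinite_finite_induct) (simp_all add: single_add)

lemma scl_single [simp]: "scl c (Poly_Mapping.single x d) = Poly_Mapping.single x (c * d)"
  by (simp add: poly_mapping_eq_iff fun_eq_iff lookup_single when_def)

lemma scl_add: "scl c (p + q) = scl c p + scl c q"
  and scl_minus: "scl c (p - q) = scl c p - scl c q"
  and scl_sum: "scl c (sum f A) = (\<Sum>i\<in>A. scl c (f i))"
  and scl_scl [simp]: "scl c (scl d p) = scl (c * d) p"
  and scl_add_left: "scl (c + d) p = scl c p + scl d p"
  and scl_one [simp]: "scl 1 p = p"
  and scl_zero_left [simp]: "scl 0 p = 0"
  and scl_zero_right [simp]: "scl c 0 = 0"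
  and scl_sum_left: "scl (sum g A) p = (\<Sum>i\<in>A. scl (g i) p)"
  by (simp_all add: poly_mapping_eq_iff fun_eq_iff lookup_add lookup_minus lookup_sum algebra_simps
      sum_distrib_left sum_distrib_right)

lemma free_on_vect:
  assumes "free_on F D" shows "vect F"
proof -
  have cl: "Poly_Mapping.keys (p + q) \<subseteq> D" if "Poly_Mapping.keys p \<subseteq> D" "Poly_Mapping.keys q \<subseteq> D"
    for p q :: "'a \<Rightarrow>\<^sub>0 'b"
    using that keys_add[of p q] by auto
  have cl2: "Poly_Mapping.keys (scl c p) \<subseteq> D" if "Poly_Mapping.keys p \<subseteq> D" for p :: "'a \<Rightarrow>\<^sub>0 'b" and c
    using that keys_scl[of c p] by auto
  show ?thesis
    by (rule vectI_inverse) (use assms cl cl2 in \<open>auto simp: free_on_def scl_add scl_add_left add.assoc add.commute\<close>)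
qed

lemma free_on_minus:
  assumes "free_on F D" "p \<in> carrier F" "q \<in> carrier F"
  shows "p - q \<in> carrier F" "p - q = p \<oplus>\<^bsub>F\<^esub> (\<ominus>\<^bsub>F\<^esub> q)" "\<ominus>\<^bsub>F\<^esub> q = - q"
proof -
  have k: "Poly_Mapping.keys (p - q) \<subseteq> Poly_Mapping.keys p \<union> Poly_Mapping.keys q"
    by (auto simp: in_keys_iff lookup_minus)
  show "p - q \<in> carrier F" using assms k by (auto simp: free_on_def)
  have "\<ominus>\<^bsub>F\<^esub> q = scl (-1) q"
    using vect_a_inv[OF free_on_vect[OF assms(1)] assms(3)] assms(1) by (simp add: free_on_def)
  also have "\<dots> = - q" by (simp add: poly_mapping_eq_iff fun_eq_iff)
  finally show "\<ominus>\<^bsub>F\<^esub> q = - q" .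
  then show "p - q = p \<oplus>\<^bsub>F\<^esub> (\<ominus>\<^bsub>F\<^esub> q)" using assms(1) by (simp add: free_on_def)
qed

lemma poly_mapping_expand:
  "(p :: 'x \<Rightarrow>\<^sub>0 'k::field) = (\<Sum>x\<in>Poly_Mapping.keys p. Poly_Mapping.single x (Poly_Mapping.lookup p x))"
  by (simp add: poly_mapping_eq_iff fun_eq_iff lookup_sum lookup_single when_def in_keys_iff)

lemma poly_mapping_on_induct [consumes 1, case_names zero single add]:
  assumes "Poly_Mapping.keys (p :: 'x \<Rightarrow>\<^sub>0 'k::field) \<subseteq> D"
    and "P 0" and "\<And>x c. x \<in> D \<Longrightarrow> P (Poly_Mapping.single x c)"
    and "\<And>p q. Poly_Mapping.keys p \<subseteq> D \<Longrightarrow> Poly_Mapping.keys q \<subseteq> D \<Longrightarrow> P p \<Longrightarrow> P q \<Longrightarrow> P (p + q)"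
  shows "P p"
proof -
  have "Poly_Mapping.keys (\<Sum>x\<in>K. Poly_Mapping.single x (Poly_Mapping.lookup p x)) \<subseteq> D \<and>
      P (\<Sum>x\<in>K. Poly_Mapping.single x (Poly_Mapping.lookup p x))"
    if "finite K" "K \<subseteq> D" for K
    using that
  proof (induction K rule: finite_induct)
    case (insert x K)
    have "Poly_Mapping.keys (Poly_Mapping.single x (Poly_Mapping.lookup p x)) \<subseteq> D"
      using insert.prems by auto
    moreover have "P (Poly_Mapping.single x (Poly_Mapping.lookup p x))"
      using insert.prems assms(3) by auto
    moreover have "K \<subseteq> D" using insert.prems by auto
    ultimately show ?case
      using insert.IH insert.hyps assms(4)
      by (auto intro!: order_trans[OF keys_add] simp del: keys_single)
  qed (use assms(2) in auto)
  from this[OF finite_keys assms(1)] show ?thesis using poly_mapping_expand[of p] by simp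
qed

text \<open>
  The support in the definition of \<open>lin_ext\<close> varies with the argument; a common finite superset
  makes additivity visible.
\<close>

lemma lin_ext_superset:
  assumes U: "vect U" and b: "\<beta> \<in> D \<rightarrow> carrier U" and K: "finite K" "Poly_Mapping.keys p \<subseteq> K" "K \<subseteq> D"
  shows "lin_ext U \<beta> p = (\<Oplus>\<^bsub>U\<^esub>x\<in>K. Poly_Mapping.lookup p x \<odot>\<^bsub>U\<^esub> \<beta> x)"
proof -
  interpret abelian_group U using U by (rule vect_abelian_group)
  show ?thesis unfolding lin_ext_def
    by (rule add.finprod_mono_neutral_cong_left)
       (use assms in \<open>auto simp: in_keys_iff Pi_def subset_iff\<close>)
qed

lemma lin_ext_lin_hom:
  assumes F: "free_on F D" and U: "vect U" and b: "\<beta> \<in> D \<rightarrow> carrier U"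
  shows "lin_ext U \<beta> \<in> lin_hom F U"
proof -
  interpret abelian_group U using U by (rule vect_abelian_group)
  show ?thesis
  proof (rule lin_homI)
    fix p assume "p \<in> carrier F"
    then have p: "Poly_Mapping.keys p \<subseteq> D" using F by (simp add: free_on_def)
    have bp: "(\<lambda>x. c x \<odot>\<^bsub>U\<^esub> \<beta> x) \<in> Poly_Mapping.keys p \<rightarrow> carrier U" for c using p b U by (auto simp: Pi_def)
    show "lin_ext U \<beta> p \<in> carrier U" unfolding lin_ext_def
      by (rule vect_finsum_closed[OF U]) (rule bp)
    { fix c
      have "lin_ext U \<beta> (scl c p) = (\<Oplus>\<^bsub>U\<^esub>x\<in>Poly_Mapping.keys p. (c * Poly_Mapping.lookup p x) \<odot>\<^bsub>U\<^esub> \<beta> x)"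
        by (subst lin_ext_superset[OF U b finite_keys keys_scl]) (use p in auto)
      also have "\<dots> = (\<Oplus>\<^bsub>U\<^esub>x\<in>Poly_Mapping.keys p. c \<odot>\<^bsub>U\<^esub> (Poly_Mapping.lookup p x \<odot>\<^bsub>U\<^esub> \<beta> x))"
        by (rule finsum_cong') (use p b U in \<open>auto simp: vect_smult_assoc Pi_def subset_iff\<close>)
      also have "\<dots> = c \<odot>\<^bsub>U\<^esub> lin_ext U \<beta> p"
        unfolding lin_ext_def
        by (rule lin_hom_finsum[OF U U lin_hom_smult[OF U lin_hom_id], symmetric]) (rule bp)
      finally show "lin_ext U \<beta> (c \<odot>\<^bsub>F\<^esub> p) = c \<odot>\<^bsub>U\<^esub> lin_ext U \<beta> p" using F by (simp add: free_on_def) }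
    { fix q assume "q \<in> carrier F"
      then have q: "Poly_Mapping.keys q \<subseteq> D" using F by (simp add: free_on_def)
      let ?K = "Poly_Mapping.keys p \<union> Poly_Mapping.keys q"
      have K: "finite ?K" "?K \<subseteq> D" using p q by auto
      have bK: "(\<lambda>x. c x \<odot>\<^bsub>U\<^esub> \<beta> x) \<in> ?K \<rightarrow> carrier U" for c using K b U by (auto simp: Pi_def)
      have "lin_ext U \<beta> (p + q) = (\<Oplus>\<^bsub>U\<^esub>x\<in>?K. (Poly_Mapping.lookup p x + Poly_Mapping.lookup q x) \<odot>\<^bsub>U\<^esub> \<beta> x)"
        by (subst lin_ext_superset[OF U b K(1) keys_add K(2)]) (simp add: lookup_add)
      also have "\<dots> = (\<Oplus>\<^bsub>U\<^esub>x\<in>?K. Poly_Mapping.lookup p x \<odot>\<^bsub>U\<^esub> \<beta> x \<oplus>\<^bsub>U\<^esub> Poly_Mapping.lookup q x \<odot>\<^bsub>U\<^esub> \<beta> x)"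
        by (rule finsum_cong') (use K b U in \<open>auto simp: vect_smult_l_distr Pi_def subset_iff\<close>)
      also have "\<dots> = lin_ext U \<beta> p \<oplus>\<^bsub>U\<^esub> lin_ext U \<beta> q"
        by (simp add: finsum_addf[OF bK bK] lin_ext_superset[OF U b K(1) _ K(2)])
      finally show "lin_ext U \<beta> (p \<oplus>\<^bsub>F\<^esub> q) = lin_ext U \<beta> p \<oplus>\<^bsub>U\<^esub> lin_ext U \<beta> q"
        using F by (simp add: free_on_def) }
  qed
qed

lemma lin_ext_zero: "vect U \<Longrightarrow> lin_ext U \<beta> 0 = \<zero>\<^bsub>U\<^esub>"
  by (simp add: lin_ext_def abelian_monoid.finsum_empty vect_abelian_monoid)

lemma lin_ext_single:
  assumes "vect U" "\<beta> x \<in> carrier U"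
  shows "lin_ext U \<beta> (Poly_Mapping.single x c) = c \<odot>\<^bsub>U\<^esub> \<beta> x"
proof -
  interpret abelian_group U using assms(1) by (rule vect_abelian_group)
  show ?thesis
    using assms by (cases "c = 0") (auto simp: lin_ext_def finsum_insert Pi_def finsum_empty)
qed

lemma lin_hom_free_eq:
  assumes F: "free_on F D" and U: "vect U" and fg: "f \<in> lin_hom F U" "g \<in> lin_hom F U"
    and eq: "\<And>x. x \<in> D \<Longrightarrow> f (Poly_Mapping.single x 1) = g (Poly_Mapping.single x 1)"
    and p: "p \<in> carrier F"
  shows "f p = g p"
proof -
  have "Poly_Mapping.keys p \<subseteq> D" using F p by (simp add: free_on_def)
  then show ?thesis
  proof (induction rule: poly_mapping_on_induct)
    case zero
    then show ?case
      using lin_hom_zero[OF free_on_vect[OF F] U] fg F by (metis free_on_def)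
  next
    case (single x c)
    have "Poly_Mapping.single x c = c \<odot>\<^bsub>F\<^esub> Poly_Mapping.single x 1" using F by (simp add: free_on_def)
    moreover have "Poly_Mapping.single x 1 \<in> carrier F" using F single by (simp add: free_on_def)
    ultimately show ?case using lin_homD(3)[OF fg(1)] lin_homD(3)[OF fg(2)] eq[OF single] by simp
  next
    case (add p q)
    then have "p \<in> carrier F" "q \<in> carrier F" "p + q = p \<oplus>\<^bsub>F\<^esub> q" using F by (simp_all add: free_on_def)
    then show ?case using lin_homD(2)[OF fg(1)] lin_homD(2)[OF fg(2)] add by simp
  qed
qed

subsection \<open>Quotients\<close>

text \<open>
  The axioms pass along any surjection that is compatible with the operations, in particular to
  quotients.
\<close>

lemma surj_image_vect:
  assumes V: "vect V" and surj: "carrier Q = \<pi> ` carrier V"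
    and add: "\<And>x y. x \<in> carrier V \<Longrightarrow> y \<in> carrier V \<Longrightarrow> \<pi> x \<oplus>\<^bsub>Q\<^esub> \<pi> y = \<pi> (x \<oplus>\<^bsub>V\<^esub> y)"
    and zero: "\<zero>\<^bsub>Q\<^esub> = \<pi> \<zero>\<^bsub>V\<^esub>"
    and smult: "\<And>c x. x \<in> carrier V \<Longrightarrow> c \<odot>\<^bsub>Q\<^esub> \<pi> x = \<pi> (c \<odot>\<^bsub>V\<^esub> x)"
  shows "vect Q"
proof (rule vectI_inverse)
  fix x y assume "x \<in> carrier Q" "y \<in> carrier Q"
  then obtain x' y' where "x' \<in> carrier V" "y' \<in> carrier V" "x = \<pi> x'" "y = \<pi> y'"
    unfolding surj by blast
  then show "x \<oplus>\<^bsub>Q\<^esub> y = y \<oplus>\<^bsub>Q\<^esub> x" using vect_a_comm[OF V, of x' y'] by (simp add: add)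
qed (use V in \<open>auto simp: surj add zero smult vect_a_assoc vect_smult_l_distr vect_smult_r_distr
        vect_smult_assoc\<close>)

lemma surj_image_k_algebra:
  assumes A: "k_algebra A" and surj: "carrier Q = \<pi> ` carrier A"
    and add: "\<And>x y. x \<in> carrier A \<Longrightarrow> y \<in> carrier A \<Longrightarrow> \<pi> x \<oplus>\<^bsub>Q\<^esub> \<pi> y = \<pi> (x \<oplus>\<^bsub>A\<^esub> y)"
    and zero: "\<zero>\<^bsub>Q\<^esub> = \<pi> \<zero>\<^bsub>A\<^esub>"
    and smult: "\<And>c x. x \<in> carrier A \<Longrightarrow> c \<odot>\<^bsub>Q\<^esub> \<pi> x = \<pi> (c \<odot>\<^bsub>A\<^esub> x)"
    and mult: "\<And>x y. x \<in> carrier A \<Longrightarrow> y \<in> carrier A \<Longrightarrow> \<pi> x \<otimes>\<^bsub>Q\<^esub> \<pi> y = \<pi> (x \<otimes>\<^bsub>A\<^esub> y)"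
    and one: "\<one>\<^bsub>Q\<^esub> = \<pi> \<one>\<^bsub>A\<^esub>"
  shows "k_algebra Q"
proof -
  interpret ring A using A by (rule k_algebraD)
  note V = k_algebraD(1)[OF A]
  show ?thesis
    by (rule k_algebraI[OF surj_image_vect[OF V surj add zero smult]])
       (auto simp: surj add zero smult mult one m_assoc l_distr r_distr V k_algebraD(3,4)[OF A])
qed

lemma k_algebra_cong:
  assumes "carrier V = carrier W" "zero V = zero W" "add V = add W" "smult V = smult W"
    "mult V = mult W" "one V = one W" and V: "k_algebra V"
  shows "k_algebra W"
  by (rule surj_image_k_algebra[where \<pi> = "\<lambda>x. x", OF V]) (simp_all add: assms(1-6))

lemma k_algebra_base: "k_algebra (base :: ('k::field, 'k) module)"
  by (rule k_algebraI[OF vect_base]) (simp_all add: algebra_simps)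

lemma quot_simps:
  "carrier (quot V N) = a_rcosets\<^bsub>V\<^esub> N" "zero (quot V N) = N" "add (quot V N) = set_add V"
  "mult (quot V N) = rcoset_mult V N" "one (quot V N) = N +>\<^bsub>V\<^esub> \<one>\<^bsub>V\<^esub>"
  "smult (quot V N) = (\<lambda>c X. \<Union>x\<in>X. N +>\<^bsub>V\<^esub> (c \<odot>\<^bsub>V\<^esub> x))"
  by (simp_all add: quot_def ring.defs module.defs FactRing_def)

lemma submodule_abelian_subgroup:
  assumes "vect V" "submodule N base V" shows "abelian_subgroup N V"
  using assms by (intro abelian_subgroupI3 additive_subgroupI submodule.axioms(1) vect_abelian_group)

lemma in_coset_iff:
  assumes "vect V" "submodule N base V" "x \<in> carrier V"
  shows "y \<in> N +>\<^bsub>V\<^esub> x \<longleftrightarrow> (\<exists>h\<in>N. y = h \<oplus>\<^bsub>V\<^esub> x)"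
  by (auto simp: a_r_coset_def r_coset_def)

lemma coset_eqI:
  assumes V: "vect V" and N: "submodule N base V" and x: "x \<in> carrier V" and y: "y \<in> N +>\<^bsub>V\<^esub> x"
  shows "N +>\<^bsub>V\<^esub> y = N +>\<^bsub>V\<^esub> x"
proof -
  interpret abelian_subgroup N V using V N by (rule submodule_abelian_subgroup)
  show ?thesis using a_repr_independence[OF y x] a_subgroup by simp
qed

lemma coset_zeroI:
  assumes V: "vect V" and N: "submodule N base V" and x: "x \<in> N"
  shows "N +>\<^bsub>V\<^esub> x = \<zero>\<^bsub>quot V N\<^esub>"
proof -
  have xc: "x \<in> carrier V" using submoduleD(1)[OF V N] x by auto
  interpret abelian_subgroup N V using V N by (rule submodule_abelian_subgroup)
  have "N +>\<^bsub>V\<^esub> \<zero>\<^bsub>V\<^esub> = N"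
    using V submoduleD(1)[OF V N] by (auto simp: a_r_coset_def r_coset_def subset_iff intro!: bexI[rotated])
  moreover have "x \<in> N +>\<^bsub>V\<^esub> \<zero>\<^bsub>V\<^esub>" using calculation x by simp
  ultimately show ?thesis using coset_eqI[OF V N, of "\<zero>\<^bsub>V\<^esub>" x] V by (simp add: quot_simps)
qed

lemma quot_ops:
  assumes V: "vect V" and N: "submodule N base V"
  shows carrier_quot: "carrier (quot V N) = (\<lambda>x. N +>\<^bsub>V\<^esub> x) ` carrier V"
    and quot_zero: "\<zero>\<^bsub>quot V N\<^esub> = N +>\<^bsub>V\<^esub> \<zero>\<^bsub>V\<^esub>"
    and quot_add: "x \<in> carrier V \<Longrightarrow> y \<in> carrier V \<Longrightarrow>
      (N +>\<^bsub>V\<^esub> x) \<oplus>\<^bsub>quot V N\<^esub> (N +>\<^bsub>V\<^esub> y) = N +>\<^bsub>V\<^esub> (x \<oplus>\<^bsub>V\<^esub> y)"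
    and quot_smult: "x \<in> carrier V \<Longrightarrow> c \<odot>\<^bsub>quot V N\<^esub> (N +>\<^bsub>V\<^esub> x) = N +>\<^bsub>V\<^esub> (c \<odot>\<^bsub>V\<^esub> x)"
proof -
  interpret abelian_subgroup N V using V N by (rule submodule_abelian_subgroup)
  show "carrier (quot V N) = (\<lambda>x. N +>\<^bsub>V\<^esub> x) ` carrier V"
    by (auto simp: quot_simps A_RCOSETS_def')
  show "\<zero>\<^bsub>quot V N\<^esub> = N +>\<^bsub>V\<^esub> \<zero>\<^bsub>V\<^esub>" using coset_zeroI[OF V N submoduleD(2)[OF V N]] by simp
  show "x \<in> carrier V \<Longrightarrow> y \<in> carrier V \<Longrightarrow>
      (N +>\<^bsub>V\<^esub> x) \<oplus>\<^bsub>quot V N\<^esub> (N +>\<^bsub>V\<^esub> y) = N +>\<^bsub>V\<^esub> (x \<oplus>\<^bsub>V\<^esub> y)"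
    by (simp add: quot_simps a_rcos_sum)
  assume x: "x \<in> carrier V"
  have "N +>\<^bsub>V\<^esub> (c \<odot>\<^bsub>V\<^esub> y) = N +>\<^bsub>V\<^esub> (c \<odot>\<^bsub>V\<^esub> x)" if y: "y \<in> N +>\<^bsub>V\<^esub> x" for y
  proof -
    obtain h where h: "h \<in> N" "y = h \<oplus>\<^bsub>V\<^esub> x" using y in_coset_iff[OF V N x] by auto
    then have "c \<odot>\<^bsub>V\<^esub> y = c \<odot>\<^bsub>V\<^esub> h \<oplus>\<^bsub>V\<^esub> c \<odot>\<^bsub>V\<^esub> x"
      using vect_smult_r_distr[OF V, of h x] x submoduleD(1)[OF V N] by auto
    then have "c \<odot>\<^bsub>V\<^esub> y \<in> N +>\<^bsub>V\<^esub> (c \<odot>\<^bsub>V\<^esub> x)"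
      using in_coset_iff[OF V N, of "c \<odot>\<^bsub>V\<^esub> x"] submoduleD(4)[OF V N h(1), of c] x V by auto
    then show ?thesis using coset_eqI[OF V N] x V by auto
  qed
  note const = this
  have ne: "N +>\<^bsub>V\<^esub> x \<noteq> {}" using a_rcos_self[OF x] by blast
  show "c \<odot>\<^bsub>quot V N\<^esub> (N +>\<^bsub>V\<^esub> x) = N +>\<^bsub>V\<^esub> (c \<odot>\<^bsub>V\<^esub> x)"
    unfolding quot_simps by (rule SUP_eq_const[OF ne const])
qed

lemma vect_quot: "vect V \<Longrightarrow> submodule N base V \<Longrightarrow> vect (quot V N)"
  by (rule surj_image_vect[where \<pi> = "\<lambda>x. N +>\<^bsub>V\<^esub> x"]) (auto simp: quot_ops(1-3) quot_ops(4))

lemma quot_algebra_ops: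
  assumes A: "k_algebra A" and N: "submodule N base A" and I: "ideal N A"
  shows quot_mult: "x \<in> carrier A \<Longrightarrow> y \<in> carrier A \<Longrightarrow>
      (N +>\<^bsub>A\<^esub> x) \<otimes>\<^bsub>quot A N\<^esub> (N +>\<^bsub>A\<^esub> y) = N +>\<^bsub>A\<^esub> (x \<otimes>\<^bsub>A\<^esub> y)"
    and quot_one: "\<one>\<^bsub>quot A N\<^esub> = N +>\<^bsub>A\<^esub> \<one>\<^bsub>A\<^esub>"
    and k_algebra_quot: "k_algebra (quot A N)"
proof -
  show m: "x \<in> carrier A \<Longrightarrow> y \<in> carrier A \<Longrightarrow>
      (N +>\<^bsub>A\<^esub> x) \<otimes>\<^bsub>quot A N\<^esub> (N +>\<^bsub>A\<^esub> y) = N +>\<^bsub>A\<^esub> (x \<otimes>\<^bsub>A\<^esub> y)" for x y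
    using ideal.rcoset_mult_add[OF I] by (simp add: quot_simps)
  show o: "\<one>\<^bsub>quot A N\<^esub> = N +>\<^bsub>A\<^esub> \<one>\<^bsub>A\<^esub>" by (simp add: quot_simps)
  show "k_algebra (quot A N)"
    by (rule surj_image_k_algebra[where \<pi> = "\<lambda>x. N +>\<^bsub>A\<^esub> x", OF A])
       (simp_all add: quot_ops[OF k_algebraD(1)[OF A] N] m o)
qed

text \<open>The universal property of a quotient of a free vector space.\<close>

lemma coset_ext_coset:
  assumes F: "free_on F D" and N: "submodule N base F" and U: "vect U" and b: "\<beta> \<in> D \<rightarrow> carrier U"
    and zero: "\<And>p. p \<in> N \<Longrightarrow> lin_ext U \<beta> p = \<zero>\<^bsub>U\<^esub>" and p: "p \<in> carrier F"
  shows "coset_ext U \<beta> (N +>\<^bsub>F\<^esub> p) = lin_ext U \<beta> p"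
proof -
  note V = free_on_vect[OF F]
  note L = lin_ext_lin_hom[OF F U b]
  interpret abelian_subgroup N F using V N by (rule submodule_abelian_subgroup)
  have *: "lin_ext U \<beta> x = lin_ext U \<beta> p" if x: "x \<in> N +>\<^bsub>F\<^esub> p" for x
  proof -
    obtain h where h: "h \<in> N" "x = h \<oplus>\<^bsub>F\<^esub> p" using x in_coset_iff[OF V N p] by auto
    then show ?thesis
      using lin_homD(2)[OF L, of h p] p zero[OF h(1)] lin_homD(1)[OF L p] U by auto
  qed
  have "p \<in> N +>\<^bsub>F\<^esub> p" using p by (rule a_rcos_self)
  then show ?thesis unfolding coset_ext_def
    by (intro the_equality) (use * in metis)+
qed

lemma coset_ext_lin_hom:
  assumes F: "free_on F D" and N: "submodule N base F" and U: "vect U" and b: "\<beta> \<in> D \<rightarrow> carrier U"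
    and zero: "\<And>p. p \<in> N \<Longrightarrow> lin_ext U \<beta> p = \<zero>\<^bsub>U\<^esub>"
  shows "coset_ext U \<beta> \<in> lin_hom (quot F N) U"
proof -
  note V = free_on_vect[OF F]
  note q = quot_ops[OF V N] and c = coset_ext_coset[OF F N U b zero]
  note L = lin_homD[OF lin_ext_lin_hom[OF F U b]]
  show ?thesis
  proof (rule lin_homI)
    fix x assume "x \<in> carrier (quot F N)"
    then obtain p where p: "p \<in> carrier F" "x = N +>\<^bsub>F\<^esub> p" by (auto simp: q(1))
    then show "coset_ext U \<beta> x \<in> carrier U" by (simp add: c L(1))
    show "coset_ext U \<beta> (a \<odot>\<^bsub>quot F N\<^esub> x) = a \<odot>\<^bsub>U\<^esub> coset_ext U \<beta> x" for a
      using p V by (simp add: c L(3) q(4))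
    fix y assume "y \<in> carrier (quot F N)"
    then obtain r where r: "r \<in> carrier F" "y = N +>\<^bsub>F\<^esub> r" by (auto simp: q(1))
    then show "coset_ext U \<beta> (x \<oplus>\<^bsub>quot F N\<^esub> y) = coset_ext U \<beta> x \<oplus>\<^bsub>U\<^esub> coset_ext U \<beta> y"
      using p V by (simp add: c L(2) q(3))
  qed
qed

section \<open>Tensor products\<close>

lemma free_pairs_simps:
  "carrier (free_pairs V W) = {p. Poly_Mapping.keys p \<subseteq> carrier V \<times> carrier W}"
  "zero (free_pairs V W) = 0" "add (free_pairs V W) = (+)" "smult (free_pairs V W) = scl"
  "one (free_pairs V W) = Poly_Mapping.single (\<one>\<^bsub>V\<^esub>, \<one>\<^bsub>W\<^esub>) 1"
  by (simp_all add: free_pairs_def)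

lemma free_on_pairs: "free_on (free_pairs V W) (carrier V \<times> carrier W)"
  by (simp add: free_on_def free_pairs_simps)

lemma vect_free_pairs: "vect (free_pairs V W)"
  by (rule free_on_vect[OF free_on_pairs])

text \<open>
  The generators of the relations in the tensor product, as a set of their own so that the relations
  can be verified by a case distinction.
\<close>

definition tensor_gens ::
  "('k::field, 'v, 'm) module_scheme \<Rightarrow> ('k, 'w, 'n) module_scheme \<Rightarrow> ('v \<times> 'w \<Rightarrow>\<^sub>0 'k) set" where
  "tensor_gens V W = (let \<delta> = (\<lambda>v w. Poly_Mapping.single (v, w) (1::'k)) in
      ({\<delta> (v \<oplus>\<^bsub>V\<^esub> v') w - \<delta> v w - \<delta> v' w | v v' w. v \<in> carrier V \<and> v' \<in> carrier V \<and> w \<in> carrier W} \<union>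
       {\<delta> v (w \<oplus>\<^bsub>W\<^esub> w') - \<delta> v w - \<delta> v w' | v w w'. v \<in> carrier V \<and> w \<in> carrier W \<and> w' \<in> carrier W} \<union>
       {\<delta> (c \<odot>\<^bsub>V\<^esub> v) w - Poly_Mapping.single (v, w) c | c v w. v \<in> carrier V \<and> w \<in> carrier W} \<union>
       {\<delta> v (c \<odot>\<^bsub>W\<^esub> w) - Poly_Mapping.single (v, w) c | c v w. v \<in> carrier V \<and> w \<in> carrier W}))"

lemma tensor_rels_eq: "tensor_rels V W = lin_span (free_pairs V W) (tensor_gens V W)"
  by (simp add: tensor_rels_def tensor_gens_def Let_def)

lemma tensor_gens_cases [consumes 1, case_names add_left add_right smult_left smult_right]:
  assumes "g \<in> tensor_gens V W"
    and "\<And>v v' w. v \<in> carrier V \<Longrightarrow> v' \<in> carrier V \<Longrightarrow> w \<in> carrier W \<Longrightarrow>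
      P (Poly_Mapping.single (v \<oplus>\<^bsub>V\<^esub> v', w) 1 - Poly_Mapping.single (v, w) 1 - Poly_Mapping.single (v', w) 1)"
    and "\<And>v w w'. v \<in> carrier V \<Longrightarrow> w \<in> carrier W \<Longrightarrow> w' \<in> carrier W \<Longrightarrow>
      P (Poly_Mapping.single (v, w \<oplus>\<^bsub>W\<^esub> w') 1 - Poly_Mapping.single (v, w) 1 - Poly_Mapping.single (v, w') 1)"
    and "\<And>c v w. v \<in> carrier V \<Longrightarrow> w \<in> carrier W \<Longrightarrow>
      P (Poly_Mapping.single (c \<odot>\<^bsub>V\<^esub> v, w) 1 - Poly_Mapping.single (v, w) c)"
    and "\<And>c v w. v \<in> carrier V \<Longrightarrow> w \<in> carrier W \<Longrightarrow>
      P (Poly_Mapping.single (v, c \<odot>\<^bsub>W\<^esub> w) 1 - Poly_Mapping.single (v, w) c)"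
  shows "P g"
  using assms unfolding tensor_gens_def Let_def by blast

lemma tensor_gensI:
  "v \<in> carrier V \<Longrightarrow> v' \<in> carrier V \<Longrightarrow> w \<in> carrier W \<Longrightarrow>
    Poly_Mapping.single (v \<oplus>\<^bsub>V\<^esub> v', w) 1 - Poly_Mapping.single (v, w) 1 - Poly_Mapping.single (v', w) 1 \<in> tensor_gens V W"
  "v \<in> carrier V \<Longrightarrow> w \<in> carrier W \<Longrightarrow> w' \<in> carrier W \<Longrightarrow>
    Poly_Mapping.single (v, w \<oplus>\<^bsub>W\<^esub> w') 1 - Poly_Mapping.single (v, w) 1 - Poly_Mapping.single (v, w') 1 \<in> tensor_gens V W"
  "v \<in> carrier V \<Longrightarrow> w \<in> carrier W \<Longrightarrow>
    Poly_Mapping.single (c \<odot>\<^bsub>V\<^esub> v, w) 1 - Poly_Mapping.single (v, w) c \<in> tensor_gens V W"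
  "v \<in> carrier V \<Longrightarrow> w \<in> carrier W \<Longrightarrow>
    Poly_Mapping.single (v, c \<odot>\<^bsub>W\<^esub> w) 1 - Poly_Mapping.single (v, w) c \<in> tensor_gens V W"
  unfolding tensor_gens_def Let_def
     apply (rule UnI1, rule UnI1, rule UnI1, rule CollectI, (rule exI)+, rule conjI, rule refl, simp)
    apply (rule UnI1, rule UnI1, rule UnI2, rule CollectI, (rule exI)+, rule conjI, rule refl, simp)
   apply (rule UnI1, rule UnI2, rule CollectI, (rule exI)+, rule conjI, rule refl, simp)
  apply (rule UnI2, rule CollectI, (rule exI)+, rule conjI, rule refl, simp)
  done

locale two_vects =
  fixes V :: "('k::field, 'v, 'm) module_scheme" and W :: "('k, 'w, 'n) module_scheme"
  assumes V: "vect V" and W: "vect W"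
begin

abbreviation "F \<equiv> free_pairs V W"
abbreviation "N \<equiv> tensor_rels V W"

lemma single_in_F: "v \<in> carrier V \<Longrightarrow> w \<in> carrier W \<Longrightarrow> Poly_Mapping.single (v, w) c \<in> carrier F"
  by (simp add: free_pairs_simps)

lemma F_minus: "p \<in> carrier F \<Longrightarrow> q \<in> carrier F \<Longrightarrow> p - q \<in> carrier F"
  by (rule free_on_minus(1)[OF free_on_pairs])

lemma gens_in_F: "tensor_gens V W \<subseteq> carrier F"
proof
  fix g assume "g \<in> tensor_gens V W"
  then show "g \<in> carrier F"
    by (induct rule: tensor_gens_cases) (intro F_minus single_in_F; use V W in auto)+
qed

lemma rels_submodule: "submodule N base F"
  unfolding tensor_rels_eq by (rule lin_span_submodule[OF vect_free_pairs gens_in_F])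

lemma N_add: "p \<in> N \<Longrightarrow> q \<in> N \<Longrightarrow> p + q \<in> N"
  and N_zero: "0 \<in> N"
  and N_scl: "p \<in> N \<Longrightarrow> scl c p \<in> N"
  using submoduleD(3)[OF vect_free_pairs rels_submodule, of p q] submoduleD(2)[OF vect_free_pairs rels_submodule]
    submoduleD(4)[OF vect_free_pairs rels_submodule, of p c]
  by (simp_all only: free_pairs_simps)

lemma gen_in_N: "g \<in> tensor_gens V W \<Longrightarrow> g \<in> N"
  unfolding tensor_rels_eq by (rule subsetD[OF lin_span_superset])

lemma N_add_left: "v \<in> carrier V \<Longrightarrow> v' \<in> carrier V \<Longrightarrow> w \<in> carrier W \<Longrightarrow>
      Poly_Mapping.single (v \<oplus>\<^bsub>V\<^esub> v', w) c - Poly_Mapping.single (v, w) c - Poly_Mapping.single (v', w) c \<in> N"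
  and N_add_right: "v \<in> carrier V \<Longrightarrow> w \<in> carrier W \<Longrightarrow> w' \<in> carrier W \<Longrightarrow>
      Poly_Mapping.single (v, w \<oplus>\<^bsub>W\<^esub> w') c - Poly_Mapping.single (v, w) c - Poly_Mapping.single (v, w') c \<in> N"
  and N_smult_left: "v \<in> carrier V \<Longrightarrow> w \<in> carrier W \<Longrightarrow>
      Poly_Mapping.single (d \<odot>\<^bsub>V\<^esub> v, w) c - Poly_Mapping.single (v, w) (c * d) \<in> N"
  and N_smult_right: "v \<in> carrier V \<Longrightarrow> w \<in> carrier W \<Longrightarrow>
      Poly_Mapping.single (v, d \<odot>\<^bsub>W\<^esub> w) c - Poly_Mapping.single (v, w) (c * d) \<in> N"
proof -
  have g: "scl c g \<in> N" if "g \<in> tensor_gens V W" for g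
    by (rule N_scl[OF gen_in_N[OF that]])
  { assume "v \<in> carrier V" "v' \<in> carrier V" "w \<in> carrier W"
    then have "Poly_Mapping.single (v \<oplus>\<^bsub>V\<^esub> v', w) 1 - Poly_Mapping.single (v, w) 1 - Poly_Mapping.single (v', w) 1
        \<in> tensor_gens V W" by (rule tensor_gensI)
    from g[OF this] show "Poly_Mapping.single (v \<oplus>\<^bsub>V\<^esub> v', w) c - Poly_Mapping.single (v, w) c - Poly_Mapping.single (v', w) c \<in> N"
      by (simp add: scl_minus) }
  { assume "v \<in> carrier V" "w \<in> carrier W" "w' \<in> carrier W"
    then have "Poly_Mapping.single (v, w \<oplus>\<^bsub>W\<^esub> w') 1 - Poly_Mapping.single (v, w) 1 - Poly_Mapping.single (v, w') 1
        \<in> tensor_gens V W" by (rule tensor_gensI)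
    from g[OF this] show "Poly_Mapping.single (v, w \<oplus>\<^bsub>W\<^esub> w') c - Poly_Mapping.single (v, w) c - Poly_Mapping.single (v, w') c \<in> N"
      by (simp add: scl_minus) }
  { assume vw: "v \<in> carrier V" "w \<in> carrier W"
    then have "Poly_Mapping.single (d \<odot>\<^bsub>V\<^esub> v, w) 1 - Poly_Mapping.single (v, w) d
        \<in> tensor_gens V W" by (rule tensor_gensI)
    from g[OF this] show "Poly_Mapping.single (d \<odot>\<^bsub>V\<^esub> v, w) c - Poly_Mapping.single (v, w) (c * d) \<in> N"
      by (simp add: scl_minus)
    have "Poly_Mapping.single (v, d \<odot>\<^bsub>W\<^esub> w) 1 - Poly_Mapping.single (v, w) d
        \<in> tensor_gens V W" using vw by (rule tensor_gensI)
    from g[OF this] show "Poly_Mapping.single (v, d \<odot>\<^bsub>W\<^esub> w) c - Poly_Mapping.single (v, w) (c * d) \<in> N"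
      by (simp add: scl_minus) }
qed

lemma coset_eq_minusI:
  assumes "p \<in> carrier F" "q \<in> carrier F" "p - q \<in> N"
  shows "N +>\<^bsub>F\<^esub> p = N +>\<^bsub>F\<^esub> q"
proof (rule coset_eqI[OF vect_free_pairs rels_submodule assms(2)])
  show "p \<in> N +>\<^bsub>F\<^esub> q"
    using in_coset_iff[OF vect_free_pairs rels_submodule assms(2)] assms(3)
    by (auto simp: free_pairs_simps intro!: bexI[of _ "p - q"])
qed

lemma vect_tensor: "vect (tensor V W)"
  unfolding tensor_def by (rule vect_quot[OF vect_free_pairs rels_submodule])

lemma pure_closed: "v \<in> carrier V \<Longrightarrow> w \<in> carrier W \<Longrightarrow> pure_tensor V W v w \<in> carrier (tensor V W)"
  unfolding tensor_def pure_tensor_def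
  by (auto simp: carrier_quot[OF vect_free_pairs rels_submodule] single_in_F)

lemmas qops = quot_ops[OF vect_free_pairs rels_submodule, folded tensor_def]

lemma pure_add_left:
  assumes "v \<in> carrier V" "v' \<in> carrier V" "w \<in> carrier W"
  shows "pure_tensor V W (v \<oplus>\<^bsub>V\<^esub> v') w = pure_tensor V W v w \<oplus>\<^bsub>tensor V W\<^esub> pure_tensor V W v' w"
proof -
  have "N +>\<^bsub>F\<^esub> Poly_Mapping.single (v \<oplus>\<^bsub>V\<^esub> v', w) 1 =
      N +>\<^bsub>F\<^esub> (Poly_Mapping.single (v, w) 1 \<oplus>\<^bsub>F\<^esub> Poly_Mapping.single (v', w) 1)"
    by (rule coset_eq_minusI)
       (use assms V W N_add_left[OF assms, of 1] in \<open>auto intro!: single_in_F vect_free_pairs simp: diff_diff_eq free_pairs_simps(3)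
          intro: vect_add_closed[OF vect_free_pairs, unfolded free_pairs_simps(3)]\<close>)
  then show ?thesis
    using assms by (simp add: pure_tensor_def qops single_in_F)
qed

lemma pure_add_right:
  assumes "v \<in> carrier V" "w \<in> carrier W" "w' \<in> carrier W"
  shows "pure_tensor V W v (w \<oplus>\<^bsub>W\<^esub> w') = pure_tensor V W v w \<oplus>\<^bsub>tensor V W\<^esub> pure_tensor V W v w'"
proof -
  have "N +>\<^bsub>F\<^esub> Poly_Mapping.single (v, w \<oplus>\<^bsub>W\<^esub> w') 1 =
      N +>\<^bsub>F\<^esub> (Poly_Mapping.single (v, w) 1 \<oplus>\<^bsub>F\<^esub> Poly_Mapping.single (v, w') 1)"
    by (rule coset_eq_minusI)
       (use assms V W N_add_right[OF assms, of 1] in \<open>auto intro!: single_in_F vect_free_pairs simp: diff_diff_eq free_pairs_simps(3)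
          intro: vect_add_closed[OF vect_free_pairs, unfolded free_pairs_simps(3)]\<close>)
  then show ?thesis
    using assms by (simp add: pure_tensor_def qops single_in_F)
qed

lemma pure_smult_left:
  assumes "v \<in> carrier V" "w \<in> carrier W"
  shows "pure_tensor V W (c \<odot>\<^bsub>V\<^esub> v) w = c \<odot>\<^bsub>tensor V W\<^esub> pure_tensor V W v w"
proof -
  have "N +>\<^bsub>F\<^esub> Poly_Mapping.single (c \<odot>\<^bsub>V\<^esub> v, w) 1 = N +>\<^bsub>F\<^esub> (c \<odot>\<^bsub>F\<^esub> Poly_Mapping.single (v, w) 1)"
    by (rule coset_eq_minusI)
       (use assms V W N_smult_left[OF assms, of c 1] in \<open>auto intro!: single_in_F simp: free_pairs_simps(4)\<close>)
  then show ?thesis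
    using assms by (simp add: pure_tensor_def qops single_in_F)
qed

lemma pure_smult_right:
  assumes "v \<in> carrier V" "w \<in> carrier W"
  shows "pure_tensor V W v (c \<odot>\<^bsub>W\<^esub> w) = c \<odot>\<^bsub>tensor V W\<^esub> pure_tensor V W v w"
proof -
  have "N +>\<^bsub>F\<^esub> Poly_Mapping.single (v, c \<odot>\<^bsub>W\<^esub> w) 1 = N +>\<^bsub>F\<^esub> (c \<odot>\<^bsub>F\<^esub> Poly_Mapping.single (v, w) 1)"
    by (rule coset_eq_minusI)
       (use assms V W N_smult_right[OF assms, of c 1] in \<open>auto intro!: single_in_F simp: free_pairs_simps(4)\<close>)
  then show ?thesis
    using assms by (simp add: pure_tensor_def qops single_in_F)
qed

text \<open>
  Scalars can be absorbed into the first factor of a pure tensor, so that sums of pure tensors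
  exhaust the tensor product.
\<close>

lemma tensor_induct [consumes 1, case_names pure add]:
  assumes "x \<in> carrier (tensor V W)"
    and pure: "\<And>v w. v \<in> carrier V \<Longrightarrow> w \<in> carrier W \<Longrightarrow> P (pure_tensor V W v w)"
    and add: "\<And>x y. x \<in> carrier (tensor V W) \<Longrightarrow> y \<in> carrier (tensor V W) \<Longrightarrow> P x \<Longrightarrow> P y \<Longrightarrow> P (x \<oplus>\<^bsub>tensor V W\<^esub> y)"
  shows "P x"
proof -
  obtain p where p: "p \<in> carrier F" "x = N +>\<^bsub>F\<^esub> p" using assms(1) by (auto simp: qops)
  have "P (N +>\<^bsub>F\<^esub> p)" using p(1)[unfolded free_pairs_simps(1), simplified]
  proof (induction rule: poly_mapping_on_induct)
    case zero
    have "P (pure_tensor V W \<zero>\<^bsub>V\<^esub> \<zero>\<^bsub>W\<^esub>)" using V W by (intro pure) auto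
    also have "pure_tensor V W \<zero>\<^bsub>V\<^esub> \<zero>\<^bsub>W\<^esub> = 0 \<odot>\<^bsub>tensor V W\<^esub> pure_tensor V W \<zero>\<^bsub>V\<^esub> \<zero>\<^bsub>W\<^esub>"
      using pure_smult_left[of "\<zero>\<^bsub>V\<^esub>" "\<zero>\<^bsub>W\<^esub>" 0] V W by simp
    also have "\<dots> = N +>\<^bsub>F\<^esub> 0"
      using vect_smult_zero_left[OF vect_tensor pure_closed] V W by (simp add: qops free_pairs_simps)
    finally show ?case .
  next
    case (single x c)
    then obtain v w where x: "x = (v, w)" "v \<in> carrier V" "w \<in> carrier W" by auto
    have "P (pure_tensor V W (c \<odot>\<^bsub>V\<^esub> v) w)" using x V by (intro pure) auto
    also have "pure_tensor V W (c \<odot>\<^bsub>V\<^esub> v) w = N +>\<^bsub>F\<^esub> Poly_Mapping.single x c"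
      using x pure_smult_left[of v w c] quot_smult[OF vect_free_pairs rels_submodule single_in_F, of v w c 1]
      by (simp add: pure_tensor_def tensor_def free_pairs_simps(4))
    finally show ?case .
  next
    case (add p q)
    then have pq: "p \<in> carrier F" "q \<in> carrier F" by (simp_all add: free_pairs_simps)
    have "P ((N +>\<^bsub>F\<^esub> p) \<oplus>\<^bsub>tensor V W\<^esub> (N +>\<^bsub>F\<^esub> q))"
      by (rule assms(3)) (use add pq in \<open>auto simp: qops(1)\<close>)
    then show ?case using pq by (simp add: qops(3) free_pairs_simps(3))
  qed
  then show ?thesis using p(2) by simp
qed

lemma tensor_lin_hom_eq:
  assumes "f \<in> lin_hom (tensor V W) U" "g \<in> lin_hom (tensor V W) U"
    and "\<And>v w. v \<in> carrier V \<Longrightarrow> w \<in> carrier W \<Longrightarrow> f (pure_tensor V W v w) = g (pure_tensor V W v w)"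
    and "x \<in> carrier (tensor V W)"
  shows "f x = g x"
  using assms(4)
  by (induction rule: tensor_induct) (simp_all add: assms(3) lin_homD(2)[OF assms(1)] lin_homD(2)[OF assms(2)])

definition bilin :: "('k, 'u, 'l) module_scheme \<Rightarrow> ('v \<Rightarrow> 'w \<Rightarrow> 'u) \<Rightarrow> bool" where
  "bilin U \<beta> \<longleftrightarrow> (\<forall>v\<in>carrier V. \<beta> v \<in> lin_hom W U) \<and> (\<forall>w\<in>carrier W. (\<lambda>v. \<beta> v w) \<in> lin_hom V U)"

lemma bilinD:
  assumes "bilin U \<beta>"
  shows "v \<in> carrier V \<Longrightarrow> \<beta> v \<in> lin_hom W U" "w \<in> carrier W \<Longrightarrow> (\<lambda>v. \<beta> v w) \<in> lin_hom V U"
    "v \<in> carrier V \<Longrightarrow> w \<in> carrier W \<Longrightarrow> \<beta> v w \<in> carrier U"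
  using assms by (auto simp: bilin_def lin_hom_def)

text \<open>
  The universal property: a bilinear map kills the generators of the relations.
\<close>

lemma tensor_lift_works:
  assumes U: "vect U" and b: "bilin U \<beta>"
  shows tensor_lift_lin_hom: "tensor_lift U \<beta> \<in> lin_hom (tensor V W) U"
    and tensor_lift_pure: "v \<in> carrier V \<Longrightarrow> w \<in> carrier W \<Longrightarrow> tensor_lift U \<beta> (pure_tensor V W v w) = \<beta> v w"
proof -
  let ?b = "\<lambda>(v, w). \<beta> v w"
  have bc: "?b \<in> carrier V \<times> carrier W \<rightarrow> carrier U" using bilinD(3)[OF b] by auto
  note L = lin_ext_lin_hom[OF free_on_pairs U bc]
  have s: "lin_ext U ?b (Poly_Mapping.single (v, w) c) = c \<odot>\<^bsub>U\<^esub> \<beta> v w" if "v \<in> carrier V" "w \<in> carrier W" for v w c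
    using lin_ext_single[OF U, of ?b "(v, w)" c] bilinD(3)[OF b that] by simp
  have m: "lin_ext U ?b (p - q) = lin_ext U ?b p \<oplus>\<^bsub>U\<^esub> ((-1) \<odot>\<^bsub>U\<^esub> lin_ext U ?b q)"
    if "p \<in> carrier F" "q \<in> carrier F" for p q
  proof -
    have "p - q = p \<oplus>\<^bsub>F\<^esub> ((-1) \<odot>\<^bsub>F\<^esub> q)"
      by (simp add: free_pairs_simps poly_mapping_eq_iff fun_eq_iff lookup_minus lookup_add)
    moreover have "(-1) \<odot>\<^bsub>F\<^esub> q \<in> carrier F" using that vect_free_pairs by blast
    ultimately show ?thesis using lin_homD(2,3)[OF L] that by simp
  qed
  have cancel: "x \<oplus>\<^bsub>U\<^esub> (-1) \<odot>\<^bsub>U\<^esub> x = \<zero>\<^bsub>U\<^esub>" if "x \<in> carrier U" for x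
    using vect_a_inv[OF U that] U that by (metis vect_r_neg)
  have "tensor_gens V W \<subseteq> {p \<in> carrier F. lin_ext U ?b p \<in> {\<zero>\<^bsub>U\<^esub>}}"
  proof
    fix g assume g: "g \<in> tensor_gens V W"
    have "lin_ext U ?b g = \<zero>\<^bsub>U\<^esub>" using g
    proof (induct rule: tensor_gens_cases)
      case (add_left v v' w)
      let ?x = "\<beta> v w" and ?y = "\<beta> v' w"
      have xy: "?x \<in> carrier U" "?y \<in> carrier U" using bilinD(3)[OF b] add_left by auto
      have "lin_ext U ?b (Poly_Mapping.single (v \<oplus>\<^bsub>V\<^esub> v', w) 1 - Poly_Mapping.single (v, w) 1 - Poly_Mapping.single (v', w) 1)
          = (?x \<oplus>\<^bsub>U\<^esub> ?y) \<oplus>\<^bsub>U\<^esub> (-1) \<odot>\<^bsub>U\<^esub> ?x \<oplus>\<^bsub>U\<^esub> (-1) \<odot>\<^bsub>U\<^esub> ?y"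
        using add_left V W U xy lin_homD(2)[OF bilinD(2)[OF b]]
        by (simp add: m s single_in_F F_minus)
      also have "\<dots> = (?x \<oplus>\<^bsub>U\<^esub> ((-1) \<odot>\<^bsub>U\<^esub> ?x)) \<oplus>\<^bsub>U\<^esub> (?y \<oplus>\<^bsub>U\<^esub> ((-1) \<odot>\<^bsub>U\<^esub> ?y))"
        using xy U by (subst vect_add_swap[OF U]) (simp_all add: vect_a_assoc)
      finally show ?case using xy U by (simp add: cancel)
    next
      case (add_right v w w')
      let ?x = "\<beta> v w" and ?y = "\<beta> v w'"
      have xy: "?x \<in> carrier U" "?y \<in> carrier U" using bilinD(3)[OF b] add_right by auto
      have "lin_ext U ?b (Poly_Mapping.single (v, w \<oplus>\<^bsub>W\<^esub> w') 1 - Poly_Mapping.single (v, w) 1 - Poly_Mapping.single (v, w') 1)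
          = (?x \<oplus>\<^bsub>U\<^esub> ?y) \<oplus>\<^bsub>U\<^esub> (-1) \<odot>\<^bsub>U\<^esub> ?x \<oplus>\<^bsub>U\<^esub> (-1) \<odot>\<^bsub>U\<^esub> ?y"
        using add_right V W U xy lin_homD(2)[OF bilinD(1)[OF b]]
        by (simp add: m s single_in_F F_minus)
      also have "\<dots> = (?x \<oplus>\<^bsub>U\<^esub> ((-1) \<odot>\<^bsub>U\<^esub> ?x)) \<oplus>\<^bsub>U\<^esub> (?y \<oplus>\<^bsub>U\<^esub> ((-1) \<odot>\<^bsub>U\<^esub> ?y))"
        using xy U by (subst vect_add_swap[OF U]) (simp_all add: vect_a_assoc)
      finally show ?case using xy U by (simp add: cancel)
    next
      case (smult_left c v w)
      then have x: "\<beta> v w \<in> carrier U" using bilinD(3)[OF b] by auto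
      show ?case using smult_left V W U x lin_homD(3)[OF bilinD(2)[OF b], of w v c]
        cancel[of "c \<odot>\<^bsub>U\<^esub> \<beta> v w"] by (simp add: m s single_in_F)
    next
      case (smult_right c v w)
      then have x: "\<beta> v w \<in> carrier U" using bilinD(3)[OF b] by auto
      show ?case using smult_right V W U x lin_homD(3)[OF bilinD(1)[OF b], of v w c]
        cancel[of "c \<odot>\<^bsub>U\<^esub> \<beta> v w"] by (simp add: m s single_in_F)
    qed
    then show "g \<in> {p \<in> carrier F. lin_ext U ?b p \<in> {\<zero>\<^bsub>U\<^esub>}}" using gens_in_F g by auto
  qed
  then have "N \<subseteq> {p \<in> carrier F. lin_ext U ?b p \<in> {\<zero>\<^bsub>U\<^esub>}}" unfolding tensor_rels_eq
    by (intro lin_span_least lin_hom_kernel[OF vect_free_pairs U L] submodule_zero[OF U])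
  then have z: "lin_ext U ?b p = \<zero>\<^bsub>U\<^esub>" if "p \<in> N" for p using that by auto
  show "tensor_lift U \<beta> \<in> lin_hom (tensor V W) U"
    unfolding tensor_lift_def tensor_def
    by (rule coset_ext_lin_hom[OF free_on_pairs rels_submodule U bc z])
  show "v \<in> carrier V \<Longrightarrow> w \<in> carrier W \<Longrightarrow> tensor_lift U \<beta> (pure_tensor V W v w) = \<beta> v w"
    unfolding tensor_lift_def pure_tensor_def
    using coset_ext_coset[OF free_on_pairs rels_submodule U bc z single_in_F] s[of v w 1]
      bilinD(3)[OF b, of v w] U by simp
qed

lemma bilin_pure: "bilin (tensor V W) (pure_tensor V W)"
  unfolding bilin_def
  by (auto intro!: lin_homI simp: pure_closed pure_add_left pure_add_right pure_smult_left pure_smult_right)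

lemma pure_zero_left: "w \<in> carrier W \<Longrightarrow> pure_tensor V W \<zero>\<^bsub>V\<^esub> w = \<zero>\<^bsub>tensor V W\<^esub>"
  and pure_zero_right: "v \<in> carrier V \<Longrightarrow> pure_tensor V W v \<zero>\<^bsub>W\<^esub> = \<zero>\<^bsub>tensor V W\<^esub>"
  using lin_hom_zero[OF V vect_tensor bilinD(2)[OF bilin_pure]]
    lin_hom_zero[OF W vect_tensor bilinD(1)[OF bilin_pure]] by auto

lemma pure_finsum_left: "f \<in> A \<rightarrow> carrier V \<Longrightarrow> w \<in> carrier W \<Longrightarrow>
    pure_tensor V W (finsum V f A) w = finsum (tensor V W) (\<lambda>i. pure_tensor V W (f i) w) A"
  using lin_hom_finsum[OF V vect_tensor bilinD(2)[OF bilin_pure]] by blast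

lemma pure_finsum_right: "f \<in> A \<rightarrow> carrier W \<Longrightarrow> v \<in> carrier V \<Longrightarrow>
    pure_tensor V W v (finsum W f A) = finsum (tensor V W) (\<lambda>i. pure_tensor V W v (f i)) A"
  using lin_hom_finsum[OF W vect_tensor bilinD(1)[OF bilin_pure]] by blast

lemma bilin_comp:
  assumes V': "two_vects V' W'" and f: "f \<in> lin_hom V V'" and g: "g \<in> lin_hom W W'"
    and b: "two_vects.bilin V' W' U \<beta>"
  shows "bilin U (\<lambda>v w. \<beta> (f v) (g w))"
  unfolding bilin_def
  using two_vects.bilinD[OF V' b] lin_homD(1)[OF f] lin_homD(1)[OF g]
  by (auto intro: lin_hom_comp[OF g] lin_hom_comp[OF f])

end

lemma tensor_map_works:
  assumes "vect V" "vect W" "vect V'" "vect W'" "f \<in> lin_hom V V'" "g \<in> lin_hom W W'"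
  shows tensor_map_lin_hom: "tensor_map V' W' f g \<in> lin_hom (tensor V W) (tensor V' W')"
    and tensor_map_pure: "v \<in> carrier V \<Longrightarrow> w \<in> carrier W \<Longrightarrow>
      tensor_map V' W' f g (pure_tensor V W v w) = pure_tensor V' W' (f v) (g w)"
proof -
  interpret A: two_vects V W by (rule two_vects.intro) fact+
  interpret B: two_vects V' W' by (rule two_vects.intro) fact+
  have "A.bilin (tensor V' W') (\<lambda>v w. pure_tensor V' W' (f v) (g w))"
    by (rule A.bilin_comp[OF B.two_vects_axioms assms(5,6) B.bilin_pure])
  from A.tensor_lift_works[OF B.vect_tensor this]
  show "tensor_map V' W' f g \<in> lin_hom (tensor V W) (tensor V' W')"
    "v \<in> carrier V \<Longrightarrow> w \<in> carrier W \<Longrightarrow>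
      tensor_map V' W' f g (pure_tensor V W v w) = pure_tensor V' W' (f v) (g w)"
    by (simp_all add: tensor_map_def)
qed

text \<open>
  The map is defined by two nested lifts, one for each tensor sign; both maps to be lifted have to be
  checked to be bilinear.
\<close>

lemma tensor_assoc_works:
  assumes "vect U" "vect V" "vect W"
  shows tensor_assoc_lin_hom: "tensor_assoc U V W \<in> lin_hom (tensor (tensor U V) W) (tensor U (tensor V W))"
    and tensor_assoc_pure: "u \<in> carrier U \<Longrightarrow> v \<in> carrier V \<Longrightarrow> w \<in> carrier W \<Longrightarrow>
      tensor_assoc U V W (pure_tensor (tensor U V) W (pure_tensor U V u v) w) =
      pure_tensor U (tensor V W) u (pure_tensor V W v w)"
proof -
  interpret UV: two_vects U V by (rule two_vects.intro) fact+
  interpret VW: two_vects V W by (rule two_vects.intro) fact+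
  interpret UVW: two_vects U "tensor V W" by (rule two_vects.intro) (fact VW.vect_tensor assms)+
  interpret L: two_vects "tensor U V" W by (rule two_vects.intro) (fact UV.vect_tensor assms)+
  let ?T = "tensor U (tensor V W)"
  let ?b = "\<lambda>w u v. pure_tensor U (tensor V W) u (pure_tensor V W v w)"
  have b: "UV.bilin ?T (?b w)" if w: "w \<in> carrier W" for w
    unfolding UV.bilin_def
    using w by (auto intro!: lin_homI simp: VW.pure_closed UVW.pure_closed VW.pure_add_left VW.pure_smult_left
        UVW.pure_add_left UVW.pure_add_right UVW.pure_smult_left UVW.pure_smult_right)
  note l = UV.tensor_lift_works[OF UVW.vect_tensor b]
  let ?c = "\<lambda>x w. tensor_lift ?T (?b w) x"
  have c: "L.bilin ?T ?c"
    unfolding L.bilin_def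
  proof (intro conjI ballI)
    fix x assume x: "x \<in> carrier (tensor U V)"
    show "?c x \<in> lin_hom W ?T"
    proof (rule lin_homI)
      fix w assume w: "w \<in> carrier W"
      show "?c x w \<in> carrier ?T" using lin_homD(1)[OF l(1)[OF w] x] .
      show "?c x (c \<odot>\<^bsub>W\<^esub> w) = c \<odot>\<^bsub>?T\<^esub> ?c x w" for c
      proof (rule UV.tensor_lin_hom_eq[OF _ _ _ x])
        show "tensor_lift ?T (?b (c \<odot>\<^bsub>W\<^esub> w)) \<in> lin_hom (tensor U V) ?T" using l(1) w assms by simp
        show "(\<lambda>x. c \<odot>\<^bsub>?T\<^esub> tensor_lift ?T (?b w) x) \<in> lin_hom (tensor U V) ?T"
          by (rule lin_hom_smult[OF UVW.vect_tensor l(1)[OF w]])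
      qed (use w assms in \<open>simp add: l(2) VW.pure_smult_right UVW.pure_smult_right VW.pure_closed\<close>)
      fix w' assume w': "w' \<in> carrier W"
      show "?c x (w \<oplus>\<^bsub>W\<^esub> w') = ?c x w \<oplus>\<^bsub>?T\<^esub> ?c x w'" using x
      proof (induction rule: UV.tensor_induct)
        case (pure u v)
        then show ?case using w w' assms by (simp add: l(2) VW.pure_add_right UVW.pure_add_right VW.pure_closed)
      next
        case (add x y)
        have cl: "?c z v \<in> carrier ?T" if "v \<in> carrier W" "z \<in> carrier (tensor U V)" for v z
          using lin_homD(1)[OF l(1)[OF that(1)] that(2)] .
        have lin: "?c (x \<oplus>\<^bsub>tensor U V\<^esub> y) v = ?c x v \<oplus>\<^bsub>?T\<^esub> ?c y v" if "v \<in> carrier W" for v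
          using lin_homD(2)[OF l(1)[OF that] add(1,2)] .
        show ?case using add(3,4) w w' assms
          by (simp add: lin vect_add_swap[OF UVW.vect_tensor cl cl cl cl] add(1,2))
      qed
    qed
  qed (rule l(1))
  note t = L.tensor_lift_works[OF UVW.vect_tensor c]
  show "tensor_assoc U V W \<in> lin_hom (tensor (tensor U V) W) (tensor U (tensor V W))"
    using t(1) by (simp add: tensor_assoc_def)
  show "u \<in> carrier U \<Longrightarrow> v \<in> carrier V \<Longrightarrow> w \<in> carrier W \<Longrightarrow>
      tensor_assoc U V W (pure_tensor (tensor U V) W (pure_tensor U V u v) w) =
      pure_tensor U (tensor V W) u (pure_tensor V W v w)"
    by (simp add: tensor_assoc_def t(2) l(2) UV.pure_closed)
qed

text \<open>
  Tensor products depend on the fields of the record \<^type>\<open>module\<close> only. This removes the additional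
  fields of Hopf algebras and comodules.
\<close>

lemma tensor_cong:
  assumes "carrier V = carrier V'" "add V = add V'" "smult V = smult V'" "mult V = mult V'" "one V = one V'"
    and "carrier W = carrier W'" "add W = add W'" "smult W = smult W'" "mult W = mult W'" "one W = one W'"
  shows "tensor V W = tensor V' W'" "pure_tensor V W = pure_tensor V' W'"
proof -
  have F: "free_pairs V W = free_pairs V' W'" using assms by (simp add: free_pairs_def)
  have N: "tensor_rels V W = tensor_rels V' W'" unfolding tensor_rels_def F assms ..
  show "tensor V W = tensor V' W'" unfolding tensor_def F N ..
  show "pure_tensor V W = pure_tensor V' W'" unfolding pure_tensor_def F N ..
qed

lemma tensor_lift_cong:
  assumes "carrier U = carrier U'" "add U = add U'" "smult U = smult U'" "zero U = zero U'"
  shows "tensor_lift U \<beta> = tensor_lift U' \<beta>"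
  unfolding tensor_lift_def coset_ext_def lin_ext_def
  using assms by (simp add: finsum_record_cong[OF assms(1,4,2)] fun_eq_iff)

subsection \<open>Tensor products of algebras\<close>

abbreviation pair_mult where
  "pair_mult V W x y \<equiv> (fst x \<otimes>\<^bsub>V\<^esub> fst y, snd x \<otimes>\<^bsub>W\<^esub> snd y)"

lemma pairs_mult_superset:
  assumes "finite K" "Poly_Mapping.keys p \<subseteq> K" "finite L" "Poly_Mapping.keys q \<subseteq> L"
  shows "p \<otimes>\<^bsub>free_pairs V W\<^esub> q = (\<Sum>x\<in>K. \<Sum>y\<in>L. Poly_Mapping.single (pair_mult V W x y)
      (Poly_Mapping.lookup p x * Poly_Mapping.lookup q y))"
proof -
  have "p \<otimes>\<^bsub>free_pairs V W\<^esub> q = (\<Sum>x\<in>Poly_Mapping.keys p. \<Sum>y\<in>Poly_Mapping.keys q.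
      Poly_Mapping.single (pair_mult V W x y) (Poly_Mapping.lookup p x * Poly_Mapping.lookup q y))"
    by (simp add: free_pairs_def case_prod_beta)
  also have "\<dots> = (\<Sum>x\<in>Poly_Mapping.keys p. \<Sum>y\<in>L.
      Poly_Mapping.single (pair_mult V W x y) (Poly_Mapping.lookup p x * Poly_Mapping.lookup q y))"
    by (intro sum.cong refl sum.mono_neutral_left) (use assms in \<open>auto simp: in_keys_iff\<close>)
  also have "\<dots> = (\<Sum>x\<in>K. \<Sum>y\<in>L.
      Poly_Mapping.single (pair_mult V W x y) (Poly_Mapping.lookup p x * Poly_Mapping.lookup q y))"
    by (intro sum.mono_neutral_left) (use assms in \<open>auto simp: in_keys_iff\<close>)
  finally show ?thesis .
qed

lemma pairs_mult_add_left: "(p + p') \<otimes>\<^bsub>free_pairs V W\<^esub> q = p \<otimes>\<^bsub>free_pairs V W\<^esub> q + p' \<otimes>\<^bsub>free_pairs V W\<^esub> q"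
proof -
  let ?K = "Poly_Mapping.keys p \<union> Poly_Mapping.keys p'" and ?L = "Poly_Mapping.keys q"
  have "Poly_Mapping.keys (p + p') \<subseteq> ?K" by (rule keys_add)
  then show ?thesis
    by (simp add: pairs_mult_superset[where K="?K" and L="?L"] lookup_add distrib_right single_add sum.distrib)
qed

lemma pairs_mult_add_right: "q \<otimes>\<^bsub>free_pairs V W\<^esub> (p + p') = q \<otimes>\<^bsub>free_pairs V W\<^esub> p + q \<otimes>\<^bsub>free_pairs V W\<^esub> p'"
proof -
  let ?K = "Poly_Mapping.keys p \<union> Poly_Mapping.keys p'" and ?L = "Poly_Mapping.keys q"
  have "Poly_Mapping.keys (p + p') \<subseteq> ?K" by (rule keys_add)
  then show ?thesis
    by (simp add: pairs_mult_superset[where K="?L" and L="?K"] lookup_add distrib_left single_add sum.distrib)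
qed

lemma pairs_mult_scl_left: "scl c p \<otimes>\<^bsub>free_pairs V W\<^esub> q = scl c (p \<otimes>\<^bsub>free_pairs V W\<^esub> q)"
  by (simp add: pairs_mult_superset[OF finite_keys keys_scl finite_keys order_refl]
      pairs_mult_superset[OF finite_keys order_refl finite_keys order_refl, where p=p] scl_sum mult.assoc)

lemma pairs_mult_scl_right: "p \<otimes>\<^bsub>free_pairs V W\<^esub> scl c q = scl c (p \<otimes>\<^bsub>free_pairs V W\<^esub> q)"
  by (simp add: pairs_mult_superset[OF finite_keys order_refl finite_keys keys_scl]
      pairs_mult_superset[OF finite_keys order_refl finite_keys order_refl, where p=p] scl_sum mult.left_commute)

lemma pairs_mult_zero: "0 \<otimes>\<^bsub>free_pairs V W\<^esub> q = 0" "q \<otimes>\<^bsub>free_pairs V W\<^esub> 0 = 0"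
  by (simp_all add: free_pairs_def case_prod_beta)

lemma pairs_mult_single:
  "Poly_Mapping.single x c \<otimes>\<^bsub>free_pairs V W\<^esub> Poly_Mapping.single y d = Poly_Mapping.single (pair_mult V W x y) (c * d)"
  by (subst pairs_mult_superset[where K="{x}" and L="{y}"]) auto

lemma pairs_mult_minus_right:
  "q \<otimes>\<^bsub>free_pairs V W\<^esub> (p - p') = q \<otimes>\<^bsub>free_pairs V W\<^esub> p - q \<otimes>\<^bsub>free_pairs V W\<^esub> p'"
  using pairs_mult_add_right[where q=q and V=V and W=W and p="p - p'" and p'=p'] by (simp add: algebra_simps)

lemma pairs_mult_minus_left:
  "(p - p') \<otimes>\<^bsub>free_pairs V W\<^esub> q = p \<otimes>\<^bsub>free_pairs V W\<^esub> q - p' \<otimes>\<^bsub>free_pairs V W\<^esub> q"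
  using pairs_mult_add_left[where q=q and V=V and W=W and p="p - p'" and p'=p'] by (simp add: algebra_simps)

locale two_algebras =
  fixes V :: "('k::field, 'v, 'm) module_scheme" and W :: "('k, 'w, 'n) module_scheme"
  assumes VA: "k_algebra V" and WA: "k_algebra W"

sublocale two_algebras \<subseteq> two_vects V W
  by (rule two_vects.intro) (rule k_algebraD VA WA)+

context two_algebras
begin

lemma alg_ops:
  "x \<in> carrier V \<Longrightarrow> y \<in> carrier V \<Longrightarrow> x \<otimes>\<^bsub>V\<^esub> y \<in> carrier V" "\<one>\<^bsub>V\<^esub> \<in> carrier V"
  "x' \<in> carrier W \<Longrightarrow> y' \<in> carrier W \<Longrightarrow> x' \<otimes>\<^bsub>W\<^esub> y' \<in> carrier W" "\<one>\<^bsub>W\<^esub> \<in> carrier W"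
  "x \<in> carrier V \<Longrightarrow> \<one>\<^bsub>V\<^esub> \<otimes>\<^bsub>V\<^esub> x = x" "x \<in> carrier V \<Longrightarrow> x \<otimes>\<^bsub>V\<^esub> \<one>\<^bsub>V\<^esub> = x"
  "x' \<in> carrier W \<Longrightarrow> \<one>\<^bsub>W\<^esub> \<otimes>\<^bsub>W\<^esub> x' = x'" "x' \<in> carrier W \<Longrightarrow> x' \<otimes>\<^bsub>W\<^esub> \<one>\<^bsub>W\<^esub> = x'"
  "x \<in> carrier V \<Longrightarrow> y \<in> carrier V \<Longrightarrow> z \<in> carrier V \<Longrightarrow> x \<otimes>\<^bsub>V\<^esub> y \<otimes>\<^bsub>V\<^esub> z = x \<otimes>\<^bsub>V\<^esub> (y \<otimes>\<^bsub>V\<^esub> z)"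
  "x' \<in> carrier W \<Longrightarrow> y' \<in> carrier W \<Longrightarrow> z' \<in> carrier W \<Longrightarrow> x' \<otimes>\<^bsub>W\<^esub> y' \<otimes>\<^bsub>W\<^esub> z' = x' \<otimes>\<^bsub>W\<^esub> (y' \<otimes>\<^bsub>W\<^esub> z')"
proof -
  interpret RV: ring V using VA by (rule k_algebraD)
  interpret RW: ring W using WA by (rule k_algebraD)
  show "x \<in> carrier V \<Longrightarrow> y \<in> carrier V \<Longrightarrow> x \<otimes>\<^bsub>V\<^esub> y \<in> carrier V" "\<one>\<^bsub>V\<^esub> \<in> carrier V"
  "x' \<in> carrier W \<Longrightarrow> y' \<in> carrier W \<Longrightarrow> x' \<otimes>\<^bsub>W\<^esub> y' \<in> carrier W" "\<one>\<^bsub>W\<^esub> \<in> carrier W"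
  "x \<in> carrier V \<Longrightarrow> \<one>\<^bsub>V\<^esub> \<otimes>\<^bsub>V\<^esub> x = x" "x \<in> carrier V \<Longrightarrow> x \<otimes>\<^bsub>V\<^esub> \<one>\<^bsub>V\<^esub> = x"
  "x' \<in> carrier W \<Longrightarrow> \<one>\<^bsub>W\<^esub> \<otimes>\<^bsub>W\<^esub> x' = x'" "x' \<in> carrier W \<Longrightarrow> x' \<otimes>\<^bsub>W\<^esub> \<one>\<^bsub>W\<^esub> = x'"
  "x \<in> carrier V \<Longrightarrow> y \<in> carrier V \<Longrightarrow> z \<in> carrier V \<Longrightarrow> x \<otimes>\<^bsub>V\<^esub> y \<otimes>\<^bsub>V\<^esub> z = x \<otimes>\<^bsub>V\<^esub> (y \<otimes>\<^bsub>V\<^esub> z)"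
  "x' \<in> carrier W \<Longrightarrow> y' \<in> carrier W \<Longrightarrow> z' \<in> carrier W \<Longrightarrow> x' \<otimes>\<^bsub>W\<^esub> y' \<otimes>\<^bsub>W\<^esub> z' = x' \<otimes>\<^bsub>W\<^esub> (y' \<otimes>\<^bsub>W\<^esub> z')"
    by (simp_all add: RV.m_assoc RW.m_assoc)
qed

lemma F_add: "p \<in> carrier F \<Longrightarrow> q \<in> carrier F \<Longrightarrow> p + q \<in> carrier F"
  using vect_add_closed[OF vect_free_pairs[of V W]] by (simp only: free_pairs_simps(3))

lemma F_zero: "0 \<in> carrier F"
  by (simp add: free_pairs_simps)

lemma F_mult_closed:
  assumes "p \<in> carrier F" "q \<in> carrier F" shows "p \<otimes>\<^bsub>F\<^esub> q \<in> carrier F"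
  using assms(1)[unfolded free_pairs_simps(1), simplified]
proof (induction rule: poly_mapping_on_induct)
  case (single x c)
  show ?case using assms(2)[unfolded free_pairs_simps(1), simplified]
  proof (induction rule: poly_mapping_on_induct)
    case (single y d)
    then show ?case using \<open>x \<in> carrier V \<times> carrier W\<close>
      by (auto simp: pairs_mult_single intro!: single_in_F alg_ops)
  qed (auto simp: pairs_mult_add_right pairs_mult_zero F_add F_zero)
qed (auto simp: pairs_mult_add_left pairs_mult_zero F_add F_zero)

lemma F_mult_assoc:
  assumes "p \<in> carrier F" "q \<in> carrier F" "r \<in> carrier F"
  shows "p \<otimes>\<^bsub>F\<^esub> q \<otimes>\<^bsub>F\<^esub> r = p \<otimes>\<^bsub>F\<^esub> (q \<otimes>\<^bsub>F\<^esub> r)"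
  using assms(1)[unfolded free_pairs_simps(1), simplified]
proof (induction rule: poly_mapping_on_induct)
  case (single x c)
  show ?case using assms(2)[unfolded free_pairs_simps(1), simplified]
  proof (induction rule: poly_mapping_on_induct)
    case (single y d)
    show ?case using assms(3)[unfolded free_pairs_simps(1), simplified]
    proof (induction rule: poly_mapping_on_induct)
      case (single z e)
      then show ?case using \<open>x \<in> carrier V \<times> carrier W\<close> \<open>y \<in> carrier V \<times> carrier W\<close>
        by (auto simp: pairs_mult_single alg_ops mult.assoc)
    qed (auto simp: pairs_mult_add_right pairs_mult_zero)
  qed (auto simp: pairs_mult_add_right pairs_mult_add_left pairs_mult_zero)
qed (auto simp: pairs_mult_add_left pairs_mult_zero)

lemma F_one:
  assumes "p \<in> carrier F" shows "\<one>\<^bsub>F\<^esub> \<otimes>\<^bsub>F\<^esub> p = p" "p \<otimes>\<^bsub>F\<^esub> \<one>\<^bsub>F\<^esub> = p"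
proof -
  have "\<one>\<^bsub>F\<^esub> \<otimes>\<^bsub>F\<^esub> p = p \<and> p \<otimes>\<^bsub>F\<^esub> \<one>\<^bsub>F\<^esub> = p"
    using assms[unfolded free_pairs_simps(1), simplified]
    by (induction rule: poly_mapping_on_induct)
       (auto simp: free_pairs_simps(5) pairs_mult_zero pairs_mult_add_left pairs_mult_add_right pairs_mult_single alg_ops)
  then show "\<one>\<^bsub>F\<^esub> \<otimes>\<^bsub>F\<^esub> p = p" "p \<otimes>\<^bsub>F\<^esub> \<one>\<^bsub>F\<^esub> = p" by auto
qed

lemma F_algebra: "k_algebra F"
  by (rule k_algebraI[OF vect_free_pairs])
     (auto simp: F_mult_closed F_mult_assoc F_one[unfolded free_pairs_simps(5)] pairs_mult_add_left pairs_mult_add_right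
        pairs_mult_scl_left pairs_mult_scl_right free_pairs_simps(3,4) alg_ops
        intro!: single_in_F simp: free_pairs_simps(5))

text \<open>
  Multiplying a defining relation by a pair gives a scalar multiple of the same kind of relation, with
  the components multiplied.
\<close>

lemma single_mult_N:
  assumes x: "v \<in> carrier V" "w \<in> carrier W" and p: "p \<in> N"
  shows "Poly_Mapping.single (v, w) c \<otimes>\<^bsub>F\<^esub> p \<in> N" "p \<otimes>\<^bsub>F\<^esub> Poly_Mapping.single (v, w) c \<in> N"
proof -
  interpret RV: ring V using VA by (rule k_algebraD)
  interpret RW: ring W using WA by (rule k_algebraD)
  have 1: "(\<lambda>p. Poly_Mapping.single (v, w) c \<otimes>\<^bsub>F\<^esub> p) \<in> lin_hom F F"
    by (rule lin_homI) (use x in \<open>auto simp: free_pairs_simps(3,4) pairs_mult_add_right pairs_mult_scl_right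
          intro!: F_mult_closed single_in_F\<close>)
  have 2: "(\<lambda>p. p \<otimes>\<^bsub>F\<^esub> Poly_Mapping.single (v, w) c) \<in> lin_hom F F"
    by (rule lin_homI) (use x in \<open>auto simp: free_pairs_simps(3,4) pairs_mult_add_left pairs_mult_scl_left
          intro!: F_mult_closed single_in_F\<close>)
  have "tensor_gens V W \<subseteq> {p \<in> carrier F. Poly_Mapping.single (v, w) c \<otimes>\<^bsub>F\<^esub> p \<in> N}"
  proof
    fix g assume g: "g \<in> tensor_gens V W"
    have "Poly_Mapping.single (v, w) c \<otimes>\<^bsub>F\<^esub> g \<in> N" using g
    proof (induct rule: tensor_gens_cases)
      case (add_left a a' b)
      then show ?case using x N_add_left[of "v \<otimes>\<^bsub>V\<^esub> a" "v \<otimes>\<^bsub>V\<^esub> a'" "w \<otimes>\<^bsub>W\<^esub> b" c]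
        by (simp add: pairs_mult_minus_right pairs_mult_single RV.r_distr)
    next
      case (add_right a b b')
      then show ?case using x N_add_right[of "v \<otimes>\<^bsub>V\<^esub> a" "w \<otimes>\<^bsub>W\<^esub> b" "w \<otimes>\<^bsub>W\<^esub> b'" c]
        by (simp add: pairs_mult_minus_right pairs_mult_single RW.r_distr)
    next
      case (smult_left d a b)
      then show ?case using x N_smult_left[of "v \<otimes>\<^bsub>V\<^esub> a" "w \<otimes>\<^bsub>W\<^esub> b" d c]
        by (simp add: pairs_mult_minus_right pairs_mult_single k_algebraD[OF VA])
    next
      case (smult_right d a b)
      then show ?case using x N_smult_right[of "v \<otimes>\<^bsub>V\<^esub> a" "w \<otimes>\<^bsub>W\<^esub> b" d c]
        by (simp add: pairs_mult_minus_right pairs_mult_single k_algebraD[OF WA])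
    qed
    then show "g \<in> {p \<in> carrier F. Poly_Mapping.single (v, w) c \<otimes>\<^bsub>F\<^esub> p \<in> N}" using gens_in_F g by auto
  qed
  then have "N \<subseteq> {p \<in> carrier F. Poly_Mapping.single (v, w) c \<otimes>\<^bsub>F\<^esub> p \<in> N}"
    unfolding tensor_rels_eq
    by (intro lin_span_least lin_hom_kernel[OF vect_free_pairs vect_free_pairs 1])
       (auto simp: rels_submodule[unfolded tensor_rels_eq])
  then show "Poly_Mapping.single (v, w) c \<otimes>\<^bsub>F\<^esub> p \<in> N" using p by auto
  have "tensor_gens V W \<subseteq> {p \<in> carrier F. p \<otimes>\<^bsub>F\<^esub> Poly_Mapping.single (v, w) c \<in> N}"
  proof
    fix g assume g: "g \<in> tensor_gens V W"
    have "g \<otimes>\<^bsub>F\<^esub> Poly_Mapping.single (v, w) c \<in> N" using g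
    proof (induct rule: tensor_gens_cases)
      case (add_left a a' b)
      then show ?case using x N_add_left[of "a \<otimes>\<^bsub>V\<^esub> v" "a' \<otimes>\<^bsub>V\<^esub> v" "b \<otimes>\<^bsub>W\<^esub> w" c]
        by (simp add: pairs_mult_minus_left pairs_mult_single RV.l_distr)
    next
      case (add_right a b b')
      then show ?case using x N_add_right[of "a \<otimes>\<^bsub>V\<^esub> v" "b \<otimes>\<^bsub>W\<^esub> w" "b' \<otimes>\<^bsub>W\<^esub> w" c]
        by (simp add: pairs_mult_minus_left pairs_mult_single RW.l_distr)
    next
      case (smult_left d a b)
      then show ?case using x N_smult_left[of "a \<otimes>\<^bsub>V\<^esub> v" "b \<otimes>\<^bsub>W\<^esub> w" d c]
        by (simp add: pairs_mult_minus_left pairs_mult_single k_algebraD[OF VA] mult.commute)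
    next
      case (smult_right d a b)
      then show ?case using x N_smult_right[of "a \<otimes>\<^bsub>V\<^esub> v" "b \<otimes>\<^bsub>W\<^esub> w" d c]
        by (simp add: pairs_mult_minus_left pairs_mult_single k_algebraD[OF WA] mult.commute)
    qed
    then show "g \<in> {p \<in> carrier F. p \<otimes>\<^bsub>F\<^esub> Poly_Mapping.single (v, w) c \<in> N}" using gens_in_F g by auto
  qed
  then have "N \<subseteq> {p \<in> carrier F. p \<otimes>\<^bsub>F\<^esub> Poly_Mapping.single (v, w) c \<in> N}"
    unfolding tensor_rels_eq
    by (intro lin_span_least lin_hom_kernel[OF vect_free_pairs vect_free_pairs 2])
       (auto simp: rels_submodule[unfolded tensor_rels_eq])
  then show "p \<otimes>\<^bsub>F\<^esub> Poly_Mapping.single (v, w) c \<in> N" using p by auto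
qed

lemma rels_ideal: "ideal N F"
proof (rule idealI)
  show "ring F" by (rule k_algebraD[OF F_algebra])
  show "subgroup N (add_monoid F)" by (rule submodule.axioms(1)[OF rels_submodule])
  fix a x assume a: "a \<in> N" and x: "x \<in> carrier F"
  have "x \<otimes>\<^bsub>F\<^esub> a \<in> N \<and> a \<otimes>\<^bsub>F\<^esub> x \<in> N"
    using x[unfolded free_pairs_simps(1), simplified]
    by (induction rule: poly_mapping_on_induct)
       (auto simp: pairs_mult_zero pairs_mult_add_left pairs_mult_add_right N_zero N_add single_mult_N a)
  then show "x \<otimes>\<^bsub>F\<^esub> a \<in> N" "a \<otimes>\<^bsub>F\<^esub> x \<in> N" by auto
qed

lemma k_algebra_tensor: "k_algebra (tensor V W)"
  unfolding tensor_def by (rule k_algebra_quot[OF F_algebra rels_submodule rels_ideal])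

lemma pure_mult:
  assumes "v \<in> carrier V" "w \<in> carrier W" "v' \<in> carrier V" "w' \<in> carrier W"
  shows "pure_tensor V W v w \<otimes>\<^bsub>tensor V W\<^esub> pure_tensor V W v' w' = pure_tensor V W (v \<otimes>\<^bsub>V\<^esub> v') (w \<otimes>\<^bsub>W\<^esub> w')"
  unfolding tensor_def pure_tensor_def
  by (simp add: quot_mult[OF F_algebra rels_submodule rels_ideal] single_in_F assms pairs_mult_single)

lemma tensor_one: "\<one>\<^bsub>tensor V W\<^esub> = pure_tensor V W \<one>\<^bsub>V\<^esub> \<one>\<^bsub>W\<^esub>"
  unfolding tensor_def pure_tensor_def
  by (simp add: quot_one[OF F_algebra rels_submodule rels_ideal] free_pairs_simps(5))

end

subsection \<open>Linear extension with values in a free vector space\<close>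

text \<open>
  Linear extension with values in the type class of finitely supported functions (\<open>psum\<close>) or in the
  field (\<open>ksum\<close>). There the library sums and their simplification rules are available, in contrast to
  \<^const>\<open>lin_ext\<close>, which sums in a record.
\<close>

definition psum :: "('x \<Rightarrow> 'y \<Rightarrow>\<^sub>0 'k::field) \<Rightarrow> ('x \<Rightarrow>\<^sub>0 'k) \<Rightarrow> 'y \<Rightarrow>\<^sub>0 'k" where
  "psum f p = (\<Sum>x\<in>Poly_Mapping.keys p. scl (Poly_Mapping.lookup p x) (f x))"

definition ksum :: "('x \<Rightarrow> 'k) \<Rightarrow> ('x \<Rightarrow>\<^sub>0 'k::field) \<Rightarrow> 'k" where
  "ksum f p = (\<Sum>x\<in>Poly_Mapping.keys p. Poly_Mapping.lookup p x * f x)"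

lemma psum_superset:
  "finite K \<Longrightarrow> Poly_Mapping.keys p \<subseteq> K \<Longrightarrow> psum f p = (\<Sum>x\<in>K. scl (Poly_Mapping.lookup p x) (f x))"
  unfolding psum_def by (intro sum.mono_neutral_left) (auto simp: in_keys_iff)

lemma ksum_superset:
  "finite K \<Longrightarrow> Poly_Mapping.keys p \<subseteq> K \<Longrightarrow> ksum f p = (\<Sum>x\<in>K. Poly_Mapping.lookup p x * f x)"
  unfolding ksum_def by (intro sum.mono_neutral_left) (auto simp: in_keys_iff)

lemma psum_zero [simp]: "psum f 0 = 0" and ksum_zero [simp]: "ksum g 0 = 0"
  by (simp_all add: psum_def ksum_def)

lemma psum_single [simp]: "psum f (Poly_Mapping.single x c) = scl c (f x)"
  by (simp add: psum_def)

lemma ksum_single [simp]: "ksum f (Poly_Mapping.single x c) = c * f x"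
  by (simp add: ksum_def)

lemma psum_add: "psum f (p + q) = psum f p + psum f q"
proof -
  let ?K = "Poly_Mapping.keys p \<union> Poly_Mapping.keys q"
  have "Poly_Mapping.keys (p + q) \<subseteq> ?K" by (rule keys_add)
  then show ?thesis
    by (simp add: psum_superset[of ?K] lookup_add scl_add_left sum.distrib)
qed

lemma ksum_add: "ksum f (p + q) = ksum f p + ksum f q"
proof -
  let ?K = "Poly_Mapping.keys p \<union> Poly_Mapping.keys q"
  have "Poly_Mapping.keys (p + q) \<subseteq> ?K" by (rule keys_add)
  then show ?thesis
    by (simp add: ksum_superset[of ?K] lookup_add distrib_right sum.distrib)
qed

lemma psum_scl: "psum f (scl c p) = scl c (psum f p)"
  by (simp add: psum_superset[OF finite_keys keys_scl] psum_def[of f p] scl_sum)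

lemma ksum_scl: "ksum f (scl c p) = c * ksum f p"
  by (simp add: ksum_superset[OF finite_keys keys_scl] ksum_def[of f p] sum_distrib_left mult.assoc)

lemma psum_minus: "psum f (p - q) = psum f p - psum f q"
  using psum_add[of f "p - q" q] by (simp add: algebra_simps)

lemma ksum_minus: "ksum f (p - q) = ksum f p - ksum f q"
  using ksum_add[of f "p - q" q] by (simp add: algebra_simps)

lemma psum_sum: "psum f (sum g A) = (\<Sum>i\<in>A. psum f (g i))"
  by (induction A rule: infinite_finite_induct) (auto simp: psum_add)

lemma ksum_sum: "ksum f (sum g A) = (\<Sum>i\<in>A. ksum f (g i))"
  by (induction A rule: infinite_finite_induct) (auto simp: ksum_add)

lemma psum_fun_add: "psum (\<lambda>x. f x + g x) p = psum f p + psum g p"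
  and psum_fun_scl: "psum (\<lambda>x. scl c (f x)) p = scl c (psum f p)"
  by (simp_all add: psum_def scl_add sum.distrib scl_sum mult.commute)

lemma lin_ext_base: "lin_ext base f = ksum f"
  by (simp add: fun_eq_iff lin_ext_def ksum_def finsum_base)

lemmas poly_mapping_single_induct = poly_mapping_on_induct[OF subset_UNIV, simplified, case_names zero single add]

lemma scl_mult_left: "scl c (p * q) = scl c p * (q :: 'm::monoid_add \<Rightarrow>\<^sub>0 'k::field)"
  by (simp add: mult_map_scale_conv_mult mult.assoc)

lemma scl_mult_right: "scl c (p * q) = p * scl c (q :: 'm::monoid_add \<Rightarrow>\<^sub>0 'k::field)"
proof (induction p rule: poly_mapping_single_induct)
  case (single x a)
  show ?case
    by (induction q rule: poly_mapping_single_induct)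
       (simp_all add: mult_single distrib_left scl_add mult.left_commute)
qed (simp_all add: distrib_right scl_add)

text \<open>
  The tensor product of two free vector spaces, on the product of the bases. The product of two
  monoids of words is a monoid, so that for free algebras the multiplication on the right-hand side
  is the library convolution product (\<open>tens_mult\<close>).
\<close>

definition tens :: "('x \<Rightarrow>\<^sub>0 'k::field) \<Rightarrow> ('y \<Rightarrow>\<^sub>0 'k) \<Rightarrow> ('x \<times> 'y) \<Rightarrow>\<^sub>0 'k" where
  "tens p q = psum (\<lambda>x. psum (\<lambda>y. Poly_Mapping.single (x, y) 1) q) p"

lemma tens_single [simp]:
  "tens (Poly_Mapping.single x c) (Poly_Mapping.single y d) = Poly_Mapping.single (x, y) (c * d)"
  by (simp add: tens_def)

lemma tens_add_left: "tens (p + p') q = tens p q + tens p' q"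
  and tens_scl_left: "tens (scl c p) q = scl c (tens p q)"
  and tens_minus_left: "tens (p - p') q = tens p q - tens p' q"
  and tens_zero_left [simp]: "tens 0 q = 0"
  and tens_sum_left: "tens (sum f A) q = (\<Sum>i\<in>A. tens (f i) q)"
  by (simp_all add: tens_def psum_add psum_scl psum_minus psum_sum)

lemma tens_add_right: "tens p (q + q') = tens p q + tens p q'"
  and tens_scl_right: "tens p (scl c q) = scl c (tens p q)"
  and tens_zero_right [simp]: "tens p 0 = 0"
  by (simp_all add: tens_def psum_add psum_scl psum_fun_add psum_fun_scl) (simp add: psum_def)

lemma tens_minus_right: "tens p (q - q') = tens p q - tens p q'"
  using tens_add_right[of p "q - q'" q'] by (simp add: algebra_simps)

lemma tens_sum_right: "tens p (sum f A) = (\<Sum>i\<in>A. tens p (f i))"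
  by (induction A rule: infinite_finite_induct) (auto simp: tens_add_right)

lemma tens_mult:
  fixes p p' :: "'m::monoid_add \<Rightarrow>\<^sub>0 'k::field" and q q' :: "'n::monoid_add \<Rightarrow>\<^sub>0 'k"
  shows "tens p q * tens p' q' = tens (p * p') (q * q')"
proof (induction p rule: poly_mapping_single_induct)
  case (single x a)
  show ?case
  proof (induction q rule: poly_mapping_single_induct)
    case (single y b)
    show ?case
    proof (induction p' rule: poly_mapping_single_induct)
      case (single x' a')
      show ?case
        by (induction q' rule: poly_mapping_single_induct)
           (simp_all add: mult_single distrib_left tens_add_right ac_simps)
    qed (simp_all add: distrib_left distrib_right tens_add_left tens_add_right)
  qed (simp_all add: distrib_left distrib_right tens_add_left tens_add_right)
qed (simp_all add: distrib_left distrib_right tens_add_left tens_add_right)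

lemma tens_one: "tens (1 :: 'm::monoid_add \<Rightarrow>\<^sub>0 'k::field) (1 :: 'n::monoid_add \<Rightarrow>\<^sub>0 'k) = 1"
  by (simp add: zero_prod_def flip: single_one)

section \<open>Presented algebras\<close>

lemma free_algebra_simps [simp]:
  "carrier free_algebra = UNIV" "mult free_algebra = (*)" "one free_algebra = 1"
  "zero free_algebra = 0" "add free_algebra = (+)" "smult free_algebra = scl"
  by (simp_all add: free_algebra_def)

lemma free_on_free_algebra: "free_on (free_algebra :: ('k::field, 'x list \<Rightarrow>\<^sub>0 'k) module) UNIV"
  by (simp add: free_on_def)

lemma vect_free_algebra: "vect (free_algebra :: ('k::field, 'x list \<Rightarrow>\<^sub>0 'k) module)"
  by (rule free_on_vect[OF free_on_free_algebra])

lemma k_algebra_free_algebra: "k_algebra (free_algebra :: ('k::field, 'x list \<Rightarrow>\<^sub>0 'k) module)"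
  by (rule k_algebraI[OF vect_free_algebra])
     (simp_all add: mult.assoc distrib_left distrib_right scl_mult_left[symmetric] scl_mult_right[symmetric])

lemma const_eq: "const c = (Poly_Mapping.single 0 c :: 'x list \<Rightarrow>\<^sub>0 'k::field)"
  by (simp add: const_def zero_list_def)

lemma const_mult: "const c * p = scl c (p :: 'x list \<Rightarrow>\<^sub>0 'k::field)"
  by (simp add: const_eq mult_map_scale_conv_mult)

lemma mult_const: "p * const c = scl c (p :: 'x list \<Rightarrow>\<^sub>0 'k::field)"
proof -
  have "(Poly_Mapping.single 0 c :: 'x list \<Rightarrow>\<^sub>0 'k) = scl c 1"
    by (simp flip: single_one)
  then show ?thesis using scl_mult_right[of c p 1] by (simp add: const_eq)
qed

lemma const_one: "const 1 = (1 :: 'x list \<Rightarrow>\<^sub>0 'k::field)"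
  by (simp add: const_eq)

lemma const_scl: "const c = scl c (1 :: 'x list \<Rightarrow>\<^sub>0 'k::field)"
  using const_mult[of c 1] by simp

text \<open>
  Two-sided ideals of a type-class ring; for the free algebra they coincide with the ideals of the
  record \<^const>\<open>free_algebra\<close>.
\<close>

definition two_sided_ideal :: "'a::ring_1 set \<Rightarrow> bool" where
  "two_sided_ideal J \<longleftrightarrow> 0 \<in> J \<and> (\<forall>x\<in>J. \<forall>y\<in>J. x + y \<in> J) \<and> (\<forall>x\<in>J. \<forall>p. p * x \<in> J \<and> x * p \<in> J)"

lemma tidealD:
  assumes "two_sided_ideal J"
  shows "0 \<in> J" "x \<in> J \<Longrightarrow> y \<in> J \<Longrightarrow> x + y \<in> J" "x \<in> J \<Longrightarrow> p * x \<in> J" "x \<in> J \<Longrightarrow> x * p \<in> J"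
    "x \<in> J \<Longrightarrow> - x \<in> J" "x \<in> J \<Longrightarrow> y \<in> J \<Longrightarrow> x - y \<in> J"
    "(\<And>i. i \<in> A \<Longrightarrow> f i \<in> J) \<Longrightarrow> sum f A \<in> J"
proof -
  show *: "0 \<in> J" "x \<in> J \<Longrightarrow> y \<in> J \<Longrightarrow> x + y \<in> J" "x \<in> J \<Longrightarrow> p * x \<in> J" "x \<in> J \<Longrightarrow> x * p \<in> J" for x y p
    using assms by (auto simp: two_sided_ideal_def)
  show neg: "x \<in> J \<Longrightarrow> - x \<in> J" for x using *(3)[of x "-1"] by simp
  show "x \<in> J \<Longrightarrow> y \<in> J \<Longrightarrow> x - y \<in> J" using *(2)[of x "- y"] neg[of y] by simp
  show "(\<And>i. i \<in> A \<Longrightarrow> f i \<in> J) \<Longrightarrow> sum f A \<in> J"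
    by (induction A rule: infinite_finite_induct) (auto simp: *)
qed

lemma two_sided_ideal_scl: "two_sided_ideal J \<Longrightarrow> x \<in> J \<Longrightarrow> scl c (x :: 'm::monoid_add \<Rightarrow>\<^sub>0 'k::field) \<in> J"
  by (simp add: mult_map_scale_conv_mult tidealD(3))

abbreviation gen_ideal :: "('x list \<Rightarrow>\<^sub>0 'k::field) set \<Rightarrow> ('x list \<Rightarrow>\<^sub>0 'k) set" where
  "gen_ideal R \<equiv> genideal free_algebra R"

lemma ideal_gen_ideal: "ideal (gen_ideal R) (free_algebra :: ('k::field, 'x list \<Rightarrow>\<^sub>0 'k) module)"
  by (rule ring.genideal_ideal[OF k_algebraD(2)[OF k_algebra_free_algebra]]) simp

lemma two_sided_ideal_gen_ideal: "two_sided_ideal (gen_ideal R)"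
proof -
  interpret ideal "gen_ideal R" "free_algebra" by (rule ideal_gen_ideal)
  have "0 \<in> gen_ideal R" using additive_subgroup.zero_closed[OF is_additive_subgroup] by (simp only: free_algebra_simps)
  moreover have "x + y \<in> gen_ideal R" if "x \<in> gen_ideal R" "y \<in> gen_ideal R" for x y
    using additive_subgroup.a_closed[OF is_additive_subgroup that] by (simp only: free_algebra_simps)
  ultimately show ?thesis unfolding two_sided_ideal_def
    using I_l_closed I_r_closed by auto
qed

lemma gen_ideal_superset: "R \<subseteq> gen_ideal R"
  by (rule ring.genideal_self[OF k_algebraD(2)[OF k_algebra_free_algebra]]) simp

lemma gen_ideal_least:
  assumes J: "two_sided_ideal J" and R: "R \<subseteq> J" shows "gen_ideal R \<subseteq> J"
proof -
  interpret ring "free_algebra" by (rule k_algebraD[OF k_algebra_free_algebra])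
  have s: "submodule J base free_algebra"
    using tidealD(1,2)[OF J] two_sided_ideal_scl[OF J] by (auto simp: submodule_base_iff[OF vect_free_algebra])
  have "ideal J free_algebra"
    by (rule idealI) (use tidealD(3,4)[OF J] submodule.axioms(1)[OF s] ring_axioms in auto)
  then show ?thesis using R by (rule genideal_minimal)
qed

lemma gen_ideal_submodule: "submodule (gen_ideal R) base free_algebra"
  using tidealD(1,2)[OF two_sided_ideal_gen_ideal] two_sided_ideal_scl[OF two_sided_ideal_gen_ideal]
  by (auto simp: submodule_base_iff[OF vect_free_algebra])

lemmas pres_ops = quot_ops[OF vect_free_algebra gen_ideal_submodule, folded presented_algebra_def cls_def, simplified]
lemmas pres_alg_ops = quot_algebra_ops[OF k_algebra_free_algebra gen_ideal_submodule ideal_gen_ideal,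
  folded presented_algebra_def cls_def, simplified]

lemma carrier_presented: "carrier (presented_algebra R) = range (cls R)"
  using pres_ops(1) by auto

lemma cls_closed [simp, intro]: "cls R p \<in> carrier (presented_algebra R)"
  by (simp add: carrier_presented)

lemma k_algebra_presented: "k_algebra (presented_algebra R)"
  by (rule pres_alg_ops(3))

lemma vect_presented: "vect (presented_algebra R)"
  by (rule k_algebraD[OF k_algebra_presented])

lemma cls_add: "cls R (p + q) = cls R p \<oplus>\<^bsub>presented_algebra R\<^esub> cls R q"
  and cls_scl: "cls R (scl c p) = c \<odot>\<^bsub>presented_algebra R\<^esub> cls R p"
  and cls_mult: "cls R (p * q) = cls R p \<otimes>\<^bsub>presented_algebra R\<^esub> cls R q"
  and cls_one: "cls R 1 = \<one>\<^bsub>presented_algebra R\<^esub>"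
  and cls_zero: "cls R 0 = \<zero>\<^bsub>presented_algebra R\<^esub>"
  by (simp_all add: pres_ops pres_alg_ops)

lemma cls_eqI: "p - q \<in> gen_ideal R \<Longrightarrow> cls R p = cls R q"
proof -
  assume *: "p - q \<in> gen_ideal R"
  have "p \<in> gen_ideal R +>\<^bsub>free_algebra\<^esub> q"
    using in_coset_iff[OF vect_free_algebra gen_ideal_submodule, of q p R] * by (auto intro!: bexI[of _ "p - q"])
  then show ?thesis
    unfolding cls_def by (intro coset_eqI[OF vect_free_algebra gen_ideal_submodule]) auto
qed

lemma cls_sum:
  assumes "finite A" shows "cls R (sum f A) = (\<Oplus>\<^bsub>presented_algebra R\<^esub>i\<in>A. cls R (f i))"
proof -
  interpret abelian_monoid "presented_algebra R" by (rule vect_abelian_monoid[OF vect_presented])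
  show ?thesis using assms
    by (induction A rule: finite_induct) (simp_all add: cls_zero cls_add Pi_def)
qed

lemma presented_induct [consumes 1, case_names word smult add]:
  assumes "x \<in> carrier (presented_algebra R)"
    and word: "\<And>w. P (cls R (Poly_Mapping.single w 1))"
    and smult: "\<And>c x. x \<in> carrier (presented_algebra R) \<Longrightarrow> P x \<Longrightarrow> P (c \<odot>\<^bsub>presented_algebra R\<^esub> x)"
    and add: "\<And>x y. x \<in> carrier (presented_algebra R) \<Longrightarrow> y \<in> carrier (presented_algebra R) \<Longrightarrow>
        P x \<Longrightarrow> P y \<Longrightarrow> P (x \<oplus>\<^bsub>presented_algebra R\<^esub> y)"
  shows "P x"
proof -
  have s: "P (cls R (Poly_Mapping.single w c))" for w c
    using smult[OF cls_closed word[of w], of c] by (simp flip: cls_scl)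
  have "P (cls R p)" for p
  proof (induction p rule: poly_mapping_single_induct)
    case zero
    show ?case using s[of undefined 0] by simp
  qed (simp_all add: s cls_add add)
  then show ?thesis using assms(1) by (auto simp: carrier_presented)
qed

lemma presented_lin_hom_eq:
  assumes "f \<in> lin_hom (presented_algebra R) U" "g \<in> lin_hom (presented_algebra R) U"
    and "\<And>w. f (cls R (Poly_Mapping.single w 1)) = g (cls R (Poly_Mapping.single w 1))"
    and "x \<in> carrier (presented_algebra R)"
  shows "f x = g x"
  using assms(4)
  by (induction rule: presented_induct)
     (simp_all add: assms(3) lin_homD(2,3)[OF assms(1)] lin_homD(2,3)[OF assms(2)])

lemma coset_ext_presented:
  assumes U: "vect U" and b: "\<And>w. \<beta> w \<in> carrier U" and zero: "\<And>p. p \<in> gen_ideal R \<Longrightarrow> lin_ext U \<beta> p = \<zero>\<^bsub>U\<^esub>"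
  shows coset_ext_cls: "coset_ext U \<beta> (cls R p) = lin_ext U \<beta> p"
    and coset_ext_presented_lin_hom: "coset_ext U \<beta> \<in> lin_hom (presented_algebra R) U"
proof -
  have b': "\<beta> \<in> UNIV \<rightarrow> carrier U" using b by auto
  show "coset_ext U \<beta> (cls R p) = lin_ext U \<beta> p"
    unfolding cls_def using coset_ext_coset[OF free_on_free_algebra gen_ideal_submodule U b' zero] by simp
  show "coset_ext U \<beta> \<in> lin_hom (presented_algebra R) U"
    unfolding presented_algebra_def
    by (rule coset_ext_lin_hom[OF free_on_free_algebra gen_ideal_submodule U b' zero])
qed

subsection \<open>Homomorphisms out of presented algebras\<close>

context
  fixes U :: "('k::field, 'u, 'm) module_scheme" and g :: "'x \<Rightarrow> 'u"
  assumes U: "k_algebra U" and g: "\<And>x. g x \<in> carrier U"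
begin

interpretation U: ring U by (rule k_algebraD[OF U])

lemma word_prod_closed: "word_prod U g w \<in> carrier U"
  by (induction w) (auto simp: word_prod_def g)

lemma word_prod_append: "word_prod U g (v @ w) = word_prod U g v \<otimes>\<^bsub>U\<^esub> word_prod U g w"
proof (induction v)
  case Nil
  show ?case using word_prod_closed[of w] by (simp add: word_prod_def)
next
  case (Cons x v)
  then show ?case using word_prod_closed by (simp add: word_prod_def U.m_assoc g)
qed

lemma word_prod_lin_hom: "lin_ext U (word_prod U g) \<in> lin_hom free_algebra U"
  by (rule lin_ext_lin_hom[OF free_on_free_algebra k_algebraD(1)[OF U]]) (simp add: word_prod_closed)

lemma word_prod_ev:
  shows "lin_ext U (word_prod U g) (p + q) = lin_ext U (word_prod U g) p \<oplus>\<^bsub>U\<^esub> lin_ext U (word_prod U g) q"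
    and "lin_ext U (word_prod U g) (scl c p) = c \<odot>\<^bsub>U\<^esub> lin_ext U (word_prod U g) p"
    and "lin_ext U (word_prod U g) p \<in> carrier U"
    and "lin_ext U (word_prod U g) (Poly_Mapping.single w c) = c \<odot>\<^bsub>U\<^esub> word_prod U g w"
    and "lin_ext U (word_prod U g) 0 = \<zero>\<^bsub>U\<^esub>"
  using lin_homD[OF word_prod_lin_hom] lin_ext_zero[OF k_algebraD(1)[OF U]]
    lin_ext_single[OF k_algebraD(1)[OF U], of "word_prod U g" w, OF word_prod_closed] by auto

lemma word_prod_ev_mult:
  "lin_ext U (word_prod U g) (p * q) = lin_ext U (word_prod U g) p \<otimes>\<^bsub>U\<^esub> lin_ext U (word_prod U g) q"
proof (induction p rule: poly_mapping_single_induct)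
  case (single v a)
  show ?case
  proof (induction q rule: poly_mapping_single_induct)
    case (single w b)
    show ?case using word_prod_closed
      by (simp add: mult_single word_prod_ev plus_list_def word_prod_append k_algebraD[OF U] vect_smult_assoc mult.commute)
  qed (simp_all add: word_prod_ev distrib_left U.r_distr word_prod_closed k_algebraD(1)[OF U])
qed (simp_all add: word_prod_ev distrib_right U.l_distr)

lemma word_prod_ev_one: "lin_ext U (word_prod U g) 1 = \<one>\<^bsub>U\<^esub>"
  using word_prod_ev(4)[of "[]" 1] k_algebraD(1)[OF U]
  by (simp add: word_prod_def flip: single_one) (simp add: zero_list_def)

lemma ev_kernel_two_sided_ideal: "two_sided_ideal {p. lin_ext U (word_prod U g) p = \<zero>\<^bsub>U\<^esub>}"
  unfolding two_sided_ideal_def using word_prod_ev(3)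
  by (auto simp: word_prod_ev(1,5) word_prod_ev_mult)

lemma induced_hom_works:
  assumes R: "\<And>r. r \<in> R \<Longrightarrow> lin_ext U (word_prod U g) r = \<zero>\<^bsub>U\<^esub>"
  shows induced_hom_cls: "induced_hom U g (cls R p) = lin_ext U (word_prod U g) p"
    and induced_hom_alg_hom: "induced_hom U g \<in> alg_hom (presented_algebra R) U"
proof -
  have "R \<subseteq> {p. lin_ext U (word_prod U g) p = \<zero>\<^bsub>U\<^esub>}" using R by auto
  note z = subsetD[OF gen_ideal_least[OF ev_kernel_two_sided_ideal this], simplified]
  note c = coset_ext_presented[OF k_algebraD(1)[OF U] word_prod_closed z, folded induced_hom_def]
  show cl: "induced_hom U g (cls R p) = lin_ext U (word_prod U g) p" for p by (rule c(1))
  have "induced_hom U g \<in> ring_hom (presented_algebra R) U"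
  proof (rule ring_hom_memI)
    fix x y assume "x \<in> carrier (presented_algebra R)" "y \<in> carrier (presented_algebra R)"
    then obtain p q where xy: "x = cls R p" "y = cls R q" by (auto simp: carrier_presented)
    show "induced_hom U g x \<in> carrier U" unfolding xy cl by (rule word_prod_ev)
    show "induced_hom U g (x \<otimes>\<^bsub>presented_algebra R\<^esub> y) = induced_hom U g x \<otimes>\<^bsub>U\<^esub> induced_hom U g y"
      unfolding xy cls_mult[symmetric] cl by (rule word_prod_ev_mult)
    show "induced_hom U g (x \<oplus>\<^bsub>presented_algebra R\<^esub> y) = induced_hom U g x \<oplus>\<^bsub>U\<^esub> induced_hom U g y"
      unfolding xy cls_add[symmetric] cl by (rule word_prod_ev)
  next
    show "induced_hom U g \<one>\<^bsub>presented_algebra R\<^esub> = \<one>\<^bsub>U\<^esub>"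
      unfolding cls_one[symmetric] cl by (rule word_prod_ev_one)
  qed
  then show "induced_hom U g \<in> alg_hom (presented_algebra R) U"
    using c(2) by (simp add: alg_hom_def)
qed

end

text \<open>
  An antihomomorphism into an algebra is a homomorphism into the opposite one.
\<close>

definition opposite :: "('k::field, 'u, 'm) module_scheme \<Rightarrow> ('k, 'u, 'm) module_scheme" where
  "opposite U = U\<lparr>mult := \<lambda>x y. y \<otimes>\<^bsub>U\<^esub> x\<rparr>"

lemma opposite_simps [simp]:
  "carrier (opposite U) = carrier U" "mult (opposite U) = (\<lambda>x y. y \<otimes>\<^bsub>U\<^esub> x)" "one (opposite U) = one U"
  "zero (opposite U) = zero U" "add (opposite U) = add U" "smult (opposite U) = smult U"
  by (simp_all add: opposite_def)

lemma k_algebra_opposite: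
  assumes "k_algebra U" shows "k_algebra (opposite U)"
proof -
  interpret ring U by (rule k_algebraD[OF assms])
  have "vect (opposite U)" by (rule vect_cong[OF _ _ _ _ k_algebraD(1)[OF assms]]) simp_all
  then show ?thesis
    by (rule k_algebraI) (simp_all add: k_algebraD[OF assms] m_assoc l_distr r_distr)
qed

lemma word_prod_opposite:
  assumes U: "k_algebra U" and g: "\<And>x. g x \<in> carrier U"
  shows "word_prod (opposite U) g w = word_prod U g (rev w)"
proof (induction w)
  case (Cons x w)
  interpret ring U by (rule k_algebraD[OF U])
  show ?case using Cons
    by (simp add: word_prod_append[OF U g]) (simp add: word_prod_def g)
qed (simp add: word_prod_def)

lemma lin_ext_opposite: "lin_ext (opposite U) \<beta> = lin_ext U \<beta>"
  by (simp add: fun_eq_iff lin_ext_def finsum_record_cong[of "opposite U" U])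

lemma induced_antihom_works:
  assumes U: "k_algebra U" and g: "\<And>x. g x \<in> carrier U"
    and R: "\<And>r. r \<in> R \<Longrightarrow> lin_ext U (\<lambda>w. word_prod U g (rev w)) r = \<zero>\<^bsub>U\<^esub>"
  shows induced_antihom_cls: "induced_antihom U g (cls R p) = lin_ext U (\<lambda>w. word_prod U g (rev w)) p"
    and induced_antihom_lin_hom: "induced_antihom U g \<in> lin_hom (presented_algebra R) U"
proof -
  have eq: "word_prod (opposite U) g = (\<lambda>w. word_prod U g (rev w))"
    using word_prod_opposite[of U g, OF U g] by (simp add: fun_eq_iff)
  have i: "induced_antihom U g = induced_hom (opposite U) g"
    by (simp add: induced_antihom_def induced_hom_def coset_ext_def eq lin_ext_opposite fun_eq_iff)
  note w = induced_hom_works[OF k_algebra_opposite[OF U], of g R, unfolded lin_ext_opposite eq opposite_simps, OF g R]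
  show "induced_antihom U g (cls R p) = lin_ext U (\<lambda>w. word_prod U g (rev w)) p"
    unfolding i by (rule w(1))
  show "induced_antihom U g \<in> lin_hom (presented_algebra R) U"
    unfolding i using w(2) by (simp add: alg_hom_def lin_hom_def)
qed

text \<open>Evaluation of noncommutative polynomials in a monoid algebra.\<close>

definition feval :: "('x \<Rightarrow> 'm::monoid_add \<Rightarrow>\<^sub>0 'k::field) \<Rightarrow> ('x list \<Rightarrow>\<^sub>0 'k) \<Rightarrow> 'm \<Rightarrow>\<^sub>0 'k" where
  "feval G = psum (\<lambda>w. prod_list (map G w))"

lemma feval_linear:
  "feval G (p + q) = feval G p + feval G q" "feval G (p - q) = feval G p - feval G q"
  "feval G (scl c p) = scl c (feval G p)" "feval G (sum f A) = (\<Sum>i\<in>A. feval G (f i))" "feval G 0 = 0"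
  "feval G (Poly_Mapping.single w c) = scl c (prod_list (map G w))"
  by (simp_all add: feval_def psum_add psum_minus psum_scl psum_sum)

lemma feval_mult: "feval G (p * q) = feval G p * feval G q"
proof (induction p rule: poly_mapping_single_induct)
  case (single v a)
  show ?case
    by (induction q rule: poly_mapping_single_induct)
       (simp_all add: mult_single feval_linear distrib_left plus_list_def scl_mult_left[symmetric] scl_mult_right[symmetric] mult.commute)
qed (simp_all add: feval_linear distrib_right)

lemma feval_var: "feval G (var x) = G x"
  by (simp add: var_def feval_linear)

lemma feval_const: "feval G (const c) = scl c 1"
  by (simp add: const_def feval_linear)

text \<open>
  If the generators are sent to the images \<open>\<tau> (G x)\<close> of elements of another monoid algebra under a
  homomorphism \<open>\<tau>\<close>, then the extension to words can be computed before applying \<open>\<tau>\<close>. In this way the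
  images of relations are computed with representatives, in a type-class ring.
\<close>

lemma lin_ext_feval:
  assumes U: "k_algebra U" and cl: "\<And>p. \<tau> p \<in> carrier U"
    and add: "\<And>p q. \<tau> (p + q) = \<tau> p \<oplus>\<^bsub>U\<^esub> \<tau> q" and scl: "\<And>c p. \<tau> (scl c p) = c \<odot>\<^bsub>U\<^esub> \<tau> p"
    and mult: "\<And>p q. \<tau> (p * q) = \<tau> p \<otimes>\<^bsub>U\<^esub> \<tau> q" and one: "\<tau> 1 = \<one>\<^bsub>U\<^esub>"
  shows "lin_ext U (word_prod U (\<lambda>x. \<tau> (G x))) p = \<tau> (feval G p)"
proof -
  have w: "word_prod U (\<lambda>x. \<tau> (G x)) w = \<tau> (prod_list (map G w))" for w
    by (induction w) (simp_all add: word_prod_def one mult)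
  note ev = word_prod_ev[OF U, of "\<lambda>x. \<tau> (G x)", OF cl, unfolded w]
  show ?thesis
  proof (induction p rule: poly_mapping_single_induct)
    case zero
    have "\<tau> 0 = 0 \<odot>\<^bsub>U\<^esub> \<tau> 0" using scl[of 0 0] by simp
    then show ?case using k_algebraD(1)[OF U] cl by (simp add: w ev feval_linear)
  qed (simp_all add: ev feval_linear add scl w)
qed

subsection \<open>Tensor products of presented algebras\<close>

text \<open>
  The projection from the tensor product of two free algebras onto the tensor product of the
  presented algebras.
\<close>

definition tensor_proj :: "('x list \<Rightarrow>\<^sub>0 'k::field) set \<Rightarrow> ('y list \<Rightarrow>\<^sub>0 'k) set \<Rightarrow> ('x list \<times> 'y list \<Rightarrow>\<^sub>0 'k) \<Rightarrow>
    (('x list \<Rightarrow>\<^sub>0 'k) set \<times> ('y list \<Rightarrow>\<^sub>0 'k) set \<Rightarrow>\<^sub>0 'k) set" where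
  "tensor_proj R S = lin_ext (tensor (presented_algebra R) (presented_algebra S))
     (\<lambda>(v, w). pure_tensor (presented_algebra R) (presented_algebra S)
        (cls R (Poly_Mapping.single v 1)) (cls S (Poly_Mapping.single w 1)))"

context
  fixes R :: "('x list \<Rightarrow>\<^sub>0 'k::field) set" and S :: "('y list \<Rightarrow>\<^sub>0 'k) set"
begin

interpretation T: two_algebras "presented_algebra R" "presented_algebra S"
  by (rule two_algebras.intro) (rule k_algebra_presented)+

abbreviation "TT \<equiv> tensor (presented_algebra R) (presented_algebra S)"

lemma tensor_proj_hom: "\<And>c. tensor_proj R S (scl c p) = c \<odot>\<^bsub>TT\<^esub> tensor_proj R S p"
  "tensor_proj R S (p + q) = tensor_proj R S p \<oplus>\<^bsub>TT\<^esub> tensor_proj R S q" "tensor_proj R S p \<in> carrier TT"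
  "tensor_proj R S 0 = \<zero>\<^bsub>TT\<^esub>"
proof -
  let ?F = "\<lparr>carrier = UNIV, mult = (\<lambda>_ _. 0), one = 0, zero = 0, add = (+), smult = scl\<rparr> ::
    ('k, 'x list \<times> 'y list \<Rightarrow>\<^sub>0 'k) module"
  have "free_on ?F UNIV" by (simp add: free_on_def)
  then have "tensor_proj R S \<in> lin_hom ?F TT" unfolding tensor_proj_def
    by (rule lin_ext_lin_hom[OF _ T.vect_tensor]) (auto intro: T.pure_closed)
  from lin_homD[OF this] show "\<And>c. tensor_proj R S (scl c p) = c \<odot>\<^bsub>TT\<^esub> tensor_proj R S p"
    "tensor_proj R S (p + q) = tensor_proj R S p \<oplus>\<^bsub>TT\<^esub> tensor_proj R S q" "tensor_proj R S p \<in> carrier TT" by auto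
  show "tensor_proj R S 0 = \<zero>\<^bsub>TT\<^esub>" unfolding tensor_proj_def by (rule lin_ext_zero[OF T.vect_tensor])
qed

lemma tensor_proj_single: "tensor_proj R S (Poly_Mapping.single (v, w) c) = c \<odot>\<^bsub>TT\<^esub>
    pure_tensor (presented_algebra R) (presented_algebra S)
        (cls R (Poly_Mapping.single v 1)) (cls S (Poly_Mapping.single w 1))"
  unfolding tensor_proj_def by (subst lin_ext_single[OF T.vect_tensor]) (auto intro: T.pure_closed)

lemma tensor_proj_tens: "tensor_proj R S (tens p q) = pure_tensor (presented_algebra R) (presented_algebra S) (cls R p) (cls S q)"
proof (induction p rule: poly_mapping_single_induct)
  case zero
  show ?case by (simp add: tensor_proj_hom cls_zero T.pure_zero_left)
next
  case (single v a)
  show ?case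
  proof (induction q rule: poly_mapping_single_induct)
    case zero
    show ?case by (simp add: tensor_proj_hom cls_zero T.pure_zero_right)
  next
    case (single w b)
    have "cls R (Poly_Mapping.single v a) = a \<odot>\<^bsub>presented_algebra R\<^esub> cls R (Poly_Mapping.single v 1)"
      "cls S (Poly_Mapping.single w b) = b \<odot>\<^bsub>presented_algebra S\<^esub> cls S (Poly_Mapping.single w 1)"
      by (simp_all flip: cls_scl)
    then show ?case
      by (simp add: tensor_proj_single T.pure_smult_left T.pure_smult_right T.vect_tensor vect_smult_assoc T.pure_closed
          vect_presented mult.commute)
  qed (simp add: tens_add_right tensor_proj_hom cls_add T.pure_add_right)
qed (simp add: tens_add_left tensor_proj_hom cls_add T.pure_add_left)

lemma tensor_proj_mult: "tensor_proj R S (p * q) = tensor_proj R S p \<otimes>\<^bsub>TT\<^esub> tensor_proj R S q"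
proof -
  interpret TR: ring TT by (rule k_algebraD[OF T.k_algebra_tensor])
  show ?thesis
  proof (induction p rule: poly_mapping_single_induct)
    case (single x a)
    show ?case
    proof (induction q rule: poly_mapping_single_induct)
      case (single y b)
      obtain v w v' w' where xy: "x = (v, w)" "y = (v', w')" by (cases x, cases y) auto
      let ?t = "tens (Poly_Mapping.single v a) (Poly_Mapping.single w 1)"
      let ?s = "tens (Poly_Mapping.single v' b) (Poly_Mapping.single w' 1)"
      have "tensor_proj R S (?t * ?s) = tensor_proj R S ?t \<otimes>\<^bsub>TT\<^esub> tensor_proj R S ?s"
        unfolding tens_mult tensor_proj_tens cls_mult by (rule T.pure_mult[symmetric]) auto
      then show ?case by (simp add: xy)
    qed (simp_all add: tensor_proj_hom distrib_left TR.r_distr)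
  qed (simp_all add: tensor_proj_hom distrib_right TR.l_distr)
qed

lemma tensor_proj_one: "tensor_proj R S 1 = \<one>\<^bsub>TT\<^esub>"
  using tensor_proj_tens[of 1 1] by (simp add: tens_one cls_one T.tensor_one)

lemma tensor_proj_sum:
  assumes "finite A" shows "tensor_proj R S (sum f A) = (\<Oplus>\<^bsub>TT\<^esub>i\<in>A. tensor_proj R S (f i))"
proof -
  interpret abelian_monoid TT by (rule vect_abelian_monoid[OF T.vect_tensor])
  show ?thesis using assms
    by (induction A rule: finite_induct) (simp_all add: tensor_proj_hom Pi_def)
qed

lemma tensor_proj_feval: "lin_ext TT (word_prod TT (\<lambda>x. tensor_proj R S (G x))) p = tensor_proj R S (feval G p)"
  by (rule lin_ext_feval[OF T.k_algebra_tensor]) (simp_all add: tensor_proj_hom tensor_proj_mult tensor_proj_one)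

lemma tensor_proj_kernel_two_sided_ideal: "two_sided_ideal {p. tensor_proj R S p = \<zero>\<^bsub>TT\<^esub>}"
proof -
  interpret TR: ring TT by (rule k_algebraD[OF T.k_algebra_tensor])
  show ?thesis unfolding two_sided_ideal_def
    by (auto simp: tensor_proj_hom tensor_proj_mult)
qed

lemma tens_in_tensor_proj_kernel:
  "p \<in> gen_ideal R \<Longrightarrow> tensor_proj R S (tens p q) = \<zero>\<^bsub>TT\<^esub>" "q \<in> gen_ideal S \<Longrightarrow> tensor_proj R S (tens p q) = \<zero>\<^bsub>TT\<^esub>"
proof -
  show "p \<in> gen_ideal R \<Longrightarrow> tensor_proj R S (tens p q) = \<zero>\<^bsub>TT\<^esub>"
    using cls_eqI[of p 0 R] by (simp add: tensor_proj_tens cls_zero T.pure_zero_left)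
  show "q \<in> gen_ideal S \<Longrightarrow> tensor_proj R S (tens p q) = \<zero>\<^bsub>TT\<^esub>"
    using cls_eqI[of q 0 S] by (simp add: tensor_proj_tens cls_zero T.pure_zero_right)
qed

end

section \<open>Raising and lowering operators on tensors\<close>

definition words :: "nat \<Rightarrow> 'n list set" where "words j = {w. length w = j}"

definition words_le :: "nat \<Rightarrow> 'n list set" where "words_le N = {w. length w \<le> N}"

lemma finite_words [simp, intro]: "finite (words j :: 'n::finite list set)"
  using finite_lists_length_eq[of "UNIV :: 'n set" j] by (simp add: words_def)

lemma finite_words_le [simp, intro]: "finite (words_le j :: 'n::finite list set)"
  using finite_lists_length_le[of "UNIV :: 'n set" j] by (simp add: words_le_def)

lemma words_0 [simp]: "words 0 = {[]}" and words_le_0 [simp]: "words_le 0 = {[]}"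
  by (auto simp: words_def words_le_def)

lemma in_words [simp]: "w \<in> words j \<longleftrightarrow> length w = j"
  and in_words_le [simp]: "w \<in> words_le j \<longleftrightarrow> length w \<le> j"
  by (auto simp: words_def words_le_def)

lemma sum_words_Suc:
  "(\<Sum>w\<in>words (Suc j). f w) = (\<Sum>a\<in>(UNIV::'n::finite set). \<Sum>w\<in>words j. f (a # w))"
proof -
  have "(\<Sum>a\<in>(UNIV::'n set). \<Sum>w\<in>words j. f (a # w)) = (\<Sum>(a, w)\<in>UNIV \<times> words j. f (a # w))"
    by (rule sum.cartesian_product)
  also have "\<dots> = (\<Sum>w\<in>words (Suc j). f w)"
    by (rule sum.reindex_bij_witness[of _ "\<lambda>w. (hd w, tl w)" "\<lambda>(a, w). a # w"])
       (auto simp: length_Suc_conv)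
  finally show ?thesis by simp
qed

lemma sum_words_le_Suc:
  "(\<Sum>w\<in>words_le (Suc j). f w) = f [] + (\<Sum>a\<in>(UNIV::'n::finite set). \<Sum>w\<in>words_le j. f (a # w))"
proof -
  have "(\<Sum>a\<in>(UNIV::'n set). \<Sum>w\<in>words_le j. f (a # w)) = (\<Sum>(a, w)\<in>UNIV \<times> words_le j. f (a # w))"
    by (rule sum.cartesian_product)
  also have "\<dots> = (\<Sum>w\<in>words_le (Suc j) - {[]}. f w)"
    by (rule sum.reindex_bij_witness[of _ "\<lambda>w. (hd w, tl w)" "\<lambda>(a, w). a # w"]) auto
  finally show ?thesis by (simp add: sum.remove[of "words_le (Suc j)" "[]"])
qed

text \<open>
  A nondegenerate form \<open>\<beta>\<close> with inverse matrix \<open>\<omega>\<close> and a sequence \<open>c\<close> of quantum integers, all of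
  them invertible, such that the contraction of \<open>\<omega>\<close> with \<open>\<beta>\<close> is \<open>- c 2\<close>. The assumptions are symmetric
  in \<open>\<beta>\<close> and \<open>\<omega>\<close> (\<open>dual\<close>): exchanging them passes to the dual space, in which the row indices of
  matrix coefficients live.
\<close>

locale quantum_form =
  fixes \<beta> \<omega> :: "'n::finite \<Rightarrow> 'n \<Rightarrow> 'k::field" and c :: "nat \<Rightarrow> 'k"
  assumes form_inv: "(\<Sum>b\<in>UNIV. \<beta> a b * \<omega> b d) = (if a = d then 1 else 0)"
    and inv_form: "(\<Sum>b\<in>UNIV. \<omega> a b * \<beta> b d) = (if a = d then 1 else 0)"
    and loop: "(\<Sum>a\<in>UNIV. \<Sum>b\<in>UNIV. \<omega> a b * \<beta> a b) = - c 2"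
    and c0: "c 0 = 0" and c1: "c (Suc 0) = 1" and crec: "c (Suc (Suc j)) = c 2 * c (Suc j) - c j"
    and cnz: "c (Suc j) \<noteq> 0"
begin

lemma dual: "quantum_form \<omega> \<beta> c"
  by unfold_locales (use form_inv inv_form loop c0 c1 crec cnz in \<open>simp_all add: mult.commute\<close>)

text \<open>
  The coefficient in Wenzl's recursion for the projections onto capfree tensors.
\<close>

definition r :: "nat \<Rightarrow> 'k" where "r j = c j / c (Suc j)"

text \<open>
  The partial trace of the projection in degree \<open>j + 1\<close> is this multiple of the projection in
  degree \<open>j\<close>.
\<close>

definition \<kappa> :: "nat \<Rightarrow> 'k" where "\<kappa> j = - c (Suc (Suc j)) / c (Suc j)"

lemma r_0 [simp]: "r 0 = 0" by (simp add: r_def c0)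

lemma kappa_eq: "\<kappa> j = - c 2 + r j"
  using cnz[of j] by (simp add: \<kappa>_def r_def crec field_simps)

lemma r_kappa: "r (Suc j) * \<kappa> j = -1"
  using cnz[of j] cnz[of "Suc j"] by (simp add: \<kappa>_def r_def)

lemma form_inv_contract: "(\<Sum>b\<in>UNIV. \<beta> a b * (\<Sum>l\<in>UNIV. \<omega> b l * f l)) = f a"
proof -
  have "(\<Sum>b\<in>UNIV. \<beta> a b * (\<Sum>l\<in>UNIV. \<omega> b l * f l)) = (\<Sum>b\<in>UNIV. \<Sum>l\<in>UNIV. \<beta> a b * \<omega> b l * f l)"
    by (simp add: sum_distrib_left mult.assoc)
  also have "\<dots> = (\<Sum>l\<in>UNIV. \<Sum>b\<in>UNIV. \<beta> a b * \<omega> b l * f l)" by (rule sum.swap)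
  also have "\<dots> = (\<Sum>l\<in>UNIV. (if a = l then 1 else 0) * f l)" by (simp add: form_inv flip: sum_distrib_right)
  finally show ?thesis by (simp add: if_distrib[of "\<lambda>x. x * _"] cong: if_cong)
qed

lemma inv_form_contract: "(\<Sum>b\<in>UNIV. \<omega> a b * (\<Sum>l\<in>UNIV. \<beta> b l * f l)) = f a"
  by (rule quantum_form.form_inv_contract[OF dual])

text \<open>
  Contraction of the vector \<open>v\<close> with the first factor of a tensor. The scalar multiplication \<open>s\<close> is a
  parameter because the operators are applied to tensors with entries in the field and in the free
  algebra on matrix entries.
\<close>

definition gdown :: "('k \<Rightarrow> 'g \<Rightarrow> 'g) \<Rightarrow> 'n \<Rightarrow> ('n list \<Rightarrow> 'g::ab_group_add) \<Rightarrow> 'n list \<Rightarrow> 'g" where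
  "gdown s v y w = (\<Sum>l\<in>UNIV. s (\<beta> v l) (y (l # w)))"

text \<open>
  For a capfree tensor \<open>y\<close> this is the projection of \<open>v \<otimes> y\<close> to capfree tensors, in the form of a
  recursion on the word: the correction term removes the contraction of \<open>v\<close> with the first
  factor of \<open>y\<close>, and its factor \<open>r\<close> is the one that makes \<open>capfree_up\<close> true.
\<close>

primrec gup :: "('k \<Rightarrow> 'g \<Rightarrow> 'g) \<Rightarrow> 'n \<Rightarrow> ('n list \<Rightarrow> 'g::ab_group_add) \<Rightarrow> 'n list \<Rightarrow> 'g" where
  "gup s v y [] = 0"
| "gup s v y (b # w) = (if b = v then y w else 0) +
     s (r (length w)) (\<Sum>a\<in>UNIV. s (\<omega> b a) (gup s a (gdown s v y) w))"

abbreviation down where "down \<equiv> gdown (*)"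
abbreviation up where "up \<equiv> gup (*)"

lemma additive_sum:
  fixes L :: "'g::ab_group_add \<Rightarrow> 'h::ab_group_add"
  assumes "\<And>x y. L (x + y) = L x + L y"
  shows "L 0 = 0" "L (sum f A) = (\<Sum>i\<in>A. L (f i))"
proof -
  show z: "L 0 = 0" using assms[of 0 0] by simp
  show "L (sum f A) = (\<Sum>i\<in>A. L (f i))"
    by (induction A rule: infinite_finite_induct) (auto simp: z assms)
qed

lemma gup_hom:
  fixes L :: "'g::ab_group_add \<Rightarrow> 'h::ab_group_add"
  assumes add: "\<And>x y. L (x + y) = L x + L y" and sc: "\<And>a x. L (s a x) = s' a (L x)"
  shows gdown_hom: "L (gdown s v y w) = gdown s' v (\<lambda>u. L (y u)) w"
    and gup_hom': "L (gup s v y w) = gup s' v (\<lambda>u. L (y u)) w"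
proof -
  note L = additive_sum[OF add]
  have d: "(\<lambda>w. L (gdown s v y w)) = gdown s' v (\<lambda>u. L (y u))" for v y
    by (simp add: fun_eq_iff gdown_def L sc)
  from fun_cong[OF this, of v y w] show "L (gdown s v y w) = gdown s' v (\<lambda>u. L (y u)) w" .
  show "L (gup s v y w) = gup s' v (\<lambda>u. L (y u)) w"
    by (induction w arbitrary: v y) (auto simp: L add sc d)
qed

lemma down_lin: "down v (\<lambda>u. \<Sum>i\<in>A. k i * y i u) w = (\<Sum>i\<in>A. k i * down v (y i) w)"
proof -
  have "(\<Sum>l\<in>UNIV. \<beta> v l * (\<Sum>i\<in>A. k i * y i (l # w))) = (\<Sum>l\<in>UNIV. \<Sum>i\<in>A. k i * (\<beta> v l * y i (l # w)))"
    by (simp add: sum_distrib_left mult.left_commute)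
  also have "\<dots> = (\<Sum>i\<in>A. \<Sum>l\<in>UNIV. k i * (\<beta> v l * y i (l # w)))" by (rule sum.swap)
  finally show ?thesis by (simp add: gdown_def sum_distrib_left)
qed

lemma up_lin: "up v (\<lambda>u. \<Sum>i\<in>A. k i * y i u) w = (\<Sum>i\<in>A. k i * up v (y i) w)"
proof (induction w arbitrary: v y)
  case (Cons b w)
  have d: "down v (\<lambda>u. \<Sum>i\<in>A. k i * y i u) = (\<lambda>w. \<Sum>i\<in>A. k i * down v (y i) w)"
    by (simp add: fun_eq_iff down_lin)
  have "(\<Sum>a\<in>UNIV. \<omega> b a * (\<Sum>i\<in>A. k i * up a (down v (y i)) w)) =
      (\<Sum>a\<in>UNIV. \<Sum>i\<in>A. k i * (\<omega> b a * up a (down v (y i)) w))"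
    by (simp add: sum_distrib_left mult.left_commute)
  also have "\<dots> = (\<Sum>i\<in>A. \<Sum>a\<in>UNIV. k i * (\<omega> b a * up a (down v (y i)) w))" by (rule sum.swap)
  finally have e: "(\<Sum>a\<in>UNIV. \<omega> b a * (\<Sum>i\<in>A. k i * up a (down v (y i)) w)) =
      (\<Sum>i\<in>A. k i * (\<Sum>a\<in>UNIV. \<omega> b a * up a (down v (y i)) w))" by (simp add: sum_distrib_left)
  define S where "S i = (\<Sum>a\<in>UNIV. \<omega> b a * up a (down v (y i)) w)" for i
  have "up v (\<lambda>u. \<Sum>i\<in>A. k i * y i u) (b # w) =
      (if b = v then \<Sum>i\<in>A. k i * y i w else 0) + r (length w) * (\<Sum>i\<in>A. k i * S i)"
    by (simp add: d Cons.IH e S_def)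
  also have "\<dots> = (\<Sum>i\<in>A. k i * ((if b = v then y i w else 0) + r (length w) * S i))"
    by (cases "b = v") (simp_all add: distrib_left sum.distrib sum_distrib_left mult.left_commute)
  finally show ?case by (simp add: S_def)
qed simp

lemma up_zero [simp]: "up v (\<lambda>u. 0) w = 0" and down_zero [simp]: "down v (\<lambda>u. 0) w = 0"
  using up_lin[where A="{}"] down_lin[where A="{}"] by simp_all

lemma up_cmult: "up v (\<lambda>u. k * y u) w = k * up v y w"
  and down_cmult: "down v (\<lambda>u. k * y u) w = k * down v y w"
  using up_lin[where A="{()}" and k="\<lambda>_. k" and y="\<lambda>_. y"] down_lin[where A="{()}" and k="\<lambda>_. k" and y="\<lambda>_. y"]
  by simp_all

lemma up_sum: "up v (\<lambda>u. \<Sum>i\<in>A. y i u) w = (\<Sum>i\<in>A. up v (y i) w)"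
  and down_sum: "down v (\<lambda>u. \<Sum>i\<in>A. y i u) w = (\<Sum>i\<in>A. down v (y i) w)"
  using up_lin[where k="\<lambda>_. 1"] down_lin[where k="\<lambda>_. 1"] by simp_all

lemma up_add: "up v (\<lambda>u. y u + z u) w = up v y w + up v z w"
  and down_add: "down v (\<lambda>u. y u + z u) w = down v y w + down v z w"
  using up_sum[where A=UNIV and y="\<lambda>b. if b then y else z"] down_sum[where A=UNIV and y="\<lambda>b. if b then y else z"]
  by (simp_all add: UNIV_bool ac_simps)

lemma up_diff: "up v (\<lambda>u. y u - z u) w = up v y w - up v z w"
  and down_diff: "down v (\<lambda>u. y u - z u) w = down v y w - down v z w"
  using up_add[of v "\<lambda>u. y u - z u" z w] down_add[of v "\<lambda>u. y u - z u" z w]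
  by simp_all

lemma down_weight: "down v (\<lambda>u. g (length u) * y u) w = g (Suc (length w)) * down v y w"
  by (simp add: gdown_def sum_distrib_left mult.left_commute)

lemma up_weight: "up v (\<lambda>u. g (length u) * y u) w = g (length w - 1) * up v y w"
proof (induction w arbitrary: v y g)
  case (Cons b w)
  have d: "down v (\<lambda>u. g (length u) * y u) = (\<lambda>w. g (Suc (length w)) * down v y w)"
    by (simp add: fun_eq_iff down_weight)
  have "up a (\<lambda>u. g (Suc (length u)) * down v y u) w = g (length w) * up a (down v y) w" for a
    using Cons.IH[of a "\<lambda>n. g (Suc n)" "down v y"] by (cases w) simp_all
  then show ?case
    by (simp add: d distrib_left sum_distrib_left mult.left_commute)
qed simp

lemma up_cong_length:
  assumes "\<And>u. Suc (length u) = length w \<Longrightarrow> y u = z u"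
  shows "up v y w = up v z w"
proof -
  have "up v y w = up v z w" if "\<And>u. Suc (length u) = length w \<Longrightarrow> y u = z u" for v y z
    using that
  proof (induction w arbitrary: v y z)
    case (Cons b w)
    have "down v y u = down v z u" if "Suc (length u) = length w" for u
      using Cons.prems that by (simp add: gdown_def)
    then have "up a (down v y) w = up a (down v z) w" for a by (rule Cons.IH)
    then show ?case using Cons.prems by simp
  qed simp
  then show ?thesis using assms by blast
qed

subsection \<open>Capfree tensors\<close>

text \<open>
  The name refers to diagrams: capping off two neighbouring strands gives zero.
\<close>

definition capfree :: "('n list \<Rightarrow> 'k) \<Rightarrow> bool" where
  "capfree y \<longleftrightarrow> (\<forall>w1 w2. (\<Sum>l\<in>UNIV. \<Sum>m\<in>UNIV. \<beta> l m * y (w1 @ l # m # w2)) = 0)"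

lemma capfreeD: "capfree y \<Longrightarrow> (\<Sum>l\<in>UNIV. \<Sum>m\<in>UNIV. \<beta> l m * y (w1 @ l # m # w2)) = 0"
  by (simp add: capfree_def)

text \<open>
  The form \<open>\<beta>\<close> undoes the contraction with \<open>\<omega>\<close> in the correction term of \<open>up\<close>.
\<close>

lemma down_up: "down a (up b y) w = \<beta> a b * y w + r (length w) * up a (down b y) w"
proof -
  let ?X = "\<lambda>x. up x (down b y) w"
  have "down a (up b y) w = (\<Sum>l\<in>UNIV. \<beta> a l * ((if l = b then y w else 0) + r (length w) * (\<Sum>x\<in>UNIV. \<omega> l x * ?X x)))"
    by (simp add: gdown_def)
  also have "\<dots> = (\<Sum>l\<in>UNIV. \<beta> a l * (if l = b then y w else 0)) +
      (\<Sum>l\<in>UNIV. \<beta> a l * (r (length w) * (\<Sum>x\<in>UNIV. \<omega> l x * ?X x)))"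
    by (simp only: distrib_left sum.distrib)
  also have "(\<Sum>l\<in>UNIV. \<beta> a l * (if l = b then y w else 0)) = \<beta> a b * y w"
    by (simp add: if_distrib[of "\<lambda>x. _ * x"] cong: if_cong)
  also have "(\<Sum>l\<in>UNIV. \<beta> a l * (r (length w) * (\<Sum>x\<in>UNIV. \<omega> l x * ?X x))) =
      r (length w) * (\<Sum>l\<in>UNIV. \<beta> a l * (\<Sum>x\<in>UNIV. \<omega> l x * ?X x))"
      using sum_distrib_left[of "r (length w)" "\<lambda>l. \<beta> a l * (\<Sum>x\<in>UNIV. \<omega> l x * ?X x)" UNIV]
      by (simp only: mult.left_commute[of _ "r (length w)"])
  also have "(\<Sum>l\<in>UNIV. \<beta> a l * (\<Sum>x\<in>UNIV. \<omega> l x * ?X x)) = ?X a" by (rule form_inv_contract)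
  finally show ?thesis .
qed

lemma cap_first: "capfree y \<Longrightarrow> (\<Sum>a\<in>UNIV. down a (\<lambda>u. y (a # u)) w) = 0"
  using capfreeD[of y "[]" w] by (simp add: gdown_def)

text \<open>
  Reading the first factor and raising it again restores the tensor, because the correction terms sum
  up to a contraction of \<open>y\<close>.
\<close>

lemma up_first:
  assumes "capfree y"
  shows "(\<Sum>a\<in>UNIV. up a (\<lambda>u. y (a # u)) w) = (if w = [] then 0 else y w)"
proof (cases w)
  case (Cons b w')
  have "(\<Sum>a\<in>UNIV. \<Sum>x\<in>UNIV. \<omega> b x * up x (down a (\<lambda>u. y (a # u))) w') =
      (\<Sum>x\<in>UNIV. \<omega> b x * (\<Sum>a\<in>UNIV. up x (down a (\<lambda>u. y (a # u))) w'))"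
    by (subst sum.swap) (simp add: sum_distrib_left)
  also have "\<dots> = (\<Sum>x\<in>UNIV. \<omega> b x * up x (\<lambda>u. \<Sum>a\<in>UNIV. down a (\<lambda>u. y (a # u)) u) w')"
    by (simp add: up_sum)
  also have "\<dots> = 0" by (simp add: cap_first[OF assms])
  finally have "(\<Sum>a\<in>UNIV. \<Sum>x\<in>UNIV. \<omega> b x * up x (down a (\<lambda>u. y (a # u))) w') = 0" .
  then show ?thesis
    by (simp add: Cons sum.distrib flip: sum_distrib_left)
qed simp

lemma up_down_omega:
  assumes "capfree y"
  shows "(\<Sum>a\<in>UNIV. \<Sum>b\<in>UNIV. \<omega> a b * up a (down b y) w) = (if w = [] then 0 else y w)"
proof -
  have "(\<Sum>b\<in>UNIV. \<omega> a b * up a (down b y) w) = up a (\<lambda>u. y (a # u)) w" for a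
    unfolding up_lin[symmetric] by (simp add: gdown_def inv_form_contract)
  then show ?thesis using up_first[OF assms] by simp
qed

text \<open>
  A bubble: inserting \<open>down_up\<close>, the first summand gives the loop value \<open>- c 2\<close> and the second
  one \<open>r j\<close>; the sum of the two is \<open>\<kappa> j\<close>.
\<close>

lemma down_up_omega:
  assumes "capfree y"
  shows "(\<Sum>a\<in>UNIV. \<Sum>b\<in>UNIV. \<omega> a b * down a (up b y) w) = \<kappa> (length w) * y w"
proof -
  have "(\<Sum>a\<in>UNIV. \<Sum>b\<in>UNIV. \<omega> a b * down a (up b y) w) =
      (\<Sum>a\<in>UNIV. \<Sum>b\<in>UNIV. \<omega> a b * \<beta> a b) * y w + r (length w) * (\<Sum>a\<in>UNIV. \<Sum>b\<in>UNIV. \<omega> a b * up a (down b y) w)"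
    by (simp only: down_up distrib_left sum.distrib sum_distrib_left[where r = "r (length w)"]
        sum_distrib_right mult.assoc mult.left_commute[of _ "r (length w)"])
  then show ?thesis
    unfolding loop up_down_omega[OF assms] kappa_eq by (simp add: algebra_simps)
qed

lemma down_down_omega:
  assumes "capfree y"
  shows "(\<Sum>a\<in>UNIV. \<Sum>b\<in>UNIV. \<omega> a b * down a (down b y) w) = 0"
proof -
  have "(\<Sum>b\<in>UNIV. \<omega> a b * down a (down b y) w) = down a (\<lambda>u. y (a # u)) w" for a
    unfolding down_lin[symmetric] by (simp add: gdown_def inv_form_contract)
  then show ?thesis using cap_first[OF assms] by simp
qed

lemma capfree_lin: "(\<And>i. i \<in> A \<Longrightarrow> capfree (y i)) \<Longrightarrow> capfree (\<lambda>w. \<Sum>i\<in>A. k i * y i w)"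
proof -
  assume *: "\<And>i. i \<in> A \<Longrightarrow> capfree (y i)"
  have "(\<Sum>l\<in>UNIV. \<Sum>m\<in>UNIV. \<beta> l m * (\<Sum>i\<in>A. k i * y i (w1 @ l # m # w2))) =
     (\<Sum>i\<in>A. k i * (\<Sum>l\<in>UNIV. \<Sum>m\<in>UNIV. \<beta> l m * y i (w1 @ l # m # w2)))" for w1 w2
  proof -
    have "(\<Sum>l\<in>UNIV. \<Sum>m\<in>UNIV. \<beta> l m * (\<Sum>i\<in>A. k i * y i (w1 @ l # m # w2))) =
       (\<Sum>l\<in>UNIV. \<Sum>i\<in>A. \<Sum>m\<in>UNIV. k i * (\<beta> l m * y i (w1 @ l # m # w2)))"
      by (subst (2) sum.swap) (simp add: sum_distrib_left mult.left_commute)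
    also have "\<dots> = (\<Sum>i\<in>A. \<Sum>l\<in>UNIV. \<Sum>m\<in>UNIV. k i * (\<beta> l m * y i (w1 @ l # m # w2)))" by (rule sum.swap)
    finally show ?thesis by (simp add: sum_distrib_left)
  qed
  then show "capfree (\<lambda>w. \<Sum>i\<in>A. k i * y i w)" using * by (simp add: capfree_def)
qed

lemma capfree_zero: "capfree (\<lambda>_. 0)" by (simp add: capfree_def)

lemma capfree_add: "capfree y \<Longrightarrow> capfree z \<Longrightarrow> capfree (\<lambda>w. y w + z w)"
  by (simp add: capfree_def distrib_left sum.distrib)

lemma capfree_diff: "capfree y \<Longrightarrow> capfree z \<Longrightarrow> capfree (\<lambda>w. y w - z w)"
  by (simp add: capfree_def right_diff_distrib sum_subtractf)

lemma capfree_weight: "capfree y \<Longrightarrow> capfree (\<lambda>w. g (length w) * y w)"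
  by (simp add: capfree_def mult.left_commute[of "\<beta> _ _"] flip: sum_distrib_left)

lemma capfree_cmult: "capfree y \<Longrightarrow> capfree (\<lambda>w. k * y w)"
  by (rule capfree_weight)

lemma capfree_tail: "capfree y \<Longrightarrow> capfree (\<lambda>w. y (a # w))"
  using capfreeD[of y "a # w1" w2 for w1 w2] by (simp add: capfree_def)

lemma capfree_down: "capfree y \<Longrightarrow> capfree (down v y)"
  using capfree_lin[of UNIV "\<lambda>l w. y (l # w)" "\<beta> v"] capfree_tail
  by (simp add: gdown_def[abs_def])

text \<open>
  Only the contraction of the first two factors is not covered by induction. There the inserted vector
  contributes \<open>down v y\<close> and the correction term contributes \<open>r (j + 1) * \<kappa> j\<close> times the same tensor,
  and \<open>r (j + 1) * \<kappa> j = - 1\<close>.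
\<close>

lemma capfree_up:
  assumes "capfree y" shows "capfree (up v y)"
proof -
  have "(\<Sum>l\<in>UNIV. \<Sum>m\<in>UNIV. \<beta> l m * up v y (w1 @ l # m # w2)) = 0" if "capfree y" for v y w1 w2
    using that
  proof (induction w1 arbitrary: v y)
    case Nil
    let ?z = "down v y"
    have u: "up v y (l # m # w2) = (if l = v then y (m # w2) else 0) +
        r (Suc (length w2)) * (\<Sum>a\<in>UNIV. \<omega> l a * up a ?z (m # w2))" for l m by simp
    have "(\<Sum>l\<in>UNIV. \<Sum>m\<in>UNIV. \<beta> l m * up v y (l # m # w2)) =
        (\<Sum>l\<in>UNIV. \<Sum>m\<in>UNIV. \<beta> l m * (if l = v then y (m # w2) else 0)) +
        (\<Sum>l\<in>UNIV. \<Sum>m\<in>UNIV. \<beta> l m * (r (Suc (length w2)) * (\<Sum>a\<in>UNIV. \<omega> l a * up a ?z (m # w2))))"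
      by (simp only: u distrib_left sum.distrib)
    also have "(\<Sum>l\<in>UNIV. \<Sum>m\<in>UNIV. \<beta> l m * (if l = v then y (m # w2) else 0)) = ?z w2"
      by (subst sum.swap) (simp add: gdown_def if_distrib[of "\<lambda>x. _ * x"] cong: if_cong)
    also have "(\<Sum>l\<in>UNIV. \<Sum>m\<in>UNIV. \<beta> l m * (r (Suc (length w2)) * (\<Sum>a\<in>UNIV. \<omega> l a * up a ?z (m # w2)))) =
        r (Suc (length w2)) * (\<Sum>l\<in>UNIV. \<Sum>m\<in>UNIV. \<Sum>a\<in>UNIV. \<omega> l a * (\<beta> l m * up a ?z (m # w2)))"
      by (simp add: sum_distrib_left mult.left_commute)
    also have "(\<Sum>l\<in>UNIV. \<Sum>m\<in>UNIV. \<Sum>a\<in>UNIV. \<omega> l a * (\<beta> l m * up a ?z (m # w2))) =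
        (\<Sum>l\<in>UNIV. \<Sum>a\<in>UNIV. \<omega> l a * down l (up a ?z) w2)"
      unfolding gdown_def[of _ _ "gup _ _ _"] sum_distrib_left by (intro sum.cong refl sum.swap)
    also have "\<dots> = \<kappa> (length w2) * ?z w2"
      by (rule down_up_omega[OF capfree_down[OF Nil]])
    also have "?z w2 + r (Suc (length w2)) * (\<kappa> (length w2) * ?z w2) = 0"
      by (simp add: r_kappa flip: mult.assoc)
    finally show ?case by simp
  next
    case (Cons x w1)
    let ?n = "Suc (Suc (length w1 + length w2))"
    have "(\<Sum>l\<in>UNIV. \<Sum>m\<in>UNIV. \<beta> l m * up v y ((x # w1) @ l # m # w2)) =
        (if x = v then (\<Sum>l\<in>UNIV. \<Sum>m\<in>UNIV. \<beta> l m * y (w1 @ l # m # w2)) else 0) +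
        r ?n * (\<Sum>l\<in>UNIV. \<Sum>m\<in>UNIV. \<beta> l m * (\<Sum>a\<in>UNIV. \<omega> x a * up a (down v y) (w1 @ l # m # w2)))"
      by (cases "x = v") (simp_all add: distrib_left sum.distrib sum_distrib_left mult.left_commute)
    moreover have "(\<Sum>l\<in>UNIV. \<Sum>m\<in>UNIV. \<beta> l m * (\<Sum>a\<in>UNIV. \<omega> x a * up a (down v y) (w1 @ l # m # w2))) =
        (\<Sum>a\<in>UNIV. \<omega> x a * (\<Sum>l\<in>UNIV. \<Sum>m\<in>UNIV. \<beta> l m * up a (down v y) (w1 @ l # m # w2)))"
    proof -
      have "(\<Sum>l\<in>UNIV. \<Sum>m\<in>UNIV. \<beta> l m * (\<Sum>a\<in>UNIV. \<omega> x a * up a (down v y) (w1 @ l # m # w2))) =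
         (\<Sum>l\<in>UNIV. \<Sum>a\<in>UNIV. \<Sum>m\<in>UNIV. \<omega> x a * (\<beta> l m * up a (down v y) (w1 @ l # m # w2)))"
        by (subst (2) sum.swap) (simp add: sum_distrib_left mult.left_commute)
      also have "\<dots> = (\<Sum>a\<in>UNIV. \<Sum>l\<in>UNIV. \<Sum>m\<in>UNIV. \<omega> x a * (\<beta> l m * up a (down v y) (w1 @ l # m # w2)))"
        by (rule sum.swap)
      finally show ?thesis by (simp add: sum_distrib_left)
    qed
    ultimately show ?case
      using Cons.IH[OF capfree_down[OF Cons.prems]] capfreeD[OF Cons.prems] by simp
  qed
  then show ?thesis using assms by (simp add: capfree_def)
qed

text \<open>
  Raising twice with the two halves of \<open>\<omega>\<close> inserts a cup, which the projection kills; in coordinates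
  the two terms of the recursion cancel, again by \<open>r (j + 1) * \<kappa> j = - 1\<close>.
\<close>

lemma up_up_omega:
  assumes "capfree y"
  shows "(\<Sum>a\<in>UNIV. \<Sum>b\<in>UNIV. \<omega> a b * up a (up b y) w) = 0"
proof (cases w)
  case (Cons x w')
  have "(\<Sum>a\<in>UNIV. \<Sum>b\<in>UNIV. \<omega> a b * up a (up b y) w) =
      (\<Sum>a\<in>UNIV. \<Sum>b\<in>UNIV. (if x = a then \<omega> a b * up b y w' else 0)) +
      (\<Sum>a\<in>UNIV. \<Sum>b\<in>UNIV. \<omega> a b * (r (length w') * (\<Sum>d\<in>UNIV. \<omega> x d * up d (down a (up b y)) w')))"
    by (auto simp: Cons distrib_left intro!: sum.cong simp flip: sum.distrib)
  also have "(\<Sum>a\<in>UNIV. \<Sum>b\<in>UNIV. (if x = a then \<omega> a b * up b y w' else 0)) = (\<Sum>b\<in>UNIV. \<omega> x b * up b y w')"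
    by (subst sum.swap) simp
  also have "(\<Sum>a\<in>UNIV. \<Sum>b\<in>UNIV. \<omega> a b * (r (length w') * (\<Sum>d\<in>UNIV. \<omega> x d * up d (down a (up b y)) w'))) =
      (\<Sum>a\<in>UNIV. \<Sum>b\<in>UNIV. \<Sum>d\<in>UNIV. r (length w') * \<omega> x d * (\<omega> a b * up d (down a (up b y)) w'))"
    by (simp add: sum_distrib_left ac_simps)
  also have "\<dots> = (\<Sum>a\<in>UNIV. \<Sum>d\<in>UNIV. \<Sum>b\<in>UNIV. r (length w') * \<omega> x d * (\<omega> a b * up d (down a (up b y)) w'))"
    by (intro sum.cong refl sum.swap)
  also have "\<dots> = (\<Sum>d\<in>UNIV. \<Sum>a\<in>UNIV. \<Sum>b\<in>UNIV. r (length w') * \<omega> x d * (\<omega> a b * up d (down a (up b y)) w'))"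
    by (rule sum.swap)
  also have "\<dots> = (\<Sum>d\<in>UNIV. r (length w') * \<omega> x d * up d (\<lambda>u. \<Sum>a\<in>UNIV. \<Sum>b\<in>UNIV. \<omega> a b * down a (up b y) u) w')"
    by (simp add: up_lin up_sum sum_distrib_left)
  also have "\<dots> = (\<Sum>d\<in>UNIV. r (length w') * \<omega> x d * (\<kappa> (length w' - 1) * up d y w'))"
    by (simp add: down_up_omega[OF assms] up_weight)
  also have "\<dots> = - (\<Sum>d\<in>UNIV. \<omega> x d * up d y w')"
  proof (cases w')
    case (Cons x' u)
    have "r (length w') * \<omega> x d * (\<kappa> (length w' - 1) * up d y w') = - (\<omega> x d * up d y w')" for d
    proof -
      have "r (length w') * \<omega> x d * (\<kappa> (length w' - 1) * up d y w') =
          (r (Suc (length u)) * \<kappa> (length u)) * (\<omega> x d * up d y w')"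
        unfolding Cons by (simp only: ac_simps length_Cons diff_Suc_1)
      then show ?thesis by (simp add: r_kappa)
    qed
    then show ?thesis by (simp add: sum_negf)
  qed simp
  finally show ?thesis by simp
qed simp

subsection \<open>Normal forms in the quadratic algebra\<close>

text \<open>
  The coefficient of the lowering part in the action of the generators of \<open>\<A>(E\<^sup>-\<^sup>1, t)\<close>; the
  recursion is the condition that \<open>act_act_omega\<close> holds.
\<close>

primrec low_coef :: "'k \<Rightarrow> nat \<Rightarrow> 'k" where
  "low_coef t 0 = 0"
| "low_coef t (Suc j) = r (Suc j) * (low_coef t j - t)"

lemma low_coef_zero [simp]: "low_coef 0 j = 0" by (induction j) simp_all

text \<open>
  The action of the generator \<open>x\<^sub>v\<close> on tensors. For \<open>t = 0\<close> it is \<open>up v\<close>, which raises the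
  degree by exactly one.
\<close>

definition act :: "'k \<Rightarrow> 'n \<Rightarrow> ('n list \<Rightarrow> 'k) \<Rightarrow> 'n list \<Rightarrow> 'k" where
  "act t v y w = up v y w + low_coef t (Suc (length w)) * down v y w"

lemma act_zero [simp]: "act t v (\<lambda>_. 0) w = 0" by (simp add: act_def)

lemma act_0: "act 0 v y = up v y" by (simp add: act_def fun_eq_iff)

lemma act_lin: "act t v (\<lambda>u. \<Sum>i\<in>A. k i * y i u) w = (\<Sum>i\<in>A. k i * act t v (y i) w)"
  by (simp add: act_def up_lin down_lin distrib_left sum.distrib sum_distrib_left mult.left_commute)

lemma capfree_act: "capfree y \<Longrightarrow> capfree (act t v y)"
  unfolding act_def[abs_def]
  using capfree_add[OF capfree_up capfree_weight[OF capfree_down, of y "\<lambda>j. low_coef t (Suc j)"]] by blast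

text \<open>
  Of the four composites only \<open>up \<circ> down\<close> and \<open>down \<circ> up\<close> survive the contraction, and their
  coefficients are arranged to sum to \<open>t\<close>.
\<close>

lemma act_act_omega:
  assumes "capfree y"
  shows "(\<Sum>a\<in>UNIV. \<Sum>b\<in>UNIV. \<omega> a b * act t a (act t b y) w) = t * y w"
proof -
  let ?n = "length w"
  have *: "act t a (act t b y) w = up a (up b y) w + low_coef t ?n * up a (down b y) w
      + low_coef t (Suc ?n) * down a (up b y) w + low_coef t (Suc ?n) * low_coef t (Suc (Suc ?n)) * down a (down b y) w" for a b
  proof -
    have "up a (\<lambda>u. low_coef t (Suc (length u)) * down b y u) w = low_coef t ?n * up a (down b y) w"
      using up_weight[of a "\<lambda>j. low_coef t (Suc j)" "down b y" w] by (cases w) simp_all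
    moreover have "down a (\<lambda>u. low_coef t (Suc (length u)) * down b y u) w = low_coef t (Suc (Suc ?n)) * down a (down b y) w"
      using down_weight[of a "\<lambda>j. low_coef t (Suc j)" "down b y" w] by simp
    ultimately show ?thesis
      by (simp only: act_def[abs_def] up_add down_add distrib_left ac_simps)
  qed
  have "(\<Sum>a\<in>UNIV. \<Sum>b\<in>UNIV. \<omega> a b * act t a (act t b y) w) =
      (\<Sum>a\<in>UNIV. \<Sum>b\<in>UNIV. \<omega> a b * up a (up b y) w)
      + low_coef t ?n * (\<Sum>a\<in>UNIV. \<Sum>b\<in>UNIV. \<omega> a b * up a (down b y) w)
      + low_coef t (Suc ?n) * (\<Sum>a\<in>UNIV. \<Sum>b\<in>UNIV. \<omega> a b * down a (up b y) w)
      + low_coef t (Suc ?n) * low_coef t (Suc (Suc ?n)) * (\<Sum>a\<in>UNIV. \<Sum>b\<in>UNIV. \<omega> a b * down a (down b y) w)"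
    by (simp only: * distrib_left sum.distrib sum_distrib_left ac_simps)
  also have "\<dots> = low_coef t ?n * y w + low_coef t (Suc ?n) * \<kappa> ?n * y w"
    by (simp add: up_up_omega up_down_omega down_up_omega down_down_omega assms)
  also have "low_coef t (Suc ?n) * \<kappa> ?n = t - low_coef t ?n"
  proof -
    have "low_coef t (Suc ?n) * \<kappa> ?n = (r (Suc ?n) * \<kappa> ?n) * (low_coef t ?n - t)" by simp
    then show ?thesis by (simp only: r_kappa) simp
  qed
  finally show ?thesis by (simp add: algebra_simps)
qed

text \<open>
  The result of applying a word to the vacuum, as a sum of capfree tensors of degree at most the
  length of the word.
\<close>

primrec nf :: "'k \<Rightarrow> 'n list \<Rightarrow> 'n list \<Rightarrow> 'k" where
  "nf t [] = (\<lambda>u. if u = [] then 1 else 0)"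
| "nf t (x # w) = act t x (nf t w)"

lemma capfree_nf: "capfree (nf t w)"
proof (induction w)
  case Nil
  show ?case by (simp add: capfree_def)
qed (simp add: capfree_act)

lemma up_support: "(\<And>u. length u > N \<Longrightarrow> y u = 0) \<Longrightarrow> length w > Suc N \<Longrightarrow> up v y w = 0"
proof -
  assume *: "\<And>u. length u > N \<Longrightarrow> y u = 0" "length w > Suc N"
  have "up v y w = up v (\<lambda>_. 0) w" by (rule up_cong_length) (use * in auto)
  then show ?thesis by simp
qed

lemma down_support: "(\<And>u. length u > N \<Longrightarrow> y u = 0) \<Longrightarrow> length w \<ge> N \<Longrightarrow> down v y w = 0"
  by (simp add: gdown_def)

lemma act_support: "(\<And>u. length u > N \<Longrightarrow> y u = 0) \<Longrightarrow> length w > Suc N \<Longrightarrow> act t v y w = 0"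
  using up_support[of N y w v] down_support[of N y w v] by (auto simp: act_def)

lemma nf_support: "length u > length w \<Longrightarrow> nf t w u = 0"
proof (induction w arbitrary: u)
  case (Cons x w)
  then show ?case using act_support[of "length w" "nf t w" u t x] by simp
qed auto

lemma nf_homogeneous: "length u \<noteq> length w \<Longrightarrow> nf 0 w u = 0"
proof (induction w arbitrary: u)
  case (Cons x w)
  have "up x (nf 0 w) u = up x (\<lambda>_. 0) u"
    by (rule up_cong_length) (use Cons in auto)
  then show ?case by (simp add: act_0)
qed auto

text \<open>
  The component of top degree does not see the lowering operators, hence not \<open>t\<close>.
\<close>

lemma nf_top: "length u = length w \<Longrightarrow> nf t w u = nf 0 w u"
proof (induction w arbitrary: u)
  case (Cons x w)
  have "up x (nf t w) u = up x (nf 0 w) u"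
    by (rule up_cong_length) (use Cons in auto)
  moreover have "down x (nf t w) u = 0"
    by (rule down_support[of "length w"]) (use Cons nf_support in auto)
  ultimately show ?case by (simp add: act_def)
qed simp

text \<open>
  A capfree tensor, read as a combination of words, has itself as normal form: after the first letter
  has been split off, \<open>up_first\<close> and \<open>cap_first\<close> apply.
\<close>

lemma capfree_nf_sum:
  assumes "capfree y"
  shows "(\<Sum>w\<in>words j. y w * nf t w u) = (if length u = j then y u else 0)"
  using assms
proof (induction j arbitrary: y u)
  case 0
  then show ?case by simp
next
  case (Suc j)
  let ?g = "\<lambda>n. if n = j then 1 else (0::'k)"
  have "(\<Sum>w\<in>words (Suc j). y w * nf t w u) = (\<Sum>a\<in>UNIV. act t a (\<lambda>u. \<Sum>w\<in>words j. y (a # w) * nf t w u) u)"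
    by (simp add: sum_words_Suc act_lin)
  also have "\<dots> = (\<Sum>a\<in>UNIV. act t a (\<lambda>u. ?g (length u) * y (a # u)) u)"
    using Suc.IH[OF capfree_tail[OF Suc.prems]] by (simp add: if_distrib[of "\<lambda>x. x * _"] cong: if_cong)
  also have "\<dots> = (\<Sum>a\<in>UNIV. ?g (length u - 1) * up a (\<lambda>u. y (a # u)) u +
      low_coef t (Suc (length u)) * (?g (Suc (length u)) * down a (\<lambda>u. y (a # u)) u))"
    by (simp only: act_def up_weight[where g = ?g] down_weight[where g = ?g])
  also have "\<dots> = ?g (length u - 1) * (\<Sum>a\<in>UNIV. up a (\<lambda>u. y (a # u)) u) +
      low_coef t (Suc (length u)) * ?g (Suc (length u)) * (\<Sum>a\<in>UNIV. down a (\<lambda>u. y (a # u)) u)"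
    by (simp only: sum.distrib sum_distrib_left ac_simps)
  also have "\<dots> = (if length u = Suc j then y u else 0)"
    by (auto simp: up_first[OF Suc.prems] cap_first[OF Suc.prems] neq_Nil_conv)
  finally show ?case .
qed

text \<open>
  Let \<open>h\<close> be a function on words with values in a vector space that respects the relation
  \<open>\<Sum> \<omega>\<^sub>b\<^sub>a x\<^sub>b x\<^sub>a = t\<close> modulo a subspace \<open>I\<close>. Under the pairing with such an \<open>h\<close> the action of \<open>x\<^sub>v\<close> on tensors
  is the same as putting the letter \<open>v\<close> in front of words: the difference, the correction
  term of \<open>up\<close> together with the lowering term, is a combination of instances of the relation. The
  induction on the degree follows the recursion of \<open>up\<close>, whose correction term raises \<open>down v y\<close>, a
  tensor of smaller degree.
\<close>

lemma pair_act:
  fixes s :: "'k \<Rightarrow> 'g \<Rightarrow> 'g::ab_group_add" and h :: "'n list \<Rightarrow> 'g"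
  assumes "vector_space s"
    and I: "0 \<in> I" "\<And>x y. x \<in> I \<Longrightarrow> y \<in> I \<Longrightarrow> x + y \<in> I" "\<And>a x. x \<in> I \<Longrightarrow> s a x \<in> I"
    and h: "\<And>w1 w2. (\<Sum>b\<in>UNIV. \<Sum>a\<in>UNIV. s (\<omega> b a) (h (w1 @ b # a # w2))) - s t (h (w1 @ w2)) \<in> I"
    and supp: "\<And>w. length w > N \<Longrightarrow> y w = 0"
  shows "(\<Sum>w\<in>words_le (Suc N). s (act t v y w) (h w)) - (\<Sum>w\<in>words_le N. s (y w) (h (v # w))) \<in> I"
proof -
  interpret vector_space s by fact
  have Isum: "(\<And>i. i \<in> A \<Longrightarrow> f i \<in> I) \<Longrightarrow> sum f A \<in> I" for f and A :: "'i set"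
    by (induction A rule: infinite_finite_induct) (auto simp: I)
  show ?thesis using h supp
  proof (induction N arbitrary: h y v)
    case 0
    have d: "down v y w = 0" for w by (rule down_support[of 0]) (use 0 in auto)
    have "(\<Sum>w\<in>words_le (Suc 0). s (act t v y w) (h w)) = (\<Sum>b\<in>UNIV. s (if b = v then y [] else 0) (h [b]))"
      unfolding sum_words_le_Suc by (simp add: act_def d)
    also have "\<dots> = s (y []) (h [v])"
      by (simp add: if_distrib[of "\<lambda>x. s x _"] cong: if_cong)
    finally show ?case using I(1) by simp
  next
    case (Suc M)
    let ?N = "Suc M"
    \<comment> \<open>The correction term of \<open>up v y\<close> consists of raisings of this tensor.\<close>
    let ?z = "\<lambda>w. r (Suc (length w)) * down v y w"
    have zsupp: "?z w = 0" if "length w > M" for w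
      using down_support[of ?N y w v] Suc.prems(2) that by simp
    have zup: "r (length w) * up a (down v y) w = up a ?z w" for a w
      using up_weight[of a "\<lambda>j. r (Suc j)" "down v y" w] by (cases w) simp_all
    have act: "up a ?z w = act t a ?z w - low_coef t (Suc (length w)) * down a ?z w" for a w
      by (simp add: act_def)
    have ups: "up v y (b # w) = (if b = v then y w else 0) + (\<Sum>a\<in>UNIV. \<omega> b a * act t a ?z w)
        - low_coef t (Suc (length w)) * ?z (b # w)" for b w
    proof -
      have "up v y (b # w) = (if b = v then y w else 0) + (\<Sum>a\<in>UNIV. \<omega> b a * up a ?z w)"
        by (simp add: sum_distrib_left mult.left_commute[of "r _"] zup)
      also have "(\<Sum>a\<in>UNIV. \<omega> b a * up a ?z w) = (\<Sum>a\<in>UNIV. \<omega> b a * act t a ?z w) -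
          low_coef t (Suc (length w)) * (\<Sum>a\<in>UNIV. \<omega> b a * down a ?z w)"
        by (simp only: act right_diff_distrib sum_subtractf sum_distrib_left mult.left_commute)
      also have "(\<Sum>a\<in>UNIV. \<omega> b a * down a ?z w) = ?z (b # w)"
        unfolding gdown_def[of _ _ "\<lambda>w. r (Suc (length w)) * gdown _ _ _ w"] by (rule inv_form_contract)
      finally show ?thesis by simp
    qed
    \<comment> \<open>By its recursion, \<open>low_coef\<close> turns the lowering term into a multiple of the same tensor.\<close>
    have acts: "act t v y w = up v y w + (low_coef t (length w) - t) * ?z w" for w
      by (simp add: act_def algebra_simps)
    let ?Y = "\<Sum>w\<in>words_le ?N. s (y w) (h (v # w))"
    let ?P = "\<Sum>b\<in>UNIV. \<Sum>a\<in>UNIV. s (\<omega> b a) (\<Sum>w\<in>words_le ?N. s (act t a ?z w) (h (b # w)))"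
    let ?Q = "\<Sum>b\<in>UNIV. \<Sum>a\<in>UNIV. s (\<omega> b a) (\<Sum>w\<in>words_le M. s (?z w) (h (b # a # w)))"
    let ?Z = "\<lambda>k. \<Sum>w\<in>words_le (Suc ?N). s (k w * ?z w) (h w)"
    have "(\<Sum>w\<in>words_le (Suc ?N). s (up v y w) (h w)) =
      (\<Sum>b\<in>UNIV. \<Sum>w\<in>words_le ?N. s (if b = v then y w else 0) (h (b # w)) +
         (\<Sum>a\<in>UNIV. s (\<omega> b a) (s (act t a ?z w) (h (b # w)))) -
         s (low_coef t (Suc (length w)) * ?z (b # w)) (h (b # w)))"
      unfolding sum_words_le_Suc ups
      by (simp add: scale_left_distrib scale_left_diff_distrib scale_sum_left scale_scale del: gup.simps(2) cong: if_cong)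
    also have "\<dots> = (\<Sum>b\<in>UNIV. \<Sum>w\<in>words_le ?N. s (if b = v then y w else 0) (h (b # w))) +
        (\<Sum>b\<in>UNIV. \<Sum>w\<in>words_le ?N. \<Sum>a\<in>UNIV. s (\<omega> b a) (s (act t a ?z w) (h (b # w)))) -
        (\<Sum>b\<in>UNIV. \<Sum>w\<in>words_le ?N. s (low_coef t (Suc (length w)) * ?z (b # w)) (h (b # w)))"
      by (simp add: sum.distrib sum_subtractf)
    also have "(\<Sum>b\<in>UNIV. \<Sum>w\<in>words_le ?N. s (if b = v then y w else 0) (h (b # w))) = ?Y"
      by (subst sum.swap) (simp add: if_distrib[of "\<lambda>x. s x _"] cong: if_cong)
    also have "(\<Sum>b\<in>UNIV. \<Sum>w\<in>words_le ?N. \<Sum>a\<in>UNIV. s (\<omega> b a) (s (act t a ?z w) (h (b # w)))) = ?P"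
      unfolding scale_sum_right by (intro sum.cong refl sum.swap)
    also have "(\<Sum>b\<in>UNIV. \<Sum>w\<in>words_le ?N. s (low_coef t (Suc (length w)) * ?z (b # w)) (h (b # w))) =
        ?Z (\<lambda>w. low_coef t (length w))"
      by (subst sum_words_le_Suc) simp
    finally have 1: "(\<Sum>w\<in>words_le (Suc ?N). s (up v y w) (h w)) = ?Y + ?P - ?Z (\<lambda>w. low_coef t (length w))" .
    have "(\<Sum>w\<in>words_le (Suc ?N). s (act t v y w) (h w)) =
        (\<Sum>w\<in>words_le (Suc ?N). s (up v y w) (h w)) + ?Z (\<lambda>w. low_coef t (length w)) - ?Z (\<lambda>_. t)"
      unfolding acts by (simp add: scale_left_distrib scale_left_diff_distrib sum.distrib sum_subtractf left_diff_distrib)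
    then have 2: "(\<Sum>w\<in>words_le (Suc ?N). s (act t v y w) (h w)) - ?Y = ?P - ?Z (\<lambda>_. t)"
      unfolding 1 by simp
    have "(\<Sum>w\<in>words_le ?N. s (act t a ?z w) (h (b # w))) - (\<Sum>w\<in>words_le M. s (?z w) (h (b # a # w))) \<in> I" for a b
    proof (rule Suc.IH)
      show "(\<Sum>x\<in>UNIV. \<Sum>a\<in>UNIV. s (\<omega> x a) (h (b # w1 @ x # a # w2))) - s t (h (b # w1 @ w2)) \<in> I" for w1 w2
        using Suc.prems(1)[of "b # w1" w2] by simp
    qed (rule zsupp)
    then have "?P - ?Q \<in> I"
      unfolding sum_subtractf[symmetric] scale_right_diff_distrib[symmetric] by (intro Isum I(3)) auto
    moreover have "?Q - ?Z (\<lambda>_. t) \<in> I"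
    proof -
      have "?Q = (\<Sum>b\<in>UNIV. \<Sum>a\<in>UNIV. \<Sum>w\<in>words_le M. s (?z w) (s (\<omega> b a) (h (b # a # w))))"
        by (simp add: scale_sum_right scale_scale mult.commute)
      also have "\<dots> = (\<Sum>b\<in>UNIV. \<Sum>w\<in>words_le M. \<Sum>a\<in>UNIV. s (?z w) (s (\<omega> b a) (h (b # a # w))))"
        by (intro sum.cong refl sum.swap)
      also have "\<dots> = (\<Sum>w\<in>words_le M. \<Sum>b\<in>UNIV. \<Sum>a\<in>UNIV. s (?z w) (s (\<omega> b a) (h (b # a # w))))"
        by (rule sum.swap)
      also have "\<dots> = (\<Sum>w\<in>words_le M. s (?z w) (\<Sum>b\<in>UNIV. \<Sum>a\<in>UNIV. s (\<omega> b a) (h (b # a # w))))"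
        by (simp add: scale_sum_right)
      finally have q: "?Q = (\<Sum>w\<in>words_le M. s (?z w) (\<Sum>b\<in>UNIV. \<Sum>a\<in>UNIV. s (\<omega> b a) (h (b # a # w))))" .
      have z: "?Z (\<lambda>_. t) = (\<Sum>w\<in>words_le M. s (?z w) (s t (h w)))"
      proof -
        have "?Z (\<lambda>_. t) = (\<Sum>w\<in>words_le M. s (t * ?z w) (h w))"
          by (rule sum.mono_neutral_right) (use zsupp in \<open>auto simp del: mult_eq_0_iff\<close>)
        then show ?thesis by (simp add: scale_scale mult.commute)
      qed
      show ?thesis unfolding q z sum_subtractf[symmetric] scale_right_diff_distrib[symmetric]
        using Suc.prems(1)[of "[]"] by (intro Isum I(3)) auto
    qed
    ultimately have "(?P - ?Q) + (?Q - ?Z (\<lambda>_. t)) \<in> I" by (rule I(2))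
    then show ?case unfolding 2 by simp
  qed
qed

text \<open>
  Every word equals its normal form modulo the relation: apply \<open>pair_act\<close> letter by letter.
\<close>

lemma nf_pair:
  fixes s :: "'k \<Rightarrow> 'g \<Rightarrow> 'g::ab_group_add" and h :: "'n list \<Rightarrow> 'g"
  assumes s: "vector_space s"
    and I: "0 \<in> I" "\<And>x y. x \<in> I \<Longrightarrow> y \<in> I \<Longrightarrow> x + y \<in> I" "\<And>a x. x \<in> I \<Longrightarrow> s a x \<in> I"
    and h: "\<And>w1 w2. (\<Sum>b\<in>UNIV. \<Sum>a\<in>UNIV. s (\<omega> b a) (h (w1 @ b # a # w2))) - s t (h (w1 @ w2)) \<in> I"
  shows "(\<Sum>u\<in>words_le (length w). s (nf t w u) (h u)) - h w \<in> I"
proof -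
  interpret vector_space s by (rule s)
  show ?thesis using h
  proof (induction w arbitrary: h)
    case (Cons x w)
    have 1: "(\<Sum>u\<in>words_le (Suc (length w)). s (act t x (nf t w) u) (h u)) -
        (\<Sum>u\<in>words_le (length w). s (nf t w u) (h (x # u))) \<in> I"
      by (rule pair_act[OF s I]) (use Cons.prems nf_support in auto)
    have 2: "(\<Sum>u\<in>words_le (length w). s (nf t w u) (h (x # u))) - h (x # w) \<in> I"
    proof (rule Cons.IH)
      show "(\<Sum>b\<in>UNIV. \<Sum>a\<in>UNIV. s (\<omega> b a) (h (x # w1 @ b # a # w2))) - s t (h (x # w1 @ w2)) \<in> I" for w1 w2
        using Cons.prems[of "x # w1" w2] by simp
    qed
    show ?case using I(2)[OF 1 2] by simp
  qed (simp add: I)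
qed

lemma nf0_pair:
  fixes s :: "'k \<Rightarrow> 'g \<Rightarrow> 'g::ab_group_add" and h :: "'n list \<Rightarrow> 'g"
  assumes s: "vector_space s"
    and I: "0 \<in> I" "\<And>x y. x \<in> I \<Longrightarrow> y \<in> I \<Longrightarrow> x + y \<in> I" "\<And>a x. x \<in> I \<Longrightarrow> s a x \<in> I"
    and h: "\<And>w1 w2. (\<Sum>b\<in>UNIV. \<Sum>a\<in>UNIV. s (\<omega> b a) (h (w1 @ b # a # w2))) \<in> I"
  shows "(\<Sum>u\<in>words (length w). s (nf 0 w u) (h u)) - h w \<in> I"
proof -
  interpret vector_space s by (rule s)
  have "(\<Sum>u\<in>words_le (length w). s (nf 0 w u) (h u)) - h w \<in> I"
    by (rule nf_pair[OF s I]) (use h in auto)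
  moreover have "(\<Sum>u\<in>words_le (length w). s (nf 0 w u) (h u)) = (\<Sum>u\<in>words (length w). s (nf 0 w u) (h u))"
    by (rule sum.mono_neutral_right) (auto simp: nf_homogeneous)
  ultimately show ?thesis by simp
qed

definition cofree :: "('n list \<Rightarrow> 'k) \<Rightarrow> bool" where
  "cofree h \<longleftrightarrow> (\<forall>w1 w2. (\<Sum>l\<in>UNIV. \<Sum>m\<in>UNIV. \<omega> l m * h (w1 @ l # m # w2)) = 0)"

lemma vector_space_field: "vector_space ((*) :: 'k \<Rightarrow> 'k \<Rightarrow> 'k)"
  by unfold_locales (simp_all add: algebra_simps)

text \<open>
  For \<open>t = 0\<close> and \<open>I = 0\<close> the relation says that \<open>h\<close> is killed by contractions with \<open>\<omega>\<close>; thus the matrix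
  \<open>nf 0\<close> acts as the identity on such functions, in accordance with its being a projection.
\<close>

lemma nf0_cofree:
  assumes "cofree h"
  shows "(\<Sum>u\<in>words (length w). nf 0 w u * h u) = h w"
  using nf0_pair[OF vector_space_field, of "{0}" h w] assms by (simp add: cofree_def)

lemma up_cofree:
  assumes "cofree h" and "\<And>w. length w > N \<Longrightarrow> y w = 0"
  shows "(\<Sum>w\<in>words_le (Suc N). up v y w * h w) = (\<Sum>w\<in>words_le N. y w * h (v # w))"
  using pair_act[OF vector_space_field, of "{0}" h 0 N y v] assms by (simp add: cofree_def act_0)

text \<open>
  Expanding the first argument of \<open>W\<close> into delta functions reduces this to \<open>up_cofree\<close>: when paired with
  a tensor killed by \<open>\<omega>\<close>, raising is dual to prefixing a letter.
\<close>

lemma up_trace: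
  assumes W: "\<And>z. cofree (W z)" and supp: "\<And>z u. length z > N \<Longrightarrow> W z u = 0"
  shows "(\<Sum>u\<in>words_le (Suc N). up l (\<lambda>z. W z u) u) = (\<Sum>z\<in>words_le N. W z (l # z))"
proof -
  let ?d = "\<lambda>z u. if u = z then 1 else (0::'k)"
  have "up l (\<lambda>z. W z u) u = (\<Sum>z\<in>words_le N. W z u * up l (?d z) u)" for u
  proof -
    have "(\<lambda>z'. W z' u) = (\<lambda>z'. \<Sum>z\<in>words_le N. W z u * ?d z z')"
      by (auto simp: fun_eq_iff supp if_distrib[of "\<lambda>x. _ * x"] cong: if_cong)
    then show ?thesis by (simp only: up_lin)
  qed
  then have "(\<Sum>u\<in>words_le (Suc N). up l (\<lambda>z. W z u) u) =
      (\<Sum>u\<in>words_le (Suc N). \<Sum>z\<in>words_le N. up l (?d z) u * W z u)"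
    by (simp add: mult.commute)
  also have "\<dots> = (\<Sum>z\<in>words_le N. \<Sum>u\<in>words_le (Suc N). up l (?d z) u * W z u)" by (rule sum.swap)
  also have "\<dots> = (\<Sum>z\<in>words_le N. \<Sum>u\<in>words_le N. ?d z u * W z (l # u))"
    by (intro sum.cong refl up_cofree W) auto
  also have "\<dots> = (\<Sum>z\<in>words_le N. W z (l # z))"
    by (simp add: if_distrib[of "\<lambda>x. x * _"] cong: if_cong)
  finally show ?thesis .
qed

end

text \<open>
  Tensors with two word arguments are treated by applying an operator in one argument to values of a
  linear functional in the other; the operators for the two arguments then commute by
  \<open>up_linear_functional\<close> and \<open>down_linear_functional\<close>.
\<close>

definition linear_functional :: "(('x \<Rightarrow> 'k::field) \<Rightarrow> 'k) \<Rightarrow> bool" where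
  "linear_functional L \<longleftrightarrow> (\<forall>f g. L (\<lambda>x. f x + g x) = L f + L g) \<and> (\<forall>a f. L (\<lambda>x. a * f x) = a * L f)"

lemma linear_functional_sum:
  assumes "linear_functional L"
  shows "L (\<lambda>x. \<Sum>i\<in>A. a i * f i x) = (\<Sum>i\<in>A. a i * L (f i))"
proof -
  have z: "L (\<lambda>x. 0) = 0" using assms[unfolded linear_functional_def, THEN conjunct2, rule_format, of 0] by simp
  show ?thesis
    using assms by (induction A rule: infinite_finite_induct) (simp_all add: z linear_functional_def)
qed

lemma linear_functional_zero: "linear_functional L \<Longrightarrow> L (\<lambda>x. 0) = 0"
  using linear_functional_sum[where L=L and A="{}"] by simp

text \<open>
  The monomial \<open>a\<^sub>v\<^sub>1\<^sub>w\<^sub>1 \<dots> a\<^sub>v\<^sub>j\<^sub>w\<^sub>j\<close>, an entry of the \<open>j\<close>-th tensor power of the matrix of generators.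
\<close>

definition a_word :: "'n list \<Rightarrow> 'n list \<Rightarrow> ('n \<times> 'n) list \<Rightarrow>\<^sub>0 'k::field" where
  "a_word v w = Poly_Mapping.single (zip v w) 1"

lemma a_word_Nil: "a_word [] [] = 1" by (simp add: a_word_def zero_list_def flip: single_one)

lemma a_word_Cons: "a_word (a # v) (b # w) = var (a, b) * a_word v w"
  by (simp add: a_word_def var_def mult_single plus_list_def)

text \<open>
  A row vector times the \<open>j\<close>-th tensor power of the matrix of generators.
\<close>

definition row_a :: "('n::finite list \<Rightarrow> 'k) \<Rightarrow> 'n list \<Rightarrow> ('n \<times> 'n) list \<Rightarrow>\<^sub>0 'k::field" where
  "row_a f w = (\<Sum>w'\<in>words (length w). scl (f w') (a_word w' w))"

lemma row_a_Cons: "row_a f (b # w) = (\<Sum>a\<in>UNIV. var (a, b) * row_a (\<lambda>w'. f (a # w')) w)"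
  by (simp add: row_a_def sum_words_Suc a_word_Cons sum_distrib_left scl_mult_right)

text \<open>
  The interpretation of the locale with the two forms exchanged covers the facts proved so far. The
  locale is reopened below where later facts are needed for the dual form as well.
\<close>

context quantum_form
begin

interpretation dual: quantum_form \<omega> \<beta> c by (rule dual)

lemma linear_functional_up: "linear_functional (\<lambda>f. up v f w)" and linear_functional_down: "linear_functional (\<lambda>f. down v f w)"
  by (simp_all add: linear_functional_def up_add up_cmult down_add down_cmult)

lemma down_linear_functional:
  assumes "linear_functional L"
  shows "down v (\<lambda>z. L (\<lambda>x. X x z)) u = L (\<lambda>x. down v (X x) u)"
  unfolding gdown_def by (rule linear_functional_sum[OF assms, symmetric])

lemma up_linear_functional:
  assumes L: "linear_functional L"
  shows "up v (\<lambda>z. L (\<lambda>x. X x z)) u = L (\<lambda>x. up v (X x) u)"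
proof (induction u arbitrary: v X)
  case Nil
  then show ?case using linear_functional_zero[OF L] by simp
next
  case (Cons b u)
  have d: "down v (\<lambda>z. L (\<lambda>x. X x z)) = (\<lambda>z. L (\<lambda>x. down v (X x) z))" by (simp add: fun_eq_iff down_linear_functional[OF L])
  have "up v (\<lambda>z. L (\<lambda>x. X x z)) (b # u) = (if b = v then 1 else 0) * L (\<lambda>x. X x u) +
      r (length u) * (\<Sum>a\<in>UNIV. \<omega> b a * L (\<lambda>x. up a (down v (X x)) u))"
    by (simp add: d Cons.IH)
  also have "\<dots> = L (\<lambda>x. (if b = v then 1 else 0) * X x u + r (length u) * (\<Sum>a\<in>UNIV. \<omega> b a * up a (down v (X x)) u))"
    using L unfolding linear_functional_sum[OF L, symmetric] linear_functional_def by presburger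
  also have "\<dots> = L (\<lambda>x. up v (X x) (b # u))"
    by (rule arg_cong[of _ _ L]) auto
  finally show ?case .
qed

lemma capfree_linear_functional:
  assumes L: "linear_functional L" and Y: "\<And>x. capfree (Y x)"
  shows "capfree (\<lambda>u. L (\<lambda>x. Y x u))"
proof -
  have "(\<Sum>l\<in>UNIV. \<Sum>m\<in>UNIV. \<beta> l m * L (\<lambda>x. Y x (w1 @ l # m # w2))) = 0" for w1 w2
  proof -
    have "(\<Sum>l\<in>UNIV. \<Sum>m\<in>UNIV. \<beta> l m * L (\<lambda>x. Y x (w1 @ l # m # w2))) =
        (\<Sum>l\<in>UNIV. 1 * L (\<lambda>x. \<Sum>m\<in>UNIV. \<beta> l m * Y x (w1 @ l # m # w2)))"
      by (simp add: linear_functional_sum[OF L])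
    also have "\<dots> = L (\<lambda>x. \<Sum>l\<in>UNIV. 1 * (\<Sum>m\<in>UNIV. \<beta> l m * Y x (w1 @ l # m # w2)))"
      by (rule linear_functional_sum[OF L, symmetric])
    finally show ?thesis using capfreeD[OF Y] by (simp add: linear_functional_zero[OF L])
  qed
  then show ?thesis by (simp add: capfree_def)
qed

end

context quantum_form
begin

interpretation dual: quantum_form \<omega> \<beta> c by (rule dual)

lemma cofree_dual: "cofree h \<longleftrightarrow> dual.capfree h"
  by (simp add: cofree_def dual.capfree_def)

lemma dual_cofree: "dual.cofree h \<longleftrightarrow> capfree h"
  by (simp add: capfree_def dual.cofree_def)

subsection \<open>Generators acting on matrix coefficients\<close>

text \<open>
  The action of the generator \<open>a\<^sub>k\<^sub>l\<close> on tensors with a row argument \<open>u'\<close> and a column argument \<open>u\<close>. It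
  models the decomposition of the product of \<open>a\<^sub>k\<^sub>l\<close> with a matrix coefficient of \<open>K\<^sub>j\<close> into matrix
  coefficients of \<open>K\<^sub>j\<^sub>+\<^sub>1\<close> and \<open>K\<^sub>j\<^sub>-\<^sub>1\<close>.
\<close>

definition gen_op :: "'n \<Rightarrow> 'n \<Rightarrow> ('n list \<Rightarrow> 'n list \<Rightarrow> 'k) \<Rightarrow> 'n list \<Rightarrow> 'n list \<Rightarrow> 'k" where
  "gen_op k l X u' u = dual.up k (\<lambda>z'. up l (X z') u) u' -
     r (Suc (length u)) * dual.down k (\<lambda>z'. down l (X z') u) u'"

lemma gen_op_alt: "gen_op k l X u' u = up l (\<lambda>z. dual.up k (\<lambda>z'. X z' z) u') u -
     r (Suc (length u)) * down l (\<lambda>z. dual.down k (\<lambda>z'. X z' z) u') u"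
  by (simp add: gen_op_def up_linear_functional[OF dual.linear_functional_up] down_linear_functional[OF dual.linear_functional_down])

definition balanced :: "('n list \<Rightarrow> 'n list \<Rightarrow> 'k) \<Rightarrow> bool" where
  "balanced X \<longleftrightarrow> (\<forall>u' u. length u' \<noteq> length u \<longrightarrow> X u' u = 0)"

definition bi_capfree :: "('n list \<Rightarrow> 'n list \<Rightarrow> 'k) \<Rightarrow> bool" where
  "bi_capfree X \<longleftrightarrow> balanced X \<and> (\<forall>u'. capfree (X u')) \<and> (\<forall>u. dual.capfree (\<lambda>u'. X u' u))"

lemma balanced_down: "balanced X \<Longrightarrow> length u' \<noteq> length u \<Longrightarrow> dual.down k (\<lambda>z'. down l (X z') u) u' = 0"
  by (simp add: gdown_def dual.gdown_def balanced_def)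

lemma balanced_up:
  assumes "balanced X" "length u' \<noteq> length u"
  shows "dual.up k (\<lambda>z'. up l (X z') u) u' = 0"
proof -
  have "dual.up k (\<lambda>z'. up l (X z') u) u' = dual.up k (\<lambda>z'. 0) u'"
  proof (rule dual.up_cong_length)
    fix z' :: "'n list" assume z': "Suc (length z') = length u'"
    have "up l (X z') u = up l (\<lambda>_. 0) u"
      by (rule up_cong_length) (use assms z' in \<open>auto simp: balanced_def\<close>)
    then show "up l (X z') u = 0" by simp
  qed
  then show ?thesis by simp
qed

lemma balanced_gen_op: "balanced X \<Longrightarrow> balanced (gen_op k l X)"
  unfolding balanced_def[of "gen_op k l X"] by (simp add: gen_op_def balanced_up balanced_down)

lemma bi_capfree_gen_op:
  assumes "bi_capfree X" shows "bi_capfree (gen_op k l X)"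
proof -
  have X: "balanced X" "\<And>u'. capfree (X u')" "\<And>u. dual.capfree (\<lambda>u'. X u' u)"
    using assms by (auto simp: bi_capfree_def)
  have 1: "capfree (gen_op k l X u')" for u'
  proof -
    have "capfree (\<lambda>u. dual.up k (\<lambda>z'. up l (X z') u) u')"
      by (rule capfree_linear_functional[OF dual.linear_functional_up]) (rule capfree_up[OF X(2)])
    moreover have "capfree (\<lambda>u. r (Suc (length u)) * dual.down k (\<lambda>z'. down l (X z') u) u')"
      by (rule capfree_weight[of _ "\<lambda>j. r (Suc j)"], rule capfree_linear_functional[OF dual.linear_functional_down])
         (rule capfree_down[OF X(2)])
    ultimately show ?thesis unfolding gen_op_def[abs_def] by (rule capfree_diff)
  qed
  have 2: "dual.capfree (\<lambda>u'. gen_op k l X u' u)" for u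
  proof -
    have "dual.capfree (\<lambda>u'. up l (\<lambda>z. dual.up k (\<lambda>z'. X z' z) u') u)"
      by (rule dual.capfree_linear_functional[OF linear_functional_up]) (rule dual.capfree_up[OF X(3)])
    moreover have "dual.capfree (\<lambda>u'. r (Suc (length u)) * down l (\<lambda>z. dual.down k (\<lambda>z'. X z' z) u') u)"
      by (rule dual.capfree_cmult, rule dual.capfree_linear_functional[OF linear_functional_down]) (rule dual.capfree_down[OF X(3)])
    ultimately show ?thesis unfolding gen_op_alt by (rule dual.capfree_diff)
  qed
  show ?thesis unfolding bi_capfree_def using 1 2 balanced_gen_op[OF X(1)] by blast
qed

lemma gen_op_gen_op:
  "gen_op a s (gen_op b t X) u' u =
     dual.up a (dual.up b (\<lambda>y. up s (up t (X y)) u)) u'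
     - r (length u) * dual.up a (dual.down b (\<lambda>y. up s (down t (X y)) u)) u'
     - r (Suc (length u)) * dual.down a (dual.up b (\<lambda>y. down s (up t (X y)) u)) u'
     + r (Suc (length u)) * r (Suc (Suc (length u))) * dual.down a (dual.down b (\<lambda>y. down s (down t (X y)) u)) u'"
proof -
  have 1: "up s (gen_op b t X z') u = dual.up b (\<lambda>y. up s (up t (X y)) u) z'
      - r (length u) * dual.down b (\<lambda>y. up s (down t (X y)) u) z'" for z'
  proof -
    have "up s (\<lambda>z. r (Suc (length z)) * dual.down b (\<lambda>y. down t (X y) z) z') u =
        r (length u) * up s (\<lambda>z. dual.down b (\<lambda>y. down t (X y) z) z') u"
      using up_weight[of s "\<lambda>j. r (Suc j)" "\<lambda>z. dual.down b (\<lambda>y. down t (X y) z) z'" u] by (cases u) simp_all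
    then show ?thesis
      by (simp add: gen_op_def[abs_def] up_diff up_linear_functional[OF dual.linear_functional_up] up_linear_functional[OF dual.linear_functional_down])
  qed
  have 2: "down s (gen_op b t X z') u = dual.up b (\<lambda>y. down s (up t (X y)) u) z'
      - r (Suc (Suc (length u))) * dual.down b (\<lambda>y. down s (down t (X y)) u) z'" for z'
    using down_weight[of s "\<lambda>j. r (Suc j)" "\<lambda>z. dual.down b (\<lambda>y. down t (X y) z) z'" u]
    by (simp add: gen_op_def[abs_def] down_diff down_linear_functional[OF dual.linear_functional_up] down_linear_functional[OF dual.linear_functional_down])
  show ?thesis
    unfolding gen_op_def[of a s] 1 2 dual.up_diff dual.down_diff dual.up_cmult dual.down_cmult
    by (simp add: algebra_simps)
qed

text \<open>
  The relation \<open>a E\<^sup>-\<^sup>1 a\<^sup>t = E\<^sup>-\<^sup>1\<close> holds for these operators. Of the four composites of raising and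
  lowering operators, contraction with \<open>\<omega>\<close> on the column side kills two, and the remaining two
  combine to a multiple of the identity on the row side by \<open>down_up\<close> for the dual form.
\<close>

lemma gen_op_omega:
  assumes "bi_capfree X"
  shows "(\<Sum>s\<in>UNIV. \<Sum>t\<in>UNIV. \<omega> s t * gen_op a s (gen_op b t X) u' u) = \<omega> a b * X u' u"
proof -
  have X: "balanced X" "\<And>u'. capfree (X u')" using assms by (auto simp: bi_capfree_def)
  let ?n = "length u"
  have L: "linear_functional (\<lambda>f. dual.up a (dual.up b f) u')" "linear_functional (\<lambda>f. dual.up a (dual.down b f) u')"
    "linear_functional (\<lambda>f. dual.down a (dual.up b f) u')" "linear_functional (\<lambda>f. dual.down a (dual.down b f) u')"
    by (simp_all add: linear_functional_def dual.up_add dual.up_cmult dual.down_add dual.down_cmult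
        dual.up_add[abs_def] dual.up_cmult[abs_def] dual.down_add[abs_def] dual.down_cmult[abs_def])
  have S: "(\<Sum>s\<in>UNIV. \<Sum>t\<in>UNIV. \<omega> s t * L (F s t)) = L (\<lambda>y. \<Sum>s\<in>UNIV. \<Sum>t\<in>UNIV. \<omega> s t * F s t y)"
    if "linear_functional L" for L and F :: "'n \<Rightarrow> 'n \<Rightarrow> 'n list \<Rightarrow> 'k"
    using linear_functional_sum[OF that, where A=UNIV and a="\<lambda>_. 1" and f="\<lambda>s y. \<Sum>t\<in>UNIV. \<omega> s t * F s t y"]
    by (simp add: linear_functional_sum[OF that])
  let ?L2 = "dual.up a (dual.down b (\<lambda>y. X y u)) u'"
  have "(\<Sum>s\<in>UNIV. \<Sum>t\<in>UNIV. \<omega> s t * gen_op a s (gen_op b t X) u' u) =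
     (\<Sum>s\<in>UNIV. \<Sum>t\<in>UNIV. \<omega> s t * dual.up a (dual.up b (\<lambda>y. up s (up t (X y)) u)) u')
     - r ?n * (\<Sum>s\<in>UNIV. \<Sum>t\<in>UNIV. \<omega> s t * dual.up a (dual.down b (\<lambda>y. up s (down t (X y)) u)) u')
     - r (Suc ?n) * (\<Sum>s\<in>UNIV. \<Sum>t\<in>UNIV. \<omega> s t * dual.down a (dual.up b (\<lambda>y. down s (up t (X y)) u)) u')
     + r (Suc ?n) * r (Suc (Suc ?n)) *
        (\<Sum>s\<in>UNIV. \<Sum>t\<in>UNIV. \<omega> s t * dual.down a (dual.down b (\<lambda>y. down s (down t (X y)) u)) u')"
    unfolding gen_op_gen_op by (simp only: distrib_left right_diff_distrib sum.distrib sum_subtractf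
        sum_distrib_left mult.left_commute[of "\<omega> _ _" "r _"] mult.assoc)
  also have "\<dots> = - r ?n * ?L2 - r (Suc ?n) * (\<kappa> ?n * dual.down a (dual.up b (\<lambda>y. X y u)) u')"
    unfolding S[OF L(1)] S[OF L(2)] S[OF L(3)] S[OF L(4)] up_up_omega[OF X(2)] up_down_omega[OF X(2)]
      down_up_omega[OF X(2)] down_down_omega[OF X(2)]
    using linear_functional_zero[OF L(1)] linear_functional_zero[OF L(4)]
    by (cases u) (simp_all add: dual.up_cmult[abs_def] dual.down_cmult)
  also have "\<dots> = - r ?n * ?L2 + dual.down a (dual.up b (\<lambda>y. X y u)) u'"
    by (simp add: r_kappa flip: mult.assoc)
  also have "\<dots> = \<omega> a b * X u' u + (r (length u') - r ?n) * ?L2"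
    by (simp add: dual.down_up algebra_simps)
  also have "(r (length u') - r ?n) * ?L2 = 0"
  proof (cases "length u' = ?n")
    case False
    have "?L2 = dual.up a (\<lambda>_. 0) u'"
      by (rule dual.up_cong_length) (use False X(1) in \<open>auto simp: dual.gdown_def balanced_def\<close>)
    then show ?thesis by simp
  qed simp
  finally show ?thesis by simp
qed

end

context quantum_form
begin

interpretation dual: quantum_form \<omega> \<beta> c by (rule dual)

text \<open>
  Exchanging rows and columns exchanges \<open>\<beta>\<close> and \<open>\<omega>\<close>. This turns the second relation of \<open>\<B>(E)\<close> into
  the first one.
\<close>

lemma gen_op_transpose:
  assumes "balanced X"
  shows "dual.gen_op l k (\<lambda>z z'. X z' z) u u' = gen_op k l X u' u"
proof (cases "length u' = length u")
  case True
  then show ?thesis by (simp add: gen_op_alt dual.gen_op_def)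
next
  case False
  then show ?thesis using balanced_down[OF assms False, of k l]
    by (simp add: gen_op_alt dual.gen_op_def down_linear_functional[OF dual.linear_functional_down])
qed

lemma gen_op_beta:
  assumes X: "bi_capfree X"
  shows "(\<Sum>s\<in>UNIV. \<Sum>t\<in>UNIV. \<beta> s t * gen_op s a (gen_op t b X) u' u) = \<beta> a b * X u' u"
proof -
  have b: "balanced X" using X by (simp add: bi_capfree_def)
  have "dual.bi_capfree (\<lambda>z z'. X z' z)"
    using X by (auto simp: bi_capfree_def dual.bi_capfree_def balanced_def dual.balanced_def)
  note o = dual.gen_op_omega[OF this, of a b u u']
  have "dual.gen_op b t (\<lambda>z z'. X z' z) = (\<lambda>z z'. gen_op t b X z' z)" for t
    by (simp add: fun_eq_iff gen_op_transpose[OF b])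
  with o show ?thesis
    by (simp add: gen_op_transpose[OF balanced_gen_op[OF b]])
qed

lemma gen_op_lin: "gen_op k l (\<lambda>u' u. \<Sum>i\<in>A. a i * X i u' u) u' u = (\<Sum>i\<in>A. a i * gen_op k l (X i) u' u)"
  unfolding gen_op_def up_lin down_lin dual.up_lin dual.down_lin
  by (simp add: right_diff_distrib sum_subtractf sum_distrib_left mult.left_commute)

lemma gen_op_product: "gen_op k l (\<lambda>u' u. f u' * g u) u' u =
    dual.up k f u' * up l g u - r (Suc (length u)) * (dual.down k f u' * down l g u)"
proof -
  have "dual.up k (\<lambda>z'. f z' * up l g u) u' = dual.up k f u' * up l g u"
    using dual.up_cmult[of k "up l g u" f u'] by (simp add: mult.commute)
  moreover have "dual.down k (\<lambda>z'. f z' * down l g u) u' = dual.down k f u' * down l g u"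
    using dual.down_cmult[of k "down l g u" f u'] by (simp add: mult.commute)
  ultimately show ?thesis by (simp add: gen_op_def up_cmult down_cmult)
qed

text \<open>
  The result of applying a word in the generators to the vacuum. As a function of the word, each entry
  is a functional on the free algebra; these functionals give a Peter-Weyl decomposition.
\<close>

primrec pw_coef :: "('n \<times> 'n) list \<Rightarrow> 'n list \<Rightarrow> 'n list \<Rightarrow> 'k" where
  "pw_coef [] = (\<lambda>u' u. if u' = [] \<and> u = [] then 1 else 0)"
| "pw_coef (x # b) = gen_op (fst x) (snd x) (pw_coef b)"

lemma bi_capfree_pw_coef: "bi_capfree (pw_coef b)"
proof (induction b)
  case Nil
  show ?case by (auto simp: bi_capfree_def balanced_def capfree_def dual.capfree_def)
qed (simp add: bi_capfree_gen_op)

lemma pw_coef_balanced: "length u' \<noteq> length u \<Longrightarrow> pw_coef b u' u = 0"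
  using bi_capfree_pw_coef[of b] by (simp add: bi_capfree_def balanced_def)

lemma pw_coef_support: "length u > length b \<Longrightarrow> pw_coef b u' u = 0"
proof (induction b arbitrary: u' u)
  case (Cons x b)
  have "up l (pw_coef b z') u = 0" for l z'
    by (rule up_support[of "length b"]) (use Cons in auto)
  moreover have "down l (pw_coef b z') u = 0" for l z'
    by (rule down_support[of "length b"]) (use Cons in auto)
  ultimately show ?case by (simp add: gen_op_def)
qed auto

lemma first_cut:
  assumes "capfree y"
  shows up_first_cut: "(\<Sum>a\<in>UNIV. up a (\<lambda>u. (if length u = j then 1 else 0) * y (a # u)) u) =
      (if length u = Suc j then y u else 0)"
    and down_first_cut: "(\<Sum>a\<in>UNIV. down a (\<lambda>u. (if length u = j then 1 else 0) * y (a # u)) u) = 0"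
proof -
  let ?g = "\<lambda>n. if n = j then 1 else (0::'k)"
  show "(\<Sum>a\<in>UNIV. up a (\<lambda>u. ?g (length u) * y (a # u)) u) = (if length u = Suc j then y u else 0)"
    unfolding up_weight[where g = ?g] sum_distrib_left[symmetric] up_first[OF assms] by (cases u) auto
  show "(\<Sum>a\<in>UNIV. down a (\<lambda>u. ?g (length u) * y (a # u)) u) = 0"
    unfolding down_weight[where g = ?g] sum_distrib_left[symmetric] cap_first[OF assms] by simp
qed

text \<open>
  The functional with indices \<open>u'\<close>, \<open>u\<close> sees of a capfree column vector \<open>y\<close> only its entry at \<open>u\<close>, and of
  the row index only the projection to capfree tensors. This makes the operators on \<open>K\<^sub>j\<close> below have
  rank one.
\<close>

lemma pw_coef_pair:
  assumes "capfree y"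
  shows "(\<Sum>w\<in>words (length v). y w * pw_coef (zip v w) u' u) = (if length u = length v then y u else 0) * dual.nf 0 v u'"
  using assms
proof (induction v arbitrary: y u' u)
  case (Cons x v)
  let ?m = "length v"
  let ?cut = "\<lambda>a u. (if length u = ?m then 1 else 0) * y (a # u)"
  have "(\<Sum>w\<in>words (length (x # v)). y w * pw_coef (zip (x # v) w) u' u) =
      (\<Sum>a\<in>UNIV. gen_op x a (\<lambda>z' z. \<Sum>w\<in>words ?m. y (a # w) * pw_coef (zip v w) z' z) u' u)"
    by (simp add: sum_words_Suc gen_op_lin)
  also have "(\<lambda>a z' z. \<Sum>w\<in>words ?m. y (a # w) * pw_coef (zip v w) z' z) = (\<lambda>a z' z. dual.nf 0 v z' * ?cut a z)"
    using Cons.IH[OF capfree_tail[OF Cons.prems]] by (auto simp: fun_eq_iff)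
  also have "(\<Sum>a\<in>UNIV. gen_op x a ((\<lambda>a z' z. dual.nf 0 v z' * ?cut a z) a) u' u) =
      (\<Sum>a\<in>UNIV. dual.up x (dual.nf 0 v) u' * up a (?cut a) u) -
      r (Suc (length u)) * (\<Sum>a\<in>UNIV. dual.down x (dual.nf 0 v) u' * down a (?cut a) u)"
    by (simp only: gen_op_product sum_subtractf sum_distrib_left)
  also have "\<dots> = dual.up x (dual.nf 0 v) u' * (if length u = Suc ?m then y u else 0)"
    unfolding sum_distrib_left[symmetric] up_first_cut[OF Cons.prems] down_first_cut[OF Cons.prems] by simp
  finally show ?case by (simp add: dual.act_0 mult.commute)
qed simp

text \<open>
  The raising part of \<open>gen_op k l\<close> has, by \<open>up_trace\<close> applied on both sides, the trace of \<open>X\<close> for \<open>k = l\<close>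
  plus a term that is cancelled exactly by the lowering part.
\<close>

lemma gen_op_trace:
  assumes X: "bi_capfree X" and supp: "\<And>u' u. length u > N \<Longrightarrow> X u' u = 0"
  shows "(\<Sum>u\<in>words_le (Suc N). gen_op k l X u u) = (if k = l then \<Sum>u\<in>words_le N. X u u else 0)"
proof -
  have bal: "balanced X" and cap: "\<And>u'. capfree (X u')" "\<And>u. dual.capfree (\<lambda>u'. X u' u)"
    using X by (auto simp: bi_capfree_def)
  have supp': "X u' u = 0" if "length u' > N" for u' u
    using supp[of u u'] bal that by (cases "length u' = length u") (auto simp: balanced_def)
  let ?Z = "\<lambda>z' z. r (Suc (length z')) * dual.down k (\<lambda>y. X y z) z'"
  have "(\<Sum>u\<in>words_le (Suc N). up l (\<lambda>z. dual.up k (\<lambda>z'. X z' z) u) u) =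
      (\<Sum>z\<in>words_le N. dual.up k (\<lambda>z'. X z' z) (l # z))"
    by (rule up_trace) (simp_all add: cofree_dual dual.capfree_up[OF cap(2)] supp)
  also have "\<dots> = (\<Sum>z\<in>words_le N. (if l = k then X z z else 0) + (\<Sum>d\<in>UNIV. \<beta> l d * dual.up d (\<lambda>z'. ?Z z' z) z))"
  proof (rule sum.cong[OF refl])
    fix z :: "'n list"
    have "r (length z) * dual.up d (dual.down k (\<lambda>z'. X z' z)) z = dual.up d (\<lambda>z'. ?Z z' z) z" for d
      using dual.up_weight[of d "\<lambda>j. r (Suc j)" "dual.down k (\<lambda>z'. X z' z)" z] by (cases z) simp_all
    then show "dual.up k (\<lambda>z'. X z' z) (l # z) =
        (if l = k then X z z else 0) + (\<Sum>d\<in>UNIV. \<beta> l d * dual.up d (\<lambda>z'. ?Z z' z) z)"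
      by (simp add: sum_distrib_left mult.left_commute[of "r _"])
  qed
  also have "\<dots> = (if k = l then \<Sum>u\<in>words_le N. X u u else 0) +
      (\<Sum>d\<in>UNIV. \<beta> l d * (\<Sum>z\<in>words_le N. dual.up d (\<lambda>z'. ?Z z' z) z))"
    by (auto simp: sum.distrib sum_distrib_left intro: sum.swap)
  also have "(\<Sum>d\<in>UNIV. \<beta> l d * (\<Sum>z\<in>words_le N. dual.up d (\<lambda>z'. ?Z z' z) z)) =
      (\<Sum>d\<in>UNIV. \<beta> l d * (\<Sum>z\<in>words_le N. ?Z z (d # z)))"
  proof (rule sum.cong[OF refl])
    fix d
    have "(\<Sum>z\<in>words_le N. dual.up d (\<lambda>z'. ?Z z' z) z) = (\<Sum>z\<in>words_le (Suc N). dual.up d (\<lambda>z'. ?Z z' z) z)"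
      by (rule sum.mono_neutral_left) (auto simp: supp)
    also have "\<dots> = (\<Sum>z\<in>words_le N. ?Z z (d # z))"
    proof (rule dual.up_trace)
      show "dual.cofree (?Z z')" for z'
        unfolding dual_cofree by (rule capfree_cmult, rule capfree_linear_functional[OF dual.linear_functional_down cap(1)])
      show "?Z z' z = 0" if "length z' > N" for z' z
        using that by (simp add: dual.gdown_def supp')
    qed
    finally show "\<beta> l d * (\<Sum>z\<in>words_le N. dual.up d (\<lambda>z'. ?Z z' z) z) = \<beta> l d * (\<Sum>z\<in>words_le N. ?Z z (d # z))"
      by (rule arg_cong)
  qed
  also have "\<dots> = (\<Sum>u\<in>words_le N. r (Suc (length u)) * down l (\<lambda>z. dual.down k (\<lambda>z'. X z' z) u) u)"
    unfolding gdown_def[of _ l] sum_distrib_left by (subst sum.swap) (simp only: mult.left_commute)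
  also have "\<dots> = (\<Sum>u\<in>words_le (Suc N). r (Suc (length u)) * down l (\<lambda>z. dual.down k (\<lambda>z'. X z' z) u) u)"
    by (rule sum.mono_neutral_left) (auto simp: gdown_def dual.gdown_def supp)
  finally show ?thesis
    unfolding gen_op_alt sum_subtractf by simp
qed

lemma pw_coef_trace:
  assumes "N \<ge> length b"
  shows "(\<Sum>u\<in>words_le N. pw_coef b u u) = (if map fst b = map snd b then 1 else 0)"
proof -
  have "(\<Sum>u\<in>words_le (length b). pw_coef b u u) = (if map fst b = map snd b then 1 else 0)"
    by (induction b) (simp_all add: gen_op_trace[OF bi_capfree_pw_coef] pw_coef_support)
  moreover have "(\<Sum>u\<in>words_le (length b). pw_coef b u u) = (\<Sum>u\<in>words_le N. pw_coef b u u)"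
    by (rule sum.mono_neutral_left) (use assms in \<open>auto simp: pw_coef_support\<close>)
  ultimately show ?thesis by simp
qed

subsection \<open>Compatibility with the matrix of generators\<close>

lemma gup_scl_sum: "gup scl v (\<lambda>u. \<Sum>i\<in>A. Y i u) w = (\<Sum>i\<in>A. gup scl v (Y i :: _ \<Rightarrow> 'x \<Rightarrow>\<^sub>0 'k) w)"
  and gdown_scl_sum: "gdown scl v (\<lambda>u. \<Sum>i\<in>A. Y i u) w = (\<Sum>i\<in>A. gdown scl v (Y i) w)"
proof -
  have d: "gdown scl v (\<lambda>u. \<Sum>i\<in>A. Y i u) w = (\<Sum>i\<in>A. gdown scl v (Y i) w)" for v w and Y :: "'a \<Rightarrow> _ \<Rightarrow> 'x \<Rightarrow>\<^sub>0 'k"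
    unfolding gdown_def scl_sum by (rule sum.swap)
  show "gdown scl v (\<lambda>u. \<Sum>i\<in>A. Y i u) w = (\<Sum>i\<in>A. gdown scl v (Y i) w)" by (rule d)
  show "gup scl v (\<lambda>u. \<Sum>i\<in>A. Y i u) w = (\<Sum>i\<in>A. gup scl v (Y i) w)"
  proof (induction w arbitrary: v Y)
    case (Cons b w)
    have d': "gdown scl v (\<lambda>u. \<Sum>i\<in>A. Y i u) = (\<lambda>w. \<Sum>i\<in>A. gdown scl v (Y i) w)"
      by (simp add: fun_eq_iff d)
    have "(\<Sum>a\<in>UNIV. scl (\<omega> b a) (\<Sum>i\<in>A. gup scl a (gdown scl v (Y i)) w)) =
        (\<Sum>i\<in>A. \<Sum>a\<in>UNIV. scl (\<omega> b a) (gup scl a (gdown scl v (Y i)) w))"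
      unfolding scl_sum by (rule sum.swap)
    then show ?case
      by (cases "b = v") (simp_all add: d' Cons.IH sum.distrib scl_sum)
  qed simp
qed

lemma gup_scl_diff: "gup scl v (\<lambda>u. Y u - Z u) w = gup scl v Y w - gup scl v (Z :: _ \<Rightarrow> 'x \<Rightarrow>\<^sub>0 'k) w"
  and gdown_scl_diff: "gdown scl v (\<lambda>u. Y u - Z u) w = gdown scl v Y w - gdown scl v Z w"
  using gup_scl_sum[of v "\<lambda>i u. if i then Y u - Z u else Z u" UNIV w]
    gdown_scl_sum[of v "\<lambda>i u. if i then Y u - Z u else Z u" UNIV w]
  by (simp_all add: UNIV_bool algebra_simps)

lemma gup_scl_apply: "scl (up v f w) p = gup scl v (\<lambda>u. scl (f u) p) w"
  and gdown_scl_apply: "scl (down v f w) p = gdown scl v (\<lambda>u. scl (f u) p) w"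
  by (rule gup_hom' gdown_hom; simp add: scl_add_left)+

lemma gup_scl_mult: "p * gup scl v Y w = gup scl v (\<lambda>u. p * Y u) w"
  and gdown_scl_mult: "p * gdown scl v Y w = gdown scl v (\<lambda>u. (p :: 'm::monoid_add \<Rightarrow>\<^sub>0 'k) * Y u) w"
  by (rule gup_hom' gdown_hom; simp add: distrib_left scl_mult_right)+

context
  fixes J :: "(('n \<times> 'n) list \<Rightarrow>\<^sub>0 'k) set"
  assumes J: "two_sided_ideal J"
begin

lemma gdown_in_J: "(\<And>u. Y u \<in> J) \<Longrightarrow> gdown scl v Y w \<in> J"
  unfolding gdown_def by (intro tidealD(7)[OF J] two_sided_ideal_scl[OF J])

lemma gup_in_J: "(\<And>u. Y u \<in> J) \<Longrightarrow> gup scl v Y w \<in> J"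
proof (induction w arbitrary: v Y)
  case (Cons b w)
  have "gup scl a (gdown scl v Y) w \<in> J" for a by (rule Cons.IH) (rule gdown_in_J[OF Cons.prems])
  then have "scl (r (length w)) (\<Sum>a\<in>UNIV. scl (\<omega> b a) (gup scl a (gdown scl v Y) w)) \<in> J"
    by (intro tidealD(7)[OF J] two_sided_ideal_scl[OF J])
  then show ?case using Cons.prems tidealD(1,2)[OF J] by auto
qed (simp add: tidealD[OF J])

end

end

context quantum_form
begin

interpretation dual: quantum_form \<omega> \<beta> c by (rule dual)

context
  fixes J :: "(('n \<times> 'n) list \<Rightarrow>\<^sub>0 'k) set"
  assumes J: "two_sided_ideal J"
    and sigma: "\<And>k l'. (\<Sum>s\<in>UNIV. \<Sum>l\<in>UNIV. scl (\<omega> s l) (var (k, s) * var (l', l))) - scl (\<omega> k l') 1 \<in> J"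
    and rho: "\<And>s v. (\<Sum>t\<in>UNIV. \<Sum>u\<in>UNIV. scl (\<beta> t u) (var (t, s) * var (u, v))) - scl (\<beta> s v) 1 \<in> J"
begin

lemma J_trans: "x - y \<in> J \<Longrightarrow> y - z \<in> J \<Longrightarrow> x - z \<in> J"
  using tidealD(2)[OF J, of "x - y" "y - z"] by simp

lemma J_sym: "x - y \<in> J \<Longrightarrow> y - x \<in> J"
  using tidealD(5)[OF J, of "x - y"] by simp

lemma J_sum: "(\<And>i. i \<in> A \<Longrightarrow> f i - g i \<in> J) \<Longrightarrow> sum f A - sum g A \<in> J"
  unfolding sum_subtractf[symmetric] by (rule tidealD(7)[OF J])

lemma J_scl: "x - y \<in> J \<Longrightarrow> scl a x - scl a y \<in> J"
  unfolding scl_minus[symmetric] by (rule two_sided_ideal_scl[OF J])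

lemma J_left: "x - y \<in> J \<Longrightarrow> p * x - p * y \<in> J"
  unfolding right_diff_distrib[symmetric] by (rule tidealD(3)[OF J])

lemma J_right: "x - y \<in> J \<Longrightarrow> x * p - y * p \<in> J"
  unfolding left_diff_distrib[symmetric] by (rule tidealD(4)[OF J])

text \<open>
  Modulo the relation \<open>a E\<^sup>-\<^sup>1 a\<^sup>t = E\<^sup>-\<^sup>1\<close> the operators \<open>down\<close> for the dual form commute with
  multiplication by tensor powers of \<open>a\<close>, the vector \<open>s\<close> being transformed by \<open>a\<close> as well.
\<close>

lemma down_intertwine:
  "(\<Sum>s\<in>UNIV. var (k, s) * dual.gdown scl s (row_a f) w) - row_a (dual.down k f) w \<in> J"
proof -
  have "(\<Sum>s\<in>UNIV. var (k, s) * dual.gdown scl s (row_a f) w) =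
      (\<Sum>s\<in>UNIV. \<Sum>l\<in>UNIV. \<Sum>l'\<in>UNIV. scl (\<omega> s l) (var (k, s) * var (l', l)) * row_a (\<lambda>w'. f (l' # w')) w)"
    by (simp add: dual.gdown_def row_a_Cons sum_distrib_left scl_sum scl_mult_right[symmetric] scl_mult_left[symmetric] mult.assoc)
  also have "\<dots> = (\<Sum>s\<in>UNIV. \<Sum>l'\<in>UNIV. \<Sum>l\<in>UNIV. scl (\<omega> s l) (var (k, s) * var (l', l)) * row_a (\<lambda>w'. f (l' # w')) w)"
    by (intro sum.cong refl sum.swap)
  also have "\<dots> = (\<Sum>l'\<in>UNIV. \<Sum>s\<in>UNIV. \<Sum>l\<in>UNIV. scl (\<omega> s l) (var (k, s) * var (l', l)) * row_a (\<lambda>w'. f (l' # w')) w)"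
    by (rule sum.swap)
  also have "\<dots> = (\<Sum>l'\<in>UNIV. (\<Sum>s\<in>UNIV. \<Sum>l\<in>UNIV. scl (\<omega> s l) (var (k, s) * var (l', l))) * row_a (\<lambda>w'. f (l' # w')) w)"
    by (simp add: sum_distrib_right)
  finally have 1: "(\<Sum>s\<in>UNIV. var (k, s) * dual.gdown scl s (row_a f) w) = \<dots>" .
  have 2: "row_a (dual.down k f) w = (\<Sum>l'\<in>UNIV. scl (\<omega> k l') 1 * row_a (\<lambda>w'. f (l' # w')) w)"
  proof -
    have "row_a (dual.down k f) w = (\<Sum>w'\<in>words (length w). \<Sum>l'\<in>UNIV. scl (\<omega> k l' * f (l' # w')) (a_word w' w))"
      by (simp add: row_a_def dual.gdown_def scl_sum_left)
    also have "\<dots> = (\<Sum>l'\<in>UNIV. \<Sum>w'\<in>words (length w). scl (\<omega> k l' * f (l' # w')) (a_word w' w))"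
      by (rule sum.swap)
    finally show ?thesis by (simp add: row_a_def scl_mult_left[symmetric] scl_sum)
  qed
  show ?thesis unfolding 1 2 by (intro J_sum J_right sigma)
qed

text \<open>
  The correction term of \<open>up\<close> involves \<open>down\<close> and a contraction with \<open>\<beta>\<close>; the latter is invariant by
  the relation \<open>a\<^sup>t E a = E\<close>.
\<close>

lemma up_intertwine:
  "(\<Sum>s\<in>UNIV. var (k, s) * dual.gup scl s (row_a f) w) - row_a (dual.up k f) w \<in> J"
proof (induction w arbitrary: k f)
  case Nil
  show ?case by (simp add: row_a_def tidealD[OF J])
next
  case (Cons b w)
  let ?g = "dual.down k f"
  let ?T = "\<Sum>s\<in>UNIV. scl (\<beta> b s) (dual.gup scl s (row_a ?g) w)"
  have sc: "(\<Sum>s\<in>UNIV. var (k, s) * dual.gup scl d (dual.gdown scl s (row_a f)) w) - dual.gup scl d (row_a ?g) w \<in> J" for d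
  proof -
    have "(\<Sum>s\<in>UNIV. var (k, s) * dual.gup scl d (dual.gdown scl s (row_a f)) w) =
        dual.gup scl d (\<lambda>z. \<Sum>s\<in>UNIV. var (k, s) * dual.gdown scl s (row_a f) z) w"
      by (simp add: dual.gup_scl_mult dual.gup_scl_sum)
    then show ?thesis
      unfolding dual.gup_scl_diff[symmetric] using dual.gup_in_J[OF J down_intertwine]
      by (simp add: dual.gup_scl_diff)
  qed
  have "(\<Sum>s\<in>UNIV. var (k, s) * dual.gup scl s (row_a f) (b # w)) =
      (\<Sum>s\<in>UNIV. var (k, s) * (if b = s then row_a f w else 0)) +
      (\<Sum>s\<in>UNIV. \<Sum>d\<in>UNIV. scl (r (length w)) (scl (\<beta> b d) (var (k, s) * dual.gup scl d (dual.gdown scl s (row_a f)) w)))"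
    by (simp add: distrib_left sum.distrib scl_mult_right[symmetric] sum_distrib_left scl_sum del: scl_scl)
  also have "(\<Sum>s\<in>UNIV. var (k, s) * (if b = s then row_a f w else 0)) = var (k, b) * row_a f w"
    by (simp add: if_distrib[of "\<lambda>x. _ * x"] cong: if_cong)
  also have "(\<Sum>s\<in>UNIV. \<Sum>d\<in>UNIV. scl (r (length w)) (scl (\<beta> b d) (var (k, s) * dual.gup scl d (dual.gdown scl s (row_a f)) w))) =
     scl (r (length w)) (\<Sum>d\<in>UNIV. scl (\<beta> b d) (\<Sum>s\<in>UNIV. var (k, s) * dual.gup scl d (dual.gdown scl s (row_a f)) w))"
    unfolding scl_sum by (rule sum.swap)
  finally have 1: "(\<Sum>s\<in>UNIV. var (k, s) * dual.gup scl s (row_a f) (b # w)) =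
     var (k, b) * row_a f w +
     scl (r (length w)) (\<Sum>d\<in>UNIV. scl (\<beta> b d) (\<Sum>s\<in>UNIV. var (k, s) * dual.gup scl d (dual.gdown scl s (row_a f)) w))" .
  have A: "(\<Sum>s\<in>UNIV. var (k, s) * dual.gup scl s (row_a f) (b # w)) - (var (k, b) * row_a f w + scl (r (length w)) ?T) \<in> J"
    unfolding 1 add_diff_cancel_left by (intro J_scl J_sum sc)
  have "row_a (dual.up k f) (b # w) = (\<Sum>a\<in>UNIV. var (a, b) * ((if a = k then row_a f w else 0) +
      scl (r (length w)) (\<Sum>d\<in>UNIV. scl (\<beta> a d) (row_a (dual.up d ?g) w))))"
  proof -
    have "row_a (\<lambda>w'. dual.up k f (a # w')) w = (if a = k then row_a f w else 0) +
      scl (r (length w)) (\<Sum>d\<in>UNIV. scl (\<beta> a d) (row_a (dual.up d ?g) w))" for a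
    proof -
      have "row_a (\<lambda>w'. dual.up k f (a # w')) w = (\<Sum>w'\<in>words (length w). scl (if a = k then f w' else 0) (a_word w' w) +
        scl (r (length w)) (\<Sum>d\<in>UNIV. scl (\<beta> a d) (scl (dual.up d ?g w') (a_word w' w))))"
        unfolding row_a_def by (intro sum.cong refl) (simp add: scl_add_left scl_sum_left scl_sum sum_distrib_left)
      also have "\<dots> = (\<Sum>w'\<in>words (length w). scl (if a = k then f w' else 0) (a_word w' w)) +
        scl (r (length w)) (\<Sum>w'\<in>words (length w). \<Sum>d\<in>UNIV. scl (\<beta> a d) (scl (dual.up d ?g w') (a_word w' w)))"
        by (simp only: sum.distrib scl_sum)
      also have "(\<Sum>w'\<in>words (length w). \<Sum>d\<in>UNIV. scl (\<beta> a d) (scl (dual.up d ?g w') (a_word w' w))) =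
        (\<Sum>d\<in>UNIV. scl (\<beta> a d) (row_a (dual.up d ?g) w))"
        unfolding row_a_def scl_sum by (rule sum.swap)
      also have "(\<Sum>w'\<in>words (length w). scl (if a = k then f w' else 0) (a_word w' w)) = (if a = k then row_a f w else 0)"
        by (simp add: row_a_def)
      finally show ?thesis .
    qed
    then show ?thesis by (simp add: row_a_Cons)
  qed
  also have "\<dots> = (\<Sum>a\<in>UNIV. var (a, b) * (if a = k then row_a f w else 0)) +
      scl (r (length w)) (\<Sum>a\<in>UNIV. \<Sum>d\<in>UNIV. scl (\<beta> a d) (var (a, b) * row_a (dual.up d ?g) w))"
    by (simp add: distrib_left sum.distrib scl_mult_right[symmetric] sum_distrib_left scl_sum)
  also have "(\<Sum>a\<in>UNIV. var (a, b) * (if a = k then row_a f w else 0)) = var (k, b) * row_a f w"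
    by (simp add: if_distrib[of "\<lambda>x. _ * x"] cong: if_cong)
  finally have 2: "row_a (dual.up k f) (b # w) = var (k, b) * row_a f w +
      scl (r (length w)) (\<Sum>a\<in>UNIV. \<Sum>d\<in>UNIV. scl (\<beta> a d) (var (a, b) * row_a (dual.up d ?g) w))" .
  have "(\<Sum>a\<in>UNIV. \<Sum>d\<in>UNIV. scl (\<beta> a d) (var (a, b) * row_a (dual.up d ?g) w)) -
      (\<Sum>a\<in>UNIV. \<Sum>d\<in>UNIV. scl (\<beta> a d) (var (a, b) * (\<Sum>s\<in>UNIV. var (d, s) * dual.gup scl s (row_a ?g) w))) \<in> J"
    by (intro J_sum J_scl J_left J_sym[OF Cons.IH])
  moreover have "(\<Sum>a\<in>UNIV. \<Sum>d\<in>UNIV. scl (\<beta> a d) (var (a, b) * (\<Sum>s\<in>UNIV. var (d, s) * dual.gup scl s (row_a ?g) w))) - ?T \<in> J"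
  proof -
    have "(\<Sum>a\<in>UNIV. \<Sum>d\<in>UNIV. scl (\<beta> a d) (var (a, b) * (\<Sum>s\<in>UNIV. var (d, s) * dual.gup scl s (row_a ?g) w))) =
        (\<Sum>a\<in>UNIV. \<Sum>d\<in>UNIV. \<Sum>s\<in>UNIV. scl (\<beta> a d) (var (a, b) * var (d, s)) * dual.gup scl s (row_a ?g) w)"
      by (simp add: sum_distrib_left scl_sum scl_mult_left[symmetric] mult.assoc)
    also have "\<dots> = (\<Sum>a\<in>UNIV. \<Sum>s\<in>UNIV. \<Sum>d\<in>UNIV. scl (\<beta> a d) (var (a, b) * var (d, s)) * dual.gup scl s (row_a ?g) w)"
      by (intro sum.cong refl sum.swap)
    also have "\<dots> = (\<Sum>s\<in>UNIV. \<Sum>a\<in>UNIV. \<Sum>d\<in>UNIV. scl (\<beta> a d) (var (a, b) * var (d, s)) * dual.gup scl s (row_a ?g) w)"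
      by (rule sum.swap)
    also have "\<dots> = (\<Sum>s\<in>UNIV. (\<Sum>a\<in>UNIV. \<Sum>d\<in>UNIV. scl (\<beta> a d) (var (a, b) * var (d, s))) * dual.gup scl s (row_a ?g) w)"
      by (simp add: sum_distrib_right)
    finally have 3: "(\<Sum>a\<in>UNIV. \<Sum>d\<in>UNIV. scl (\<beta> a d) (var (a, b) * (\<Sum>s\<in>UNIV. var (d, s) * dual.gup scl s (row_a ?g) w))) = \<dots>" .
    have 4: "?T = (\<Sum>s\<in>UNIV. scl (\<beta> b s) 1 * dual.gup scl s (row_a ?g) w)"
      by (simp add: scl_mult_left[symmetric])
    show ?thesis unfolding 3 4 by (intro J_sum J_right rho)
  qed
  ultimately have "(\<Sum>a\<in>UNIV. \<Sum>d\<in>UNIV. scl (\<beta> a d) (var (a, b) * row_a (dual.up d ?g) w)) - ?T \<in> J"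
    by (rule J_trans)
  then have B: "row_a (dual.up k f) (b # w) - (var (k, b) * row_a f w + scl (r (length w)) ?T) \<in> J"
    unfolding 2 add_diff_cancel_left by (rule J_scl)
  show ?case by (rule J_trans[OF A J_sym[OF B]])
qed

text \<open>
  A form of coinvariance: on the left-hand side the functional with indices \<open>w\<close>, \<open>u\<close> is applied to the
  second factor of the coproduct of a word, on the right-hand side its row index is transformed by the
  matrix of generators.
\<close>

lemma pw_coef_intertwine:
  "(\<Sum>m\<in>words (length b). scl (pw_coef (zip m (map snd b)) w u) (a_word (map fst b) m)) - row_a (\<lambda>w'. pw_coef b w' u) w \<in> J"
proof (induction b arbitrary: w u)
  case Nil
  have "row_a (\<lambda>w'. pw_coef [] w' u) w = (if w = [] \<and> u = [] then 1 else 0)"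
    by (cases "w = []") (auto simp: row_a_def a_word_Nil intro!: sum.neutral)
  then show ?case by (auto simp: a_word_Nil tidealD[OF J])
next
  case (Cons x b)
  obtain p q where x: "x = (p, q)" by (cases x)
  let ?i = "map fst b" and ?j = "map snd b" and ?K = "words (length b)"
  let ?\<Phi> = "\<lambda>w u. \<Sum>m\<in>?K. scl (pw_coef (zip m ?j) w u) (a_word ?i m)"
  have U: "(\<Sum>m\<in>?K. scl (dual.up s (\<lambda>z'. up q (pw_coef (zip m ?j) z') u) w) (a_word ?i m)) =
      dual.gup scl s (\<lambda>z'. gup scl q (\<lambda>z. ?\<Phi> z' z) u) w" for s
    by (simp add: dual.gup_scl_apply gup_scl_apply dual.gup_scl_sum gup_scl_sum)
  have D: "(\<Sum>m\<in>?K. scl (dual.down s (\<lambda>z'. down q (pw_coef (zip m ?j) z') u) w) (a_word ?i m)) =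
      dual.gdown scl s (\<lambda>z'. gdown scl q (\<lambda>z. ?\<Phi> z' z) u) w" for s
    by (simp add: dual.gdown_scl_apply gdown_scl_apply dual.gdown_scl_sum gdown_scl_sum)
  have UF: "gup scl q (\<lambda>z. row_a (\<lambda>w'. pw_coef b w' z) z') u = row_a (\<lambda>w'. up q (pw_coef b w') u) z'" for z'
    by (simp add: row_a_def gup_scl_apply gup_scl_sum)
  have DF: "gdown scl q (\<lambda>z. row_a (\<lambda>w'. pw_coef b w' z) z') u = row_a (\<lambda>w'. down q (pw_coef b w') u) z'" for z'
    by (simp add: row_a_def gdown_scl_apply gdown_scl_sum)
  have u1: "gup scl q (\<lambda>z. ?\<Phi> z' z) u - row_a (\<lambda>w'. up q (pw_coef b w') u) z' \<in> J" for z'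
    unfolding UF[symmetric] gup_scl_diff[symmetric] by (rule gup_in_J[OF J Cons.IH])
  have d1: "gdown scl q (\<lambda>z. ?\<Phi> z' z) u - row_a (\<lambda>w'. down q (pw_coef b w') u) z' \<in> J" for z'
    unfolding DF[symmetric] gdown_scl_diff[symmetric] by (rule gdown_in_J[OF J Cons.IH])
  have u2: "dual.gup scl s (\<lambda>z'. gup scl q (\<lambda>z. ?\<Phi> z' z) u) w - dual.gup scl s (row_a (\<lambda>w'. up q (pw_coef b w') u)) w \<in> J" for s
    unfolding dual.gup_scl_diff[symmetric] by (rule dual.gup_in_J[OF J u1])
  have d2: "dual.gdown scl s (\<lambda>z'. gdown scl q (\<lambda>z. ?\<Phi> z' z) u) w - dual.gdown scl s (row_a (\<lambda>w'. down q (pw_coef b w') u)) w \<in> J" for s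
    unfolding dual.gdown_scl_diff[symmetric] by (rule dual.gdown_in_J[OF J d1])
  let ?A = "\<Sum>s\<in>UNIV. var (p, s) * dual.gup scl s (\<lambda>z'. gup scl q (\<lambda>z. ?\<Phi> z' z) u) w"
  let ?B = "\<Sum>s\<in>UNIV. var (p, s) * dual.gdown scl s (\<lambda>z'. gdown scl q (\<lambda>z. ?\<Phi> z' z) u) w"
  let ?FA = "row_a (dual.up p (\<lambda>w'. up q (pw_coef b w') u)) w"
  let ?FB = "row_a (dual.down p (\<lambda>w'. down q (pw_coef b w') u)) w"
  have A: "?A - ?FA \<in> J" by (rule J_trans[OF J_sum up_intertwine]) (rule J_left[OF u2])
  have B: "?B - ?FB \<in> J" by (rule J_trans[OF J_sum down_intertwine]) (rule J_left[OF d2])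
  have lhs: "(\<Sum>m\<in>words (length (x # b)). scl (pw_coef (zip m (map snd (x # b))) w u) (a_word (map fst (x # b)) m)) =
      ?A - scl (r (Suc (length u))) ?B"
  proof -
    have "(\<Sum>m\<in>words (length (x # b)). scl (pw_coef (zip m (map snd (x # b))) w u) (a_word (map fst (x # b)) m)) =
        (\<Sum>s\<in>UNIV. \<Sum>m\<in>?K. scl (gen_op s q (pw_coef (zip m ?j)) w u) (var (p, s) * a_word ?i m))"
      by (simp add: x sum_words_Suc a_word_Cons)
    also have "\<dots> = (\<Sum>s\<in>UNIV. var (p, s) * (\<Sum>m\<in>?K. scl (gen_op s q (pw_coef (zip m ?j)) w u) (a_word ?i m)))"
      by (simp add: sum_distrib_left scl_mult_right)
    also have "\<dots> = (\<Sum>s\<in>UNIV. var (p, s) * (dual.gup scl s (\<lambda>z'. gup scl q (\<lambda>z. ?\<Phi> z' z) u) w -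
       scl (r (Suc (length u))) (dual.gdown scl s (\<lambda>z'. gdown scl q (\<lambda>z. ?\<Phi> z' z) u) w)))"
    proof -
      have sd: "scl (a - b) y = scl a y - scl b y" for a b and y :: "('n \<times> 'n) list \<Rightarrow>\<^sub>0 'k"
        by (simp add: poly_mapping_eq_iff fun_eq_iff lookup_minus algebra_simps)
      have "(\<Sum>m\<in>?K. scl (gen_op s q (pw_coef (zip m ?j)) w u) (a_word ?i m)) =
        (\<Sum>m\<in>?K. scl (dual.up s (\<lambda>z'. up q (pw_coef (zip m ?j) z') u) w) (a_word ?i m)) -
        scl (r (Suc (length u))) (\<Sum>m\<in>?K. scl (dual.down s (\<lambda>z'. down q (pw_coef (zip m ?j) z') u) w) (a_word ?i m))" for s
        by (simp add: gen_op_def sd sum_subtractf scl_sum)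
      then show ?thesis by (simp only: U D)
    qed
    finally show ?thesis by (simp add: right_diff_distrib sum_subtractf scl_mult_right[symmetric] scl_sum)
  qed
  have rhs: "row_a (\<lambda>w'. pw_coef (x # b) w' u) w = ?FA - scl (r (Suc (length u))) ?FB"
  proof -
    have sd: "scl (a - b) y = scl a y - scl b y" for a b and y :: "('n \<times> 'n) list \<Rightarrow>\<^sub>0 'k"
      by (simp add: poly_mapping_eq_iff fun_eq_iff lookup_minus algebra_simps)
    show ?thesis by (simp add: x row_a_def gen_op_def sd sum_subtractf scl_sum)
  qed
  have "(?A - ?FA) - (scl (r (Suc (length u))) ?B - scl (r (Suc (length u))) ?FB) \<in> J"
    by (rule tidealD(6)[OF J A J_scl[OF B]])
  then show ?case unfolding lhs rhs by (simp add: algebra_simps)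
qed

text \<open>
  A contraction of the column vector \<open>a\<^sup>\<otimes>\<^sup>j y\<close> equals the contraction of \<open>y\<close> modulo \<open>a\<^sup>t E a = E\<close>.
\<close>

lemma cap_col_a:
  assumes y: "capfree y"
  shows "(\<Sum>l\<in>UNIV. \<Sum>m\<in>UNIV. scl (\<beta> l m) (\<Sum>w\<in>words (length v1 + Suc (Suc (length v2))). scl (y w) (a_word (v1 @ l # m # v2) w))) \<in> J"
  using y
proof (induction v1 arbitrary: y)
  case Nil
  let ?y = "\<lambda>a b. \<Sum>w\<in>words (length v2). scl (y (a # b # w)) (a_word v2 w)"
  have "(\<Sum>l\<in>UNIV. \<Sum>m\<in>UNIV. scl (\<beta> l m) (\<Sum>w\<in>words (Suc (Suc (length v2))). scl (y w) (a_word (l # m # v2) w))) =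
      (\<Sum>l\<in>UNIV. \<Sum>m\<in>UNIV. \<Sum>a\<in>UNIV. \<Sum>b\<in>UNIV. scl (\<beta> l m) (var (l, a) * var (m, b)) * ?y a b)"
    by (simp add: sum_words_Suc a_word_Cons scl_sum sum_distrib_left scl_mult_right[symmetric] scl_mult_left[symmetric]
        mult.assoc mult.commute[of "y _"])
  also have "\<dots> = (\<Sum>l\<in>UNIV. \<Sum>a\<in>UNIV. \<Sum>m\<in>UNIV. \<Sum>b\<in>UNIV. scl (\<beta> l m) (var (l, a) * var (m, b)) * ?y a b)"
    by (intro sum.cong refl sum.swap)
  also have "\<dots> = (\<Sum>l\<in>UNIV. \<Sum>a\<in>UNIV. \<Sum>b\<in>UNIV. \<Sum>m\<in>UNIV. scl (\<beta> l m) (var (l, a) * var (m, b)) * ?y a b)"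
    by (intro sum.cong refl sum.swap)
  also have "\<dots> = (\<Sum>a\<in>UNIV. \<Sum>l\<in>UNIV. \<Sum>b\<in>UNIV. \<Sum>m\<in>UNIV. scl (\<beta> l m) (var (l, a) * var (m, b)) * ?y a b)"
    by (rule sum.swap)
  also have "\<dots> = (\<Sum>a\<in>UNIV. \<Sum>b\<in>UNIV. \<Sum>l\<in>UNIV. \<Sum>m\<in>UNIV. scl (\<beta> l m) (var (l, a) * var (m, b)) * ?y a b)"
    by (intro sum.cong refl sum.swap)
  also have "\<dots> = (\<Sum>a\<in>UNIV. \<Sum>b\<in>UNIV. (\<Sum>l\<in>UNIV. \<Sum>m\<in>UNIV. scl (\<beta> l m) (var (l, a) * var (m, b))) * ?y a b)"
    by (simp add: sum_distrib_right)
  finally have 1: "(\<Sum>l\<in>UNIV. \<Sum>m\<in>UNIV. scl (\<beta> l m) (\<Sum>w\<in>words (Suc (Suc (length v2))). scl (y w) (a_word (l # m # v2) w))) = \<dots>" .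
  have "\<dots> - (\<Sum>a\<in>UNIV. \<Sum>b\<in>UNIV. scl (\<beta> a b) 1 * ?y a b) \<in> J"
    by (intro J_sum J_right rho)
  moreover have "(\<Sum>a\<in>UNIV. \<Sum>b\<in>UNIV. scl (\<beta> a b) 1 * ?y a b) = 0"
  proof -
    have "(\<Sum>a\<in>UNIV. \<Sum>b\<in>UNIV. scl (\<beta> a b) 1 * ?y a b) =
        (\<Sum>a\<in>UNIV. \<Sum>b\<in>UNIV. \<Sum>w\<in>words (length v2). scl (\<beta> a b * y (a # b # w)) (a_word v2 w))"
      by (simp add: scl_mult_left[symmetric] scl_sum)
    also have "\<dots> = (\<Sum>a\<in>UNIV. \<Sum>w\<in>words (length v2). \<Sum>b\<in>UNIV. scl (\<beta> a b * y (a # b # w)) (a_word v2 w))"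
      by (intro sum.cong refl sum.swap)
    also have "\<dots> = (\<Sum>w\<in>words (length v2). \<Sum>a\<in>UNIV. \<Sum>b\<in>UNIV. scl (\<beta> a b * y (a # b # w)) (a_word v2 w))"
      by (rule sum.swap)
    also have "\<dots> = (\<Sum>w\<in>words (length v2). scl (\<Sum>a\<in>UNIV. \<Sum>b\<in>UNIV. \<beta> a b * y (a # b # w)) (a_word v2 w))"
      by (simp add: scl_sum_left)
    finally show ?thesis using capfreeD[OF Nil, of "[]"] by simp
  qed
  ultimately show ?case using 1 by simp
next
  case (Cons x v1)
  have "(\<Sum>l\<in>UNIV. \<Sum>m\<in>UNIV. scl (\<beta> l m) (\<Sum>w\<in>words (length (x # v1) + Suc (Suc (length v2))). scl (y w) (a_word ((x # v1) @ l # m # v2) w))) =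
     (\<Sum>l\<in>UNIV. \<Sum>m\<in>UNIV. \<Sum>a\<in>UNIV. var (x, a) * scl (\<beta> l m) (\<Sum>w\<in>words (length v1 + Suc (Suc (length v2))). scl (y (a # w)) (a_word (v1 @ l # m # v2) w)))"
    by (simp add: sum_words_Suc a_word_Cons scl_sum sum_distrib_left scl_mult_right)
  also have "\<dots> = (\<Sum>l\<in>UNIV. \<Sum>a\<in>UNIV. \<Sum>m\<in>UNIV. var (x, a) * scl (\<beta> l m) (\<Sum>w\<in>words (length v1 + Suc (Suc (length v2))). scl (y (a # w)) (a_word (v1 @ l # m # v2) w)))"
    by (intro sum.cong refl sum.swap)
  also have "\<dots> = (\<Sum>a\<in>UNIV. \<Sum>l\<in>UNIV. \<Sum>m\<in>UNIV. var (x, a) * scl (\<beta> l m) (\<Sum>w\<in>words (length v1 + Suc (Suc (length v2))). scl (y (a # w)) (a_word (v1 @ l # m # v2) w)))"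
    by (rule sum.swap)
  also have "\<dots> = (\<Sum>a\<in>UNIV. var (x, a) * (\<Sum>l\<in>UNIV. \<Sum>m\<in>UNIV. scl (\<beta> l m) (\<Sum>w\<in>words (length v1 + Suc (Suc (length v2))). scl (y (a # w)) (a_word (v1 @ l # m # v2) w))))"
    by (simp add: sum_distrib_left)
  also have "\<dots> \<in> J"
    by (intro tidealD(7)[OF J] tidealD(3)[OF J] Cons.IH capfree_tail[OF Cons.prems])
  finally show ?case .
qed

end

end

section \<open>The Hopf algebra and its comodule algebra\<close>

lemma matrix_inv_both:
  assumes "invertible (A :: 'k::field^'n^'n)"
  shows "A ** matrix_inv A = mat 1" "matrix_inv A ** A = mat 1"
  using someI_ex[of "\<lambda>A'. A ** A' = mat 1 \<and> A' ** A = mat 1"] assms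
  by (auto simp: invertible_def matrix_inv_def)

locale inv_matrix =
  fixes E :: "'k::field^'n::finite^'n"
  assumes inv: "invertible E"
begin

abbreviation \<beta> :: "'n \<Rightarrow> 'n \<Rightarrow> 'k" where "\<beta> a b \<equiv> E $ a $ b"
abbreviation \<omega> :: "'n \<Rightarrow> 'n \<Rightarrow> 'k" where "\<omega> a b \<equiv> matrix_inv E $ a $ b"

lemma beta_omega: "(\<Sum>b\<in>UNIV. \<beta> a b * \<omega> b d) = (if a = d then 1 else 0)"
proof -
  have "(E ** matrix_inv E) $ a $ d = (mat 1 :: 'k^'n^'n) $ a $ d"
    using matrix_inv_both[OF inv] by simp
  then show ?thesis by (simp add: matrix_matrix_mult_def mat_def)
qed

lemma omega_beta: "(\<Sum>b\<in>UNIV. \<omega> a b * \<beta> b d) = (if a = d then 1 else 0)"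
proof -
  have "(matrix_inv E ** E) $ a $ d = (mat 1 :: 'k^'n^'n) $ a $ d"
    using matrix_inv_both[OF inv] by simp
  then show ?thesis by (simp add: matrix_matrix_mult_def mat_def)
qed

lemma omega_beta_transposed: "(\<Sum>b\<in>UNIV. \<omega> b a * \<beta> d b) = (if a = d then 1 else 0)"
  using beta_omega[of d a] by (simp add: mult.commute eq_commute)

abbreviation "R \<equiv> B_rels E"
abbreviation "H \<equiv> B_alg E"

lemma H_eq: "H = presented_algebra R" by (simp add: B_alg_def)

text \<open>
  The entries of \<open>a\<^sup>t E a - E\<close> and of \<open>a E\<^sup>-\<^sup>1 a\<^sup>t - E\<^sup>-\<^sup>1\<close>. They generate the same ideal as the relations of
  \<open>\<B>(E)\<close> and each of them contracts two copies of \<open>a\<close> with one form only.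
\<close>

definition \<rho> :: "'n \<Rightarrow> 'n \<Rightarrow> ('n \<times> 'n) list \<Rightarrow>\<^sub>0 'k" where
  "\<rho> s v = (\<Sum>t\<in>UNIV. \<Sum>u\<in>UNIV. scl (\<beta> t u) (var (t, s) * var (u, v))) - scl (\<beta> s v) 1"

definition \<sigma> :: "'n \<Rightarrow> 'n \<Rightarrow> ('n \<times> 'n) list \<Rightarrow>\<^sub>0 'k" where
  "\<sigma> k l' = (\<Sum>s\<in>UNIV. \<Sum>l\<in>UNIV. scl (\<omega> s l) (var (k, s) * var (l', l))) - scl (\<omega> k l') 1"

definition S_gen :: "'n \<times> 'n \<Rightarrow> ('n \<times> 'n) list \<Rightarrow>\<^sub>0 'k" where
  "S_gen x = antipode_matrix E $ fst x $ snd x"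

lemma S_gen_eq: "S_gen (i, j) = (\<Sum>k\<in>UNIV. \<Sum>l\<in>UNIV. scl (\<omega> i l * \<beta> k j) (var (k, l)))"
  by (simp add: S_gen_def antipode_matrix_def matrix_matrix_mult_def map_matrix_def transpose_def gen_matrix_def
      const_mult mult_const sum_distrib_right scl_sum mult.commute)

definition rel_left :: "'n \<Rightarrow> 'n \<Rightarrow> ('n \<times> 'n) list \<Rightarrow>\<^sub>0 'k" where
  "rel_left i j = (\<Sum>m\<in>UNIV. S_gen (i, m) * var (m, j)) - scl (if i = j then 1 else 0) 1"

definition rel_right :: "'n \<Rightarrow> 'n \<Rightarrow> ('n \<times> 'n) list \<Rightarrow>\<^sub>0 'k" where
  "rel_right i j = (\<Sum>m\<in>UNIV. var (i, m) * S_gen (m, j)) - scl (if i = j then 1 else 0) 1"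

lemma R_eq: "R = {rel_left i j | i j. True} \<union> {rel_right i j | i j. True}"
  by (simp add: B_rels_def rel_left_def rel_right_def S_gen_def matrix_matrix_mult_def mat_def gen_matrix_def if_distrib
      cong: if_cong)

lemma S_gen_left: "S_gen (i, j) = (\<Sum>l\<in>UNIV. scl (\<omega> i l) (\<Sum>k\<in>UNIV. scl (\<beta> k j) (var (k, l))))"
  unfolding S_gen_eq by (subst sum.swap) (simp add: scl_sum)

lemma S_gen_right: "S_gen (i, j) = (\<Sum>k\<in>UNIV. scl (\<beta> k j) (\<Sum>l\<in>UNIV. scl (\<omega> i l) (var (k, l))))"
  unfolding S_gen_eq by (simp add: scl_sum mult.commute)

lemma scl_delta_sum: "(\<Sum>l\<in>UNIV. scl (f l) (X l)) = X a" if "\<And>l. f l = (if l = (a::'n) then 1 else 0)" for X :: "'n \<Rightarrow> 'x \<Rightarrow>\<^sub>0 'k"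
  by (simp add: that if_distrib[of "\<lambda>x. scl x _"] cong: if_cong)

lemma scl_contract:
  assumes "\<And>a d. (\<Sum>b\<in>UNIV. f a b * g b d) = (if a = d then 1 else (0::'k))"
  shows "(\<Sum>b\<in>UNIV. scl (f (a::'n) (b::'n)) (\<Sum>d\<in>UNIV. scl (g b (d::'n)) (X d))) = (X a :: 'x \<Rightarrow>\<^sub>0 'k)"
proof -
  have "(\<Sum>b\<in>UNIV. scl (f a b) (\<Sum>d\<in>UNIV. scl (g b d) (X d))) = (\<Sum>b\<in>UNIV. \<Sum>d\<in>UNIV. scl (f a b * g b d) (X d))"
    by (simp add: scl_sum)
  also have "\<dots> = (\<Sum>d\<in>UNIV. \<Sum>b\<in>UNIV. scl (f a b * g b d) (X d))" by (rule sum.swap)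
  also have "\<dots> = (\<Sum>d\<in>UNIV. scl (\<Sum>b\<in>UNIV. f a b * g b d) (X d))" by (simp add: scl_sum_left)
  also have "\<dots> = X a" unfolding assms by (rule scl_delta_sum) auto
  finally show ?thesis .
qed

lemma sum_S_gen_var: "(\<Sum>m\<in>UNIV. S_gen (i, m) * var (m, j)) = (\<Sum>l\<in>UNIV. scl (\<omega> i l) (\<rho> l j + scl (\<beta> l j) 1))"
proof -
  have "(\<Sum>m\<in>UNIV. S_gen (i, m) * var (m, j)) =
      (\<Sum>m\<in>UNIV. \<Sum>l\<in>UNIV. scl (\<omega> i l) (\<Sum>k\<in>UNIV. scl (\<beta> k m) (var (k, l) * var (m, j))))"
    by (simp only: S_gen_left sum_distrib_right scl_mult_left[symmetric])
  also have "\<dots> = (\<Sum>l\<in>UNIV. \<Sum>m\<in>UNIV. scl (\<omega> i l) (\<Sum>k\<in>UNIV. scl (\<beta> k m) (var (k, l) * var (m, j))))"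
    by (rule sum.swap)
  also have "\<dots> = (\<Sum>l\<in>UNIV. scl (\<omega> i l) (\<Sum>m\<in>UNIV. \<Sum>k\<in>UNIV. scl (\<beta> k m) (var (k, l) * var (m, j))))"
    by (simp add: scl_sum)
  also have "\<dots> = (\<Sum>l\<in>UNIV. scl (\<omega> i l) (\<rho> l j + scl (\<beta> l j) 1))"
    unfolding \<rho>_def diff_add_cancel by (intro sum.cong refl arg_cong[of _ _ "scl _"] sum.swap)
  finally show ?thesis .
qed

text \<open>
  \<open>E\<^sup>-\<^sup>1 a\<^sup>t E a - 1 = E\<^sup>-\<^sup>1 (a\<^sup>t E a - E)\<close>.
\<close>

lemma rel_left_eq: "rel_left i j = (\<Sum>l\<in>UNIV. scl (\<omega> i l) (\<rho> l j))"
proof -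
  have "(\<Sum>l\<in>UNIV. scl (\<omega> i l) (scl (\<beta> l j) 1)) = (scl (\<Sum>l\<in>UNIV. \<omega> i l * \<beta> l j) 1 :: ('n \<times> 'n) list \<Rightarrow>\<^sub>0 'k)"
    by (simp only: scl_scl scl_sum_left)
  then show ?thesis
    unfolding rel_left_def sum_S_gen_var by (simp only: scl_add sum.distrib omega_beta) simp
qed

text \<open>
  \<open>a E\<^sup>-\<^sup>1 a\<^sup>t E - 1 = (a E\<^sup>-\<^sup>1 a\<^sup>t - E\<^sup>-\<^sup>1) E\<close>.
\<close>

lemma rel_right_eq: "rel_right i j = (\<Sum>k\<in>UNIV. scl (\<beta> k j) (\<sigma> i k))"
proof -
  have "(\<Sum>m\<in>UNIV. var (i, m) * S_gen (m, j)) =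
      (\<Sum>m\<in>UNIV. \<Sum>k\<in>UNIV. scl (\<beta> k j) (\<Sum>l\<in>UNIV. scl (\<omega> m l) (var (i, m) * var (k, l))))"
    by (simp only: S_gen_right sum_distrib_left scl_mult_right[symmetric])
  also have "\<dots> = (\<Sum>k\<in>UNIV. \<Sum>m\<in>UNIV. scl (\<beta> k j) (\<Sum>l\<in>UNIV. scl (\<omega> m l) (var (i, m) * var (k, l))))"
    by (rule sum.swap)
  also have "\<dots> = (\<Sum>k\<in>UNIV. scl (\<beta> k j) (\<sigma> i k + scl (\<omega> i k) 1))"
    unfolding \<sigma>_def diff_add_cancel by (simp add: scl_sum)
  finally have 1: "(\<Sum>m\<in>UNIV. var (i, m) * S_gen (m, j)) = (\<Sum>k\<in>UNIV. scl (\<beta> k j) (\<sigma> i k + scl (\<omega> i k) 1))" .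
  have "(\<Sum>k\<in>UNIV. scl (\<beta> k j) (scl (\<omega> i k) 1)) = (scl (\<Sum>k\<in>UNIV. \<omega> i k * \<beta> k j) 1 :: ('n \<times> 'n) list \<Rightarrow>\<^sub>0 'k)"
    by (simp only: scl_scl scl_sum_left mult.commute)
  then show ?thesis
    unfolding rel_right_def 1 by (simp only: scl_add sum.distrib omega_beta) simp
qed

lemma rels_subset:
  assumes J: "two_sided_ideal J" and "\<And>s v. \<rho> s v \<in> J" "\<And>r u. \<sigma> r u \<in> J"
  shows "R \<subseteq> J"
  unfolding R_eq by (auto simp: rel_left_eq rel_right_eq intro!: tidealD(7)[OF J] two_sided_ideal_scl[OF J] assms)

lemma rel_left_in: "rel_left i j \<in> gen_ideal R" and rel_right_in: "rel_right i j \<in> gen_ideal R"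
  using gen_ideal_superset[of R] unfolding R_eq by auto

lemma rho_in: "\<rho> s v \<in> gen_ideal R"
proof -
  have "\<rho> s v = (\<Sum>i\<in>UNIV. scl (\<beta> s i) (rel_left i v))"
    unfolding rel_left_eq by (rule scl_contract[OF beta_omega, symmetric])
  note eq = this
  show ?thesis unfolding eq by (intro tidealD(7)[OF two_sided_ideal_gen_ideal] two_sided_ideal_scl[OF two_sided_ideal_gen_ideal] rel_left_in)
qed

lemma sigma_in: "\<sigma> r u \<in> gen_ideal R"
proof -

  have "\<sigma> r u = (\<Sum>j\<in>UNIV. scl (\<omega> j u) (rel_right r j))"
    unfolding rel_right_eq
    by (rule scl_contract[of "\<lambda>a b. \<omega> b a" "\<lambda>b d. \<beta> d b", OF omega_beta_transposed, symmetric])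
  note eq = this
  show ?thesis unfolding eq by (intro tidealD(7)[OF two_sided_ideal_gen_ideal] two_sided_ideal_scl[OF two_sided_ideal_gen_ideal] rel_right_in)
qed

abbreviation C :: "'n list \<Rightarrow> 'n list \<Rightarrow> (('n \<times> 'n) list \<Rightarrow>\<^sub>0 'k) set" where
  "C v w \<equiv> cls R (a_word v w)"

lemma single_a_word: "Poly_Mapping.single b 1 = a_word (map fst b) (map snd b)"
  by (simp add: a_word_def zip_map_fst_snd)

lemma vect_H: "vect H" and k_algebra_H: "k_algebra H"
  unfolding H_eq by (rule vect_presented k_algebra_presented)+

lemma C_closed [simp, intro]: "cls R p \<in> carrier H"
  unfolding H_eq by (rule cls_closed)

lemma cls_mult_H: "cls R p \<otimes>\<^bsub>H\<^esub> cls R q = cls R (p * q)"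
  unfolding H_eq by (rule cls_mult[symmetric])

subsection \<open>Comultiplication and coaction\<close>

text \<open>
  If \<open>a\<close> satisfies \<open>a E\<^sup>-\<^sup>1 a\<^sup>t = E\<^sup>-\<^sup>1\<close>, then the contraction of \<open>\<Sum>\<^sub>k x\<^sub>k \<otimes> a\<^sub>k\<^sub>s\<close> and \<open>\<Sum>\<^sub>l y\<^sub>l \<otimes> a\<^sub>l\<^sub>t\<close> with \<open>\<omega>\<close> is
  that of \<open>x\<close> and \<open>y\<close>. This serves both the coproduct (\<open>x\<close> a row of \<open>a\<close>) and the coaction
  on \<open>\<A>(E\<^sup>-\<^sup>1, t)\<close> (\<open>x\<close> the generators).
\<close>

lemma omega_tens:
  fixes x y :: "'n \<Rightarrow> 'm::monoid_add \<Rightarrow>\<^sub>0 'k"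
  shows "(\<Sum>s\<in>UNIV. \<Sum>t\<in>UNIV. scl (\<omega> s t) ((\<Sum>k\<in>UNIV. tens (x k) (var (k, s))) * (\<Sum>l\<in>UNIV. tens (y l) (var (l, t))))) =
    (\<Sum>k\<in>UNIV. \<Sum>l\<in>UNIV. tens (x k * y l) (\<sigma> k l)) + tens (\<Sum>k\<in>UNIV. \<Sum>l\<in>UNIV. scl (\<omega> k l) (x k * y l)) 1"
proof -
  have "(\<Sum>s\<in>UNIV. \<Sum>t\<in>UNIV. scl (\<omega> s t) ((\<Sum>k\<in>UNIV. tens (x k) (var (k, s))) * (\<Sum>l\<in>UNIV. tens (y l) (var (l, t))))) =
      (\<Sum>s\<in>UNIV. \<Sum>t\<in>UNIV. \<Sum>k\<in>UNIV. \<Sum>l\<in>UNIV. tens (x k * y l) (scl (\<omega> s t) (var (k, s) * var (l, t))))"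
    by (simp add: sum_product tens_mult scl_sum tens_scl_right)
  also have "\<dots> = (\<Sum>s\<in>UNIV. \<Sum>k\<in>UNIV. \<Sum>t\<in>UNIV. \<Sum>l\<in>UNIV. tens (x k * y l) (scl (\<omega> s t) (var (k, s) * var (l, t))))"
    by (intro sum.cong refl sum.swap)
  also have "\<dots> = (\<Sum>k\<in>UNIV. \<Sum>s\<in>UNIV. \<Sum>t\<in>UNIV. \<Sum>l\<in>UNIV. tens (x k * y l) (scl (\<omega> s t) (var (k, s) * var (l, t))))"
    by (rule sum.swap)
  also have "\<dots> = (\<Sum>k\<in>UNIV. \<Sum>s\<in>UNIV. \<Sum>l\<in>UNIV. \<Sum>t\<in>UNIV. tens (x k * y l) (scl (\<omega> s t) (var (k, s) * var (l, t))))"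
    by (intro sum.cong refl sum.swap)
  also have "\<dots> = (\<Sum>k\<in>UNIV. \<Sum>l\<in>UNIV. \<Sum>s\<in>UNIV. \<Sum>t\<in>UNIV. tens (x k * y l) (scl (\<omega> s t) (var (k, s) * var (l, t))))"
    by (intro sum.cong refl sum.swap)
  also have "\<dots> = (\<Sum>k\<in>UNIV. \<Sum>l\<in>UNIV. tens (x k * y l) (\<sigma> k l + scl (\<omega> k l) 1))"
    by (simp add: \<sigma>_def tens_sum_right)
  finally show ?thesis
    by (simp only: tens_add_right sum.distrib tens_scl_right tens_sum_left tens_scl_left)
qed

lemma beta_tens:
  fixes x y :: "'n \<Rightarrow> 'm::monoid_add \<Rightarrow>\<^sub>0 'k"
  shows "(\<Sum>s\<in>UNIV. \<Sum>t\<in>UNIV. scl (\<beta> s t) ((\<Sum>k\<in>UNIV. tens (var (s, k)) (x k)) * (\<Sum>l\<in>UNIV. tens (var (t, l)) (y l)))) =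
    (\<Sum>k\<in>UNIV. \<Sum>l\<in>UNIV. tens (\<rho> k l) (x k * y l)) + tens 1 (\<Sum>k\<in>UNIV. \<Sum>l\<in>UNIV. scl (\<beta> k l) (x k * y l))"
proof -
  have "(\<Sum>s\<in>UNIV. \<Sum>t\<in>UNIV. scl (\<beta> s t) ((\<Sum>k\<in>UNIV. tens (var (s, k)) (x k)) * (\<Sum>l\<in>UNIV. tens (var (t, l)) (y l)))) =
      (\<Sum>s\<in>UNIV. \<Sum>t\<in>UNIV. \<Sum>k\<in>UNIV. \<Sum>l\<in>UNIV. tens (scl (\<beta> s t) (var (s, k) * var (t, l))) (x k * y l))"
    by (simp add: sum_product tens_mult scl_sum tens_scl_left)
  also have "\<dots> = (\<Sum>s\<in>UNIV. \<Sum>k\<in>UNIV. \<Sum>t\<in>UNIV. \<Sum>l\<in>UNIV. tens (scl (\<beta> s t) (var (s, k) * var (t, l))) (x k * y l))"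
    by (intro sum.cong refl sum.swap)
  also have "\<dots> = (\<Sum>k\<in>UNIV. \<Sum>s\<in>UNIV. \<Sum>t\<in>UNIV. \<Sum>l\<in>UNIV. tens (scl (\<beta> s t) (var (s, k) * var (t, l))) (x k * y l))"
    by (rule sum.swap)
  also have "\<dots> = (\<Sum>k\<in>UNIV. \<Sum>s\<in>UNIV. \<Sum>l\<in>UNIV. \<Sum>t\<in>UNIV. tens (scl (\<beta> s t) (var (s, k) * var (t, l))) (x k * y l))"
    by (intro sum.cong refl sum.swap)
  also have "\<dots> = (\<Sum>k\<in>UNIV. \<Sum>l\<in>UNIV. \<Sum>s\<in>UNIV. \<Sum>t\<in>UNIV. tens (scl (\<beta> s t) (var (s, k) * var (t, l))) (x k * y l))"
    by (intro sum.cong refl sum.swap)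
  also have "\<dots> = (\<Sum>k\<in>UNIV. \<Sum>l\<in>UNIV. tens (\<rho> k l + scl (\<beta> k l) 1) (x k * y l))"
    by (simp add: \<rho>_def tens_sum_left)
  finally show ?thesis
    by (simp only: tens_add_left sum.distrib tens_scl_right tens_sum_right tens_scl_left)
qed

text \<open>
  The coproduct on generators, lifted to the free algebra.
\<close>

definition Delta_free :: "'n \<times> 'n \<Rightarrow> ('n \<times> 'n) list \<times> ('n \<times> 'n) list \<Rightarrow>\<^sub>0 'k" where
  "Delta_free x = (\<Sum>k\<in>UNIV. tens (var (fst x, k)) (var (k, snd x)))"

interpretation HH: two_algebras H H by (rule two_algebras.intro) (rule k_algebra_H)+

definition \<Delta> where
  "\<Delta> = induced_hom (tensor H H) (\<lambda>(i, j). \<Oplus>\<^bsub>tensor H H\<^esub> k \<in> UNIV. pure_tensor H H (B_gen E i k) (B_gen E k j))"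

lemma B_gen_eq: "B_gen E i j = cls R (var (i, j))"
  by (simp add: B_gen_def gen_matrix_def)

lemma Delta_gen: "(\<lambda>(i, j). \<Oplus>\<^bsub>tensor H H\<^esub> k \<in> UNIV. pure_tensor H H (B_gen E i k) (B_gen E k j)) = (\<lambda>x. tensor_proj R R (Delta_free x))"
  by (simp add: fun_eq_iff Delta_free_def tensor_proj_sum tensor_proj_tens B_gen_eq H_eq)

lemma tensor_proj_Delta_free_zero: "r \<in> R \<Longrightarrow> tensor_proj R R (feval Delta_free r) = \<zero>\<^bsub>tensor H H\<^esub>"
proof -
  let ?K = "{q. tensor_proj R R q = \<zero>\<^bsub>tensor H H\<^esub>}" and ?J = "{p. tensor_proj R R (feval Delta_free p) = \<zero>\<^bsub>tensor H H\<^esub>}"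
  have K: "two_sided_ideal ?K" unfolding H_eq by (rule tensor_proj_kernel_two_sided_ideal)
  have tK: "p \<in> gen_ideal R \<Longrightarrow> tens p q \<in> ?K" "q \<in> gen_ideal R \<Longrightarrow> tens p q \<in> ?K" for p q
    by (simp_all add: tens_in_tensor_proj_kernel H_eq)
  have J: "two_sided_ideal ?J"
    unfolding two_sided_ideal_def using tidealD[OF K] by (auto simp: feval_linear feval_mult)
  have Delta_free: "feval Delta_free (var (i, j)) = (\<Sum>k\<in>UNIV. tens (var (i, k)) (var (k, j)))" for i j
    by (simp add: feval_var Delta_free_def)
  have one: "feval Delta_free 1 = tens 1 1" using feval_const[of Delta_free 1] by (simp add: const_one tens_one)
  have "feval Delta_free (\<sigma> r u) \<in> ?K" for r u
  proof -
    have "feval Delta_free (\<sigma> r u) = (\<Sum>k\<in>UNIV. \<Sum>l\<in>UNIV. tens (var (r, k) * var (u, l)) (\<sigma> k l)) + tens (\<sigma> r u) 1"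
      unfolding \<sigma>_def[of r u] feval_linear feval_mult Delta_free omega_tens one tens_minus_left tens_scl_left
      by (simp add: algebra_simps)
    also have "\<dots> \<in> ?K"
      by (intro tidealD(2)[OF K] tidealD(7)[OF K] tK(1)[OF sigma_in] tK(2)[OF sigma_in])
    finally show ?thesis .
  qed
  moreover have "feval Delta_free (\<rho> s v) \<in> ?K" for s v
  proof -
    have "feval Delta_free (\<rho> s v) = (\<Sum>k\<in>UNIV. \<Sum>l\<in>UNIV. tens (\<rho> k l) (var (k, s) * var (l, v))) + tens 1 (\<rho> s v)"
      unfolding \<rho>_def[of s v] feval_linear feval_mult Delta_free beta_tens one tens_minus_right tens_scl_right
      by (simp add: algebra_simps)
    also have "\<dots> \<in> ?K"
      by (intro tidealD(2)[OF K] tidealD(7)[OF K] tK(1)[OF rho_in] tK(2)[OF rho_in])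
    finally show ?thesis .
  qed
  ultimately have "R \<subseteq> ?J" by (intro rels_subset[OF J]) auto
  then show "r \<in> R \<Longrightarrow> tensor_proj R R (feval Delta_free r) = \<zero>\<^bsub>tensor H H\<^esub>" by auto
qed

lemma Delta_works:
  shows Delta_cls: "\<Delta> (cls R p) = tensor_proj R R (feval Delta_free p)"
    and Delta_alg_hom: "\<Delta> \<in> alg_hom H (tensor H H)"
proof -
  note w = induced_hom_works[OF HH.k_algebra_tensor, of "\<lambda>x. tensor_proj R R (Delta_free x)" R]
  have c: "tensor_proj R R p \<in> carrier (tensor H H)" for p unfolding H_eq by (rule tensor_proj_hom)
  have z: "lin_ext (tensor H H) (word_prod (tensor H H) (\<lambda>x. tensor_proj R R (Delta_free x))) r = \<zero>\<^bsub>tensor H H\<^esub>" if "r \<in> R" for r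
    using tensor_proj_Delta_free_zero[OF that] tensor_proj_feval[of R R Delta_free r] by (simp add: H_eq)
  show "\<Delta> (cls R p) = tensor_proj R R (feval Delta_free p)"
  proof -
    have "\<Delta> (cls R p) = lin_ext (tensor H H) (word_prod (tensor H H) (\<lambda>x. tensor_proj R R (Delta_free x))) p"
      unfolding \<Delta>_def Delta_gen by (rule w(1)[OF c z])
    then show ?thesis using tensor_proj_feval[of R R Delta_free p] by (simp add: H_eq)
  qed
  show "\<Delta> \<in> alg_hom H (tensor H H)"
    using w(2)[OF c z] unfolding \<Delta>_def Delta_gen by (simp add: H_eq)
qed

lemma prod_list_Delta_free: "prod_list (map Delta_free b) = (\<Sum>m\<in>words (length b). tens (a_word (map fst b) m) (a_word m (map snd b)))"
proof (induction b)
  case Nil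
  show ?case by (simp add: a_word_Nil tens_one)
next
  case (Cons x b)
  then show ?case
    by (simp add: Delta_free_def sum_product sum_words_Suc tens_mult a_word_Cons)
qed

lemma tensor_proj_sum_H: "finite A \<Longrightarrow> tensor_proj R R (sum f A) = (\<Oplus>\<^bsub>tensor H H\<^esub>i\<in>A. tensor_proj R R (f i))"
  unfolding H_eq by (rule tensor_proj_sum)

lemma Delta_C:
  assumes "length v = length w"
  shows "\<Delta> (C v w) = (\<Oplus>\<^bsub>tensor H H\<^esub>m\<in>words (length w). pure_tensor H H (C v m) (C m w))"
proof -
  have "\<Delta> (C v w) = tensor_proj R R (\<Sum>m\<in>words (length w). tens (a_word v m) (a_word m w))"
    using assms by (simp add: Delta_cls a_word_def[of v w] feval_linear prod_list_Delta_free)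
  then show ?thesis by (simp add: tensor_proj_sum_H tensor_proj_tens H_eq)
qed

subsection \<open>Counit\<close>

definition \<epsilon> where "\<epsilon> = induced_hom base (\<lambda>(i, j). if i = j then 1 else (0::'k))"

lemma eps_works:
  shows eps_cls: "\<epsilon> (cls R p) = ksum (\<lambda>b. if map fst b = map snd b then 1 else 0) p"
    and eps_alg_hom: "\<epsilon> \<in> alg_hom H base"
proof -
  let ?g = "\<lambda>(i :: 'n, j). if i = j then 1 else (0::'k)"
  let ?L = "lin_ext base (word_prod base ?g)"
  have wp: "word_prod base ?g b = (if map fst b = map snd b then 1 else 0)" for b :: "('n \<times> 'n) list"
    by (induction b) (auto simp: word_prod_def)
  have L: "?L = ksum (\<lambda>b. if map fst b = map snd b then 1 else 0)"
    unfolding lin_ext_base by (rule arg_cong[of _ _ ksum], rule ext, rule wp)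
  note ev = word_prod_ev_mult[OF k_algebra_base, of ?g] word_prod_ev_one[OF k_algebra_base, of ?g]
    ev_kernel_two_sided_ideal[OF k_algebra_base, of ?g]
  have m: "?L (p * q) = ?L p * ?L q" "?L 1 = 1" for p q using ev by simp_all
  have J: "two_sided_ideal {p. ?L p = 0}" using ev by simp
  have lin: "?L (scl a p) = a * ?L p" "?L (p - q) = ?L p - ?L q" "?L (sum f A) = (\<Sum>i\<in>A. ?L (f i))"
    for a p q f and A :: "'n set"
    unfolding L by (simp_all add: ksum_scl ksum_minus ksum_sum)
  have var: "?L (var (i, j)) = (if i = j then 1 else 0)" for i j
    unfolding L by (simp add: var_def)
  have s: "(\<Sum>t\<in>UNIV. \<Sum>u\<in>UNIV. f t u * ((if t = a then 1 else 0) * (if u = b then 1 else 0))) = f a b"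
    "(\<Sum>t\<in>UNIV. \<Sum>u\<in>UNIV. f t u * ((if a = t then 1 else 0) * (if b = u then 1 else 0))) = f a b"
    for f :: "'n \<Rightarrow> 'n \<Rightarrow> 'k" and a b
    by (simp_all add: if_distrib[of "\<lambda>x. _ * x"] if_distrib[of "\<lambda>x. x * _"] cong: if_cong)
  have "R \<subseteq> {p. ?L p = 0}"
    by (rule rels_subset[OF J]) (simp_all add: \<rho>_def \<sigma>_def lin m var s del: mult_1_right mult_zero_right)
  then have z: "?L r = \<zero>\<^bsub>base\<^esub>" if "r \<in> R" for r using that by auto
  note w = induced_hom_works[OF k_algebra_base, of ?g R, OF _ z]
  show "\<epsilon> (cls R p) = ksum (\<lambda>b. if map fst b = map snd b then 1 else 0) p"
    unfolding \<epsilon>_def using w(1) by (simp add: L)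
  show "\<epsilon> \<in> alg_hom H base" unfolding \<epsilon>_def H_eq using w(2) by simp
qed

lemma eps_C: "length v = length w \<Longrightarrow> \<epsilon> (C v w) = (if v = w then 1 else 0)"
  unfolding eps_cls a_word_def ksum_single by (simp only: map_fst_zip map_snd_zip) simp

subsection \<open>Antipode\<close>

text \<open>
  The antipode, lifted to an antihomomorphism of the free algebra.
\<close>

definition S_free :: "(('n \<times> 'n) list \<Rightarrow>\<^sub>0 'k) \<Rightarrow> ('n \<times> 'n) list \<Rightarrow>\<^sub>0 'k" where
  "S_free = psum (\<lambda>b. prod_list (map S_gen (rev b)))"

lemma S_free_linear: "S_free (p + q) = S_free p + S_free q" "S_free (p - q) = S_free p - S_free q"
  "S_free (scl a p) = scl a (S_free p)" "S_free (sum f A) = (\<Sum>i\<in>A. S_free (f i))" "S_free 0 = 0"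
  by (simp_all add: S_free_def psum_add psum_minus psum_scl psum_sum)

lemma S_free_mult: "S_free (p * q) = S_free q * S_free p"
proof (induction p rule: poly_mapping_single_induct)
  case (single v a)
  show ?case
    by (induction q rule: poly_mapping_single_induct)
       (simp_all add: S_free_def psum_add mult_single distrib_left distrib_right plus_list_def scl_mult_left[symmetric]
          scl_mult_right[symmetric] scl_add mult.commute)
qed (simp_all add: S_free_linear distrib_right distrib_left)

lemma S_free_var: "S_free (var x) = S_gen x" by (simp add: S_free_def var_def)

lemma S_free_one: "S_free 1 = 1"
proof -
  have "S_free (Poly_Mapping.single [] 1) = 1" by (simp add: S_free_def)
  then show ?thesis using const_one[where 'x="'n \<times> 'n" and 'k='k] by (simp add: const_def)
qed

lemma S_free_sigma: "S_free (\<sigma> r u) \<in> gen_ideal R"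
proof -
  let ?P = "\<lambda>r t. \<Sum>m\<in>UNIV. scl (\<omega> r m) (var (t, m) :: ('n \<times> 'n) list \<Rightarrow>\<^sub>0 'k)"
  have ct: "(\<Sum>s\<in>UNIV. scl (\<omega> s t) (S_gen (r, s))) = ?P r t" for t
    unfolding S_gen_right
    by (rule scl_contract[of "\<lambda>a b. \<omega> b a" "\<lambda>b d. \<beta> d b", OF omega_beta_transposed])
  have "S_free (\<sigma> r u) = (\<Sum>s\<in>UNIV. \<Sum>t\<in>UNIV. scl (\<omega> s t) (S_gen (u, t) * S_gen (r, s))) - scl (\<omega> r u) 1"
    by (simp add: \<sigma>_def S_free_linear S_free_mult S_free_var S_free_one)
  also have "(\<Sum>s\<in>UNIV. \<Sum>t\<in>UNIV. scl (\<omega> s t) (S_gen (u, t) * S_gen (r, s))) =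
      (\<Sum>t\<in>UNIV. \<Sum>s\<in>UNIV. S_gen (u, t) * scl (\<omega> s t) (S_gen (r, s)))"
    by (subst sum.swap) (simp only: scl_mult_right)
  also have "\<dots> = (\<Sum>t\<in>UNIV. S_gen (u, t) * ?P r t)"
    by (simp only: ct flip: sum_distrib_left)
  also have "\<dots> = (\<Sum>t\<in>UNIV. \<Sum>m\<in>UNIV. scl (\<omega> r m) (S_gen (u, t) * var (t, m)))"
    by (simp only: sum_distrib_left scl_mult_right)
  also have "\<dots> = (\<Sum>m\<in>UNIV. scl (\<omega> r m) (\<Sum>t\<in>UNIV. S_gen (u, t) * var (t, m)))"
    by (subst sum.swap) (simp only: scl_sum)
  also have "\<dots> = (\<Sum>m\<in>UNIV. scl (\<omega> r m) (rel_left u m)) + (\<Sum>m\<in>UNIV. scl (\<omega> r m) (scl (if u = m then 1 else 0) 1))"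
    unfolding rel_left_def scl_minus sum_subtractf by simp
  also have "(\<Sum>m\<in>UNIV. scl (\<omega> r m) (scl (if u = m then 1 else 0) 1)) = (scl (\<omega> r u) 1 :: ('n \<times> 'n) list \<Rightarrow>\<^sub>0 'k)"
    by (simp add: if_distrib[of "\<lambda>x. _ * x"] if_distrib[of "\<lambda>x. scl x _"] if_distrib[of "\<lambda>x. scl _ x"] cong: if_cong)
  finally have "S_free (\<sigma> r u) = (\<Sum>m\<in>UNIV. scl (\<omega> r m) (rel_left u m))" by simp
  note eq = this
  show ?thesis unfolding eq by (intro tidealD(7)[OF two_sided_ideal_gen_ideal] two_sided_ideal_scl[OF two_sided_ideal_gen_ideal] rel_left_in)
qed

lemma S_free_rho: "S_free (\<rho> s v) \<in> gen_ideal R"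
proof -
  let ?Q = "\<lambda>t v. \<Sum>j\<in>UNIV. scl (\<beta> j v) (var (j, t) :: ('n \<times> 'n) list \<Rightarrow>\<^sub>0 'k)"
  have ct: "(\<Sum>u\<in>UNIV. scl (\<beta> t u) (S_gen (u, v))) = ?Q t v" for t
    unfolding S_gen_left by (rule scl_contract[OF beta_omega])
  have "S_free (\<rho> s v) = (\<Sum>t\<in>UNIV. \<Sum>u\<in>UNIV. scl (\<beta> t u) (S_gen (u, v) * S_gen (t, s))) - scl (\<beta> s v) 1"
    by (simp add: \<rho>_def S_free_linear S_free_mult S_free_var S_free_one)
  also have "(\<Sum>t\<in>UNIV. \<Sum>u\<in>UNIV. scl (\<beta> t u) (S_gen (u, v) * S_gen (t, s))) = (\<Sum>t\<in>UNIV. ?Q t v * S_gen (t, s))"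
    by (simp only: scl_mult_left ct flip: sum_distrib_right)
  also have "\<dots> = (\<Sum>t\<in>UNIV. \<Sum>j\<in>UNIV. scl (\<beta> j v) (var (j, t) * S_gen (t, s)))"
    by (simp only: sum_distrib_right scl_mult_left)
  also have "\<dots> = (\<Sum>j\<in>UNIV. scl (\<beta> j v) (\<Sum>t\<in>UNIV. var (j, t) * S_gen (t, s)))"
    by (subst sum.swap) (simp only: scl_sum)
  also have "\<dots> = (\<Sum>j\<in>UNIV. scl (\<beta> j v) (rel_right j s)) + (\<Sum>j\<in>UNIV. scl (\<beta> j v) (scl (if j = s then 1 else 0) 1))"
    unfolding rel_right_def scl_minus sum_subtractf by simp
  also have "(\<Sum>j\<in>UNIV. scl (\<beta> j v) (scl (if j = s then 1 else 0) 1)) = (scl (\<beta> s v) 1 :: ('n \<times> 'n) list \<Rightarrow>\<^sub>0 'k)"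
    by (simp add: if_distrib[of "\<lambda>x. _ * x"] if_distrib[of "\<lambda>x. scl x _"] if_distrib[of "\<lambda>x. scl _ x"] cong: if_cong)
  finally have "S_free (\<rho> s v) = (\<Sum>j\<in>UNIV. scl (\<beta> j v) (rel_right j s))" by simp
  note eq = this
  show ?thesis unfolding eq by (intro tidealD(7)[OF two_sided_ideal_gen_ideal] two_sided_ideal_scl[OF two_sided_ideal_gen_ideal] rel_right_in)
qed

definition S where "S = induced_antihom H (\<lambda>(i, j). cls R (antipode_matrix E $ i $ j))"

lemma S_works:
  shows S_cls: "S (cls R p) = cls R (S_free p)"
    and S_lin_hom: "S \<in> lin_hom H H"
proof -
  let ?g = "\<lambda>(i, j). cls R (antipode_matrix E $ i $ j)"
  have g: "?g = (\<lambda>x. cls R (S_gen x))" by (auto simp: S_gen_def)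
  have wp: "word_prod H ?g w = cls R (prod_list (map S_gen w))" for w
    unfolding g by (induction w) (simp_all add: word_prod_def H_eq cls_one cls_mult)
  have L: "lin_ext H (\<lambda>w. word_prod H ?g (rev w)) p = cls R (S_free p)" for p
  proof (rule lin_hom_free_eq[OF free_on_free_algebra vect_H, where f = "lin_ext H (\<lambda>w. word_prod H ?g (rev w))"
        and g = "\<lambda>p. cls R (S_free p)"])
    show "lin_ext H (\<lambda>w. word_prod H ?g (rev w)) \<in> lin_hom free_algebra H"
      by (rule lin_ext_lin_hom[OF free_on_free_algebra vect_H]) (simp add: wp)
    show "(\<lambda>p. cls R (S_free p)) \<in> lin_hom free_algebra H"
      by (rule lin_homI) (simp_all add: S_free_linear H_eq cls_add cls_scl)
    show "lin_ext H (\<lambda>w. word_prod H ?g (rev w)) (Poly_Mapping.single x 1) = cls R (S_free (Poly_Mapping.single x 1))" for x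
      by (subst lin_ext_single[OF vect_H]) (simp_all add: wp S_free_def vect_H)
  qed simp
  have J: "two_sided_ideal {p. S_free p \<in> gen_ideal R}"
    unfolding two_sided_ideal_def using tidealD[OF two_sided_ideal_gen_ideal] by (auto simp: S_free_linear S_free_mult)
  have "R \<subseteq> {p. S_free p \<in> gen_ideal R}"
    by (rule rels_subset[OF J]) (simp_all add: S_free_sigma S_free_rho)
  then have z: "lin_ext H (\<lambda>w. word_prod H ?g (rev w)) r = \<zero>\<^bsub>H\<^esub>" if "r \<in> R" for r
    using that cls_eqI[of "S_free r" 0 R] unfolding L by (auto simp: H_eq cls_zero)
  note w = induced_antihom_works[OF k_algebra_H, of ?g R, OF _ z]
  show "S (cls R p) = cls R (S_free p)" unfolding S_def using w(1) L by auto
  show "S \<in> lin_hom H H" unfolding S_def using w(2) by (auto simp: H_eq)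
qed

text \<open>
  For words of length one these are the relations of the algebra. For longer words the middle
  factors cancel one after the other.
\<close>

lemma S_free_left:
  assumes "length v = length w"
  shows "(\<Sum>m\<in>words (length w). S_free (a_word v m) * a_word m w) - scl (if v = w then 1 else 0) 1 \<in> gen_ideal R"
  using assms
proof (induction v w rule: list_induct2)
  case Nil
  show ?case by (simp add: a_word_Nil S_free_one tidealD[OF two_sided_ideal_gen_ideal])
next
  case (Cons k v l w)
  let ?T = "\<Sum>m\<in>words (length w). S_free (a_word v m) * a_word m w"
  have "(\<Sum>m\<in>words (length (l # w)). S_free (a_word (k # v) m) * a_word m (l # w)) =
      (\<Sum>s\<in>UNIV. \<Sum>m\<in>words (length w). S_free (a_word v m) * (S_gen (k, s) * var (s, l)) * a_word m w)"
    by (simp add: sum_words_Suc a_word_Cons S_free_mult S_free_var mult.assoc)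
  also have "\<dots> = (\<Sum>m\<in>words (length w). S_free (a_word v m) * (\<Sum>s\<in>UNIV. S_gen (k, s) * var (s, l)) * a_word m w)"
    by (subst sum.swap) (simp only: sum_distrib_left sum_distrib_right)
  also have "\<dots> = (\<Sum>m\<in>words (length w). S_free (a_word v m) * (rel_left k l + scl (if k = l then 1 else 0) 1) * a_word m w)"
    by (simp add: rel_left_def)
  also have "\<dots> = (\<Sum>m\<in>words (length w). S_free (a_word v m) * rel_left k l * a_word m w) + scl (if k = l then 1 else 0) ?T"
    by (auto simp: distrib_left distrib_right sum.distrib)
  finally have 1: "(\<Sum>m\<in>words (length (l # w)). S_free (a_word (k # v) m) * a_word m (l # w)) = \<dots>" .
  have "(\<Sum>m\<in>words (length w). S_free (a_word v m) * rel_left k l * a_word m w) \<in> gen_ideal R"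
    by (intro tidealD(7)[OF two_sided_ideal_gen_ideal] tidealD(3,4)[OF two_sided_ideal_gen_ideal] rel_left_in)
  moreover have "scl (if k = l then 1 else 0) (?T - scl (if v = w then 1 else 0) 1) \<in> gen_ideal R"
    by (rule two_sided_ideal_scl[OF two_sided_ideal_gen_ideal Cons.IH])
  ultimately have "(\<Sum>m\<in>words (length w). S_free (a_word v m) * rel_left k l * a_word m w) +
      scl (if k = l then 1 else 0) (?T - scl (if v = w then 1 else 0) 1) \<in> gen_ideal R"
    by (rule tidealD(2)[OF two_sided_ideal_gen_ideal])
  then show ?case unfolding 1 by (auto simp: scl_minus add_diff_eq split: if_splits)
qed

lemma S_free_right:
  assumes "length v = length w"
  shows "(\<Sum>m\<in>words (length w). a_word v m * S_free (a_word m w)) - scl (if v = w then 1 else 0) 1 \<in> gen_ideal R"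
  using assms
proof (induction v w rule: list_induct2)
  case Nil
  show ?case by (simp add: a_word_Nil S_free_one tidealD[OF two_sided_ideal_gen_ideal])
next
  case (Cons k v l w)
  let ?T = "\<Sum>m\<in>words (length w). a_word v m * S_free (a_word m w)"
  have "(\<Sum>m\<in>words (length (l # w)). a_word (k # v) m * S_free (a_word m (l # w))) =
      (\<Sum>s\<in>UNIV. var (k, s) * ?T * S_gen (s, l))"
    by (simp add: sum_words_Suc a_word_Cons S_free_mult S_free_var mult.assoc sum_distrib_left sum_distrib_right)
  also have "\<dots> = (\<Sum>s\<in>UNIV. var (k, s) * (?T - scl (if v = w then 1 else 0) 1) * S_gen (s, l)) +
      scl (if v = w then 1 else 0) (\<Sum>s\<in>UNIV. var (k, s) * S_gen (s, l))"
    by (auto simp: left_diff_distrib right_diff_distrib sum_subtractf)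
  also have "scl (if v = w then 1 else 0) (\<Sum>s\<in>UNIV. var (k, s) * S_gen (s, l)) =
      scl (if v = w then 1 else 0) (rel_right k l) + scl (if k # v = l # w then 1 else 0) 1"
    by (auto simp: rel_right_def)
  finally have 1: "(\<Sum>m\<in>words (length (l # w)). a_word (k # v) m * S_free (a_word m (l # w))) - scl (if k # v = l # w then 1 else 0) 1
     = (\<Sum>s\<in>UNIV. var (k, s) * (?T - scl (if v = w then 1 else 0) 1) * S_gen (s, l)) + scl (if v = w then 1 else 0) (rel_right k l)"
    by (simp only: add.assoc[symmetric] add_diff_cancel_right')
  show ?case unfolding 1
    by (intro tidealD(2,7)[OF two_sided_ideal_gen_ideal] tidealD(3,4)[OF two_sided_ideal_gen_ideal] two_sided_ideal_scl[OF two_sided_ideal_gen_ideal] rel_right_in Cons.IH)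
qed

subsection \<open>The Hopf algebra structure\<close>

abbreviation "HE \<equiv> B_hopf E"

text \<open>
  The records \<open>HE\<close>, \<open>reg\<close> and, below, \<open>AE\<close> extend the underlying algebras by further fields, which
  tensor products ignore.
\<close>

lemma HE_simps [simp]:
  "carrier HE = carrier H" "mult HE = mult H" "one HE = one H" "zero HE = zero H" "add HE = add H"
  "smult HE = smult H" "comult HE = \<Delta>" "counit HE = \<epsilon>" "antipode HE = S"
  by (simp_all add: B_hopf_def module.defs hopf.defs \<Delta>_def \<epsilon>_def S_def)

lemma tensor_HE [simp]:
  "tensor HE W = tensor H W" "pure_tensor HE W = pure_tensor H W"
  "tensor V HE = tensor V H" "pure_tensor V HE = pure_tensor V H"
  by (rule tensor_cong; simp)+

lemma lift_HE [simp]: "tensor_lift HE f = tensor_lift H f"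
  by (rule tensor_lift_cong) simp_all

lemma map_HE [simp]: "tensor_map HE W = tensor_map H W" "tensor_map V HE = tensor_map V H"
  by (simp_all add: fun_eq_iff tensor_map_def)

lemma assoc_HE [simp]: "tensor_assoc HE V W = tensor_assoc H V W" "tensor_assoc U HE W = tensor_assoc U H W"
  "tensor_assoc U V HE = tensor_assoc U V H"
  by (simp_all add: fun_eq_iff tensor_assoc_def)

abbreviation "reg \<equiv> regular_comodule HE"

lemma reg_simps [simp]:
  "carrier reg = carrier H" "zero reg = zero H" "add reg = add H" "smult reg = smult H"
  "mult reg = mult H" "one reg = one H" "coaction reg = \<Delta>"
  by (simp_all add: regular_comodule_def module.defs comodule.defs)

lemma tensor_reg [simp]:
  "tensor reg W = tensor H W" "pure_tensor reg W = pure_tensor H W"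
  by (rule tensor_cong; simp)+

lemma lift_reg [simp]: "tensor_lift reg f = tensor_lift H f"
  by (rule tensor_lift_cong) simp_all

lemma map_reg [simp]: "tensor_map reg W = tensor_map H W"
  by (simp add: fun_eq_iff tensor_map_def)

lemma assoc_reg [simp]: "tensor_assoc reg V W = tensor_assoc H V W"
  by (simp add: fun_eq_iff tensor_assoc_def)

lemma lin_hom_HE: "lin_hom HE U = lin_hom H U" "lin_hom U HE = lin_hom U H" "lin_hom reg U = lin_hom H U"
  "lin_hom U reg = lin_hom U H"
  by (simp_all add: lin_hom_def)

lemma alg_hom_HE: "alg_hom HE U = alg_hom H U"
  by (simp add: alg_hom_def lin_hom_HE ring_hom_def)

lemma Delta_lin_hom: "\<Delta> \<in> lin_hom H (tensor H H)" and eps_lin_hom: "\<epsilon> \<in> lin_hom H base"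
  using Delta_alg_hom eps_alg_hom by (simp_all add: alg_hom_def)

lemma H_induct_hom_eq:
  assumes "f \<in> lin_hom H U" "g \<in> lin_hom H U"
    and "\<And>v w. length v = length w \<Longrightarrow> f (C v w) = g (C v w)"
    and "x \<in> carrier H"
  shows "f x = g x"
  by (rule presented_lin_hom_eq[of f R U g])
     (use assms in \<open>simp_all add: single_a_word flip: H_eq\<close>)

lemma counit_bilin:
  assumes "vect V" shows "two_vects.bilin V H V (\<lambda>x h. \<epsilon> h \<odot>\<^bsub>V\<^esub> x)"
proof -
  interpret two_vects V H by (rule two_vects.intro) (fact assms vect_H)+
  show ?thesis unfolding bilin_def
    using assms lin_homD[OF eps_lin_hom]
    by (auto intro!: lin_homI simp: vect_smult_l_distr vect_smult_r_distr vect_smult_assoc mult.commute)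
qed

text \<open>
  If a coaction is given on vectors \<open>e w\<close> by a tensor power of the matrix of generators, then the
  comodule laws at these vectors follow from the matrix form of the coproduct and the counit.
\<close>

lemma matrix_coaction:
  assumes V: "vect V" and \<alpha>: "\<alpha> \<in> lin_hom V (tensor V H)"
    and e: "\<And>w. w \<in> words n \<Longrightarrow> e w \<in> carrier V"
    and \<alpha>e: "\<And>w. w \<in> words n \<Longrightarrow> \<alpha> (e w) = (\<Oplus>\<^bsub>tensor V H\<^esub>u\<in>words n. pure_tensor V H (e u) (C u w))"
    and w: "w \<in> words n"
  shows "tensor_assoc V H H (tensor_map (tensor V H) H \<alpha> (\<lambda>h. h) (\<alpha> (e w))) =
      tensor_map V (tensor H H) (\<lambda>x. x) \<Delta> (\<alpha> (e w))"
    and "tensor_lift V (\<lambda>x h. \<epsilon> h \<odot>\<^bsub>V\<^esub> x) (\<alpha> (e w)) = e w"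
proof -
  interpret VH: two_vects V H by (rule two_vects.intro) (fact V vect_H)+
  interpret VHH: two_vects V "tensor H H" by (rule two_vects.intro) (fact V HH.vect_tensor)+
  interpret L: two_vects "tensor V H" H by (rule two_vects.intro) (fact VH.vect_tensor vect_H)+
  note m1 = tensor_map_works[OF V vect_H VH.vect_tensor vect_H \<alpha> lin_hom_id]
  note m2 = tensor_map_works[OF V vect_H V HH.vect_tensor lin_hom_id Delta_lin_hom]
  note as = tensor_assoc_works[OF V vect_H vect_H]
  let ?T = "tensor V (tensor H H)"
  interpret T: abelian_monoid ?T by (rule vect_abelian_monoid[OF VHH.vect_tensor])
  have pc: "(\<lambda>u. pure_tensor V H (e u) (C u w)) \<in> words n \<rightarrow> carrier (tensor V H)" for w
    using e by (auto intro!: VH.pure_closed)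
  note comp = lin_hom_comp[OF m1(1) as(1)]
  have "tensor_assoc V H H (tensor_map (tensor V H) H \<alpha> (\<lambda>h. h) (\<alpha> (e w))) =
      (\<Oplus>\<^bsub>?T\<^esub>u\<in>words n. tensor_assoc V H H (tensor_map (tensor V H) H \<alpha> (\<lambda>h. h) (pure_tensor V H (e u) (C u w))))"
    unfolding \<alpha>e[OF w] by (rule lin_hom_finsum[OF VH.vect_tensor VHH.vect_tensor comp pc])
  also have "\<dots> = (\<Oplus>\<^bsub>?T\<^esub>u\<in>words n. \<Oplus>\<^bsub>?T\<^esub>z\<in>words n. pure_tensor V (tensor H H) (e z) (pure_tensor H H (C z u) (C u w)))"
  proof (rule T.finsum_cong')
    show "(\<lambda>u. \<Oplus>\<^bsub>?T\<^esub>z\<in>words n. pure_tensor V (tensor H H) (e z) (pure_tensor H H (C z u) (C u w))) \<in> words n \<rightarrow> carrier ?T"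
      using e by (auto intro!: T.finsum_closed VHH.pure_closed HH.pure_closed)
    fix u :: "'n list" assume u: "u \<in> words n"
    have "tensor_map (tensor V H) H \<alpha> (\<lambda>h. h) (pure_tensor V H (e u) (C u w)) =
        (\<Oplus>\<^bsub>tensor (tensor V H) H\<^esub>z\<in>words n. pure_tensor (tensor V H) H (pure_tensor V H (e z) (C z u)) (C u w))"
      using m1(2)[OF e[OF u] C_closed] \<alpha>e[OF u] L.pure_finsum_left[OF pc C_closed] by simp
    also have "tensor_assoc V H H \<dots> = (\<Oplus>\<^bsub>?T\<^esub>z\<in>words n. tensor_assoc V H H (pure_tensor (tensor V H) H (pure_tensor V H (e z) (C z u)) (C u w)))"
      by (rule lin_hom_finsum[OF L.vect_tensor VHH.vect_tensor as(1)])
         (use e in \<open>auto intro!: L.pure_closed VH.pure_closed\<close>)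
    also have "\<dots> = (\<Oplus>\<^bsub>?T\<^esub>z\<in>words n. pure_tensor V (tensor H H) (e z) (pure_tensor H H (C z u) (C u w)))"
      by (rule T.finsum_cong') (use e in \<open>auto intro!: VHH.pure_closed HH.pure_closed simp: as(2)\<close>)
    finally show "tensor_assoc V H H (tensor_map (tensor V H) H \<alpha> (\<lambda>h. h) (pure_tensor V H (e u) (C u w))) = \<dots>" .
  qed simp
  also have "\<dots> = (\<Oplus>\<^bsub>?T\<^esub>z\<in>words n. \<Oplus>\<^bsub>?T\<^esub>u\<in>words n. pure_tensor V (tensor H H) (e z) (pure_tensor H H (C z u) (C u w)))"
    by (rule finsum_swap[OF VHH.vect_tensor]) (use e in \<open>auto intro!: VHH.pure_closed HH.pure_closed\<close>)
  also have "\<dots> = (\<Oplus>\<^bsub>?T\<^esub>z\<in>words n. tensor_map V (tensor H H) (\<lambda>x. x) \<Delta> (pure_tensor V H (e z) (C z w)))"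
  proof (rule T.finsum_cong')
    show "(\<lambda>z. tensor_map V (tensor H H) (\<lambda>x. x) \<Delta> (pure_tensor V H (e z) (C z w))) \<in> words n \<rightarrow> carrier ?T"
      using pc[of w] lin_homD(1)[OF m2(1)] by auto
    fix z :: "'n list" assume z: "z \<in> words n"
    have "tensor_map V (tensor H H) (\<lambda>x. x) \<Delta> (pure_tensor V H (e z) (C z w)) = pure_tensor V (tensor H H) (e z) (\<Delta> (C z w))"
      using m2(2)[OF e[OF z] C_closed] .
    also have "\<Delta> (C z w) = (\<Oplus>\<^bsub>tensor H H\<^esub>u\<in>words n. pure_tensor H H (C z u) (C u w))"
      using Delta_C[of z w] z w by simp
    also have "pure_tensor V (tensor H H) (e z) \<dots> =
        (\<Oplus>\<^bsub>?T\<^esub>u\<in>words n. pure_tensor V (tensor H H) (e z) (pure_tensor H H (C z u) (C u w)))"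
      by (rule VHH.pure_finsum_right) (use e z in \<open>auto intro!: HH.pure_closed\<close>)
    finally show "(\<Oplus>\<^bsub>?T\<^esub>u\<in>words n. pure_tensor V (tensor H H) (e z) (pure_tensor H H (C z u) (C u w))) =
      tensor_map V (tensor H H) (\<lambda>x. x) \<Delta> (pure_tensor V H (e z) (C z w))" ..
  qed simp
  also have "\<dots> = tensor_map V (tensor H H) (\<lambda>x. x) \<Delta> (\<alpha> (e w))"
    unfolding \<alpha>e[OF w] by (rule lin_hom_finsum[OF VH.vect_tensor VHH.vect_tensor m2(1) pc, symmetric])
  finally show "tensor_assoc V H H (tensor_map (tensor V H) H \<alpha> (\<lambda>h. h) (\<alpha> (e w))) =
      tensor_map V (tensor H H) (\<lambda>x. x) \<Delta> (\<alpha> (e w))" .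
  interpret Vm: abelian_monoid V by (rule vect_abelian_monoid[OF V])
  note l = VH.tensor_lift_works[OF V counit_bilin[OF V]]
  have "tensor_lift V (\<lambda>x h. \<epsilon> h \<odot>\<^bsub>V\<^esub> x) (\<alpha> (e w)) = (\<Oplus>\<^bsub>V\<^esub>u\<in>words n. tensor_lift V (\<lambda>x h. \<epsilon> h \<odot>\<^bsub>V\<^esub> x) (pure_tensor V H (e u) (C u w)))"
    unfolding \<alpha>e[OF w] by (rule lin_hom_finsum[OF VH.vect_tensor V l(1) pc])
  also have "\<dots> = (\<Oplus>\<^bsub>V\<^esub>u\<in>words n. (if u = w then 1 else 0) \<odot>\<^bsub>V\<^esub> e u)"
    by (rule Vm.finsum_cong') (use e w V in \<open>auto simp: l(2) eps_C\<close>)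
  also have "\<dots> = e w" by (rule vect_finsum_delta[OF V]) (use w e in auto)
  finally show "tensor_lift V (\<lambda>x h. \<epsilon> h \<odot>\<^bsub>V\<^esub> x) (\<alpha> (e w)) = e w" .
qed

lemma right_comodule_reg: "right_comodule HE reg"
proof -
  note m1 = tensor_map_works[OF vect_H vect_H HH.vect_tensor vect_H Delta_lin_hom lin_hom_id]
  note m2 = tensor_map_works[OF vect_H vect_H vect_H HH.vect_tensor lin_hom_id Delta_lin_hom]
  note as = tensor_assoc_works[OF vect_H vect_H vect_H]
  note l = HH.tensor_lift_works[OF vect_H counit_bilin[OF vect_H]]
  have e: "C v w \<in> carrier H" for v w by simp
  have V: "vect reg" by (rule vect_cong[OF _ _ _ _ vect_H]) simp_all
  have 1: "tensor_assoc H H H (tensor_map (tensor H H) H \<Delta> (\<lambda>h. h) (\<Delta> x)) = tensor_map H (tensor H H) (\<lambda>x. x) \<Delta> (\<Delta> x)"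
    if "x \<in> carrier H" for x
  proof (rule H_induct_hom_eq[OF _ _ _ that])
    show "(\<lambda>x. tensor_assoc H H H (tensor_map (tensor H H) H \<Delta> (\<lambda>h. h) (\<Delta> x))) \<in> lin_hom H (tensor H (tensor H H))"
      by (intro lin_hom_comp[OF Delta_lin_hom lin_hom_comp[OF m1(1) as(1)]])
    show "(\<lambda>x. tensor_map H (tensor H H) (\<lambda>x. x) \<Delta> (\<Delta> x)) \<in> lin_hom H (tensor H (tensor H H))"
      by (intro lin_hom_comp[OF Delta_lin_hom m2(1)])
    show "tensor_assoc H H H (tensor_map (tensor H H) H \<Delta> (\<lambda>h. h) (\<Delta> (C v w))) =
        tensor_map H (tensor H H) (\<lambda>x. x) \<Delta> (\<Delta> (C v w))" if "length v = length w" for v w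
      by (rule matrix_coaction(1)[OF vect_H Delta_lin_hom, of "length v" "C v"])
         (use that in \<open>auto simp: Delta_C\<close>)
  qed
  have 2: "tensor_lift H (\<lambda>x h. \<epsilon> h \<odot>\<^bsub>H\<^esub> x) (\<Delta> x) = x" if "x \<in> carrier H" for x
  proof (rule H_induct_hom_eq[OF lin_hom_comp[OF Delta_lin_hom l(1)] lin_hom_id _ that])
    show "tensor_lift H (\<lambda>x h. \<epsilon> h \<odot>\<^bsub>H\<^esub> x) (\<Delta> (C v w)) = C v w" if "length v = length w" for v w
      by (rule matrix_coaction(2)[OF vect_H Delta_lin_hom, of "length v" "C v"])
         (use that in \<open>auto simp: Delta_C\<close>)
  qed
  show ?thesis unfolding right_comodule_def
    using V 1 2 by (simp add: lin_hom_HE Delta_lin_hom)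
qed

lemma hopf_algebra_HE: "hopf_algebra HE"
proof -
  interpret RH: ring H by (rule k_algebraD[OF k_algebra_H])
  have kH: "k_algebra HE" by (rule k_algebra_cong[OF _ _ _ _ _ _ k_algebra_H]) simp_all
  have b1: "HH.bilin H (\<lambda>x y. \<epsilon> x \<odot>\<^bsub>H\<^esub> y)"
    unfolding HH.bilin_def using vect_H lin_homD[OF eps_lin_hom]
    by (auto intro!: lin_homI simp: vect_smult_l_distr vect_smult_r_distr vect_smult_assoc mult.commute)
  have b2: "HH.bilin H (\<lambda>x y. S x \<otimes>\<^bsub>H\<^esub> y)" and b3: "HH.bilin H (\<lambda>x y. x \<otimes>\<^bsub>H\<^esub> S y)"
    unfolding HH.bilin_def using k_algebraD[OF k_algebra_H] lin_homD[OF S_lin_hom]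
    by (auto intro!: lin_homI simp: RH.r_distr RH.l_distr)
  note l1 = HH.tensor_lift_works[OF vect_H b1]
  note l2 = HH.tensor_lift_works[OF vect_H b2]
  note l3 = HH.tensor_lift_works[OF vect_H b3]
  have pc: "(\<lambda>m. pure_tensor H H (C v m) (C m w)) \<in> words n \<rightarrow> carrier (tensor H H)" for v w n
    by (auto intro!: HH.pure_closed)
  have 1: "tensor_lift H (\<lambda>x y. \<epsilon> x \<odot>\<^bsub>H\<^esub> y) (\<Delta> h) = h" if "h \<in> carrier H" for h
  proof (rule H_induct_hom_eq[OF lin_hom_comp[OF Delta_lin_hom l1(1)] lin_hom_id _ that])
    fix v w :: "'n list" assume vw: "length v = length w"
    have "tensor_lift H (\<lambda>x y. \<epsilon> x \<odot>\<^bsub>H\<^esub> y) (\<Delta> (C v w)) =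
        (\<Oplus>\<^bsub>H\<^esub>m\<in>words (length w). tensor_lift H (\<lambda>x y. \<epsilon> x \<odot>\<^bsub>H\<^esub> y) (pure_tensor H H (C v m) (C m w)))"
      unfolding Delta_C[OF vw] by (rule lin_hom_finsum[OF HH.vect_tensor vect_H l1(1) pc])
    also have "\<dots> = (\<Oplus>\<^bsub>H\<^esub>m\<in>words (length w). (if v = m then 1 else 0) \<odot>\<^bsub>H\<^esub> C m w)"
      by (rule RH.finsum_cong') (use vw vect_H in \<open>auto simp: l1(2) eps_C\<close>)
    also have "\<dots> = C v w" by (rule vect_finsum_delta(2)[OF vect_H]) (use vw in auto)
    finally show "tensor_lift H (\<lambda>x y. \<epsilon> x \<odot>\<^bsub>H\<^esub> y) (\<Delta> (C v w)) = C v w" .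
  qed
  have unit: "(\<lambda>h. \<epsilon> h \<odot>\<^bsub>H\<^esub> \<one>\<^bsub>H\<^esub>) \<in> lin_hom H H"
    using vect_H lin_homD[OF eps_lin_hom]
    by (auto intro!: lin_homI simp: vect_smult_l_distr vect_smult_assoc)
  have eC: "cls R (scl (if v = w then 1 else 0) 1) = \<epsilon> (C v w) \<odot>\<^bsub>H\<^esub> \<one>\<^bsub>H\<^esub>" if "length v = length w" for v w
    using that by (simp only: eps_C cls_scl H_eq cls_one)
  have 2: "tensor_lift H (\<lambda>x y. S x \<otimes>\<^bsub>H\<^esub> y) (\<Delta> h) = \<epsilon> h \<odot>\<^bsub>H\<^esub> \<one>\<^bsub>H\<^esub>" if "h \<in> carrier H" for h
  proof (rule H_induct_hom_eq[OF lin_hom_comp[OF Delta_lin_hom l2(1)] unit _ that])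
    fix v w :: "'n list" assume vw: "length v = length w"
    have "tensor_lift H (\<lambda>x y. S x \<otimes>\<^bsub>H\<^esub> y) (\<Delta> (C v w)) =
        (\<Oplus>\<^bsub>H\<^esub>m\<in>words (length w). tensor_lift H (\<lambda>x y. S x \<otimes>\<^bsub>H\<^esub> y) (pure_tensor H H (C v m) (C m w)))"
      unfolding Delta_C[OF vw] by (rule lin_hom_finsum[OF HH.vect_tensor vect_H l2(1) pc])
    also have "\<dots> = (\<Oplus>\<^bsub>H\<^esub>m\<in>words (length w). cls R (S_free (a_word v m) * a_word m w))"
      by (rule RH.finsum_cong') (auto simp: l2(2) S_cls cls_mult_H)
    also have "\<dots> = cls R (\<Sum>m\<in>words (length w). S_free (a_word v m) * a_word m w)"
      by (simp add: cls_sum H_eq)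
    also have "\<dots> = cls R (scl (if v = w then 1 else 0) 1)" by (rule cls_eqI[OF S_free_left[OF vw]])
    finally show "tensor_lift H (\<lambda>x y. S x \<otimes>\<^bsub>H\<^esub> y) (\<Delta> (C v w)) = \<epsilon> (C v w) \<odot>\<^bsub>H\<^esub> \<one>\<^bsub>H\<^esub>"
      by (simp only: eC[OF vw])
  qed
  have 3: "tensor_lift H (\<lambda>x y. x \<otimes>\<^bsub>H\<^esub> S y) (\<Delta> h) = \<epsilon> h \<odot>\<^bsub>H\<^esub> \<one>\<^bsub>H\<^esub>" if "h \<in> carrier H" for h
  proof (rule H_induct_hom_eq[OF lin_hom_comp[OF Delta_lin_hom l3(1)] unit _ that])
    fix v w :: "'n list" assume vw: "length v = length w"
    have "tensor_lift H (\<lambda>x y. x \<otimes>\<^bsub>H\<^esub> S y) (\<Delta> (C v w)) =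
        (\<Oplus>\<^bsub>H\<^esub>m\<in>words (length w). tensor_lift H (\<lambda>x y. x \<otimes>\<^bsub>H\<^esub> S y) (pure_tensor H H (C v m) (C m w)))"
      unfolding Delta_C[OF vw] by (rule lin_hom_finsum[OF HH.vect_tensor vect_H l3(1) pc])
    also have "\<dots> = (\<Oplus>\<^bsub>H\<^esub>m\<in>words (length w). cls R (a_word v m * S_free (a_word m w)))"
      by (rule RH.finsum_cong') (auto simp: l3(2) S_cls cls_mult_H)
    also have "\<dots> = cls R (\<Sum>m\<in>words (length w). a_word v m * S_free (a_word m w))"
      by (simp add: cls_sum H_eq)
    also have "\<dots> = cls R (scl (if v = w then 1 else 0) 1)" by (rule cls_eqI[OF S_free_right[OF vw]])
    finally show "tensor_lift H (\<lambda>x y. x \<otimes>\<^bsub>H\<^esub> S y) (\<Delta> (C v w)) = \<epsilon> (C v w) \<odot>\<^bsub>H\<^esub> \<one>\<^bsub>H\<^esub>"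
      by (simp only: eC[OF vw])
  qed
  show ?thesis unfolding hopf_algebra_def
    using kH right_comodule_reg 1 2 3 Delta_alg_hom eps_alg_hom S_lin_hom
    by (simp add: alg_hom_HE lin_hom_HE)
qed

end

context inv_matrix
begin

interpretation HH: two_algebras H H by (rule two_algebras.intro) (rule k_algebra_H)+

subsection \<open>The comodule algebra\<close>

context
  fixes t :: 'k
begin

abbreviation "RA \<equiv> A_rels (matrix_inv E) t"
abbreviation "A \<equiv> A_alg (matrix_inv E) t"
abbreviation "AE \<equiv> A_comodule E t"
abbreviation X :: "'n list \<Rightarrow> ('n list \<Rightarrow>\<^sub>0 'k) set" where "X w \<equiv> cls RA (Poly_Mapping.single w 1)"

lemma A_eq: "A = presented_algebra RA" by (simp add: A_alg_def)

definition arel :: "'n list \<Rightarrow>\<^sub>0 'k" where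
  "arel = (\<Sum>i\<in>UNIV. \<Sum>j\<in>UNIV. scl (\<omega> i j) (var i * var j)) - scl t 1"

lemma RA_eq: "RA = {arel}"
proof -
  have "const a * var i * var j = scl a (var i * var j :: 'n list \<Rightarrow>\<^sub>0 'k)" for a i j
    by (simp add: const_mult mult.assoc scl_mult_left)
  then show ?thesis by (simp add: A_rels_def arel_def const_scl)
qed

lemma arel_in: "arel \<in> gen_ideal RA" using gen_ideal_superset[of RA] by (simp add: RA_eq)

lemma vect_A: "vect A" and k_algebra_A: "k_algebra A"
  unfolding A_eq by (rule vect_presented k_algebra_presented)+

lemma A_closed [simp, intro]: "cls RA p \<in> carrier A"
  unfolding A_eq by (rule cls_closed)

lemma two_algebras_AH: "two_algebras A H"
  by (rule two_algebras.intro) (rule k_algebra_A k_algebra_H)+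

interpretation AH: two_algebras A H by (rule two_algebras_AH)

text \<open>
  The coaction on generators, lifted to the free algebras.
\<close>

definition alpha_free :: "'n \<Rightarrow> 'n list \<times> ('n \<times> 'n) list \<Rightarrow>\<^sub>0 'k" where
  "alpha_free i = (\<Sum>k\<in>UNIV. tens (var k) (var (k, i)))"

definition \<alpha> where
  "\<alpha> = induced_hom (tensor A H) (\<lambda>i. \<Oplus>\<^bsub>tensor A H\<^esub> k \<in> UNIV. pure_tensor A H (cls RA (var k)) (B_gen E k i))"

lemma alpha_gen: "(\<lambda>i. \<Oplus>\<^bsub>tensor A H\<^esub> k \<in> UNIV. pure_tensor A H (cls RA (var k)) (B_gen E k i)) = (\<lambda>i. tensor_proj RA R (alpha_free i))"
  by (simp add: fun_eq_iff alpha_free_def tensor_proj_sum tensor_proj_tens B_gen_eq H_eq A_eq)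

lemma tensor_proj_alpha_free_zero: "tensor_proj RA R (feval alpha_free arel) = \<zero>\<^bsub>tensor A H\<^esub>"
proof -
  let ?K = "{q. tensor_proj RA R q = \<zero>\<^bsub>tensor A H\<^esub>}"
  have K: "two_sided_ideal ?K" unfolding H_eq A_eq by (rule tensor_proj_kernel_two_sided_ideal)
  have tK: "p \<in> gen_ideal RA \<Longrightarrow> tens p q \<in> ?K" "q \<in> gen_ideal R \<Longrightarrow> tens p q \<in> ?K" for p q
    by (simp_all add: tens_in_tensor_proj_kernel H_eq A_eq)
  have G: "feval alpha_free (var i) = (\<Sum>k\<in>UNIV. tens (var k) (var (k, i)))" for i
    by (simp add: feval_var alpha_free_def)
  have one: "feval alpha_free 1 = tens 1 1" using feval_const[of alpha_free 1] by (simp add: const_one tens_one)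
  have "feval alpha_free arel = (\<Sum>k\<in>UNIV. \<Sum>l\<in>UNIV. tens (var k * var l) (\<sigma> k l)) + tens arel 1"
    unfolding arel_def feval_linear feval_mult G omega_tens one tens_minus_left tens_scl_left
    by (simp add: algebra_simps)
  also have "\<dots> \<in> ?K"
    by (intro tidealD(2)[OF K] tidealD(7)[OF K] tK(1)[OF arel_in] tK(2)[OF sigma_in])
  finally show ?thesis by simp
qed

lemma alpha_works:
  shows alpha_cls: "\<alpha> (cls RA p) = tensor_proj RA R (feval alpha_free p)"
    and alpha_alg_hom: "\<alpha> \<in> alg_hom A (tensor A H)"
proof -
  note w = induced_hom_works[OF AH.k_algebra_tensor, of "\<lambda>x. tensor_proj RA R (alpha_free x)" RA]
  have c: "tensor_proj RA R p \<in> carrier (tensor A H)" for p unfolding H_eq A_eq by (rule tensor_proj_hom)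
  have z: "lin_ext (tensor A H) (word_prod (tensor A H) (\<lambda>x. tensor_proj RA R (alpha_free x))) r = \<zero>\<^bsub>tensor A H\<^esub>" if "r \<in> RA" for r
    using tensor_proj_alpha_free_zero that tensor_proj_feval[of RA R alpha_free r] by (simp add: H_eq A_eq RA_eq)
  show "\<alpha> (cls RA p) = tensor_proj RA R (feval alpha_free p)"
  proof -
    have "\<alpha> (cls RA p) = lin_ext (tensor A H) (word_prod (tensor A H) (\<lambda>x. tensor_proj RA R (alpha_free x))) p"
      unfolding \<alpha>_def alpha_gen by (rule w(1)[OF c z])
    then show ?thesis using tensor_proj_feval[of RA R alpha_free p] by (simp add: H_eq A_eq)
  qed
  show "\<alpha> \<in> alg_hom A (tensor A H)"
    using w(2)[OF c z] unfolding \<alpha>_def alpha_gen by (simp add: H_eq A_eq)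
qed

lemma alpha_lin_hom: "\<alpha> \<in> lin_hom A (tensor A H)"
  using alpha_alg_hom by (simp add: alg_hom_def)

lemma prod_list_alpha_free: "prod_list (map alpha_free w) = (\<Sum>u\<in>words (length w). tens (Poly_Mapping.single u 1) (a_word u w))"
proof (induction w)
  case Nil
  show ?case by (simp add: a_word_Nil zero_list_def zero_prod_def a_word_def flip: single_one)
next
  case (Cons x w)
  have "var k * Poly_Mapping.single u 1 = Poly_Mapping.single (k # u) (1::'k)" for k :: 'n and u
    by (simp add: var_def mult_single plus_list_def)
  with Cons show ?case
    by (simp add: alpha_free_def sum_product sum_words_Suc tens_mult a_word_Cons del: tens_single)
qed

lemma alpha_X: "\<alpha> (X w) = (\<Oplus>\<^bsub>tensor A H\<^esub>u\<in>words (length w). pure_tensor A H (X u) (C u w))"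
proof -
  have "\<alpha> (X w) = tensor_proj RA R (\<Sum>u\<in>words (length w). tens (Poly_Mapping.single u 1) (a_word u w))"
    by (simp add: alpha_cls feval_linear prod_list_alpha_free)
  then show ?thesis by (simp only: tensor_proj_sum[OF finite_words] tensor_proj_tens H_eq A_eq)
qed

lemma AE_simps [simp]:
  "carrier AE = carrier A" "mult AE = mult A" "one AE = one A" "zero AE = zero A" "add AE = add A"
  "smult AE = smult A" "coaction AE = \<alpha>"
  by (simp_all add: A_comodule_def Let_def module.defs comodule.defs \<alpha>_def)

lemma tensor_AE [simp]: "tensor AE W = tensor A W" "pure_tensor AE W = pure_tensor A W"
  by (rule tensor_cong; simp)+

lemma lift_AE [simp]: "tensor_lift AE f = tensor_lift A f"
  by (rule tensor_lift_cong) simp_all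

lemma map_AE [simp]: "tensor_map AE W = tensor_map A W"
  by (simp add: fun_eq_iff tensor_map_def)

lemma assoc_AE [simp]: "tensor_assoc AE V W = tensor_assoc A V W"
  by (simp add: fun_eq_iff tensor_assoc_def)

lemma lin_hom_AE: "lin_hom AE U = lin_hom A U" "lin_hom U AE = lin_hom U A"
  by (simp_all add: lin_hom_def)

lemma vect_AE: "vect AE" by (rule vect_cong[OF _ _ _ _ vect_A]) simp_all

lemma A_induct_hom_eq:
  assumes "f \<in> lin_hom A U" "g \<in> lin_hom A U" "\<And>w. f (X w) = g (X w)" "x \<in> carrier A"
  shows "f x = g x"
  by (rule presented_lin_hom_eq[of f RA U g]) (use assms in \<open>simp_all flip: A_eq\<close>)

lemma right_comodule_AE: "right_comodule HE AE"
proof -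
  note m1 = tensor_map_works[OF vect_A vect_H AH.vect_tensor vect_H alpha_lin_hom lin_hom_id]
  note m2 = tensor_map_works[OF vect_A vect_H vect_A HH.vect_tensor lin_hom_id Delta_lin_hom]
  note as = tensor_assoc_works[OF vect_A vect_H vect_H]
  note l = AH.tensor_lift_works[OF vect_A counit_bilin[OF vect_A]]
  have 1: "tensor_assoc A H H (tensor_map (tensor A H) H \<alpha> (\<lambda>h. h) (\<alpha> x)) = tensor_map A (tensor H H) (\<lambda>x. x) \<Delta> (\<alpha> x)"
    if "x \<in> carrier A" for x
  proof (rule A_induct_hom_eq[OF _ _ _ that])
    show "(\<lambda>x. tensor_assoc A H H (tensor_map (tensor A H) H \<alpha> (\<lambda>h. h) (\<alpha> x))) \<in> lin_hom A (tensor A (tensor H H))"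
      by (intro lin_hom_comp[OF alpha_lin_hom lin_hom_comp[OF m1(1) as(1)]])
    show "(\<lambda>x. tensor_map A (tensor H H) (\<lambda>x. x) \<Delta> (\<alpha> x)) \<in> lin_hom A (tensor A (tensor H H))"
      by (intro lin_hom_comp[OF alpha_lin_hom m2(1)])
    show "tensor_assoc A H H (tensor_map (tensor A H) H \<alpha> (\<lambda>h. h) (\<alpha> (X w))) =
        tensor_map A (tensor H H) (\<lambda>x. x) \<Delta> (\<alpha> (X w))" for w
      by (rule matrix_coaction(1)[OF vect_A alpha_lin_hom, of "length w" X]) (auto simp: alpha_X)
  qed
  have 2: "tensor_lift A (\<lambda>x h. \<epsilon> h \<odot>\<^bsub>A\<^esub> x) (\<alpha> x) = x" if "x \<in> carrier A" for x
  proof (rule A_induct_hom_eq[OF lin_hom_comp[OF alpha_lin_hom l(1)] lin_hom_id _ that])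
    show "tensor_lift A (\<lambda>x h. \<epsilon> h \<odot>\<^bsub>A\<^esub> x) (\<alpha> (X w)) = X w" for w
      by (rule matrix_coaction(2)[OF vect_A alpha_lin_hom, of "length w" X]) (auto simp: alpha_X)
  qed
  show ?thesis unfolding right_comodule_def
    using vect_AE 1 2 by (simp add: lin_hom_AE alpha_lin_hom)
qed

lemma right_comodule_algebra_AE: "right_comodule_algebra HE AE"
proof -
  have "k_algebra AE" by (rule k_algebra_cong[OF _ _ _ _ _ _ k_algebra_A]) simp_all
  then show ?thesis unfolding right_comodule_algebra_def
    using right_comodule_AE alpha_alg_hom by (simp add: alg_hom_def lin_hom_AE ring_hom_def)
qed

end

end

section \<open>Direct sums of simple submodules\<close>

text \<open>
  Independence and sum of a family of subspaces, by finite subfamilies; together they amount to an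
  internal direct sum (\<open>direct_sum_ofI\<close>).
\<close>

definition indep :: "('k::field, 'v, 'm) module_scheme \<Rightarrow> 'v set set \<Rightarrow> bool" where
  "indep V \<S> \<longleftrightarrow> (\<forall>F f. finite F \<longrightarrow> F \<subseteq> \<S> \<longrightarrow> (\<forall>S\<in>F. f S \<in> S) \<longrightarrow> finsum V f F = \<zero>\<^bsub>V\<^esub> \<longrightarrow> (\<forall>S\<in>F. f S = \<zero>\<^bsub>V\<^esub>))"

definition ssum :: "('k::field, 'v, 'm) module_scheme \<Rightarrow> 'v set set \<Rightarrow> 'v set" where
  "ssum V \<S> = {v. \<exists>F f. finite F \<and> F \<subseteq> \<S> \<and> (\<forall>S\<in>F. f S \<in> S) \<and> v = finsum V f F}"

lemma indepD: "indep V \<S> \<Longrightarrow> finite F \<Longrightarrow> F \<subseteq> \<S> \<Longrightarrow> (\<And>S. S \<in> F \<Longrightarrow> f S \<in> S) \<Longrightarrow> finsum V f F = \<zero>\<^bsub>V\<^esub> \<Longrightarrow>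
    S \<in> F \<Longrightarrow> f S = \<zero>\<^bsub>V\<^esub>"
  unfolding indep_def by blast

lemma submodule_ssum:
  assumes V: "vect V" and sub: "\<And>S. S \<in> \<S> \<Longrightarrow> submodule S base V"
  shows "submodule (ssum V \<S>) base V"
proof -
  interpret abelian_group V using V by (rule vect_abelian_group)
  note subD = submoduleD[OF V sub]
  show ?thesis unfolding submodule_base_iff[OF V]
  proof (intro conjI ballI allI subsetI)
    fix x assume "x \<in> ssum V \<S>"
    then obtain F f where F: "finite F" "F \<subseteq> \<S>" "\<forall>S\<in>F. f S \<in> S" "x = finsum V f F" by (auto simp: ssum_def)
    have fc: "f \<in> F \<rightarrow> carrier V" using F subD(1) by blast
    then show "x \<in> carrier V" using F(4) V by auto
    { fix c
      have "c \<odot>\<^bsub>V\<^esub> x = finsum V (\<lambda>S. c \<odot>\<^bsub>V\<^esub> f S) F"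
        unfolding F(4) by (rule lin_hom_finsum[OF V V lin_hom_smult[OF V lin_hom_id] fc])
      moreover have "\<forall>S\<in>F. c \<odot>\<^bsub>V\<^esub> f S \<in> S" using F subD(4) by blast
      ultimately show "c \<odot>\<^bsub>V\<^esub> x \<in> ssum V \<S>" unfolding ssum_def using F(1,2)
        by (intro CollectI exI[of _ F] exI[of _ "\<lambda>S. c \<odot>\<^bsub>V\<^esub> f S"]) simp }
    fix y assume "y \<in> ssum V \<S>"
    then obtain F' g where F': "finite F'" "F' \<subseteq> \<S>" "\<forall>S\<in>F'. g S \<in> S" "y = finsum V g F'" by (auto simp: ssum_def)
    have gc: "g \<in> F' \<rightarrow> carrier V" using F' subD(1) by blast
    let ?f = "\<lambda>S. if S \<in> F then f S else \<zero>\<^bsub>V\<^esub>" and ?g = "\<lambda>S. if S \<in> F' then g S else \<zero>\<^bsub>V\<^esub>"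
    have "finsum V f F = finsum V ?f (F \<union> F')" by (rule finsum_extend[OF V]) (use F F' fc in auto)
    moreover have "finsum V g F' = finsum V ?g (F \<union> F')" by (rule finsum_extend[OF V]) (use F F' gc in auto)
    moreover have "finsum V (\<lambda>S. ?f S \<oplus>\<^bsub>V\<^esub> ?g S) (F \<union> F') = finsum V ?f (F \<union> F') \<oplus>\<^bsub>V\<^esub> finsum V ?g (F \<union> F')"
      by (rule finsum_addf) (use fc gc V in auto)
    moreover have "\<forall>S\<in>F \<union> F'. ?f S \<oplus>\<^bsub>V\<^esub> ?g S \<in> S"
    proof
      fix S assume S: "S \<in> F \<union> F'"
      then have "S \<in> \<S>" using F F' by auto
      then show "?f S \<oplus>\<^bsub>V\<^esub> ?g S \<in> S" using S F(3) F'(3) by (intro subD(3)) (auto intro: subD(2))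
    qed
    ultimately show "x \<oplus>\<^bsub>V\<^esub> y \<in> ssum V \<S>" unfolding ssum_def using F F'
      by (intro CollectI exI[of _ "F \<union> F'"] exI[of _ "\<lambda>S. ?f S \<oplus>\<^bsub>V\<^esub> ?g S"]) simp
  next
    show "\<zero>\<^bsub>V\<^esub> \<in> ssum V \<S>" unfolding ssum_def by (intro CollectI exI[of _ "{}"]) simp
  qed
qed

lemma ssum_superset:
  assumes V: "vect V" and S: "S \<in> \<S>" "submodule S base V"
  shows "S \<subseteq> ssum V \<S>"
proof
  fix x assume x: "x \<in> S"
  interpret abelian_group V using V by (rule vect_abelian_group)
  have "x \<in> carrier V" using submoduleD(1)[OF V S(2)] x by auto
  then have "finsum V (\<lambda>_. x) {S} = x" by (simp add: finsum_insert)
  then show "x \<in> ssum V \<S>" unfolding ssum_def using x S(1)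
    by (intro CollectI exI[of _ "{S}"] exI[of _ "\<lambda>_. x"]) simp
qed

lemma direct_sum_ofI:
  assumes V: "vect V" and sub: "\<And>S. S \<in> \<S> \<Longrightarrow> submodule S base V" and ind: "indep V \<S>"
    and span: "carrier V \<subseteq> ssum V \<S>"
  shows "direct_sum_of V \<S>"
  unfolding direct_sum_of_def
proof (intro conjI ballI)
  interpret abelian_group V using V by (rule vect_abelian_group)
  note subD = submoduleD[OF V sub]
  show "submodule S base V" if "S \<in> \<S>" for S by (rule sub[OF that])
  fix v assume "v \<in> carrier V"
  then obtain F f where F: "finite F" "F \<subseteq> \<S>" "\<forall>S\<in>F. f S \<in> S" "v = finsum V f F"
    using span by (auto simp: ssum_def)
  let ?P = "\<lambda>f. f \<in> (\<Pi>\<^sub>E S\<in>\<S>. S) \<and> finite {S \<in> \<S>. f S \<noteq> \<zero>\<^bsub>V\<^esub>} \<and> v = (\<Oplus>\<^bsub>V\<^esub>S\<in>{S \<in> \<S>. f S \<noteq> \<zero>\<^bsub>V\<^esub>}. f S)"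
  show "\<exists>!f. ?P f"
  proof (rule ex_ex1I)
    let ?f = "\<lambda>S\<in>\<S>. if S \<in> F then f S else \<zero>\<^bsub>V\<^esub>"
    have s: "{S \<in> \<S>. ?f S \<noteq> \<zero>\<^bsub>V\<^esub>} \<subseteq> F" by (auto split: if_splits)
    have fc: "f S \<in> carrier V" if "S \<in> F" for S using F that subD(1) by blast
    have "finsum V ?f {S \<in> \<S>. ?f S \<noteq> \<zero>\<^bsub>V\<^esub>} = finsum V f F"
      by (rule add.finprod_mono_neutral_cong_left) (use F fc s in \<open>auto simp: Pi_iff\<close>)
    moreover have "?f \<in> (\<Pi>\<^sub>E S\<in>\<S>. S)" using F(3) by (auto intro: subD(2))
    ultimately have "?P ?f" using F(1,4) s finite_subset by (auto simp del: restrict_apply)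
    then show "\<exists>f. ?P f" by blast
  next
    fix f g assume f: "?P f" and g: "?P g"
    let ?D = "{S \<in> \<S>. f S \<noteq> \<zero>\<^bsub>V\<^esub>} \<union> {S \<in> \<S>. g S \<noteq> \<zero>\<^bsub>V\<^esub>}"
    have D: "finite ?D" "?D \<subseteq> \<S>" using f g by auto
    have fg: "f S \<in> S" "g S \<in> S" if "S \<in> \<S>" for S using f g that by (auto simp: PiE_iff)
    have c: "f \<in> ?D \<rightarrow> carrier V" "g \<in> ?D \<rightarrow> carrier V" using fg subD(1) by blast+
    have "finsum V f {S \<in> \<S>. f S \<noteq> \<zero>\<^bsub>V\<^esub>} = finsum V f ?D"
      by (rule add.finprod_mono_neutral_cong_left) (use D c in auto)
    moreover have "finsum V g {S \<in> \<S>. g S \<noteq> \<zero>\<^bsub>V\<^esub>} = finsum V g ?D"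
      by (rule add.finprod_mono_neutral_cong_left) (use D c in auto)
    ultimately have e: "finsum V f ?D = v" "finsum V g ?D = v" using f g by auto
    have vc: "v \<in> carrier V" using e(1) c V by auto
    have "finsum V (\<lambda>S. f S \<oplus>\<^bsub>V\<^esub> ((-1) \<odot>\<^bsub>V\<^esub> g S)) ?D = finsum V f ?D \<oplus>\<^bsub>V\<^esub> finsum V (\<lambda>S. (-1) \<odot>\<^bsub>V\<^esub> g S) ?D"
      by (rule finsum_addf) (use c V in auto)
    also have "finsum V (\<lambda>S. (-1) \<odot>\<^bsub>V\<^esub> g S) ?D = (-1) \<odot>\<^bsub>V\<^esub> finsum V g ?D"
      by (rule lin_hom_finsum[OF V V lin_hom_smult[OF V lin_hom_id] c(2), symmetric])
    also have "finsum V f ?D \<oplus>\<^bsub>V\<^esub> (-1) \<odot>\<^bsub>V\<^esub> finsum V g ?D = \<zero>\<^bsub>V\<^esub>"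
      unfolding e using vect_a_inv[OF V vc] V vc by (metis vect_r_neg)
    finally have z: "finsum V (\<lambda>S. f S \<oplus>\<^bsub>V\<^esub> ((-1) \<odot>\<^bsub>V\<^esub> g S)) ?D = \<zero>\<^bsub>V\<^esub>" .
    have "f S = g S" if "S \<in> ?D" for S
    proof -
      have m: "f S \<oplus>\<^bsub>V\<^esub> ((-1) \<odot>\<^bsub>V\<^esub> g S) \<in> S" if "S \<in> ?D" for S
        using that fg subD(3,4) by blast
      have "f S \<oplus>\<^bsub>V\<^esub> ((-1) \<odot>\<^bsub>V\<^esub> g S) = \<zero>\<^bsub>V\<^esub>"
        by (rule indepD[OF ind D, of "\<lambda>S. f S \<oplus>\<^bsub>V\<^esub> ((-1) \<odot>\<^bsub>V\<^esub> g S)", OF m z that])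
      moreover have "f S \<in> carrier V" "g S \<in> carrier V" using c that by auto
      ultimately show ?thesis using vect_a_inv[OF V] minus_equality r_neg
        by (metis V a_inv_closed minus_minus)
    qed
    then have "f S = g S" if "S \<in> \<S>" for S using that by (cases "f S = g S") (auto, metis)
    then show "f = g" using f g
      by (intro PiE_ext[of f \<S> "\<lambda>S. S" g]) auto
  qed
qed

text \<open>
  Take a maximal independent subfamily, by Zorn's lemma. Its sum is stable under the operators, so that
  it either contains or meets in zero any given member of the family; the latter contradicts
  maximality.
\<close>

lemma direct_sum_exists:
  assumes V: "vect V" and ops: "\<And>f. f \<in> Ops \<Longrightarrow> f \<in> lin_hom V V"
    and sub: "\<And>G. G \<in> \<G> \<Longrightarrow> submodule G base V"
    and stable: "\<And>G f x. G \<in> \<G> \<Longrightarrow> f \<in> Ops \<Longrightarrow> x \<in> G \<Longrightarrow> f x \<in> G"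
    and nz: "\<And>G. G \<in> \<G> \<Longrightarrow> G \<noteq> {\<zero>\<^bsub>V\<^esub>}"
    and simple: "\<And>G T. G \<in> \<G> \<Longrightarrow> T \<subseteq> G \<Longrightarrow> submodule T base V \<Longrightarrow> (\<And>f x. f \<in> Ops \<Longrightarrow> x \<in> T \<Longrightarrow> f x \<in> T) \<Longrightarrow>
        T = {\<zero>\<^bsub>V\<^esub>} \<or> T = G"
    and span: "\<And>M. submodule M base V \<Longrightarrow> (\<And>G. G \<in> \<G> \<Longrightarrow> G \<subseteq> M) \<Longrightarrow> carrier V \<subseteq> M"
  shows "\<exists>\<S>\<subseteq>\<G>. direct_sum_of V \<S>"
proof -
  interpret abelian_group V using V by (rule vect_abelian_group)
  let ?A = "{\<S>. \<S> \<subseteq> \<G> \<and> indep V \<S>}"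
  have "\<exists>M\<in>?A. \<forall>X\<in>?A. M \<subseteq> X \<longrightarrow> X = M"
  proof (rule subset_Zorn')
    fix Ch assume Ch: "subset.chain ?A Ch"
    show "\<Union>Ch \<in> ?A"
    proof (cases "Ch = {}")
      case True
      then show ?thesis by (auto simp: indep_def)
    next
      case False
      have "\<forall>S\<in>F. f S = \<zero>\<^bsub>V\<^esub>" if "finite F" "F \<subseteq> \<Union>Ch" "\<forall>S\<in>F. f S \<in> S" "finsum V f F = \<zero>\<^bsub>V\<^esub>" for F f
      proof -
        note F = that
        obtain \<S> where S: "\<S> \<in> Ch" "F \<subseteq> \<S>"
          using finite_subset_Union_chain[OF F(1,2) False Ch] by blast
        then have "indep V \<S>" using Ch by (auto simp: subset.chain_def)
        with S show ?thesis using F unfolding indep_def by blast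
      qed
      then show ?thesis using Ch by (auto simp: indep_def subset.chain_def)
    qed
  qed
  then obtain \<S> where "\<S> \<in> ?A" and mx: "\<forall>X\<in>?A. \<S> \<subseteq> X \<longrightarrow> X = \<S>" by (elim bexE)
  then have S: "\<S> \<subseteq> \<G>" "indep V \<S>" by simp_all
  have max: "X \<subseteq> \<G> \<Longrightarrow> indep V X \<Longrightarrow> \<S> \<subseteq> X \<Longrightarrow> X = \<S>" for X using mx by simp
  have subS: "S \<in> \<S> \<Longrightarrow> submodule S base V" for S using S(1) sub by blast
  let ?M = "ssum V \<S>"
  note M = submodule_ssum[OF V subS]
  have Mst: "f x \<in> ?M" if f: "f \<in> Ops" and x: "x \<in> ?M" for f x
  proof -
    obtain F g where F: "finite F" "F \<subseteq> \<S>" "\<forall>S\<in>F. g S \<in> S" "x = finsum V g F" using x by (auto simp: ssum_def)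
    have gc: "g \<in> F \<rightarrow> carrier V"
    proof
      fix S assume "S \<in> F"
      then have "S \<in> \<S>" "g S \<in> S" using F(2,3) by auto
      then show "g S \<in> carrier V" using submoduleD(1)[OF V subS] by blast
    qed
    have "f x = finsum V (\<lambda>S. f (g S)) F" unfolding F(4) by (rule lin_hom_finsum[OF V V ops[OF f] gc])
    moreover have "\<forall>S\<in>F. f (g S) \<in> S"
    proof
      fix S' assume "S' \<in> F"
      then have "S' \<in> \<G>" "g S' \<in> S'" using F(2,3) S(1) by auto
      then show "f (g S') \<in> S'" by (intro stable[OF _ f])
    qed
    ultimately show ?thesis unfolding ssum_def using F(1,2)
      by (intro CollectI exI[of _ F] exI[of _ "\<lambda>S. f (g S)"]) simp
  qed
  have "G \<subseteq> ?M" if G: "G \<in> \<G>" for G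
  proof -
    have "G \<inter> ?M = {\<zero>\<^bsub>V\<^esub>} \<or> G \<inter> ?M = G"
      by (rule simple[OF G _ submodule_Int[OF V sub[OF G] M]]) (use Mst stable[OF G] in auto)
    moreover have "G \<inter> ?M \<noteq> {\<zero>\<^bsub>V\<^esub>}"
    proof
      assume z: "G \<inter> ?M = {\<zero>\<^bsub>V\<^esub>}"
      \<comment> \<open>In a relation involving \<open>G\<close> the component in \<open>G\<close> lies in the sum of the other subspaces.\<close>
      have "indep V (insert G \<S>)" unfolding indep_def
      proof (intro allI impI)
        fix F f assume F: "finite F" "F \<subseteq> insert G \<S>" "\<forall>S\<in>F. f S \<in> S" "finsum V f F = \<zero>\<^bsub>V\<^esub>"
        have fc: "f S \<in> carrier V" if "S \<in> F" for S
        proof -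
          have "S \<in> \<G>" using F(2) S(1) G that by auto
          then show ?thesis using F(3) that submoduleD(1)[OF V sub] by blast
        qed
        show "\<forall>S\<in>F. f S = \<zero>\<^bsub>V\<^esub>"
        proof (cases "G \<in> F")
          case False
          then have "F \<subseteq> \<S>" using F(2) by auto
          then show ?thesis using S(2) F unfolding indep_def by blast
        next
          case True
          let ?F = "F - {G}"
          have F0: "finite ?F" "?F \<subseteq> \<S>" "\<forall>S\<in>?F. f S \<in> S" using F by auto
          have s: "finsum V f ?F \<in> ?M" unfolding ssum_def using F0
            by (intro CollectI exI[of _ ?F] exI[of _ f]) simp
          have sc: "finsum V f ?F \<in> carrier V" using submoduleD(1)[OF V M] s by blast
          have "finsum V f (insert G ?F) = f G \<oplus>\<^bsub>V\<^esub> finsum V f ?F"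
            by (rule finsum_insert) (use F(1) fc True in auto)
          then have e: "f G \<oplus>\<^bsub>V\<^esub> finsum V f ?F = \<zero>\<^bsub>V\<^esub>" using F(4) True by (simp add: insert_absorb)
          then have "f G = \<ominus>\<^bsub>V\<^esub> finsum V f ?F"
            using fc[OF True] sc by (metis minus_equality)
          then have "f G \<in> ?M" using submoduleD(5)[OF V M s] by simp
          then have "f G \<in> G \<inter> ?M" using F(3) True by auto
          then have 0: "f G = \<zero>\<^bsub>V\<^esub>" using z by auto
          with e sc have "finsum V f ?F = \<zero>\<^bsub>V\<^esub>" by simp
          then have "\<forall>S\<in>?F. f S = \<zero>\<^bsub>V\<^esub>" using S(2) F0 unfolding indep_def by blast
          with 0 show ?thesis by auto
        qed
      qed
      then have "insert G \<S> = \<S>" using max[of "insert G \<S>"] S(1) G by auto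
      then have "G \<subseteq> ?M" using ssum_superset[OF V _ sub[OF G]] by auto
      then show False using z nz[OF G] by auto
    qed
    ultimately show "G \<subseteq> ?M" by auto
  qed
  then have "carrier V \<subseteq> ?M" by (intro span[OF M]) auto
  then show ?thesis using direct_sum_ofI[OF V subS S(2)] S(1) by blast
qed

section \<open>Comodules as modules over functionals\<close>

lemma sum_words_le: "(\<Sum>u\<in>words_le N. f u) = (\<Sum>j\<le>N. \<Sum>u\<in>(words j :: 'n::finite list set). f u)"
proof -
  have "(words_le N :: 'n list set) = (\<Union>j\<in>{..N}. words j)" by auto
  then show ?thesis by (simp only:) (rule sum.UNION_disjoint, auto)
qed

text \<open>
  The map \<open>id \<otimes> \<phi>\<close>.
\<close>

definition contract :: "('k::field, 'v, 'm) module_scheme \<Rightarrow> ('h \<Rightarrow> 'k) \<Rightarrow> ('v \<times> 'h \<Rightarrow>\<^sub>0 'k) set \<Rightarrow> 'v" where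
  "contract V \<phi> = tensor_lift V (\<lambda>x h. \<phi> h \<odot>\<^bsub>V\<^esub> x)"

text \<open>
  A right comodule is a left module over the algebra of functionals.
\<close>

definition act_by :: "('k::field, 'h, 'v) comodule \<Rightarrow> ('h \<Rightarrow> 'k) \<Rightarrow> 'v \<Rightarrow> 'v" where
  "act_by W \<phi> x = contract W \<phi> (coaction W x)"

lemma contract_works:
  assumes V: "vect V" and H: "vect H" and \<phi>: "\<phi> \<in> lin_hom H base"
  shows contract_lin_hom: "contract V \<phi> \<in> lin_hom (tensor V H) V"
    and contract_pure: "x \<in> carrier V \<Longrightarrow> h \<in> carrier H \<Longrightarrow> contract V \<phi> (pure_tensor V H x h) = \<phi> h \<odot>\<^bsub>V\<^esub> x"
proof -
  interpret two_vects V H by (rule two_vects.intro) fact+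
  have "bilin V (\<lambda>x h. \<phi> h \<odot>\<^bsub>V\<^esub> x)"
    unfolding bilin_def using V lin_homD[OF \<phi>]
    by (auto intro!: lin_homI simp: vect_smult_l_distr vect_smult_r_distr vect_smult_assoc mult.commute)
  from tensor_lift_works[OF V this]
  show "contract V \<phi> \<in> lin_hom (tensor V H) V"
    "x \<in> carrier V \<Longrightarrow> h \<in> carrier H \<Longrightarrow> contract V \<phi> (pure_tensor V H x h) = \<phi> h \<odot>\<^bsub>V\<^esub> x"
    by (simp_all add: contract_def)
qed

lemma contract_tensor_map:
  assumes V: "vect V" and U: "vect U" and H: "vect H" and f: "f \<in> lin_hom V U" and \<phi>: "\<phi> \<in> lin_hom H base"
    and z: "z \<in> carrier (tensor V H)"
  shows "contract U \<phi> (tensor_map U H f (\<lambda>h. h) z) = f (contract V \<phi> z)"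
proof -
  interpret two_vects V H by (rule two_vects.intro) fact+
  note cV = contract_works[OF V H \<phi>] and cU = contract_works[OF U H \<phi>]
  note m = tensor_map_works[OF V H U H f lin_hom_id]
  show ?thesis
    by (rule tensor_lin_hom_eq[OF lin_hom_comp[OF m(1) cU(1)] lin_hom_comp[OF cV(1) f] _ z])
       (simp add: m(2) cU(2) cV(2) lin_homD[OF f])
qed

locale model = inv_matrix E + quantum_form "\<lambda>a b. E $ a $ b" "\<lambda>a b. matrix_inv E $ a $ b" c
  for E :: "'k::field^'n::finite^'n" and c :: "nat \<Rightarrow> 'k"
begin

interpretation dual: quantum_form "\<lambda>a b. matrix_inv E $ a $ b" "\<lambda>a b. E $ a $ b" c by (rule dual)
interpretation HH: two_algebras H H by (rule two_algebras.intro) (rule k_algebra_H)+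

subsection \<open>Functionals on the Hopf algebra\<close>

definition pw_poly :: "(('n \<times> 'n) list \<Rightarrow>\<^sub>0 'k) \<Rightarrow> 'n list \<Rightarrow> 'n list \<Rightarrow> 'k" where
  "pw_poly p u' u = ksum (\<lambda>b. pw_coef b u' u) p"

lemma pw_poly_linear: "pw_poly (p + q) u' u = pw_poly p u' u + pw_poly q u' u" "pw_poly (p - q) u' u = pw_poly p u' u - pw_poly q u' u"
  "pw_poly (scl a p) u' u = a * pw_poly p u' u" "pw_poly (sum f I) u' u = (\<Sum>i\<in>I. pw_poly (f i) u' u)" "pw_poly 0 u' u = 0"
  "pw_poly (Poly_Mapping.single b a) u' u = a * pw_coef b u' u"
  by (simp_all add: pw_poly_def ksum_add ksum_minus ksum_scl ksum_sum)

lemma pw_poly_expand: "pw_poly p = (\<lambda>u' u. \<Sum>b\<in>Poly_Mapping.keys p. Poly_Mapping.lookup p b * pw_coef b u' u)"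
  by (simp add: pw_poly_def ksum_def fun_eq_iff)

lemma bi_capfree_pw_poly: "bi_capfree (pw_poly p)"
  unfolding bi_capfree_def pw_poly_expand
proof (intro conjI allI)
  show "balanced (\<lambda>u' u. \<Sum>b\<in>Poly_Mapping.keys p. Poly_Mapping.lookup p b * pw_coef b u' u)"
    by (simp add: balanced_def pw_coef_balanced)
  show "capfree (\<lambda>u. \<Sum>b\<in>Poly_Mapping.keys p. Poly_Mapping.lookup p b * pw_coef b u' u)" for u'
    by (rule capfree_lin) (use bi_capfree_pw_coef in \<open>simp add: bi_capfree_def\<close>)
  show "dual.capfree (\<lambda>u'. \<Sum>b\<in>Poly_Mapping.keys p. Poly_Mapping.lookup p b * pw_coef b u' u)" for u
    by (rule dual.capfree_lin) (use bi_capfree_pw_coef in \<open>simp add: bi_capfree_def\<close>)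
qed

lemma var_times: "var x * p = (\<Sum>b\<in>Poly_Mapping.keys p. Poly_Mapping.single (x # b) (Poly_Mapping.lookup p b))"
  by (subst poly_mapping_expand[of p]) (simp add: sum_distrib_left var_def mult_single plus_list_def)

lemma pw_poly_var: "pw_poly (var x * p) u' u = gen_op (fst x) (snd x) (pw_poly p) u' u"
  unfolding pw_poly_expand[of p] gen_op_lin by (simp add: var_times pw_poly_linear)

lemma single_Cons: "Poly_Mapping.single (x # b) a = var x * Poly_Mapping.single b (a :: 'k)"
  by (simp add: var_def mult_single plus_list_def)

lemma pw_poly_left:
  assumes "\<And>u' u. pw_poly p u' u = 0" shows "pw_poly (q * p) u' u = 0"
proof (induction q arbitrary: u' u rule: poly_mapping_single_induct)
  case (single b a)
  show ?case
  proof (induction b arbitrary: u' u)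
    case Nil
    have "Poly_Mapping.single [] a * p = scl a p" using const_mult[of a p] by (simp add: const_def)
    then show ?case by (simp add: pw_poly_linear assms)
  next
    case (Cons x b)
    have "pw_poly (Poly_Mapping.single b a * p) = (\<lambda>_ _. 0)" using Cons by (simp add: fun_eq_iff)
    then show ?case by (simp add: single_Cons mult.assoc pw_poly_var gen_op_def)
  qed
qed (simp_all add: pw_poly_linear distrib_right)

text \<open>
  The elements \<open>p\<close> for which \<open>p q\<close> is killed for every \<open>q\<close> form a two-sided ideal, since killing \<open>q\<close> implies
  killing all its left multiples. It contains the generating relations because the operators
  \<^term>\<open>gen_op\<close> satisfy them.
\<close>

lemma pw_poly_gen_ideal: "p \<in> gen_ideal R \<Longrightarrow> pw_poly p u' u = 0"
proof -
  let ?J = "{p. \<forall>q u' u. pw_poly (p * q) u' u = 0}"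
  have J: "two_sided_ideal ?J" unfolding two_sided_ideal_def
    by (auto simp: pw_poly_linear distrib_right mult.assoc pw_poly_left)
  have "\<sigma> r u \<in> ?J" for r u
  proof (intro CollectI allI)
    fix q u' v
    have "pw_poly (\<sigma> r u * q) u' v = (\<Sum>s\<in>UNIV. \<Sum>l\<in>UNIV. \<omega> s l * gen_op r s (gen_op u l (pw_poly q)) u' v) - \<omega> r u * pw_poly q u' v"
    proof -
      have "pw_poly (var (u, l) * q) = gen_op u l (pw_poly q)" for l by (simp add: fun_eq_iff pw_poly_var)
      then have "pw_poly (var (r, s) * (var (u, l) * q)) u' v = gen_op r s (gen_op u l (pw_poly q)) u' v" for s l
        by (simp add: pw_poly_var)
      then show ?thesis
        by (simp add: \<sigma>_def left_diff_distrib sum_distrib_right scl_mult_left[symmetric] pw_poly_linear mult.assoc)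
    qed
    then show "pw_poly (\<sigma> r u * q) u' v = 0" by (simp add: gen_op_omega[OF bi_capfree_pw_poly])
  qed
  moreover have "\<rho> s v \<in> ?J" for s v
  proof (intro CollectI allI)
    fix q u' w
    have "pw_poly (\<rho> s v * q) u' w = (\<Sum>t\<in>UNIV. \<Sum>u\<in>UNIV. \<beta> t u * gen_op t s (gen_op u v (pw_poly q)) u' w) - \<beta> s v * pw_poly q u' w"
    proof -
      have "pw_poly (var (u, v) * q) = gen_op u v (pw_poly q)" for u by (simp add: fun_eq_iff pw_poly_var)
      then have "pw_poly (var (t, s) * (var (u, v) * q)) u' w = gen_op t s (gen_op u v (pw_poly q)) u' w" for t u
        by (simp add: pw_poly_var)
      then show ?thesis
        by (simp add: \<rho>_def left_diff_distrib sum_distrib_right scl_mult_left[symmetric] pw_poly_linear mult.assoc)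
    qed
    then show "pw_poly (\<rho> s v * q) u' w = 0" by (simp add: gen_op_beta[OF bi_capfree_pw_poly])
  qed
  ultimately have "gen_ideal R \<subseteq> ?J" by (intro gen_ideal_least[OF J] rels_subset[OF J])
  then show "p \<in> gen_ideal R \<Longrightarrow> pw_poly p u' u = 0" by (auto dest!: subsetD spec[of _ 1])
qed

definition phi :: "'n list \<Rightarrow> 'n list \<Rightarrow> (('n \<times> 'n) list \<Rightarrow>\<^sub>0 'k) set \<Rightarrow> 'k" where
  "phi u' u = coset_ext base (\<lambda>b. pw_coef b u' u)"

lemma phi_works:
  shows phi_cls: "phi u' u (cls R p) = pw_poly p u' u"
    and phi_lin_hom: "phi u' u \<in> lin_hom H base"
proof -
  have z: "lin_ext base (\<lambda>b. pw_coef b u' u) p = \<zero>\<^bsub>base\<^esub>" if "p \<in> gen_ideal R" for p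
    using pw_poly_gen_ideal[OF that] by (simp add: lin_ext_base pw_poly_def)
  note w = coset_ext_presented[OF vect_base, of "\<lambda>b. pw_coef b u' u" R, OF _ z]
  show "phi u' u (cls R p) = pw_poly p u' u" unfolding phi_def using w(1) by (simp add: lin_ext_base pw_poly_def)
  show "phi u' u \<in> lin_hom H base" unfolding phi_def H_eq using w(2) by simp
qed

lemma phi_C: "phi u' u (C v w) = pw_coef (zip v w) u' u"
  by (simp add: phi_cls a_word_def pw_poly_linear)

lemma cls_scl_H: "cls R (scl a p) = a \<odot>\<^bsub>H\<^esub> cls R p"
  unfolding H_eq by (rule cls_scl)

lemma H_cases: assumes "h \<in> carrier H" obtains p where "h = cls R p"
  using assms by (auto simp: H_eq carrier_presented)

lemma phi_nf0:
  assumes "h \<in> carrier H"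
  shows "(\<Sum>u'\<in>words (length w). nf 0 w u' * phi u' u h) = phi w u h"
proof -
  obtain p where h: "h = cls R p" using assms by (rule H_cases)
  have "cofree (\<lambda>u'. pw_poly p u' u)" using bi_capfree_pw_poly[of p] by (simp add: bi_capfree_def cofree_dual)
  from nf0_cofree[OF this] show ?thesis by (simp add: h phi_cls)
qed

text \<open>
  On a word, \<open>pw_coef_trace\<close> gives the counit as a finite trace; elements of the algebra
  need a bound on the lengths of all their words.
\<close>

lemma eps_phi:
  assumes "h \<in> carrier H" shows "\<exists>N. \<forall>n\<ge>N. \<epsilon> h = (\<Sum>u\<in>words_le n. phi u u h)"
proof -
  obtain p where h: "h = cls R p" using assms by (rule H_cases)
  let ?N = "\<Sum>b\<in>Poly_Mapping.keys p. length b"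
  have "\<epsilon> h = (\<Sum>u\<in>words_le n. phi u u h)" if n: "n \<ge> ?N" for n
  proof -
    have b: "length b \<le> n" if "b \<in> Poly_Mapping.keys p" for b
      using member_le_sum[of b "Poly_Mapping.keys p" length] n that by simp
    have "(\<Sum>u\<in>words_le n. phi u u h) = (\<Sum>b\<in>Poly_Mapping.keys p. \<Sum>u\<in>words_le n. Poly_Mapping.lookup p b * pw_coef b u u)"
      unfolding h phi_cls pw_poly_expand by (rule sum.swap)
    also have "\<dots> = (\<Sum>b\<in>Poly_Mapping.keys p. Poly_Mapping.lookup p b * (if map fst b = map snd b then 1 else 0))"
      unfolding sum_distrib_left[symmetric] by (rule sum.cong[OF refl]) (simp only: pw_coef_trace[OF b])
    finally show ?thesis by (simp only: h eps_cls ksum_def)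
  qed
  then show ?thesis by blast
qed

text \<open>
  The intertwining property, read in the Hopf algebra.
\<close>

lemma contract_phi_Delta:
  assumes "h \<in> carrier H"
  shows "contract H (phi w u) (\<Delta> h) = (\<Oplus>\<^bsub>H\<^esub>w'\<in>words (length w). phi w' u h \<odot>\<^bsub>H\<^esub> C w' w)"
proof (rule H_induct_hom_eq[OF _ _ _ assms, where U = H])
  note ct = contract_works[OF vect_H vect_H phi_lin_hom]
  show "(\<lambda>h. contract H (phi w u) (\<Delta> h)) \<in> lin_hom H H" by (rule lin_hom_comp[OF Delta_lin_hom ct(1)])
  show "(\<lambda>h. \<Oplus>\<^bsub>H\<^esub>w'\<in>words (length w). phi w' u h \<odot>\<^bsub>H\<^esub> C w' w) \<in> lin_hom H H"
    by (rule lin_hom_of_finsum[OF vect_H vect_H])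
       (auto intro!: lin_homI simp: vect_H lin_homD[OF phi_lin_hom] vect_smult_l_distr vect_smult_assoc)
  fix i j :: "'n list" assume ij: "length i = length j"
  have "contract H (phi w u) (\<Delta> (C i j)) = (\<Oplus>\<^bsub>H\<^esub>m\<in>words (length j). contract H (phi w u) (pure_tensor H H (C i m) (C m j)))"
    unfolding Delta_C[OF ij] by (rule lin_hom_finsum[OF HH.vect_tensor vect_H ct(1)]) (auto intro!: HH.pure_closed)
  also have "\<dots> = (\<Oplus>\<^bsub>H\<^esub>m\<in>words (length j). cls R (scl (pw_coef (zip m j) w u) (a_word i m)))"
    by (rule vect_finsum_cong[OF vect_H refl]) (auto simp: ct(2) phi_C cls_scl_H vect_H)
  also have "\<dots> = cls R (\<Sum>m\<in>words (length j). scl (pw_coef (zip m j) w u) (a_word i m))"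
    by (simp add: cls_sum H_eq)
  also have "\<dots> = cls R (row_a (\<lambda>w'. pw_coef (zip i j) w' u) w)"
  proof (rule cls_eqI)
    have l: "length (zip i j) = length j" "map fst (zip i j) = i" "map snd (zip i j) = j" using ij by simp_all
    show "(\<Sum>m\<in>words (length j). scl (pw_coef (zip m j) w u) (a_word i m)) - row_a (\<lambda>w'. pw_coef (zip i j) w' u) w \<in> gen_ideal R"
      using pw_coef_intertwine[OF two_sided_ideal_gen_ideal sigma_in[unfolded \<sigma>_def] rho_in[unfolded \<rho>_def], of "zip i j" w u]
      unfolding l .
  qed
  also have "\<dots> = (\<Oplus>\<^bsub>H\<^esub>w'\<in>words (length w). phi w' u (C i j) \<odot>\<^bsub>H\<^esub> C w' w)"
    by (simp add: row_a_def cls_sum cls_scl H_eq phi_C)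
  finally show "contract H (phi w u) (\<Delta> (C i j)) = (\<Oplus>\<^bsub>H\<^esub>w'\<in>words (length w). phi w' u (C i j) \<odot>\<^bsub>H\<^esub> C w' w)" .
qed

subsection \<open>The action of functionals on a comodule\<close>

context
  fixes W :: "('k, (('n \<times> 'n) list \<Rightarrow>\<^sub>0 'k) set, 'v) comodule"
  assumes W: "right_comodule HE W"
begin

lemma vect_W: "vect W" and coaction_W: "coaction W \<in> lin_hom W (tensor W H)"
  using W by (auto simp: right_comodule_def)

lemma coassoc_W: "x \<in> carrier W \<Longrightarrow>
    tensor_assoc W H H (tensor_map (tensor W H) H (coaction W) (\<lambda>h. h) (coaction W x)) =
    tensor_map W (tensor H H) (\<lambda>x. x) \<Delta> (coaction W x)"
  and counit_W: "x \<in> carrier W \<Longrightarrow> contract W \<epsilon> (coaction W x) = x"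
  using W by (auto simp: right_comodule_def contract_def)

interpretation WH: two_vects W H by (rule two_vects.intro) (rule vect_W vect_H)+

lemma act_by_lin_hom: "\<phi> \<in> lin_hom H base \<Longrightarrow> act_by W \<phi> \<in> lin_hom W W"
  unfolding act_by_def[abs_def] by (rule lin_hom_comp[OF coaction_W contract_lin_hom[OF vect_W vect_H]])

lemma act_by_closed: "\<phi> \<in> lin_hom H base \<Longrightarrow> x \<in> carrier W \<Longrightarrow> act_by W \<phi> x \<in> carrier W"
  by (rule lin_homD(1)[OF act_by_lin_hom])

lemma act_by_subcomodule:
  assumes \<phi>: "\<phi> \<in> lin_hom H base" and T: "subcomodule HE W T" and s: "s \<in> T"
  shows "act_by W \<phi> s \<in> T"
proof -
  have T': "submodule T base W" and co: "coaction W s \<in> lin_span (tensor W H) {pure_tensor W H x h | x h. x \<in> T \<and> h \<in> carrier H}"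
    using T s by (auto simp: subcomodule_def)
  note ct = contract_works[OF vect_W vect_H \<phi>]
  have Sc: "T \<subseteq> carrier W" by (rule submoduleD(1)[OF vect_W T'])
  have "lin_span (tensor W H) {pure_tensor W H x h | x h. x \<in> T \<and> h \<in> carrier H} \<subseteq> {z \<in> carrier (tensor W H). contract W \<phi> z \<in> T}"
  proof (rule lin_span_least)
    show "submodule {z \<in> carrier (tensor W H). contract W \<phi> z \<in> T} base (tensor W H)"
      by (rule lin_hom_kernel[OF WH.vect_tensor vect_W ct(1) T'])
    show "{pure_tensor W H x h | x h. x \<in> T \<and> h \<in> carrier H} \<subseteq> {z \<in> carrier (tensor W H). contract W \<phi> z \<in> T}"
      using Sc submoduleD(4)[OF vect_W T'] by (auto simp: ct(2) subset_iff intro!: WH.pure_closed)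
  qed
  then show ?thesis using co by (auto simp: act_by_def)
qed

text \<open>
  Coassociativity: \<open>\<alpha> ((id \<otimes> \<phi>) (\<alpha> x)) = (id \<otimes> (id \<otimes> \<phi>) \<Delta>) (\<alpha> x)\<close>.
\<close>

lemma coaction_act_by:
  assumes \<phi>: "\<phi> \<in> lin_hom H base" and x: "x \<in> carrier W"
  shows "coaction W (act_by W \<phi> x) = tensor_map W H (\<lambda>x. x) (\<lambda>h. contract H \<phi> (\<Delta> h)) (coaction W x)"
proof -
  interpret L: two_vects "tensor W H" H by (rule two_vects.intro) (rule WH.vect_tensor vect_H)+
  interpret WHH: two_vects W "tensor H H" by (rule two_vects.intro) (rule vect_W HH.vect_tensor)+
  note cW = contract_works[OF vect_W vect_H \<phi>] and cH = contract_works[OF vect_H vect_H \<phi>]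
  note T1 = contract_works[OF WH.vect_tensor vect_H \<phi>]
  note T2 = tensor_map_works[OF vect_W HH.vect_tensor vect_W vect_H lin_hom_id cH(1)]
  note as = tensor_assoc_works[OF vect_W vect_H vect_H]
  note m1 = tensor_map_works[OF vect_W vect_H WH.vect_tensor vect_H coaction_W lin_hom_id]
  note m2 = tensor_map_works[OF vect_W vect_H vect_W HH.vect_tensor lin_hom_id Delta_lin_hom]
  note m3 = tensor_map_works[OF vect_W vect_H vect_W vect_H lin_hom_id lin_hom_comp[OF Delta_lin_hom cH(1)]]
  have z: "coaction W x \<in> carrier (tensor W H)" using lin_homD(1)[OF coaction_W x] .
  have a: "contract (tensor W H) \<phi> y = tensor_map W H (\<lambda>x. x) (contract H \<phi>) (tensor_assoc W H H y)"
    if "y \<in> carrier (tensor (tensor W H) H)" for y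
  proof (rule L.tensor_lin_hom_eq[OF T1(1) lin_hom_comp[OF as(1) T2(1)] _ that])
    fix v h assume v: "v \<in> carrier (tensor W H)" and h: "h \<in> carrier H"
    note pl = L.bilinD(2)[OF L.bilin_pure h]
    show "contract (tensor W H) \<phi> (pure_tensor (tensor W H) H v h) =
        tensor_map W H (\<lambda>x. x) (contract H \<phi>) (tensor_assoc W H H (pure_tensor (tensor W H) H v h))"
    proof (rule WH.tensor_lin_hom_eq[OF lin_hom_comp[OF pl T1(1)] lin_hom_comp[OF pl lin_hom_comp[OF as(1) T2(1)]] _ v])
      fix x g assume "x \<in> carrier W" "g \<in> carrier H"
      then show "contract (tensor W H) \<phi> (pure_tensor (tensor W H) H (pure_tensor W H x g) h) =
        tensor_map W H (\<lambda>x. x) (contract H \<phi>) (tensor_assoc W H H (pure_tensor (tensor W H) H (pure_tensor W H x g) h))"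
        using h by (simp add: T1(2) as(2) T2(2) cH(2) WH.pure_closed HH.pure_closed WH.pure_smult_right)
    qed
  qed
  have b: "contract (tensor W H) \<phi> (tensor_map (tensor W H) H (coaction W) (\<lambda>h. h) y) = coaction W (contract W \<phi> y)"
    if "y \<in> carrier (tensor W H)" for y
    by (rule WH.tensor_lin_hom_eq[OF lin_hom_comp[OF m1(1) T1(1)] lin_hom_comp[OF cW(1) coaction_W] _ that])
       (simp add: m1(2) T1(2) cW(2) lin_homD[OF coaction_W])
  have c: "tensor_map W H (\<lambda>x. x) (contract H \<phi>) (tensor_map W (tensor H H) (\<lambda>x. x) \<Delta> y) =
      tensor_map W H (\<lambda>x. x) (\<lambda>h. contract H \<phi> (\<Delta> h)) y"
    if "y \<in> carrier (tensor W H)" for y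
    by (rule WH.tensor_lin_hom_eq[OF lin_hom_comp[OF m2(1) T2(1)] m3(1) _ that])
       (simp add: m2(2) T2(2) m3(2) lin_homD[OF Delta_lin_hom])
  have "coaction W (act_by W \<phi> x) = contract (tensor W H) \<phi> (tensor_map (tensor W H) H (coaction W) (\<lambda>h. h) (coaction W x))"
    unfolding act_by_def by (rule b[OF z, symmetric])
  also have "\<dots> = tensor_map W H (\<lambda>x. x) (contract H \<phi>) (tensor_assoc W H H (tensor_map (tensor W H) H (coaction W) (\<lambda>h. h) (coaction W x)))"
    by (rule a[OF lin_homD(1)[OF m1(1) z]])
  also have "\<dots> = tensor_map W H (\<lambda>x. x) (\<lambda>h. contract H \<phi> (\<Delta> h)) (coaction W x)"
    unfolding coassoc_W[OF x] by (rule c[OF z])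
  finally show ?thesis .
qed

text \<open>
  For fixed \<open>u\<close> and \<open>x\<close> the vectors \<open>act_by W (phi w u) x\<close> transform like the words \<open>w\<close> in the tensor
  algebra.
\<close>

lemma coaction_phi:
  assumes x: "x \<in> carrier W"
  shows "coaction W (act_by W (phi w u) x) = (\<Oplus>\<^bsub>tensor W H\<^esub>w'\<in>words (length w). pure_tensor W H (act_by W (phi w' u) x) (C w' w))"
proof -
  note cW = contract_works[OF vect_W vect_H phi_lin_hom] and cH = contract_works[OF vect_H vect_H phi_lin_hom]
  note m3 = tensor_map_works[OF vect_W vect_H vect_W vect_H lin_hom_id lin_hom_comp[OF Delta_lin_hom cH(1)]]
  have z: "coaction W x \<in> carrier (tensor W H)" using lin_homD(1)[OF coaction_W x] .
  have "tensor_map W H (\<lambda>x. x) (\<lambda>h. contract H (phi w u) (\<Delta> h)) y =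
      (\<Oplus>\<^bsub>tensor W H\<^esub>w'\<in>words (length w). pure_tensor W H (contract W (phi w' u) y) (C w' w))"
    if "y \<in> carrier (tensor W H)" for y
  proof (rule WH.tensor_lin_hom_eq[OF m3(1) _ _ that])
    show "(\<lambda>y. \<Oplus>\<^bsub>tensor W H\<^esub>w'\<in>words (length w). pure_tensor W H (contract W (phi w' u) y) (C w' w)) \<in> lin_hom (tensor W H) (tensor W H)"
      by (rule lin_hom_of_finsum[OF WH.vect_tensor WH.vect_tensor])
         (rule lin_hom_comp[OF cW(1) WH.bilinD(2)[OF WH.bilin_pure C_closed]])
    fix v h assume v: "v \<in> carrier W" and h: "h \<in> carrier H"
    have hc: "phi w' u h \<odot>\<^bsub>H\<^esub> C w' w \<in> carrier H" for w' using vect_H by simp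
    have "tensor_map W H (\<lambda>x. x) (\<lambda>h. contract H (phi w u) (\<Delta> h)) (pure_tensor W H v h) =
        pure_tensor W H v (\<Oplus>\<^bsub>H\<^esub>w'\<in>words (length w). phi w' u h \<odot>\<^bsub>H\<^esub> C w' w)"
      using m3(2)[OF v h] contract_phi_Delta[OF h] by simp
    also have "\<dots> = (\<Oplus>\<^bsub>tensor W H\<^esub>w'\<in>words (length w). pure_tensor W H v (phi w' u h \<odot>\<^bsub>H\<^esub> C w' w))"
      by (rule WH.pure_finsum_right) (use hc v in auto)
    also have "\<dots> = (\<Oplus>\<^bsub>tensor W H\<^esub>w'\<in>words (length w). pure_tensor W H (contract W (phi w' u) (pure_tensor W H v h)) (C w' w))"
      by (rule vect_finsum_cong[OF WH.vect_tensor refl])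
         (use v h vect_W in \<open>auto simp: cW(2) WH.pure_smult_left WH.pure_smult_right intro!: WH.pure_closed
            vect_smult_closed[OF WH.vect_tensor]\<close>)
    finally show "tensor_map W H (\<lambda>x. x) (\<lambda>h. contract H (phi w u) (\<Delta> h)) (pure_tensor W H v h) = \<dots>" .
  qed
  from this[OF z] show ?thesis unfolding coaction_act_by[OF phi_lin_hom x] by (simp only: act_by_def)
qed

text \<open>
  As functions of \<open>w\<close> they are moreover fixed by the projection to capfree tensors.
\<close>

lemma act_by_phi_nf0:
  assumes x: "x \<in> carrier W"
  shows "(\<Oplus>\<^bsub>W\<^esub>u'\<in>words (length w). nf 0 w u' \<odot>\<^bsub>W\<^esub> act_by W (phi u' u) x) = act_by W (phi w u) x"
proof -
  note cW = contract_works[OF vect_W vect_H phi_lin_hom]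
  have z: "coaction W x \<in> carrier (tensor W H)" using lin_homD(1)[OF coaction_W x] .
  show ?thesis unfolding act_by_def
  proof (rule WH.tensor_lin_hom_eq[OF _ cW(1) _ z])
    show "(\<lambda>z. \<Oplus>\<^bsub>W\<^esub>u'\<in>words (length w). nf 0 w u' \<odot>\<^bsub>W\<^esub> contract W (phi u' u) z) \<in> lin_hom (tensor W H) W"
      by (rule lin_hom_of_finsum[OF WH.vect_tensor vect_W]) (rule lin_hom_smult[OF vect_W cW(1)])
    fix v h assume v: "v \<in> carrier W" and h: "h \<in> carrier H"
    have "(\<Oplus>\<^bsub>W\<^esub>u'\<in>words (length w). nf 0 w u' \<odot>\<^bsub>W\<^esub> contract W (phi u' u) (pure_tensor W H v h)) =
        (\<Oplus>\<^bsub>W\<^esub>u'\<in>words (length w). (nf 0 w u' * phi u' u h) \<odot>\<^bsub>W\<^esub> v)"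
      by (rule vect_finsum_cong[OF vect_W refl]) (use v h vect_W in \<open>auto simp: cW(2) vect_smult_assoc\<close>)
    also have "\<dots> = (\<Sum>u'\<in>words (length w). nf 0 w u' * phi u' u h) \<odot>\<^bsub>W\<^esub> v"
      by (rule finsum_smult_left[OF vect_W v, symmetric])
    finally show "(\<Oplus>\<^bsub>W\<^esub>u'\<in>words (length w). nf 0 w u' \<odot>\<^bsub>W\<^esub> contract W (phi u' u) (pure_tensor W H v h)) =
        contract W (phi w u) (pure_tensor W H v h)"
      using v h by (simp add: phi_nf0 cW(2))
  qed
qed

text \<open>
  The counit axiom, with the counit written as a sum of the functionals \<open>phi u u\<close>.
\<close>

lemma act_by_phi_span:
  assumes x: "x \<in> carrier W"
  shows "\<exists>N. x = (\<Oplus>\<^bsub>W\<^esub>u\<in>words_le N. act_by W (phi u u) x)"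
proof -
  note cW = contract_works[OF vect_W vect_H phi_lin_hom]
  note ce = contract_works[OF vect_W vect_H eps_lin_hom]
  have z: "coaction W x \<in> carrier (tensor W H)" using lin_homD(1)[OF coaction_W x] .
  have "\<exists>N. \<forall>n\<ge>N. contract W \<epsilon> y = (\<Oplus>\<^bsub>W\<^esub>u\<in>words_le n. contract W (phi u u) y)" if "y \<in> carrier (tensor W H)" for y
    using that
  proof (induction rule: WH.tensor_induct)
    case (pure v h)
    obtain N where N: "\<forall>n\<ge>N. \<epsilon> h = (\<Sum>u\<in>words_le n. phi u u h)" using eps_phi[OF pure(2)] by blast
    have "contract W \<epsilon> (pure_tensor W H v h) = (\<Oplus>\<^bsub>W\<^esub>u\<in>words_le n. contract W (phi u u) (pure_tensor W H v h))" if "n \<ge> N" for n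
      using N that pure by (simp add: ce(2) cW(2) finsum_smult_left[OF vect_W])
    then show ?case by blast
  next
    case (add y y')
    obtain N N' where N: "\<forall>n\<ge>N. contract W \<epsilon> y = (\<Oplus>\<^bsub>W\<^esub>u\<in>words_le n. contract W (phi u u) y)"
      "\<forall>n\<ge>N'. contract W \<epsilon> y' = (\<Oplus>\<^bsub>W\<^esub>u\<in>words_le n. contract W (phi u u) y')" using add(3,4) by blast
    have "contract W \<epsilon> (y \<oplus>\<^bsub>tensor W H\<^esub> y') = (\<Oplus>\<^bsub>W\<^esub>u\<in>words_le n. contract W (phi u u) (y \<oplus>\<^bsub>tensor W H\<^esub> y'))"
      if "n \<ge> max N N'" for n
    proof -
      have "(\<Oplus>\<^bsub>W\<^esub>u\<in>words_le n. contract W (phi u u) (y \<oplus>\<^bsub>tensor W H\<^esub> y')) =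
          (\<Oplus>\<^bsub>W\<^esub>u\<in>words_le n. contract W (phi u u) y \<oplus>\<^bsub>W\<^esub> contract W (phi u u) y')"
        by (rule vect_finsum_cong[OF vect_W refl]) (use add vect_W in \<open>auto simp: lin_homD[OF cW(1)]\<close>)
      also have "\<dots> = (\<Oplus>\<^bsub>W\<^esub>u\<in>words_le n. contract W (phi u u) y) \<oplus>\<^bsub>W\<^esub> (\<Oplus>\<^bsub>W\<^esub>u\<in>words_le n. contract W (phi u u) y')"
        using add(1,2) by (simp add: vect_finsum_add[OF vect_W] lin_homD(1)[OF cW(1)])
      also have "\<dots> = contract W \<epsilon> y \<oplus>\<^bsub>W\<^esub> contract W \<epsilon> y'"
        using N(1)[rule_format, of n] N(2)[rule_format, of n] that by simp
      finally show ?thesis using lin_homD(2)[OF ce(1) add(1,2)] by simp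
    qed
    then show ?case by blast
  qed
  from this[OF z] show ?thesis unfolding counit_W[OF x] act_by_def by auto
qed

end

subsection \<open>The simple summands of the comodule algebra\<close>

context
  fixes t :: 'k
begin

interpretation AH: two_algebras "A t" H by (rule two_algebras_AH)

definition nf_poly :: "('n list \<Rightarrow>\<^sub>0 'k) \<Rightarrow> 'n list \<Rightarrow> 'k" where
  "nf_poly p u = ksum (\<lambda>w. nf t w u) p"

lemma nf_poly_linear: "nf_poly (p + q) u = nf_poly p u + nf_poly q u" "nf_poly (p - q) u = nf_poly p u - nf_poly q u"
  "nf_poly (scl a p) u = a * nf_poly p u" "nf_poly (sum f I) u = (\<Sum>i\<in>I. nf_poly (f i) u)" "nf_poly 0 u = 0"
  "nf_poly (Poly_Mapping.single b a) u = a * nf t b u"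
  by (simp_all add: nf_poly_def ksum_add ksum_minus ksum_scl ksum_sum)

lemma nf_poly_expand: "nf_poly p = (\<lambda>u. \<Sum>b\<in>Poly_Mapping.keys p. Poly_Mapping.lookup p b * nf t b u)"
  by (simp add: nf_poly_def ksum_def fun_eq_iff)

lemma capfree_nf_poly: "capfree (nf_poly p)"
  unfolding nf_poly_expand by (rule capfree_lin) (rule capfree_nf)

lemma nf_poly_var: "nf_poly (var x * p) u = act t x (nf_poly p) u"
  unfolding nf_poly_expand[of p] act_lin by (simp add: var_times nf_poly_linear)

lemma nf_poly_left:
  assumes "\<And>u. nf_poly p u = 0" shows "nf_poly (q * p) u = 0"
proof (induction q arbitrary: u rule: poly_mapping_single_induct)
  case (single b a)
  show ?case
  proof (induction b arbitrary: u)
    case Nil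
    have "Poly_Mapping.single [] a * p = scl a p" using const_mult[of a p] by (simp add: const_def)
    then show ?case by (simp add: nf_poly_linear assms)
  next
    case (Cons x b)
    have "nf_poly (Poly_Mapping.single b a * p) = (\<lambda>_. 0)" using Cons by (simp add: fun_eq_iff)
    moreover have "Poly_Mapping.single (x # b) a = var x * Poly_Mapping.single b a"
      by (simp add: var_def mult_single plus_list_def)
    ultimately show ?case by (simp add: mult.assoc nf_poly_var)
  qed
qed (simp_all add: nf_poly_linear distrib_right)

lemma nf_poly_gen_ideal: "p \<in> gen_ideal (RA t) \<Longrightarrow> nf_poly p u = 0"
proof -
  let ?J = "{p. \<forall>q u. nf_poly (p * q) u = 0}"
  have J: "two_sided_ideal ?J" unfolding two_sided_ideal_def
    by (auto simp: nf_poly_linear distrib_right mult.assoc nf_poly_left)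
  have "arel t \<in> ?J"
  proof (intro CollectI allI)
    fix q u
    have "nf_poly (var j * q) = act t j (nf_poly q)" for j by (simp add: fun_eq_iff nf_poly_var)
    then have "nf_poly (var i * (var j * q)) u = act t i (act t j (nf_poly q)) u" for i j by (simp add: nf_poly_var)
    then have "nf_poly (arel t * q) u = (\<Sum>i\<in>UNIV. \<Sum>j\<in>UNIV. \<omega> i j * act t i (act t j (nf_poly q)) u) - t * nf_poly q u"
      by (simp add: arel_def left_diff_distrib sum_distrib_right scl_mult_left[symmetric] nf_poly_linear mult.assoc)
    then show "nf_poly (arel t * q) u = 0" by (simp add: act_act_omega[OF capfree_nf_poly])
  qed
  then have "gen_ideal (RA t) \<subseteq> ?J" by (intro gen_ideal_least[OF J]) (simp add: RA_eq)
  then show "p \<in> gen_ideal (RA t) \<Longrightarrow> nf_poly p u = 0" by (auto dest!: subsetD spec[of _ 1])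
qed

text \<open>
  The coordinates of an element of \<open>\<A>(E\<^sup>-\<^sup>1, t)\<close> in the sum of the spaces of capfree tensors.
\<close>

definition coord :: "'n list \<Rightarrow> ('n list \<Rightarrow>\<^sub>0 'k) set \<Rightarrow> 'k" where
  "coord u = coset_ext base (\<lambda>w. nf t w u)"

lemma coord_works:
  shows coord_cls: "coord u (cls (RA t) p) = nf_poly p u"
    and coord_lin_hom: "coord u \<in> lin_hom (A t) base"
proof -
  have z: "lin_ext base (\<lambda>w. nf t w u) p = \<zero>\<^bsub>base\<^esub>" if "p \<in> gen_ideal (RA t)" for p
    using nf_poly_gen_ideal[OF that] by (simp add: lin_ext_base nf_poly_def)
  note w = coset_ext_presented[OF vect_base, of "\<lambda>w. nf t w u" "RA t", OF _ z]
  show "coord u (cls (RA t) p) = nf_poly p u" unfolding coord_def using w(1) by (simp add: lin_ext_base nf_poly_def)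
  show "coord u \<in> lin_hom (A t) base" unfolding coord_def A_eq using w(2) by simp
qed

text \<open>
  The element of the algebra given by the component of degree \<open>j\<close> of a tensor.
\<close>

definition elt :: "('n list \<Rightarrow> 'k) \<Rightarrow> nat \<Rightarrow> ('n list \<Rightarrow>\<^sub>0 'k) set" where
  "elt y j = cls (RA t) (\<Sum>w\<in>words j. Poly_Mapping.single w (y w))"

definition summand :: "nat \<Rightarrow> ('n list \<Rightarrow>\<^sub>0 'k) set set" where
  "summand j = {elt y j | y. capfree y}"

lemma elt_closed [simp, intro]: "elt y j \<in> carrier (A t)"
  unfolding elt_def by (rule A_closed)

lemma elt_finsum: "elt y j = (\<Oplus>\<^bsub>A t\<^esub>w\<in>words j. y w \<odot>\<^bsub>A t\<^esub> X t w)"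
proof -
  have "cls (RA t) (Poly_Mapping.single w (y w)) = y w \<odot>\<^bsub>A t\<^esub> X t w" for w
    by (simp add: A_eq flip: cls_scl)
  then show ?thesis unfolding elt_def by (simp add: cls_sum A_eq)
qed

lemma elt_add: "elt (\<lambda>w. y w + z w) j = elt y j \<oplus>\<^bsub>A t\<^esub> elt z j"
  by (simp add: elt_def single_add sum.distrib cls_add A_eq)

lemma elt_smult: "elt (\<lambda>w. a * y w) j = a \<odot>\<^bsub>A t\<^esub> elt y j"
  unfolding elt_def A_eq by (simp add: scl_sum flip: cls_scl)

lemma elt_zero: "elt (\<lambda>w. 0) j = \<zero>\<^bsub>A t\<^esub>"
  by (simp add: elt_def cls_zero A_eq)

lemma elt_sum: "finite I \<Longrightarrow> elt (\<lambda>w. \<Sum>i\<in>I. y i w) j = (\<Oplus>\<^bsub>A t\<^esub>i\<in>I. elt (y i) j)"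
proof -
  assume I: "finite I"
  have "(\<Sum>w\<in>words j. Poly_Mapping.single w (\<Sum>i\<in>I. y i w)) = (\<Sum>i\<in>I. \<Sum>w\<in>words j. Poly_Mapping.single w (y i w))"
    unfolding single_sum by (rule sum.swap)
  then show ?thesis using I by (simp add: elt_def cls_sum A_eq)
qed

lemma elt_cong: "(\<And>w. length w = j \<Longrightarrow> y w = z w) \<Longrightarrow> elt y j = elt z j"
  unfolding elt_def by (rule arg_cong[of _ _ "cls _"], rule sum.cong) auto

lemma coord_elt: "capfree y \<Longrightarrow> coord u (elt y j) = (if length u = j then y u else 0)"
  unfolding elt_def coord_cls by (simp add: nf_poly_linear capfree_nf_sum)

lemma summand_submodule: "submodule (summand j) base (A t)"
  unfolding submodule_base_iff[OF vect_A] summand_def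
proof (intro conjI ballI allI subsetI)
  show "\<zero>\<^bsub>A t\<^esub> \<in> {elt y j | y. capfree y}" using capfree_zero elt_zero[symmetric] by blast
  show "x \<oplus>\<^bsub>A t\<^esub> z \<in> {elt y j | y. capfree y}" if "x \<in> {elt y j | y. capfree y}" "z \<in> {elt y j | y. capfree y}" for x z
    using that capfree_add elt_add[symmetric] by blast
  show "a \<odot>\<^bsub>A t\<^esub> x \<in> {elt y j | y. capfree y}" if "x \<in> {elt y j | y. capfree y}" for a x
    using that capfree_cmult elt_smult[symmetric] by blast
qed auto

lemma summand_subset: "summand j \<subseteq> carrier (A t)"
  by (auto simp: summand_def)

lemma elt_eq_zero:
  assumes "capfree y" "elt y j = \<zero>\<^bsub>A t\<^esub>" "length u = j" shows "y u = 0"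
  using coord_elt[OF assms(1), of u j] assms lin_hom_zero[OF vect_A vect_base coord_lin_hom, of u] by simp

text \<open>
  There are capfree tensors in each degree: \<open>\<kappa> j \<noteq> 0\<close> shows that raising a nonzero tensor cannot
  give zero for all vectors.
\<close>

lemma capfree_nonzero: "\<exists>y u. capfree y \<and> length u = j \<and> y u \<noteq> 0"
proof (induction j)
  case 0
  show ?case using capfree_nf[of 0 "[]"] by (intro exI[of _ "nf 0 []"] exI[of _ "[]"]) simp
next
  case (Suc j)
  then obtain y u where y: "capfree y" "length u = j" "y u \<noteq> 0" by blast
  have "\<exists>b v. length v = Suc j \<and> up b y v \<noteq> 0"
  proof (rule ccontr)
    assume "\<not> ?thesis"
    then have "down a (up b y) u = 0" for a b using y(2) by (simp add: gdown_def del: gup.simps)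
    then have "\<kappa> j * y u = 0" using down_up_omega[OF y(1), of u] y(2) by simp
    then show False using y(3) cnz by (simp add: \<kappa>_def)
  qed
  then show ?case using capfree_up[OF y(1)] by blast
qed

lemma summand_nonzero: "summand j \<noteq> {\<zero>\<^bsub>A t\<^esub>}"
proof
  assume *: "summand j = {\<zero>\<^bsub>A t\<^esub>}"
  obtain y u where y: "capfree y" "length u = j" "y u \<noteq> 0" using capfree_nonzero by blast
  have "elt y j \<in> summand j" using y(1) by (auto simp: summand_def)
  then show False using * elt_eq_zero[OF y(1) _ y(2)] y(3) by auto
qed

lemma X_expand: "X t w = (\<Oplus>\<^bsub>A t\<^esub>j\<in>{..length w}. elt (nf t w) j)"
proof -
  have vs: "vector_space (scl :: 'k \<Rightarrow> ('n list \<Rightarrow>\<^sub>0 'k) \<Rightarrow> _)"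
    by unfold_locales (simp_all add: scl_add scl_add_left)
  have h: "(\<Sum>b\<in>UNIV. \<Sum>a\<in>UNIV. scl (\<omega> b a) (Poly_Mapping.single (w1 @ b # a # w2) 1)) - scl t (Poly_Mapping.single (w1 @ w2) 1) \<in> gen_ideal (RA t)"
    for w1 w2 :: "'n list"
  proof -
    have "Poly_Mapping.single w1 1 * arel t * Poly_Mapping.single w2 1 =
        (\<Sum>b\<in>UNIV. \<Sum>a\<in>UNIV. scl (\<omega> b a) (Poly_Mapping.single (w1 @ b # a # w2) 1)) - scl t (Poly_Mapping.single (w1 @ w2) 1)"
    proof -
      have "Poly_Mapping.single w1 1 * (var b * var a) * Poly_Mapping.single w2 (1::'k) = Poly_Mapping.single (w1 @ b # a # w2) 1" for a b
        by (simp add: var_def mult_single plus_list_def)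
      moreover have "Poly_Mapping.single w1 1 * Poly_Mapping.single w2 (1::'k) = Poly_Mapping.single (w1 @ w2) 1"
        by (simp add: mult_single plus_list_def)
      ultimately show ?thesis
        by (simp only: arel_def right_diff_distrib left_diff_distrib sum_distrib_left sum_distrib_right
            scl_mult_left[symmetric] scl_mult_right[symmetric] mult_1_right)
    qed
    moreover have "Poly_Mapping.single w1 1 * arel t * Poly_Mapping.single w2 1 \<in> gen_ideal (RA t)"
      by (intro tidealD(3,4)[OF two_sided_ideal_gen_ideal] arel_in)
    ultimately show ?thesis by simp
  qed
  have "(\<Sum>u\<in>words_le (length w). scl (nf t w u) (Poly_Mapping.single u 1)) - Poly_Mapping.single w 1 \<in> gen_ideal (RA t)"
    by (rule nf_pair[OF vs]) (use tidealD(1,2)[OF two_sided_ideal_gen_ideal] two_sided_ideal_scl[OF two_sided_ideal_gen_ideal] h in auto)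
  then have "X t w = cls (RA t) (\<Sum>u\<in>words_le (length w). Poly_Mapping.single u (nf t w u))"
    using cls_eqI[symmetric] by simp
  then show ?thesis unfolding sum_words_le by (simp add: elt_def cls_sum A_eq)
qed

lemma summand_span:
  assumes M: "submodule M base (A t)" and T: "\<And>j. summand j \<subseteq> M"
  shows "carrier (A t) \<subseteq> M"
proof
  fix x assume "x \<in> carrier (A t)"
  then have "x \<in> carrier (presented_algebra (RA t))" by (simp add: A_eq)
  then show "x \<in> M"
  proof (induction rule: presented_induct)
    case (word w)
    have "elt (nf t w) j \<in> M" for j using T[of j] capfree_nf[of t w] by (auto simp: summand_def)
    then show ?case unfolding X_expand by (intro finsum_in_submodule[OF vect_A M]) auto
  next
    case (smult a x)
    then show ?case using submoduleD(4)[OF vect_A M] by (simp add: A_eq)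
  next
    case (add x y)
    then show ?case using submoduleD(3)[OF vect_A M] by (simp add: A_eq)
  qed
qed

text \<open>
  Each of the two projections acts as the identity on the rows of the other one, so that both equal
  their product.
\<close>

lemma nf0_transpose: "dual.nf 0 u v = nf 0 v u"
proof (cases "length u = length v")
  case True
  have "(\<Sum>z\<in>words (length v). nf 0 v z * dual.nf 0 u z) = dual.nf 0 u v"
    by (rule nf0_cofree) (simp add: cofree_dual dual.capfree_nf)
  moreover have "(\<Sum>z\<in>words (length u). dual.nf 0 u z * nf 0 v z) = nf 0 v u"
    by (rule dual.nf0_cofree) (simp add: dual_cofree capfree_nf)
  ultimately show ?thesis using True by (simp add: mult.commute)
next
  case False
  then show ?thesis by (simp add: nf_homogeneous dual.nf_homogeneous)
qed

text \<open>
  The \<open>j\<close>-th tensor power of the matrix of generators times a column vector.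
\<close>

definition col_a :: "('n list \<Rightarrow> 'k) \<Rightarrow> 'n list \<Rightarrow> ('n \<times> 'n) list \<Rightarrow>\<^sub>0 'k" where
  "col_a y u = (\<Sum>w\<in>words (length u). scl (y w) (a_word u w))"

lemma cls_col_a: "cls R (col_a y u) = (\<Oplus>\<^bsub>H\<^esub>w\<in>words (length u). y w \<odot>\<^bsub>H\<^esub> C u w)"
  by (simp add: col_a_def cls_sum cls_scl H_eq)

lemma alpha_elt_tensor_proj: "\<alpha> t (elt y j) = tensor_proj (RA t) R (\<Sum>u\<in>words j. tens (Poly_Mapping.single u 1) (col_a y u))"
proof -
  have "feval (alpha_free) (\<Sum>w\<in>words j. Poly_Mapping.single w (y w)) =
      (\<Sum>w\<in>words j. \<Sum>u\<in>words j. tens (Poly_Mapping.single u 1) (scl (y w) (a_word u w)))"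
    by (simp add: feval_linear prod_list_alpha_free scl_sum tens_scl_right)
  also have "\<dots> = (\<Sum>u\<in>words j. \<Sum>w\<in>words j. tens (Poly_Mapping.single u 1) (scl (y w) (a_word u w)))"
    by (rule sum.swap)
  also have "\<dots> = (\<Sum>u\<in>words j. tens (Poly_Mapping.single u 1) (col_a y u))"
    by (simp add: col_a_def tens_sum_right)
  finally show ?thesis by (simp add: elt_def alpha_cls)
qed

lemma tensor_proj_tens_A: "tensor_proj (RA t) R (tens p q) = pure_tensor (A t) H (cls (RA t) p) (cls R q)"
  by (simp add: tensor_proj_tens A_eq H_eq)

lemma tensor_proj_sum_A: "finite I \<Longrightarrow> tensor_proj (RA t) R (sum f I) = (\<Oplus>\<^bsub>tensor (A t) H\<^esub>i\<in>I. tensor_proj (RA t) R (f i))"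
  unfolding H_eq A_eq by (rule tensor_proj_sum)

lemma alpha_elt: "\<alpha> t (elt y j) = (\<Oplus>\<^bsub>tensor (A t) H\<^esub>u\<in>words j. pure_tensor (A t) H (X t u) (cls R (col_a y u)))"
  by (simp add: alpha_elt_tensor_proj tensor_proj_sum_A tensor_proj_tens_A del: tens_single)

text \<open>
  The coaction of a capfree element is \<open>\<Sum> x\<^sub>u \<otimes> (a\<^sup>\<otimes>\<^sup>j y)\<^sub>u\<close>. The second factors are capfree as a
  function of \<open>u\<close> by \<open>cap_col_a\<close>, so that a projection can be inserted there and moved to the
  first factor.
\<close>

lemma alpha_elt_summand:
  assumes y: "capfree y"
  shows "\<alpha> t (elt y j) = (\<Oplus>\<^bsub>tensor (A t) H\<^esub>v\<in>words j. pure_tensor (A t) H (elt (nf 0 v) j) (cls R (col_a y v)))"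
proof -
  have vs: "vector_space (scl :: 'k \<Rightarrow> (('n \<times> 'n) list \<Rightarrow>\<^sub>0 'k) \<Rightarrow> _)"
    by unfold_locales (simp_all add: scl_add scl_add_left)
  let ?K = "{q. tensor_proj (RA t) R q = \<zero>\<^bsub>tensor (A t) H\<^esub>}"
  have K: "two_sided_ideal ?K" unfolding H_eq A_eq by (rule tensor_proj_kernel_two_sided_ideal)
  \<comment> \<open>The projection to be inserted acts as the identity on the second factors.\<close>
  have g: "(\<Sum>v\<in>words (length u). scl (dual.nf 0 u v) (col_a y v)) - col_a y u \<in> gen_ideal R" for u
  proof (rule dual.nf0_pair[OF vs])
    show "(\<Sum>b\<in>UNIV. \<Sum>a\<in>UNIV. scl (E $ b $ a) (col_a y (w1 @ b # a # w2))) \<in> gen_ideal R" for w1 w2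
      using cap_col_a[OF two_sided_ideal_gen_ideal sigma_in[unfolded \<sigma>_def] rho_in[unfolded \<rho>_def] y, of w1 w2]
      by (simp add: col_a_def)
  qed (use tidealD(1,2)[OF two_sided_ideal_gen_ideal] two_sided_ideal_scl[OF two_sided_ideal_gen_ideal] in auto)
  let ?a = "\<Sum>u\<in>words j. tens (Poly_Mapping.single u 1) (\<Sum>v\<in>words j. scl (dual.nf 0 u v) (col_a y v)) :: 'n list \<times> ('n \<times> 'n) list \<Rightarrow>\<^sub>0 'k"
  let ?b = "\<Sum>u\<in>words j. tens (Poly_Mapping.single u 1) (col_a y u) :: 'n list \<times> ('n \<times> 'n) list \<Rightarrow>\<^sub>0 'k"
  have "?a - ?b = (\<Sum>u\<in>words j. tens (Poly_Mapping.single u 1) ((\<Sum>v\<in>words j. scl (dual.nf 0 u v) (col_a y v)) - col_a y u))"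
    by (simp add: tens_minus_right sum_subtractf)
  also have "\<dots> \<in> ?K"
  proof (rule tidealD(7)[OF K])
    fix u :: "'n list" assume "u \<in> words j"
    then have "(\<Sum>v\<in>words j. scl (dual.nf 0 u v) (col_a y v)) - col_a y u \<in> gen_ideal R" using g[of u] by simp
    then show "tens (Poly_Mapping.single u 1) ((\<Sum>v\<in>words j. scl (dual.nf 0 u v) (col_a y v)) - col_a y u) \<in> ?K"
      by (simp add: tens_in_tensor_proj_kernel H_eq A_eq)
  qed
  finally have "tensor_proj (RA t) R (?a - ?b) = \<zero>\<^bsub>tensor (A t) H\<^esub>" by simp
  moreover have "?a = (?a - ?b) + ?b" by simp
  ultimately have "tensor_proj (RA t) R ?a = \<zero>\<^bsub>tensor (A t) H\<^esub> \<oplus>\<^bsub>tensor (A t) H\<^esub> tensor_proj (RA t) R ?b"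
    using tensor_proj_hom(2)[of "RA t" R "?a - ?b" ?b] by (simp add: A_eq H_eq)
  then have ab: "tensor_proj (RA t) R ?b = tensor_proj (RA t) R ?a"
    using AH.vect_tensor tensor_proj_hom(3)[of "RA t" R ?b] by (simp add: A_eq H_eq)
  have "?a = (\<Sum>u\<in>words j. \<Sum>v\<in>words j. tens (Poly_Mapping.single u (dual.nf 0 u v)) (col_a y v))"
  proof -
    have "tens (Poly_Mapping.single u 1) (scl (dual.nf 0 u v) (col_a y v)) = tens (Poly_Mapping.single u (dual.nf 0 u v)) (col_a y v)" for u v
      using tens_scl_left[of "dual.nf 0 u v" "Poly_Mapping.single u 1" "col_a y v"] by (simp add: tens_scl_right)
    then show ?thesis by (simp add: tens_sum_right)
  qed
  also have "\<dots> = (\<Sum>v\<in>words j. \<Sum>u\<in>words j. tens (Poly_Mapping.single u (dual.nf 0 u v)) (col_a y v))"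
    by (rule sum.swap)
  also have "\<dots> = (\<Sum>v\<in>words j. tens (\<Sum>u\<in>words j. Poly_Mapping.single u (nf 0 v u)) (col_a y v))"
    by (simp add: tens_sum_left nf0_transpose)
  finally show ?thesis
    unfolding alpha_elt_tensor_proj ab by (simp add: tensor_proj_sum_A tensor_proj_tens_A elt_def)
qed

lemma summand_subcomodule: "subcomodule HE (AE t) (summand j)"
  unfolding subcomodule_def
proof (intro conjI ballI)
  have "submodule (summand j) base (AE t) \<longleftrightarrow> submodule (summand j) base (A t)"
    by (simp add: submodule_base_iff[OF vect_AE] submodule_base_iff[OF vect_A])
  then show "submodule (summand j) base (AE t)" using summand_submodule by simp
  fix s assume "s \<in> summand j"
  then obtain y where y: "capfree y" "s = elt y j" by (auto simp: summand_def)
  let ?P = "{pure_tensor (A t) H x h | x h. x \<in> summand j \<and> h \<in> carrier H}"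
  have P: "?P \<subseteq> carrier (tensor (A t) H)" using summand_subset by (auto intro!: AH.pure_closed)
  have "(\<Oplus>\<^bsub>tensor (A t) H\<^esub>v\<in>words j. pure_tensor (A t) H (elt (nf 0 v) j) (cls R (col_a y v))) \<in> lin_span (tensor (A t) H) ?P"
  proof (rule finsum_in_submodule[OF AH.vect_tensor lin_span_submodule[OF AH.vect_tensor P]])
    show "(\<lambda>v. pure_tensor (A t) H (elt (nf 0 v) j) (cls R (col_a y v))) \<in> words j \<rightarrow> lin_span (tensor (A t) H) ?P"
    proof
      fix v :: "'n list"
      have "elt (nf 0 v) j \<in> summand j" using capfree_nf[of 0 v] by (auto simp: summand_def)
      then show "pure_tensor (A t) H (elt (nf 0 v) j) (cls R (col_a y v)) \<in> lin_span (tensor (A t) H) ?P"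
        by (intro subsetD[OF lin_span_superset]) blast
    qed
  qed
  then show "coaction (AE t) s \<in> lin_span (tensor (AE t) HE) {pure_tensor (AE t) HE x h | x h. x \<in> summand j \<and> h \<in> carrier HE}"
    by (simp add: y(2) alpha_elt_summand[OF y(1)])
qed

text \<open>
  The functionals act on the summand of degree \<open>j\<close> by rank one operators, with all coordinates and all
  elements of a spanning set occurring.
\<close>

lemma act_by_elt:
  assumes y: "capfree y"
  shows "act_by (AE t) (phi u' u) (elt y j) = (if length u = j then y u else 0) \<odot>\<^bsub>A t\<^esub> elt (nf 0 u') j"
proof -
  note ct = contract_works[OF vect_A vect_H phi_lin_hom]
  let ?a = "if length u = j then y u else 0"
  have cA: "contract (AE t) \<phi> = contract (A t) \<phi>" for \<phi> by (simp add: contract_def)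
  have "act_by (AE t) (phi u' u) (elt y j) = contract (A t) (phi u' u) (\<alpha> t (elt y j))"
    by (simp add: act_by_def cA)
  also have "\<dots> = (\<Oplus>\<^bsub>A t\<^esub>z\<in>words j. contract (A t) (phi u' u) (pure_tensor (A t) H (X t z) (cls R (col_a y z))))"
    unfolding alpha_elt by (rule lin_hom_finsum[OF AH.vect_tensor vect_A ct(1)]) (auto intro!: AH.pure_closed)
  also have "\<dots> = (\<Oplus>\<^bsub>A t\<^esub>z\<in>words j. ?a \<odot>\<^bsub>A t\<^esub> (nf 0 u' z \<odot>\<^bsub>A t\<^esub> X t z))"
  proof (rule vect_finsum_cong[OF vect_A refl])
    fix z :: "'n list" assume z: "z \<in> words j"
    have "phi u' u (cls R (col_a y z)) = (\<Sum>w\<in>words (length z). y w * pw_coef (zip z w) u' u)"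
      by (simp add: phi_cls col_a_def pw_poly_linear a_word_def)
    also have "\<dots> = ?a * nf 0 u' z" using z pw_coef_pair[OF y, of z u' u] by (simp add: nf0_transpose)
    finally show "contract (A t) (phi u' u) (pure_tensor (A t) H (X t z) (cls R (col_a y z))) = ?a \<odot>\<^bsub>A t\<^esub> (nf 0 u' z \<odot>\<^bsub>A t\<^esub> X t z)"
      using vect_A by (simp add: ct(2) vect_smult_assoc)
    show "?a \<odot>\<^bsub>A t\<^esub> (nf 0 u' z \<odot>\<^bsub>A t\<^esub> X t z) \<in> carrier (A t)" using vect_A by simp
  qed
  also have "\<dots> = ?a \<odot>\<^bsub>A t\<^esub> elt (nf 0 u') j"
    unfolding elt_finsum by (rule smult_finsum[OF vect_A, symmetric]) (use vect_A in auto)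
  finally show ?thesis .
qed

lemma elt_nf0_sum:
  assumes "capfree y"
  shows "elt y j = (\<Oplus>\<^bsub>A t\<^esub>u'\<in>words j. y u' \<odot>\<^bsub>A t\<^esub> elt (nf 0 u') j)"
proof -
  have "elt y j = elt (\<lambda>w. \<Sum>u'\<in>words j. y u' * nf 0 u' w) j"
    by (rule elt_cong) (simp add: capfree_nf_sum[OF assms])
  then show ?thesis by (simp add: elt_sum elt_smult)
qed

text \<open>
  If some \<open>s\<close> in \<open>T\<close> has a nonzero coordinate at \<open>u\<close>, then the functionals \<open>phi u' u\<close> carry \<open>s\<close> to nonzero
  multiples of elements that span the summand.
\<close>

lemma summand_simple:
  assumes T: "T \<subseteq> summand j" "submodule T base (A t)"
    and st: "\<And>u' u s. s \<in> T \<Longrightarrow> act_by (AE t) (phi u' u) s \<in> T"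
  shows "T = {\<zero>\<^bsub>A t\<^esub>} \<or> T = summand j"
proof (cases "T = {\<zero>\<^bsub>A t\<^esub>}")
  case False
  then obtain s where s: "s \<in> T" "s \<noteq> \<zero>\<^bsub>A t\<^esub>" using submoduleD(2)[OF vect_A T(2)] by auto
  then obtain y where y: "capfree y" "s = elt y j" using T(1) by (auto simp: summand_def)
  have "\<exists>u. length u = j \<and> y u \<noteq> 0"
  proof (rule ccontr)
    assume "\<not> ?thesis"
    then have "elt y j = elt (\<lambda>_. 0) j" by (intro elt_cong) blast
    then show False using s(2) y(2) by (simp only: elt_zero)
  qed
  then obtain u where u: "length u = j" "y u \<noteq> 0" by blast
  have m: "elt (nf 0 u') j \<in> T" for u'
  proof -
    have "y u \<odot>\<^bsub>A t\<^esub> elt (nf 0 u') j \<in> T"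
      using st[OF s(1), of u' u] u(1) by (simp add: y(2) act_by_elt[OF y(1)])
    then have "inverse (y u) \<odot>\<^bsub>A t\<^esub> (y u \<odot>\<^bsub>A t\<^esub> elt (nf 0 u') j) \<in> T" by (rule submoduleD(4)[OF vect_A T(2)])
    then show ?thesis using u(2) vect_A by (simp add: vect_smult_assoc)
  qed
  have "summand j \<subseteq> T"
  proof
    fix x assume "x \<in> summand j"
    then obtain z where z: "capfree z" "x = elt z j" by (auto simp: summand_def)
    show "x \<in> T" unfolding z(2) elt_nf0_sum[OF z(1)]
      by (rule finsum_in_submodule[OF vect_A T(2)]) (use m submoduleD(4)[OF vect_A T(2)] in auto)
  qed
  then show ?thesis using T(1) by auto
qed simp

subsection \<open>Maps from the simple summands into comodules\<close>

context
  fixes W :: "('k, (('n \<times> 'n) list \<Rightarrow>\<^sub>0 'k) set, 'v) comodule"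
  assumes W: "right_comodule HE W"
begin

interpretation WH: two_vects W H by (rule two_vects.intro) (rule vect_W[OF W] vect_H)+

text \<open>
  The map sending the word \<open>w\<close> of the same length as \<open>u\<close> to \<^term>\<open>act_by W (phi w u) x\<close>, extended by zero
  to the other summands.
\<close>

definition smap :: "'n list \<Rightarrow> 'v \<Rightarrow> ('n list \<Rightarrow>\<^sub>0 'k) set \<Rightarrow> 'v" where
  "smap u x a = (\<Oplus>\<^bsub>W\<^esub>u'\<in>words (length u). coord u' a \<odot>\<^bsub>W\<^esub> act_by W (phi u' u) x)"

context
  fixes u :: "'n list" and x :: 'v
  assumes x: "x \<in> carrier W"
begin

lemma act_by_phi_closed: "act_by W (phi u' v) x \<in> carrier W"
  by (rule act_by_closed[OF W phi_lin_hom x])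

lemma smap_lin_hom: "smap u x \<in> lin_hom (A t) W"
  unfolding smap_def[abs_def]
  by (rule lin_hom_of_finsum[OF vect_A vect_W[OF W]])
     (auto intro!: lin_homI simp: lin_homD[OF coord_lin_hom] vect_W[OF W] act_by_phi_closed vect_smult_l_distr vect_smult_assoc)

lemma smap_X: "length w = length u \<Longrightarrow> smap u x (X t w) = act_by W (phi w u) x"
proof -
  assume w: "length w = length u"
  have "smap u x (X t w) = (\<Oplus>\<^bsub>W\<^esub>u'\<in>words (length w). nf 0 w u' \<odot>\<^bsub>W\<^esub> act_by W (phi u' u) x)"
    unfolding smap_def
    by (rule vect_finsum_cong[OF vect_W[OF W]]) (use w act_by_phi_closed vect_W[OF W] in \<open>auto simp: coord_cls nf_poly_linear nf_top[where t = t]\<close>)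
  then show ?thesis using act_by_phi_nf0[OF W x] by simp
qed

lemma smap_elt: "smap u x (elt y (length u)) = (\<Oplus>\<^bsub>W\<^esub>w\<in>words (length u). y w \<odot>\<^bsub>W\<^esub> act_by W (phi w u) x)"
proof -
  have "smap u x (elt y (length u)) = (\<Oplus>\<^bsub>W\<^esub>w\<in>words (length u). smap u x (y w \<odot>\<^bsub>A t\<^esub> X t w))"
    unfolding elt_finsum by (rule lin_hom_finsum[OF vect_A vect_W[OF W] smap_lin_hom]) (use vect_A in auto)
  also have "\<dots> = (\<Oplus>\<^bsub>W\<^esub>w\<in>words (length u). y w \<odot>\<^bsub>W\<^esub> act_by W (phi w u) x)"
    by (rule vect_finsum_cong[OF vect_W[OF W] refl])
       (use smap_X act_by_phi_closed vect_W[OF W] in \<open>auto simp: lin_homD(3)[OF smap_lin_hom]\<close>)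
  finally show ?thesis .
qed

text \<open>
  Both sides agree by \<open>coaction_phi\<close>, once the elements of the summand are written as combinations
  of the projections of words.
\<close>

lemma smap_comodule:
  assumes s: "s \<in> summand (length u)"
  shows "coaction W (smap u x s) = tensor_map W H (smap u x) (\<lambda>h. h) (\<alpha> t s)"
proof -
  obtain y where y: "capfree y" "s = elt y (length u)" using s by (auto simp: summand_def)
  let ?n = "length u"
  note tm = tensor_map_works[OF vect_A vect_H vect_W[OF W] vect_H smap_lin_hom lin_hom_id]
  let ?p = "\<lambda>w' w. pure_tensor W H (act_by W (phi w' u) x) (C w' w)"
  have pc: "?p w' w \<in> carrier (tensor W H)" for w' w using act_by_phi_closed by (auto intro!: WH.pure_closed)
  have "coaction W (smap u x s) = (\<Oplus>\<^bsub>tensor W H\<^esub>w\<in>words ?n. coaction W (y w \<odot>\<^bsub>W\<^esub> act_by W (phi w u) x))"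
    unfolding y(2) smap_elt by (rule lin_hom_finsum[OF vect_W[OF W] WH.vect_tensor coaction_W[OF W]]) (use act_by_phi_closed vect_W[OF W] in auto)
  also have "\<dots> = (\<Oplus>\<^bsub>tensor W H\<^esub>w\<in>words ?n. \<Oplus>\<^bsub>tensor W H\<^esub>w'\<in>words ?n. y w \<odot>\<^bsub>tensor W H\<^esub> ?p w' w)"
  proof (rule vect_finsum_cong[OF WH.vect_tensor refl])
    fix w :: "'n list" assume w: "w \<in> words ?n"
    have "coaction W (y w \<odot>\<^bsub>W\<^esub> act_by W (phi w u) x) = y w \<odot>\<^bsub>tensor W H\<^esub> (\<Oplus>\<^bsub>tensor W H\<^esub>w'\<in>words ?n. ?p w' w)"
      using coaction_phi[OF W x, of w u] w by (simp add: lin_homD(3)[OF coaction_W[OF W] act_by_phi_closed])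
    also have "\<dots> = (\<Oplus>\<^bsub>tensor W H\<^esub>w'\<in>words ?n. y w \<odot>\<^bsub>tensor W H\<^esub> ?p w' w)"
      by (rule smult_finsum[OF WH.vect_tensor]) (use pc in auto)
    finally show "coaction W (y w \<odot>\<^bsub>W\<^esub> act_by W (phi w u) x) = \<dots>" .
    show "\<dots> \<in> carrier (tensor W H)" using pc WH.vect_tensor by (intro vect_finsum_closed) auto
  qed
  also have "\<dots> = (\<Oplus>\<^bsub>tensor W H\<^esub>w'\<in>words ?n. \<Oplus>\<^bsub>tensor W H\<^esub>w\<in>words ?n. y w \<odot>\<^bsub>tensor W H\<^esub> ?p w' w)"
    by (rule finsum_swap[OF WH.vect_tensor]) (use pc WH.vect_tensor in auto)
  also have "\<dots> = (\<Oplus>\<^bsub>tensor W H\<^esub>w'\<in>words ?n. tensor_map W H (smap u x) (\<lambda>h. h) (pure_tensor (A t) H (X t w') (cls R (col_a y w'))))"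
  proof (rule vect_finsum_cong[OF WH.vect_tensor refl])
    fix w' :: "'n list" assume w': "w' \<in> words ?n"
    have "tensor_map W H (smap u x) (\<lambda>h. h) (pure_tensor (A t) H (X t w') (cls R (col_a y w'))) =
        pure_tensor W H (act_by W (phi w' u) x) (\<Oplus>\<^bsub>H\<^esub>w\<in>words ?n. y w \<odot>\<^bsub>H\<^esub> C w' w)"
      using w' by (simp add: tm(2) smap_X cls_col_a[symmetric]) (simp add: cls_col_a)
    also have "\<dots> = (\<Oplus>\<^bsub>tensor W H\<^esub>w\<in>words ?n. pure_tensor W H (act_by W (phi w' u) x) (y w \<odot>\<^bsub>H\<^esub> C w' w))"
      by (rule WH.pure_finsum_right) (use act_by_phi_closed vect_H in auto)
    also have "\<dots> = (\<Oplus>\<^bsub>tensor W H\<^esub>w\<in>words ?n. y w \<odot>\<^bsub>tensor W H\<^esub> ?p w' w)"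
      by (rule vect_finsum_cong[OF WH.vect_tensor refl]) (use act_by_phi_closed pc WH.vect_tensor in \<open>auto simp: WH.pure_smult_right\<close>)
    finally show "(\<Oplus>\<^bsub>tensor W H\<^esub>w\<in>words ?n. y w \<odot>\<^bsub>tensor W H\<^esub> ?p w' w) =
      tensor_map W H (smap u x) (\<lambda>h. h) (pure_tensor (A t) H (X t w') (cls R (col_a y w')))" by simp
    show "tensor_map W H (smap u x) (\<lambda>h. h) (pure_tensor (A t) H (X t w') (cls R (col_a y w'))) \<in> carrier (tensor W H)"
      by (rule lin_homD(1)[OF tm(1)]) (auto intro!: AH.pure_closed)
  qed
  also have "\<dots> = tensor_map W H (smap u x) (\<lambda>h. h) (\<alpha> t s)"
    unfolding y(2) alpha_elt by (rule lin_hom_finsum[OF AH.vect_tensor WH.vect_tensor tm(1), symmetric])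
      (auto intro!: AH.pure_closed)
  finally show ?thesis .
qed

end

end

end

end

context model
begin

interpretation dual: quantum_form "\<lambda>a b. matrix_inv E $ a $ b" "\<lambda>a b. E $ a $ b" c by (rule dual)

context
  fixes t :: 'k and W :: "('k, (('n \<times> 'n) list \<Rightarrow>\<^sub>0 'k) set, 'v) comodule"
  assumes W: "right_comodule HE W"
begin

interpretation AH: two_algebras "A t" H by (rule two_algebras_AH)
interpretation WH: two_vects W H by (rule two_vects.intro) (rule vect_W[OF W] vect_H)+

lemma contract_AE: "contract (AE t) \<phi> = contract (A t) \<phi>" by (simp add: contract_def)

lemma summand_stable:
  assumes "\<phi> \<in> lin_hom H base" "s \<in> summand t j"
  shows "act_by (AE t) \<phi> s \<in> summand t j"
  by (rule act_by_subcomodule[OF right_comodule_AE assms(1) summand_subcomodule assms(2)])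

context
  fixes u :: "'n list" and x :: 'v
  assumes x: "x \<in> carrier W"
begin

abbreviation "f \<equiv> smap t W u x"
abbreviation "Su \<equiv> summand t (length u)"

lemma smap_lin: "f \<in> lin_hom (A t) W" by (rule smap_lin_hom[OF W x])

lemma smap_act:
  assumes s: "s \<in> Su" and \<phi>: "\<phi> \<in> lin_hom H base"
  shows "act_by W \<phi> (f s) = f (act_by (AE t) \<phi> s)"
proof -
  have "s \<in> carrier (A t)" using s summand_subset by auto
  then have z: "\<alpha> t s \<in> carrier (tensor (A t) H)" by (rule lin_homD(1)[OF alpha_lin_hom])
  show ?thesis
    using contract_tensor_map[OF vect_A vect_W[OF W] vect_H smap_lin \<phi> z]
    by (simp add: act_by_def smap_comodule[OF W x s] contract_AE)
qed

lemma smap_nf: "f (elt t (nf 0 u) (length u)) = act_by W (phi u u) x"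
  unfolding smap_elt[OF W x] by (rule act_by_phi_nf0[OF W x])

lemma smap_image_mem: "act_by W (phi u u) x \<in> f ` Su"
  unfolding smap_nf[symmetric] using capfree_nf[of 0 u] by (intro imageI) (auto simp: summand_def)

lemma smap_image_submodule: "submodule (f ` Su) base W"
  by (rule image_submodule[OF vect_A vect_W[OF W] smap_lin summand_submodule])

lemma alpha_summand:
  assumes "s \<in> summand t j"
  shows "\<alpha> t s \<in> lin_span (tensor (A t) H) {pure_tensor (A t) H a h | a h. a \<in> summand t j \<and> h \<in> carrier H}"
  using summand_subcomodule[of t j] assms by (simp add: subcomodule_def)

lemma smap_image_subcomodule: "subcomodule HE W (f ` Su)"
  unfolding subcomodule_def
proof (intro conjI ballI)
  show "submodule (f ` Su) base W" by (rule smap_image_submodule)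
  fix y assume "y \<in> f ` Su"
  then obtain s where s: "s \<in> Su" "y = f s" by auto
  let ?P = "{pure_tensor (A t) H a h | a h. a \<in> Su \<and> h \<in> carrier H}"
  let ?Q = "{pure_tensor W H x h | x h. x \<in> f ` Su \<and> h \<in> carrier H}"
  note m = tensor_map_works[OF vect_A vect_H vect_W[OF W] vect_H smap_lin lin_hom_id]
  have Sc: "Su \<subseteq> carrier (A t)" by (rule summand_subset)
  have "tensor_map W H f (\<lambda>h. h) (\<alpha> t s) \<in> lin_span (tensor W H) ?Q"
  proof (rule lin_span_image[OF AH.vect_tensor WH.vect_tensor m(1) _ _ _ alpha_summand[OF s(1)]])
    show "?P \<subseteq> carrier (tensor (A t) H)" using Sc by (auto intro!: AH.pure_closed)
    show "?Q \<subseteq> carrier (tensor W H)"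
      using submoduleD(1)[OF vect_W[OF W] smap_image_submodule] by (auto intro!: WH.pure_closed)
    show "tensor_map W H f (\<lambda>h. h) z \<in> ?Q" if "z \<in> ?P" for z
    proof -
      obtain a h where a: "z = pure_tensor (A t) H a h" "a \<in> Su" "h \<in> carrier H" using \<open>z \<in> ?P\<close> by blast
      then have "tensor_map W H f (\<lambda>h. h) z = pure_tensor W H (f a) h" using Sc by (simp add: m(2) subsetD)
      then show ?thesis using a by blast
    qed
  qed
  then show "coaction W y \<in> lin_span (tensor W HE) {pure_tensor W HE x h | x h. x \<in> f ` Su \<and> h \<in> carrier HE}"
    by (simp add: s(2) smap_comodule[OF W x s(1)])
qed

text \<open>
  The map commutes with the functionals, hence preimages of stable subspaces are stable, and the
  summand is simple.
\<close>

lemma smap_preimage: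
  assumes T: "submodule T base W" and st: "\<And>u' v y. y \<in> T \<Longrightarrow> act_by W (phi u' v) y \<in> T"
  shows "{s \<in> Su. f s \<in> T} = {\<zero>\<^bsub>A t\<^esub>} \<or> {s \<in> Su. f s \<in> T} = Su"
proof (rule summand_simple)
  show "{s \<in> Su. f s \<in> T} \<subseteq> Su" by auto
  have "{s \<in> Su. f s \<in> T} = Su \<inter> {s \<in> carrier (A t). f s \<in> T}" using summand_subset by auto
  then show "submodule {s \<in> Su. f s \<in> T} base (A t)"
    using submodule_Int[OF vect_A summand_submodule lin_hom_kernel[OF vect_A vect_W[OF W] smap_lin T]] by simp
  show "act_by (AE t) (phi u' v) s \<in> {s \<in> Su. f s \<in> T}" if "s \<in> {s \<in> Su. f s \<in> T}" for u' v s
  proof -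
    have s: "s \<in> Su" "f s \<in> T" using that by auto
    have "f (act_by (AE t) (phi u' v) s) \<in> T"
      unfolding smap_act[OF s(1) phi_lin_hom, symmetric] by (rule st[OF s(2)])
    then show ?thesis using summand_stable[OF phi_lin_hom s(1)] by blast
  qed
qed

lemma smap_zero: "f \<zero>\<^bsub>A t\<^esub> = \<zero>\<^bsub>W\<^esub>"
  by (rule lin_hom_zero[OF vect_A vect_W[OF W] smap_lin])

lemma smap_image_simple:
  assumes T: "T \<subseteq> f ` Su" "submodule T base W" and st: "\<And>u' v y. y \<in> T \<Longrightarrow> act_by W (phi u' v) y \<in> T"
  shows "T = {\<zero>\<^bsub>W\<^esub>} \<or> T = f ` Su"
proof -
  have T': "T = f ` {s \<in> Su. f s \<in> T}" using T(1) by auto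
  show ?thesis
    using smap_preimage[OF T(2) st]
  proof
    assume *: "{s \<in> Su. f s \<in> T} = {\<zero>\<^bsub>A t\<^esub>}"
    show ?thesis using T' smap_zero unfolding * by simp
  next
    assume *: "{s \<in> Su. f s \<in> T} = Su"
    show ?thesis using T' unfolding * by simp
  qed
qed

lemma smap_inj:
  assumes "f ` Su \<noteq> {\<zero>\<^bsub>W\<^esub>}" shows "inj_on f Su"
proof -
  have st: "act_by W (phi u' v) y \<in> {\<zero>\<^bsub>W\<^esub>}" if "y \<in> {\<zero>\<^bsub>W\<^esub>}" for u' v y
    using that lin_hom_zero[OF vect_W[OF W] vect_W[OF W] act_by_lin_hom[OF W phi_lin_hom]] by simp
  have "{s \<in> Su. f s \<in> {\<zero>\<^bsub>W\<^esub>}} \<noteq> Su"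
  proof
    assume "{s \<in> Su. f s \<in> {\<zero>\<^bsub>W\<^esub>}} = Su"
    then have "f ` Su \<subseteq> {\<zero>\<^bsub>W\<^esub>}" by auto
    then show False using assms submoduleD(2)[OF vect_W[OF W] smap_image_submodule] by auto
  qed
  then have k: "{s \<in> Su. f s \<in> {\<zero>\<^bsub>W\<^esub>}} = {\<zero>\<^bsub>A t\<^esub>}"
    using smap_preimage[OF submodule_zero[OF vect_W[OF W]] st] by auto
  show ?thesis
  proof (rule inj_onI)
    fix a b assume ab: "a \<in> Su" "b \<in> Su" "f a = f b"
    then have c: "a \<in> carrier (A t)" "b \<in> carrier (A t)" using summand_subset by auto
    let ?d = "a \<oplus>\<^bsub>A t\<^esub> ((-1) \<odot>\<^bsub>A t\<^esub> b)"
    have "f ?d = f a \<oplus>\<^bsub>W\<^esub> ((-1) \<odot>\<^bsub>W\<^esub> f b)"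
      using c vect_A by (simp add: lin_homD(2,3)[OF smap_lin])
    also have "\<dots> = \<zero>\<^bsub>W\<^esub>"
      using vect_a_inv[OF vect_W[OF W] lin_homD(1)[OF smap_lin c(2)]] vect_r_neg[OF vect_W[OF W] lin_homD(1)[OF smap_lin c(2)]]
      by (simp add: ab(3))
    finally have "?d \<in> {s \<in> Su. f s \<in> {\<zero>\<^bsub>W\<^esub>}}"
      using ab submoduleD(3,4)[OF vect_A summand_submodule] by auto
    then have z: "a \<oplus>\<^bsub>A t\<^esub> (\<ominus>\<^bsub>A t\<^esub> b) = \<zero>\<^bsub>A t\<^esub>" unfolding k by (simp add: vect_a_inv[OF vect_A c(2)])
    interpret abelian_group "A t" using vect_A by (rule vect_abelian_group)
    show "a = b" using z c by (metis a_inv_closed minus_equality minus_minus)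
  qed
qed

lemma smap_inverse:
  assumes nz: "f ` Su \<noteq> {\<zero>\<^bsub>W\<^esub>}" and onto: "f ` Su = carrier W"
  shows "iso_to_subcomodule HE W (AE t) Su"
proof -
  have bij: "bij_betw f Su (carrier W)" using smap_inj[OF nz] onto by (simp add: bij_betw_def)
  let ?g = "inv_into Su f"
  have gf: "?g (f s) = s" if "s \<in> Su" for s using bij that by (simp add: bij_betw_inv_into_left)
  have fg: "f (?g y) = y" "?g y \<in> Su" if "y \<in> carrier W" for y
    using bij that by (simp_all add: bij_betw_inv_into_right) (metis bij_betw_def inv_into_into)
  have Sc: "Su \<subseteq> carrier (A t)" by (rule summand_subset)
  note SD = submoduleD[OF vect_A summand_submodule]
  have g: "?g \<in> lin_hom W (A t)"
  proof (rule lin_homI)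
    fix y assume y: "y \<in> carrier W"
    show "?g y \<in> carrier (A t)" using fg(2)[OF y] Sc by auto
    have "f (a \<odot>\<^bsub>A t\<^esub> ?g y) = a \<odot>\<^bsub>W\<^esub> y" for a
      using fg[OF y] Sc lin_homD(3)[OF smap_lin, of "?g y" a] by auto
    then show "?g (a \<odot>\<^bsub>W\<^esub> y) = a \<odot>\<^bsub>A t\<^esub> ?g y" for a
      using gf[OF SD(4)[OF fg(2)[OF y]], of a] by simp
    fix y' assume y': "y' \<in> carrier W"
    have "f (?g y \<oplus>\<^bsub>A t\<^esub> ?g y') = y \<oplus>\<^bsub>W\<^esub> y'"
      using fg[OF y] fg[OF y'] Sc lin_homD(2)[OF smap_lin, of "?g y" "?g y'"] by auto
    then show "?g (y \<oplus>\<^bsub>W\<^esub> y') = ?g y \<oplus>\<^bsub>A t\<^esub> ?g y'"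
      using gf[OF SD(3)[OF fg(2)[OF y] fg(2)[OF y']]] by simp
  qed
  note m = tensor_map_works[OF vect_A vect_H vect_W[OF W] vect_H smap_lin lin_hom_id]
  note n = tensor_map_works[OF vect_W[OF W] vect_H vect_A vect_H g lin_hom_id]
  let ?P = "{pure_tensor (A t) H a h | a h. a \<in> Su \<and> h \<in> carrier H}"
  let ?Eq = "{z \<in> carrier (tensor (A t) H). tensor_map (A t) H ?g (\<lambda>h. h) (tensor_map W H f (\<lambda>h. h) z) = z}"
  \<comment> \<open>On tensors with first factor in the summand, \<open>?g \<otimes> id\<close> is inverse to \<open>f \<otimes> id\<close>, and the coaction of
    elements of the summand has values there.\<close>
  have "lin_span (tensor (A t) H) ?P \<subseteq> ?Eq"
  proof (rule lin_span_least)
    show "submodule ?Eq base (tensor (A t) H)"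
      by (rule equalizer_submodule[OF AH.vect_tensor lin_hom_comp[OF m(1) n(1)] lin_hom_id AH.vect_tensor])
    show "?P \<subseteq> ?Eq"
      using Sc lin_homD(1)[OF smap_lin] by (auto simp: m(2) n(2) gf subset_iff intro!: AH.pure_closed)
  qed
  then have inv: "tensor_map (A t) H ?g (\<lambda>h. h) (tensor_map W H f (\<lambda>h. h) (\<alpha> t s)) = \<alpha> t s" if "s \<in> Su" for s
    using alpha_summand[OF that] by auto
  have "\<alpha> t (?g y) = tensor_map (A t) H ?g (\<lambda>h. h) (coaction W y)" if y: "y \<in> carrier W" for y
    using inv[OF fg(2)[OF y]] smap_comodule[OF W x fg(2)[OF y]] fg(1)[OF y] by simp
  then have "?g \<in> comodule_hom HE W (AE t)"
    using g by (simp add: comodule_hom_def lin_hom_AE)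
  moreover have "bij_betw ?g (carrier W) Su" using bij by (rule bij_betw_inv_into)
  ultimately show ?thesis unfolding iso_to_subcomodule_def by blast
qed

end

text \<open>
  The nonzero images of the maps \<^term>\<open>smap t W u x\<close> have no proper nonzero subspace stable under
  the functionals \<^term>\<open>phi u' u\<close>, and by \<open>act_by_phi_span\<close> they span the comodule.
\<close>

lemma comodule_decomposition: "\<exists>\<S>. simple_decomposition HE W \<S>"
proof -
  let ?\<G> = "{smap t W u x ` summand t (length u) | u x. x \<in> carrier W \<and> smap t W u x ` summand t (length u) \<noteq> {\<zero>\<^bsub>W\<^esub>}}"
  let ?Ops = "{act_by W (phi u' u) | u' u. True}"
  have cases: "\<exists>u x. x \<in> carrier W \<and> G = smap t W u x ` summand t (length u) \<and> G \<noteq> {\<zero>\<^bsub>W\<^esub>}" if "G \<in> ?\<G>" for G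
    using that by blast
  have sub: "subcomodule HE W G" if "G \<in> ?\<G>" for G
    using cases[OF that] smap_image_subcomodule by blast
  have simple: "T = {\<zero>\<^bsub>W\<^esub>} \<or> T = G" if G: "G \<in> ?\<G>" and T: "T \<subseteq> G" "submodule T base W"
    and st: "\<And>f x. f \<in> ?Ops \<Longrightarrow> x \<in> T \<Longrightarrow> f x \<in> T" for G T
  proof -
    obtain u x where ux: "x \<in> carrier W" "G = smap t W u x ` summand t (length u)" using cases[OF G] by blast
    show ?thesis unfolding ux(2)
      by (rule smap_image_simple[OF ux(1) T(1)[unfolded ux(2)] T(2)]) (rule st, auto)
  qed
  have "\<exists>\<S>\<subseteq>?\<G>. direct_sum_of W \<S>"
  proof (rule direct_sum_exists[where Ops = ?Ops, OF vect_W[OF W]])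
    show "f \<in> lin_hom W W" if "f \<in> ?Ops" for f using that act_by_lin_hom[OF W phi_lin_hom] by auto
    show "submodule G base W" if "G \<in> ?\<G>" for G using sub[OF that] by (simp add: subcomodule_def)
    show "f x \<in> G" if "G \<in> ?\<G>" "f \<in> ?Ops" "x \<in> G" for G f x
      using act_by_subcomodule[OF W phi_lin_hom sub[OF that(1)] that(3)] that(2) by auto
    show "G \<noteq> {\<zero>\<^bsub>W\<^esub>}" if "G \<in> ?\<G>" for G using cases[OF that] by blast
    show "T = {\<zero>\<^bsub>W\<^esub>} \<or> T = G" if "G \<in> ?\<G>" "T \<subseteq> G" "submodule T base W" "\<And>f x. f \<in> ?Ops \<Longrightarrow> x \<in> T \<Longrightarrow> f x \<in> T" for G T
      by (rule simple[OF that(1,2,3)]) (rule that(4))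
    fix M assume M: "submodule M base W" and GM: "\<And>G. G \<in> ?\<G> \<Longrightarrow> G \<subseteq> M"
    show "carrier W \<subseteq> M"
    proof
      fix x assume x: "x \<in> carrier W"
      have "act_by W (phi u u) x \<in> M" for u
      proof (cases "smap t W u x ` summand t (length u) = {\<zero>\<^bsub>W\<^esub>}")
        case True
        then show ?thesis using smap_image_mem[OF x, of u] submoduleD(2)[OF vect_W[OF W] M] by simp
      next
        case False
        then have "smap t W u x ` summand t (length u) \<subseteq> M" using x by (intro GM) blast
        then show ?thesis using smap_image_mem[OF x, of u] by auto
      qed
      moreover obtain N where "x = (\<Oplus>\<^bsub>W\<^esub>u\<in>words_le N. act_by W (phi u u) x)"
        using act_by_phi_span[OF W x] by blast
      ultimately show "x \<in> M"
        using finsum_in_submodule[OF vect_W[OF W] M, of "\<lambda>u. act_by W (phi u u) x" "words_le N"] by auto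
    qed
  qed
  then obtain \<S> where \<S>: "\<S> \<subseteq> ?\<G>" "direct_sum_of W \<S>" by blast
  have "simple_subcomodule HE W G" if "G \<in> \<S>" for G
    unfolding simple_subcomodule_def
  proof (intro conjI allI impI)
    have G: "G \<in> ?\<G>" using that \<S>(1) by blast
    show "subcomodule HE W G" by (rule sub[OF G])
    show "G \<noteq> {\<zero>\<^bsub>W\<^esub>}" using cases[OF G] by blast
    fix T assume T: "T \<subseteq> G" "subcomodule HE W T"
    show "T = {\<zero>\<^bsub>W\<^esub>} \<or> T = G"
    proof (rule simple[OF G T(1)])
      show "submodule T base W" using T(2) by (simp add: subcomodule_def)
      show "f x \<in> T" if "f \<in> ?Ops" "x \<in> T" for f x
        using that act_by_subcomodule[OF W phi_lin_hom T(2)] by auto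
    qed
  qed
  then show ?thesis using \<S>(2) by (auto simp: simple_decomposition_def)
qed

lemma simple_comodule_iso:
  assumes simple: "simple_comodule HE W"
  shows "\<exists>j. iso_to_subcomodule HE W (AE t) (summand t j)"
proof -
  have s: "simple_subcomodule HE W (carrier W)" using simple by (simp add: simple_comodule_def)
  have "carrier W \<noteq> {\<zero>\<^bsub>W\<^esub>}" using s by (simp add: simple_subcomodule_def)
  then obtain x where x: "x \<in> carrier W" "x \<noteq> \<zero>\<^bsub>W\<^esub>" using vect_W[OF W] by auto
  obtain N where N: "x = (\<Oplus>\<^bsub>W\<^esub>u\<in>words_le N. act_by W (phi u u) x)" using act_by_phi_span[OF W x(1)] by blast
  have "\<exists>u. act_by W (phi u u) x \<noteq> \<zero>\<^bsub>W\<^esub>"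
  proof (rule ccontr)
    assume "\<not> ?thesis"
    then have "(\<Oplus>\<^bsub>W\<^esub>u\<in>words_le N. act_by W (phi u u) x) \<in> {\<zero>\<^bsub>W\<^esub>}"
      by (intro finsum_in_submodule[OF vect_W[OF W] submodule_zero[OF vect_W[OF W]]]) auto
    then show False using N x(2) by simp
  qed
  then obtain u where u: "act_by W (phi u u) x \<noteq> \<zero>\<^bsub>W\<^esub>" by blast
  have nz: "smap t W u x ` summand t (length u) \<noteq> {\<zero>\<^bsub>W\<^esub>}" using smap_image_mem[OF x(1), of u] u by auto
  have sub: "subcomodule HE W (smap t W u x ` summand t (length u))" by (rule smap_image_subcomodule[OF x(1)])
  have "smap t W u x ` summand t (length u) \<subseteq> carrier W"
    by (rule submoduleD(1)[OF vect_W[OF W] smap_image_submodule[OF x(1)]])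
  then have "smap t W u x ` summand t (length u) = carrier W"
    using s sub nz unfolding simple_subcomodule_def by blast
  then show ?thesis using smap_inverse[OF x(1) nz] by blast
qed

text \<open>
  The functionals distinguish the summands: \<open>phi u' u\<close> with \<open>u\<close> of length \<open>i\<close> kills the summand of degree
  \<open>j \<noteq> i\<close>, whereas for suitable \<open>u'\<close> and \<open>u\<close> it does not kill the one of degree \<open>i\<close>.
\<close>

lemma simple_comodule_iso_unique:
  assumes i: "iso_to_subcomodule HE W (AE t) (summand t i)" and j: "iso_to_subcomodule HE W (AE t) (summand t j)"
  shows "i = j"
proof (rule ccontr)
  assume ij: "i \<noteq> j"
  obtain f where f: "f \<in> comodule_hom HE W (AE t)" "bij_betw f (carrier W) (summand t i)"
    using i by (auto simp: iso_to_subcomodule_def)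
  obtain g where g: "g \<in> comodule_hom HE W (AE t)" "bij_betw g (carrier W) (summand t j)"
    using j by (auto simp: iso_to_subcomodule_def)
  have act: "act_by (AE t) (phi u' u) (h x) = h (act_by W (phi u' u) x)"
    if h: "h \<in> comodule_hom HE W (AE t)" and x: "x \<in> carrier W" for h x u' u
  proof -
    have hl: "h \<in> lin_hom W (A t)" and hc: "\<alpha> t (h x) = tensor_map (A t) H h (\<lambda>h. h) (coaction W x)"
      using h x by (simp_all add: comodule_hom_def lin_hom_AE)
    show ?thesis
      using contract_tensor_map[OF vect_W[OF W] vect_A vect_H hl phi_lin_hom lin_homD(1)[OF coaction_W[OF W] x]]
      by (simp add: act_by_def hc contract_AE)
  qed
  obtain y u where y: "capfree y" "length u = i" "y u \<noteq> 0" using capfree_nonzero by blast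
  have "elt t y i \<in> summand t i" using y(1) by (auto simp: summand_def)
  then obtain x where x: "x \<in> carrier W" "f x = elt t y i" using f(2) by (metis bij_betw_iff_bijections)
  have "g x \<in> summand t j" using g(2) x(1) by (metis bij_betw_apply)
  then obtain z where z: "capfree z" "g x = elt t z j" by (auto simp: summand_def)
  have W0: "act_by W (phi u' u) x = \<zero>\<^bsub>W\<^esub>" for u'
  proof -
    have act_by_phi_closed: "act_by W (phi u' u) x \<in> carrier W" by (rule act_by_closed[OF W phi_lin_hom x(1)])
    have gl: "g \<in> lin_hom W (A t)" using g(1) by (simp add: comodule_hom_def lin_hom_AE)
    have "g (act_by W (phi u' u) x) = \<zero>\<^bsub>A t\<^esub>"
      using act[OF g(1) x(1), of u' u] ij y(2) vect_A by (simp add: z(2) act_by_elt[OF z(1)])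
    also have "\<dots> = g \<zero>\<^bsub>W\<^esub>" by (rule lin_hom_zero[OF vect_W[OF W] vect_A gl, symmetric])
    finally show ?thesis
      using g(2) act_by_phi_closed vect_W[OF W] by (auto simp: bij_betw_def dest: inj_onD)
  qed
  have fl: "f \<in> lin_hom W (A t)" using f(1) by (simp add: comodule_hom_def lin_hom_AE)
  have e0: "elt t (nf 0 u') i = \<zero>\<^bsub>A t\<^esub>" for u'
  proof -
    have "y u \<odot>\<^bsub>A t\<^esub> elt t (nf 0 u') i = \<zero>\<^bsub>A t\<^esub>"
      using act[OF f(1) x(1), of u' u] y(2) lin_hom_zero[OF vect_W[OF W] vect_A fl]
      by (simp add: x(2) act_by_elt[OF y(1)] W0)
    then have "inverse (y u) \<odot>\<^bsub>A t\<^esub> (y u \<odot>\<^bsub>A t\<^esub> elt t (nf 0 u') i) = \<zero>\<^bsub>A t\<^esub>" using vect_A by simp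
    then show ?thesis using y(3) vect_A by (simp add: vect_smult_assoc)
  qed
  have "elt t y i \<in> {\<zero>\<^bsub>A t\<^esub>}"
    unfolding elt_nf0_sum[OF y(1)] e0
    by (rule finsum_in_submodule[OF vect_A submodule_zero[OF vect_A]]) (use vect_A in auto)
  then show False using elt_eq_zero[OF y(1) _ y(2), of t] y(3) by simp
qed

end

context
  fixes t :: 'k
begin

lemma submodule_AE: "submodule T base (AE t) \<longleftrightarrow> submodule T base (A t)"
  by (simp add: submodule_base_iff[OF vect_AE] submodule_base_iff[OF vect_A])

lemma summand_indep: "indep (AE t) (range (summand t))"
  unfolding indep_def
proof (intro allI impI ballI)
  fix \<F> f S assume fin: "finite \<F>" and sub: "\<F> \<subseteq> range (summand t)" and f: "\<forall>S\<in>\<F>. f S \<in> S"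
    and zero: "finsum (AE t) f \<F> = \<zero>\<^bsub>AE t\<^esub>" and S: "S \<in> \<F>"
  obtain j where j: "S = summand t j" using S sub by auto
  obtain y where y: "capfree y" "f S = elt t y j" using f S j by (auto simp: summand_def)
  have fc: "f \<in> \<F> \<rightarrow> carrier (AE t)" using f sub summand_subset by fastforce
  have "y u = 0" if u: "length u = j" for u
  proof -
    have pl: "coord t u \<in> lin_hom (AE t) base" using coord_lin_hom by (simp add: lin_hom_AE)
    have "coord t u (f S') = 0" if S': "S' \<in> \<F> - {S}" for S'
    proof -
      obtain j' where j': "S' = summand t j'" using S' sub by auto
      have "f S' \<in> summand t j'" using f S' unfolding j' by blast
      then obtain y' where y': "capfree y'" "f S' = elt t y' j'" by (auto simp: summand_def)
      have "j' \<noteq> j" using S' j j' by auto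
      then show ?thesis using u by (simp add: y'(2) coord_elt[OF y'(1)])
    qed
    then have "(\<Sum>S'\<in>\<F>. coord t u (f S')) = coord t u (f S)"
      using fin S by (simp add: sum.remove)
    also have "coord t u (f S) = y u" using u by (simp add: y(2) coord_elt[OF y(1)])
    finally have "y u = (\<Sum>S'\<in>\<F>. coord t u (f S'))" ..
    also have "\<dots> = coord t u (finsum (AE t) f \<F>)"
      using lin_hom_finsum[OF vect_AE vect_base pl fc] by (simp add: finsum_base)
    also have "\<dots> = 0" unfolding zero using lin_hom_zero[OF vect_AE vect_base pl] by simp
    finally show ?thesis .
  qed
  then have "elt t y j = elt t (\<lambda>_. 0) j" by (intro elt_cong)
  then show "f S = \<zero>\<^bsub>AE t\<^esub>" by (simp add: y(2) elt_zero)
qed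

lemma summand_simple_subcomodule: "simple_subcomodule HE (AE t) (summand t j)"
  unfolding simple_subcomodule_def
proof (intro conjI allI impI)
  show "subcomodule HE (AE t) (summand t j)" by (rule summand_subcomodule)
  show "summand t j \<noteq> {\<zero>\<^bsub>AE t\<^esub>}" using summand_nonzero by simp
  fix T assume T: "T \<subseteq> summand t j" "subcomodule HE (AE t) T"
  have "T = {\<zero>\<^bsub>A t\<^esub>} \<or> T = summand t j"
    by (rule summand_simple[OF T(1)])
       (use T(2) act_by_subcomodule[OF right_comodule_AE phi_lin_hom T(2)] in \<open>auto simp: subcomodule_def submodule_AE\<close>)
  then show "T = {\<zero>\<^bsub>AE t\<^esub>} \<or> T = summand t j" by simp
qed

lemma summand_decomposition: "simple_decomposition HE (AE t) (range (summand t))"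
proof -
  have sub: "submodule S base (AE t)" if "S \<in> range (summand t)" for S
    using that summand_submodule by (auto simp: submodule_AE)
  have "carrier (AE t) \<subseteq> ssum (AE t) (range (summand t))"
  proof -
    have "submodule (ssum (AE t) (range (summand t))) base (A t)"
      using submodule_ssum[OF vect_AE sub] by (simp add: submodule_AE)
    from summand_span[OF this] show ?thesis
      using ssum_superset[OF vect_AE _ sub] by (simp add: rangeI)
  qed
  then have "direct_sum_of (AE t) (range (summand t))"
    by (intro direct_sum_ofI[OF vect_AE sub summand_indep])
  then show ?thesis using summand_simple_subcomodule by (auto simp: simple_decomposition_def)
qed

theorem model_comodule_algebra_AE: "model_comodule_algebra TYPE('v) HE (AE t)"
  unfolding model_comodule_algebra_def
proof (intro conjI exI[of _ "range (summand t)"] allI impI)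
  show "hopf_algebra HE" by (rule hopf_algebra_HE)
  show "cosemisimple HE" unfolding cosemisimple_def by (rule comodule_decomposition[OF right_comodule_reg])
  show "right_comodule_algebra HE (AE t)" by (rule right_comodule_algebra_AE)
  show "simple_decomposition HE (AE t) (range (summand t))" by (rule summand_decomposition)
  fix W :: "('k, (('n \<times> 'n) list \<Rightarrow>\<^sub>0 'k) set, 'v) comodule"
  assume s: "simple_comodule HE W"
  then have W: "right_comodule HE W" by (simp add: simple_comodule_def)
  obtain j where j: "iso_to_subcomodule HE W (AE t) (summand t j)" using simple_comodule_iso[OF W s] by blast
  have "S = summand t j" if S: "S \<in> range (summand t)" "iso_to_subcomodule HE W (AE t) S" for S
  proof -
    obtain i where i: "S = summand t i" using S(1) by (rule rangeE)
    have "i = j" by (rule simple_comodule_iso_unique[OF W S(2)[unfolded i] j])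
    then show ?thesis using i by simp
  qed
  then have "{S \<in> range (summand t). iso_to_subcomodule HE W (AE t) S} = {summand t j}"
    using j by blast
  then show "card {S \<in> range (summand t). iso_to_subcomodule HE W (AE t) S} = 1" by simp
qed

end

end

section \<open>Quantum integers\<close>

text \<open>
  The integers \<open>[n] = (q\<^sup>n - q\<^sup>-\<^sup>n) / (q - q\<^sup>-\<^sup>1)\<close>, defined so as to make sense for \<open>q = \<plusminus>1\<close> too.
\<close>

fun qint :: "'k::field \<Rightarrow> nat \<Rightarrow> 'k" where
  "qint q 0 = 0"
| "qint q (Suc 0) = 1"
| "qint q (Suc (Suc n)) = (q + inverse q) * qint q (Suc n) - qint q n"

lemma qint_closed_form: "q \<noteq> 0 \<Longrightarrow> (q - inverse q) * qint q n = q ^ n - inverse q ^ n"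
proof (induction q n rule: qint.induct)
  case (3 q n)
  have "(q - inverse q) * qint q (Suc (Suc n)) =
      (q + inverse q) * ((q - inverse q) * qint q (Suc n)) - (q - inverse q) * qint q n"
    by (simp add: algebra_simps)
  also have "\<dots> = (q + inverse q) * (q ^ Suc n - inverse q ^ Suc n) - (q ^ n - inverse q ^ n)"
    using 3 by simp
  also have "\<dots> = q ^ Suc (Suc n) - inverse q ^ Suc (Suc n)"
    using \<open>q \<noteq> 0\<close> by (simp add: field_simps)
  finally show ?case .
qed simp_all

lemma qint_one: "qint 1 n = (of_nat n :: 'k::field)"
proof -
  have "qint q n = of_nat n" if "q = (1::'k)" for q
    using that by (induction q n rule: qint.induct) (simp_all add: algebra_simps)
  then show ?thesis by simp
qed

lemma qint_minus_one: "qint (-1) (Suc n) = (-1) ^ n * (of_nat (Suc n) :: 'k::field)"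
proof -
  have "qint q n = (-1) ^ (n + 1) * of_nat n" if "q = (-1::'k)" for q n
    using that by (induction q n rule: qint.induct) (simp_all add: algebra_simps)
  then show ?thesis by simp
qed

text \<open>
  For \<open>q\<^sup>2 \<noteq> 1\<close> a zero of \<open>[n + 1]\<close> forces \<open>q\<^sup>2\<^sup>n\<^sup>+\<^sup>2 = 1\<close>, so that \<open>q\<close> has a finite multiplicative order, which
  is at least 3. For \<open>q = \<plusminus>1\<close> the quantum integer is \<open>\<plusminus>(n + 1)\<close>, nonzero in characteristic zero.
\<close>

lemma qint_nonzero:
  fixes q :: "'k::field_char_0"
  assumes q: "q \<noteq> 0" and root: "\<not> (\<exists>m\<ge>3. root_of_unity_of_order m q)"
  shows "qint q (Suc n) \<noteq> 0"
proof (cases "q ^ 2 = 1")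
  case True
  then have "q = 1 \<or> q = -1" by (simp add: power2_eq_1_iff)
  then show ?thesis by (auto simp: qint_one qint_minus_one simp del: qint.simps of_nat_Suc)
next
  case False
  show ?thesis
  proof
    assume "qint q (Suc n) = 0"
    then have "q ^ Suc n = inverse q ^ Suc n" using qint_closed_form[OF q, of "Suc n"] by simp
    then have "q ^ Suc n * q ^ Suc n = (inverse q * q) ^ Suc n" by (simp only: power_mult_distrib)
    then have "q ^ Suc n * q ^ Suc n = 1" using q by simp
    then have ex: "\<exists>m. 0 < m \<and> q ^ m = 1" by (intro exI[of _ "Suc n + Suc n"]) (simp only: power_add, simp)
    define m where "m = (LEAST m. 0 < m \<and> q ^ m = 1)"
    have m: "0 < m" "q ^ m = 1" using LeastI_ex[OF ex] by (simp_all add: m_def)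
    have "root_of_unity_of_order m q"
      using m not_less_Least[of _ "\<lambda>m. 0 < m \<and> q ^ m = 1"] by (auto simp: root_of_unity_of_order_def m_def)
    then have "m < 3" using root by (meson not_less)
    then have "m = 1 \<or> m = 2" using m(1) by linarith
    then show False using m(2) False by auto
  qed
qed

theorem corollary5p5:
  fixes E :: "'k::field_char_0^'n::finite^'n" and t :: 'k
  assumes "invertible E"
    and "\<exists>q::'k. q \<noteq> 0 \<and> trace (matrix_inv E ** transpose E) = - q - inverse q \<and>
           \<not> (\<exists>m\<ge>3. root_of_unity_of_order m q)"
    and "t \<in> {0, 1}"
  shows "model_comodule_algebra TYPE('v) (B_hopf E) (A_comodule E t)"
proof -
  obtain q :: 'k where q: "q \<noteq> 0" "trace (matrix_inv E ** transpose E) = - q - inverse q"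
    "\<not> (\<exists>m\<ge>3. root_of_unity_of_order m q)" using assms(2) by blast
  interpret inv_matrix E by unfold_locales (rule assms(1))
  interpret model E "qint q"
  proof unfold_locales
    show "(\<Sum>a\<in>UNIV. \<Sum>b\<in>UNIV. matrix_inv E $ a $ b * E $ a $ b) = - qint q 2"
      using q(2) by (simp add: trace_def matrix_matrix_mult_def transpose_def numeral_2_eq_2)
    show "qint q (Suc (Suc j)) = qint q 2 * qint q (Suc j) - qint q j" for j
      by (simp add: numeral_2_eq_2)
  qed (simp_all add: beta_omega omega_beta qint_nonzero[OF q(1,3)])
  show ?thesis by (rule model_comodule_algebra_AE)
qed

end
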